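(* Let $N\ge 3$, let $q\in\mathbb C^{\times}$ be generic, let $d\in\mathbb C^\times$ and put $p=d^{-N}$. Let $\mathcal A$ be the associative algebra generated by the coefficients of the formal series $E_i(z),F_i(z),K_i^{\pm}(z)$, $0\le i\le N-1$, of operators on $V_Q$. If $pq^{\pm N}$ is not a root of unity (i.e. neither $pq^{N}$ nor $pq^{-N}$ is), then $V_Q$ is an irreducible $\mathcal A$-module. Therefore $V_Q$ is an irreducible module over the quantum toroidal algebra $U_q(\mathfrak{sl}_{N,tor})$, acting through the map $\pi:U_q(\mathfrak{sl}_{N,tor})\to\mathcal A$ given by $e_i(z)\mapsto E_i(z)$, $f_i(z)\mapsto F_i(z)$, $k_i^\pm(z)\mapsto K_i^\pm(z)$, $k_i^{\pm1}\mapsto K_i^{\pm}$ ($0\le i\le N-1$), $c\mapsto q^{1/2}$.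
   Context: Generic $q$: nonzero and not a root of unity; square roots $q^{1/2},p^{1/2}$ are fixed. $\delta(z)=\sum_{k\in\mathbb Z}z^k$. **Quantum toroidal algebra.** For $0\le i,j\le N-1$ read indices modulo $N$ and set $a_{ij}=2\delta_{i,j}-\delta_{i,j+1}-\delta_{i+1,j}$ and $m_{ij}=\delta_{i,j+1}-\delta_{j,i+1}$ (Kronecker deltas modulo $N$). Let $\theta_m(z)=\frac{q^mz-1}{z-q^m}$, expanded as a Taylor series in $z$. $U_q(\mathfrak{sl}_{N,tor})$ is the unital associative $\mathbb C$-algebra generated by $e_{i,k},f_{i,k},h_{i,l},k_i^{\pm1}$ ($0\le i\le N-1$, $k\in\mathbb Z$, $l\in\mathbb Z\setminus\{0\}$) and central $c^{\pm1}$. With $e_i(z)=\sum_k e_{i,k}z^{-k}$, $f_i(z)=\sum_k f_{i,k}z^{-k}$, $k_i^{\pm}(z)=k_i^{\pm1}\exp(\pm(q-q^{-1})\sum_{k\ge1}h_{i,\pm k}z^{\mp k})$, the relations are: - $k_ik_i^{-1}=k_i^{-1}k_i=cc^{-1}=1$, $[k_i^{\pm}(z),k_j^{\pm}(w)]=0$; - $\theta_{-a_{ij}}(c^2d^{-m_{ij}}\frac wz)k_i^+(z)k_j^-(w)=\theta_{-a_{ij}}(c^{-2}d^{-m_{ij}}\frac wz)k_j^-(w)k_i^+(z)$; - $k_i^{\pm}(z)e_j(w)=\theta_{\mp a_{ij}}(c^{-1}d^{\mp m_{ij}}(\frac wz)^{\pm1})e_j(w)k_i^{\pm}(z)$; -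 $k_i^{\pm}(z)f_j(w)=\theta_{\pm a_{ij}}(c\,d^{\mp m_{ij}}(\frac wz)^{\pm1})f_j(w)k_i^{\pm}(z)$; - $[e_i(z),f_j(w)]=\frac{\delta_{ij}}{q-q^{-1}}\big(\delta(c^{-2}\frac zw)k_i^+(cw)-\delta(c^2\frac zw)k_i^-(cz)\big)$; - $(d^{m_{ij}}z-q^{a_{ij}}w)e_i(z)e_j(w)=(q^{a_{ij}}d^{m_{ij}}z-w)e_j(w)e_i(z)$; - $(q^{a_{ij}}d^{m_{ij}}z-w)f_i(z)f_j(w)=(d^{m_{ij}}z-q^{a_{ij}}w)f_j(w)f_i(z)$; - if $a_{ij}=-1$: $\{e_i(z_1)e_i(z_2)e_j(w)-(q+q^{-1})e_i(z_1)e_j(w)e_i(z_2)+e_j(w)e_i(z_1)e_i(z_2)\}+\{z_1\leftrightarrow z_2\}=0$, and the same with $f$ in place of $e$; - if $a_{ij}=0$: $[e_i(z),e_j(w)]=[f_i(z),f_j(w)]=0$. **Fock space.** Let $\bigoplus_{i=1}^N\mathbb Z\epsilon_i$ carry the form $(\epsilon_i,\epsilon_j)=\delta_{ij}$, and let $Q=\bigoplus_{i=1}^{N-1}\mathbb Z(\epsilon_i-\epsilon_{i+1})$. Put $\epsilon_{i+N}=\epsilon_i$ for $i\in\mathbb Z$. Let $\varepsilon:Q\times Q\to\{\pm1\}$ be bimultiplicative with $\varepsilon(\alpha,\alpha)=(-1)^{(\alpha,\alpha)/2}$. On the group algebra $\mathbb C[Q]=\bigoplus_{\alpha\in Q}\mathbb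 Ce^\alpha$ let $e_\beta e^\alpha=\varepsilon(\beta,\alpha)e^{\alpha+\beta}$ ($\beta\in Q$), and for $\beta$ in $\bigoplus\mathbb Z\epsilon_i$ let $z^\beta e^\alpha=z^{(\beta,\alpha)}e^\alpha$ and $\mu^\beta e^\alpha=\mu^{(\beta,\alpha)}e^\alpha$ ($\mu\in\mathbb C^\times$); $z^{\beta+s}:=z^sz^\beta$ and $\mu^{\beta+s}:=\mu^s\mu^\beta$ for scalars $s$. The Heisenberg algebra has generators $\epsilon_i(n)$ ($1\le i\le N$, $n\ne0$) with $[\epsilon_i(m),\epsilon_j(n)]=m\delta_{ij}\delta_{m+n,0}C$, $C$ central. It acts on $S(\mathcal H^-)=\mathbb C[\epsilon_i(-n):1\le i\le N,n\ge1]$ with $C=1$, $\epsilon_i(-n)$ by multiplication and $\epsilon_i(n)$ by $n\,\partial/\partial\epsilon_i(-n)$ ($n\ge1$). $V_Q=S(\mathcal H^-)\otimes\mathbb C[Q]$. **Vertex operators.** For $i\in\mathbb Z$ put $\epsilon_{i+N}(n)=\epsilon_i(n)$. For $\alpha=\pm\epsilon_i$ let $E_\pm(\alpha,z)=\exp\big(\mp\sum_{n\ge1}\frac{\alpha(\pm n)}nz^{\mp n}\big)$, where $(-\epsilon_i)(n)=-\epsilon_i(n)$. For $r,i,j\in\mathbb Z$, $$X_{ij}(r,z)=E_-(\epsilon_i,z)E_-(-\epsilon_j,zq^{i-j}p^r)E_+(\epsilon_i,z)E_+(-\epsilon_j,zq^{j-i}p^r)\,e_{\epsilon_i-\epsilon_j}\,z^{\epsilon_i-\epsilon_j+\frac{(\epsilon_i-\epsilon_j,\epsilon_i-\epsilon_j)}2}\,p^{-r\epsilon_j-\frac{(\epsilon_j,\epsilon_i-\epsilon_j)}2r},$$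 and for $i\ne j$ $$u_{ij}(r,z)=q^{(j-i)(\epsilon_i-\epsilon_j)}\exp\Big(\sum_{n\ge1}\tfrac{q^{(j-i)n}-q^{(i-j)n}}n\big(q^{\frac{j-i}2n}\epsilon_i(n)-p^{-nr}q^{\frac{i-j}2n}\epsilon_j(n)\big)z^{-n}\Big),$$ $$v_{ij}(r,z)=q^{(i-j)(\epsilon_i-\epsilon_j)}\exp\Big(\sum_{n\ge1}\tfrac{q^{(i-j)n}-q^{(j-i)n}}n\big(q^{\frac{j-i}2n}\epsilon_i(-n)-p^{nr}q^{\frac{i-j}2n}\epsilon_j(-n)\big)z^{n}\Big).$$ For $1\le i\le N-1$: $E_i(z)=X_{i,i+1}(0,p^{1/2}d^iz)$, $F_i(z)=X_{i+1,i}(0,p^{1/2}d^iz)$, $K_i^+(z)=u_{i,i+1}(0,p^{1/2}d^iz)$, $K_i^-(z)=v_{i,i+1}(0,p^{1/2}d^iz)$. Moreover $E_0(z)=X_{01}(1,p^{-1/2}z)$, $F_0(z)=X_{10}(-1,p^{1/2}z)$, $K_0^+(z)=u_{01}(1,p^{-1/2}z)$, $K_0^-(z)=v_{01}(1,p^{-1/2}z)$. For $0\le i\le N-1$, $K_i^{\pm}=q^{\pm(\epsilon_i-\epsilon_{i+1})}$.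
   Formalization: The map π is taken with f_i(z) ↦ −F_i(z) instead of F_i(z): since ε(α,α) = −1 for α = ε_i−ε_{i+1}, the operators E_i, F_i satisfy the [e_i(z),f_i(w)] relation only up to a global sign, so the map as stated is not a homomorphism. *)

theory Defs
  imports
    "HOL-Algebra.QuotRing"
    "HOL-Algebra.Generated_Rings"
    "HOL-Library.FuncSet"
    "HOL-Library.Poly_Mapping"
    "HOL-Library.Groups_Big_Fun"
    "HOL-Computational_Algebra.Formal_Power_Series"
    Complex_Main
begin

definition root_of_unity :: "complex \<Rightarrow> bool" where
  "root_of_unity x \<longleftrightarrow> (\<exists>n>0. x ^ n = 1)"

definition generic :: "complex \<Rightarrow> bool" where
  "generic q \<longleftrightarrow> q \<noteq> 0 \<and> \<not> root_of_unity q"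


section \<open>The quantum toroidal algebra\<close>

text \<open>The generators $e_{i,k}, f_{i,k}, h_{i,l}, k_i, k_i^{-1}, c, c^{-1}$; the type allows all
  natural numbers $i$ and $l = 0$, and \<open>gens N\<close> selects the intended ones.\<close>

datatype gen = Egen nat int | Fgen nat int | Hgen nat int | Kgen nat | Kinv nat | Cgen | Cinv

definition gens :: "nat \<Rightarrow> gen set" where
  "gens N = {Egen i k | i k. i < N} \<union> {Fgen i k | i k. i < N} \<union> {Hgen i l | i l. i < N \<and> l \<noteq> 0}
     \<union> {Kgen i | i. i < N} \<union> {Kinv i | i. i < N} \<union> {Cgen, Cinv}"

text \<open>The free monoid on \<open>'a\<close>, written additively so that finitely supported functions on it
  carry the convolution product of \<open>Poly_Mapping\<close>, i.e. form the free algebra.\<close>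

datatype 'a word = Word (letters: "'a list")

instantiation word :: (type) monoid_add
begin
definition zero_word :: "'a word" where "0 = Word []"
definition plus_word :: "'a word \<Rightarrow> 'a word \<Rightarrow> 'a word" where
  "x + y = Word (letters x @ letters y)"
instance by standard (simp_all add: zero_word_def plus_word_def)
end

type_synonym falg = "gen word \<Rightarrow>\<^sub>0 complex"

definition free_alg :: "nat \<Rightarrow> falg ring" where
  "free_alg N = \<lparr>carrier = {x. \<forall>w \<in> Poly_Mapping.keys x. set (letters w) \<subseteq> gens N},
     monoid.mult = (*), monoid.one = 1, ring.zero = 0, ring.add = (+)\<rparr>"

definition const :: "complex \<Rightarrow> falg" where
  "const a = Poly_Mapping.single 0 a"

definition gen :: "gen \<Rightarrow> falg" where
  "gen x = Poly_Mapping.single (Word [x]) 1"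

definition cpow :: "int \<Rightarrow> falg" where
  "cpow n = (if n \<ge> 0 then gen Cgen ^ nat n else gen Cinv ^ nat (- n))"

definition exp_series :: "falg fps \<Rightarrow> falg fps" where
  "exp_series G = Abs_fps (\<lambda>n. \<Sum>r\<le>n. const (1 / fact r) * fps_nth (G ^ r) n)"

text \<open>For $s = \pm 1$, \<open>k_series q s i\<close> is $k_i^{\pm}(z)$ as a power series in $z^{-s}$, and
  \<open>k_coeff q s i n\<close> is its coefficient at $z^{-sn}$.\<close>

definition k_series :: "complex \<Rightarrow> int \<Rightarrow> nat \<Rightarrow> falg fps" where
  "k_series q s i = fps_const (gen (if s = 1 then Kgen i else Kinv i)) *
     exp_series (Abs_fps (\<lambda>n. if n = 0 then 0
       else const (of_int s * (q - inverse q)) * gen (Hgen i (s * int n))))"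

definition k_coeff :: "complex \<Rightarrow> int \<Rightarrow> nat \<Rightarrow> int \<Rightarrow> falg" where
  "k_coeff q s i n = (if n < 0 then 0 else fps_nth (k_series q s i) (nat n))"

definition cartan :: "nat \<Rightarrow> nat \<Rightarrow> nat \<Rightarrow> int" where
  "cartan N i j = 2 * of_bool (i mod N = j mod N) - of_bool (i mod N = (j + 1) mod N)
     - of_bool ((i + 1) mod N = j mod N)"

definition mskew :: "nat \<Rightarrow> nat \<Rightarrow> nat \<Rightarrow> int" where
  "mskew N i j = of_bool (i mod N = (j + 1) mod N) - of_bool (j mod N = (i + 1) mod N)"

definition theta :: "complex \<Rightarrow> int \<Rightarrow> complex fps" where
  "theta q m = (fps_const (q powi m) * fps_X - 1) / (fps_X - fps_const (q powi m))"

definition serre :: "complex \<Rightarrow> (int \<Rightarrow> gen) \<Rightarrow> (int \<Rightarrow> gen) \<Rightarrow> int \<Rightarrow> int \<Rightarrow> int \<Rightarrow> falg" where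
  "serre q x y a b k = gen (x a) * gen (x b) * gen (y k)
     - const (q + inverse q) * gen (x a) * gen (y k) * gen (x b)
     + gen (y k) * gen (x a) * gen (x b)"

text \<open>The differences of the two sides of the defining relations, coefficient by coefficient.
  The coefficient extracted is that of
    $z^{-sa} w^{-sb}$ in \<open>kk\<close>,
    $z^{-a} w^{b}$ in \<open>kpkm\<close>,
    $z^{-sa} w^{-b}$ in \<open>ke\<close> and \<open>kf\<close>,
    $z^{-a} w^{-b}$ in \<open>ef\<close>, \<open>ee\<close>, \<open>ff\<close>, \<open>ee0\<close>, \<open>ff0\<close>,
    $z_1^{-a} z_2^{-b} w^{-k}$ in \<open>serre_e\<close> and \<open>serre_f\<close>.
  All of these are finite sums. In \<open>ef\<close>, each delta function contributes a single term:
  the coefficient of $z^{-a}w^{-b}$ in $\delta(c^{-2}z/w) k_i^+(cw)$ is $c^{a-b} k^+_{i,a+b}$, and in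
  $\delta(c^{2}z/w) k_i^-(cz)$ it is $c^{b-a} k^-_{i,-(a+b)}$.\<close>

inductive_set relators :: "nat \<Rightarrow> complex \<Rightarrow> complex \<Rightarrow> falg set" for N q d where
  k_inv: "i < N \<Longrightarrow> gen (Kgen i) * gen (Kinv i) - 1 \<in> relators N q d"
| inv_k: "i < N \<Longrightarrow> gen (Kinv i) * gen (Kgen i) - 1 \<in> relators N q d"
| c_inv: "gen Cgen * gen Cinv - 1 \<in> relators N q d"
| c_central: "x \<in> gens N \<Longrightarrow> gen Cgen * gen x - gen x * gen Cgen \<in> relators N q d"
| cinv_central: "x \<in> gens N \<Longrightarrow> gen Cinv * gen x - gen x * gen Cinv \<in> relators N q d"
| kk: "\<lbrakk>i < N; j < N; s \<in> {1, -1}\<rbrakk> \<Longrightarrow>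
    k_coeff q s i a * k_coeff q s j b - k_coeff q s j b * k_coeff q s i a \<in> relators N q d"
| kpkm: "\<lbrakk>i < N; j < N\<rbrakk> \<Longrightarrow>
    (\<Sum>n\<le>nat (min a b). const (fps_nth (theta q (- cartan N i j)) n * d powi (- mskew N i j * int n))
        * cpow (2 * int n) * k_coeff q 1 i (a - int n) * k_coeff q (-1) j (b - int n))
    - (\<Sum>n\<le>nat (min a b). const (fps_nth (theta q (- cartan N i j)) n * d powi (- mskew N i j * int n))
        * cpow (- 2 * int n) * k_coeff q (-1) j (b - int n) * k_coeff q 1 i (a - int n))
    \<in> relators N q d"
| ke: "\<lbrakk>i < N; j < N; s \<in> {1, -1}\<rbrakk> \<Longrightarrow>
    k_coeff q s i a * gen (Egen j b)
    - (\<Sum>n\<le>nat a. const (fps_nth (theta q (- s * cartan N i j)) n * d powi (- s * mskew N i j * int n))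
        * cpow (- int n) * gen (Egen j (b + s * int n)) * k_coeff q s i (a - int n))
    \<in> relators N q d"
| kf: "\<lbrakk>i < N; j < N; s \<in> {1, -1}\<rbrakk> \<Longrightarrow>
    k_coeff q s i a * gen (Fgen j b)
    - (\<Sum>n\<le>nat a. const (fps_nth (theta q (s * cartan N i j)) n * d powi (- s * mskew N i j * int n))
        * cpow (int n) * gen (Fgen j (b + s * int n)) * k_coeff q s i (a - int n))
    \<in> relators N q d"
| ef: "\<lbrakk>i < N; j < N\<rbrakk> \<Longrightarrow>
    gen (Egen i a) * gen (Fgen j b) - gen (Fgen j b) * gen (Egen i a)
    - const (of_bool (i = j) / (q - inverse q)) *
        (cpow (a - b) * k_coeff q 1 i (a + b) - cpow (b - a) * k_coeff q (-1) i (- (a + b)))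
    \<in> relators N q d"
| ee: "\<lbrakk>i < N; j < N\<rbrakk> \<Longrightarrow>
    (const (d powi mskew N i j) * gen (Egen i (a + 1)) * gen (Egen j b)
      - const (q powi cartan N i j) * gen (Egen i a) * gen (Egen j (b + 1)))
    - (const (q powi cartan N i j * d powi mskew N i j) * gen (Egen j b) * gen (Egen i (a + 1))
      - gen (Egen j (b + 1)) * gen (Egen i a))
    \<in> relators N q d"
| ff: "\<lbrakk>i < N; j < N\<rbrakk> \<Longrightarrow>
    (const (q powi cartan N i j * d powi mskew N i j) * gen (Fgen i (a + 1)) * gen (Fgen j b)
      - gen (Fgen i a) * gen (Fgen j (b + 1)))
    - (const (d powi mskew N i j) * gen (Fgen j b) * gen (Fgen i (a + 1))
      - const (q powi cartan N i j) * gen (Fgen j (b + 1)) * gen (Fgen i a))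
    \<in> relators N q d"
| serre_e: "\<lbrakk>i < N; j < N; cartan N i j = -1\<rbrakk> \<Longrightarrow>
    serre q (Egen i) (Egen j) a b k + serre q (Egen i) (Egen j) b a k \<in> relators N q d"
| serre_f: "\<lbrakk>i < N; j < N; cartan N i j = -1\<rbrakk> \<Longrightarrow>
    serre q (Fgen i) (Fgen j) a b k + serre q (Fgen i) (Fgen j) b a k \<in> relators N q d"
| ee0: "\<lbrakk>i < N; j < N; cartan N i j = 0\<rbrakk> \<Longrightarrow>
    gen (Egen i a) * gen (Egen j b) - gen (Egen j b) * gen (Egen i a) \<in> relators N q d"
| ff0: "\<lbrakk>i < N; j < N; cartan N i j = 0\<rbrakk> \<Longrightarrow>
    gen (Fgen i a) * gen (Fgen j b) - gen (Fgen j b) * gen (Fgen i a) \<in> relators N q d"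

definition toroidal_ideal :: "nat \<Rightarrow> complex \<Rightarrow> complex \<Rightarrow> falg set" where
  "toroidal_ideal N q d = Idl\<^bsub>free_alg N\<^esub> (relators N q d)"

definition toroidal :: "nat \<Rightarrow> complex \<Rightarrow> complex \<Rightarrow> falg set ring" where
  "toroidal N q d = free_alg N Quot toroidal_ideal N q d"

definition tclass :: "nat \<Rightarrow> complex \<Rightarrow> complex \<Rightarrow> falg \<Rightarrow> falg set" where
  "tclass N q d x = toroidal_ideal N q d +>\<^bsub>free_alg N\<^esub> x"


section \<open>The Fock space\<close>

text \<open>A monomial in the $\epsilon_i(-n)$ is its exponent function on pairs $(i,n)$, an element of
  $\bigoplus_i \mathbb{Z}\epsilon_i$ its coefficient function. Vectors are written in the basis
  $m \otimes e^\alpha$.\<close>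

type_synonym mono = "(nat \<times> nat) \<Rightarrow>\<^sub>0 nat"
type_synonym lattice = "nat \<Rightarrow>\<^sub>0 int"
type_synonym fock = "(mono \<times> lattice) \<Rightarrow>\<^sub>0 complex"

definition idx :: "nat \<Rightarrow> int \<Rightarrow> nat" where
  "idx N i = nat ((i - 1) mod int N) + 1"

text \<open>\<open>eps N i x\<close> is $x\,\epsilon_i$, with $\epsilon_{i+N} = \epsilon_i$.\<close>

definition eps :: "nat \<Rightarrow> int \<Rightarrow> int \<Rightarrow> lattice" where
  "eps N i x = Poly_Mapping.single (idx N i) x"

definition form :: "nat \<Rightarrow> lattice \<Rightarrow> lattice \<Rightarrow> int" where
  "form N \<alpha> \<beta> = (\<Sum>i=1..N. Poly_Mapping.lookup \<alpha> i * Poly_Mapping.lookup \<beta> i)"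

definition root_lattice :: "nat \<Rightarrow> lattice set" where
  "root_lattice N = {\<Sum>i=1..<N. eps N (int i) (x i) - eps N (int i + 1) (x i) | x. True}"

definition cocycle :: "nat \<Rightarrow> (lattice \<Rightarrow> lattice \<Rightarrow> int) \<Rightarrow> bool" where
  "cocycle N \<epsilon> \<longleftrightarrow>
     (\<forall>\<alpha>\<in>root_lattice N. \<forall>\<beta>\<in>root_lattice N. \<epsilon> \<alpha> \<beta> \<in> {1, -1}) \<and>
     (\<forall>\<alpha>\<in>root_lattice N. \<forall>\<beta>\<in>root_lattice N. \<forall>\<gamma>\<in>root_lattice N.
        \<epsilon> (\<alpha> + \<beta>) \<gamma> = \<epsilon> \<alpha> \<gamma> * \<epsilon> \<beta> \<gamma> \<and> \<epsilon> \<alpha> (\<beta> + \<gamma>) = \<epsilon> \<alpha> \<beta> * \<epsilon> \<alpha> \<gamma>) \<and>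
     (\<forall>\<alpha>\<in>root_lattice N. \<epsilon> \<alpha> \<alpha> = (-1) ^ nat (form N \<alpha> \<alpha> div 2))"

definition fock_space :: "nat \<Rightarrow> fock set" where
  "fock_space N = {v. \<forall>(m, \<alpha>) \<in> Poly_Mapping.keys v.
     Poly_Mapping.keys m \<subseteq> {1..N} \<times> {1..} \<and> \<alpha> \<in> root_lattice N}"

definition scale :: "complex \<Rightarrow> fock \<Rightarrow> fock" where
  "scale x v = Poly_Mapping.map ((*) x) v"

definition linext :: "(mono \<times> lattice \<Rightarrow> fock) \<Rightarrow> fock \<Rightarrow> fock" where
  "linext f v = (\<Sum>b\<in>Poly_Mapping.keys v. scale (Poly_Mapping.lookup v b) (f b))"

text \<open>\<open>heis N i n\<close> is the action of $\epsilon_i(n)$, $n \neq 0$: multiplication by the variable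
  for $n < 0$, and $n\,\partial/\partial\epsilon_i(-n)$ for $n > 0$.\<close>

definition heis :: "nat \<Rightarrow> int \<Rightarrow> int \<Rightarrow> fock \<Rightarrow> fock" where
  "heis N i n = linext (\<lambda>(m, \<alpha>).
     if n < 0 then Poly_Mapping.single (m + Poly_Mapping.single (idx N i, nat (- n)) 1, \<alpha>) 1
     else Poly_Mapping.single (m - Poly_Mapping.single (idx N i, nat n) 1, \<alpha>)
            (of_int n * of_nat (Poly_Mapping.lookup m (idx N i, nat n))))"

definition e_shift :: "(lattice \<Rightarrow> lattice \<Rightarrow> int) \<Rightarrow> lattice \<Rightarrow> fock \<Rightarrow> fock" where
  "e_shift \<epsilon> \<beta> = linext (\<lambda>(m, \<alpha>). Poly_Mapping.single (m, \<alpha> + \<beta>) (of_int (\<epsilon> \<beta> \<alpha>)))"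

definition mu_pow :: "nat \<Rightarrow> complex \<Rightarrow> lattice \<Rightarrow> fock \<Rightarrow> fock" where
  "mu_pow N \<mu> \<beta> = linext (\<lambda>(m, \<alpha>). Poly_Mapping.single (m, \<alpha>) (\<mu> powi form N \<beta> \<alpha>))"


section \<open>Formal series of operators\<close>

text \<open>\<open>A k\<close> is the coefficient of $z^k$. In all products and exponentials below only finitely
  many terms are nonzero on a given vector, so that \<open>Sum_any\<close> is a genuine finite sum.\<close>

type_synonym opser = "int \<Rightarrow> fock \<Rightarrow> fock"

definition ser_mult :: "opser \<Rightarrow> opser \<Rightarrow> opser"  (infixr \<open>\<diamondop>\<close> 70) where
  "(A \<diamondop> B) k v = Sum_any (\<lambda>a. A a (B (k - a) v))"

definition ser_const :: "(fock \<Rightarrow> fock) \<Rightarrow> opser" where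
  "ser_const T k v = (if k = 0 then T v else 0)"

primrec ser_power :: "opser \<Rightarrow> nat \<Rightarrow> opser" where
  "ser_power A 0 = ser_const (\<lambda>v. v)"
| "ser_power A (Suc r) = A \<diamondop> ser_power A r"

definition ser_exp :: "opser \<Rightarrow> opser" where
  "ser_exp A k v = Sum_any (\<lambda>r. scale (1 / fact r) (ser_power A r k v))"

text \<open>\<open>ser_subst \<mu> A\<close> is $A(\mu z)$.\<close>

definition ser_subst :: "complex \<Rightarrow> opser \<Rightarrow> opser" where
  "ser_subst \<mu> A k v = scale (\<mu> powi k) (A k v)"

text \<open>$z^{\beta + s}$\<close>

definition z_pow :: "nat \<Rightarrow> lattice \<Rightarrow> int \<Rightarrow> opser" where
  "z_pow N \<beta> s k = linext (\<lambda>(m, \<alpha>). if form N \<beta> \<alpha> + s = k then Poly_Mapping.single (m, \<alpha>) 1 else 0)"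

text \<open>$E_\pm(\alpha, z)$ for $\alpha = s\,\epsilon_i$, $s = \pm 1$.\<close>

definition E_minus :: "nat \<Rightarrow> int \<Rightarrow> int \<Rightarrow> opser" where
  "E_minus N s i = ser_exp (\<lambda>k v. if k \<ge> 1 then scale (of_int s / of_int k) (heis N i (- k) v) else 0)"

definition E_plus :: "nat \<Rightarrow> int \<Rightarrow> int \<Rightarrow> opser" where
  "E_plus N s i = ser_exp (\<lambda>k v. if k \<le> -1 then scale (- (of_int s / of_int (- k))) (heis N i (- k) v) else 0)"

text \<open>From here on \<open>qh\<close> and \<open>ph\<close> are the fixed square roots $q^{1/2}$ and $p^{1/2}$.
  In \<open>vX\<close> the exponent $-\frac{(\epsilon_j,\epsilon_i-\epsilon_j)}{2} r$ of $p$ is half an integer.\<close>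

definition vX :: "nat \<Rightarrow> (lattice \<Rightarrow> lattice \<Rightarrow> int) \<Rightarrow> complex \<Rightarrow> complex \<Rightarrow> int \<Rightarrow> int \<Rightarrow> int \<Rightarrow> opser" where
  "vX N \<epsilon> qh ph r i j =
    (let q = qh ^ 2; p = ph ^ 2; \<beta> = eps N i 1 - eps N j 1 in
       E_minus N 1 i \<diamondop> ser_subst (q powi (i - j) * p powi r) (E_minus N (-1) j)
       \<diamondop> E_plus N 1 i \<diamondop> ser_subst (q powi (j - i) * p powi r) (E_plus N (-1) j)
       \<diamondop> ser_const (e_shift \<epsilon> \<beta>) \<diamondop> z_pow N \<beta> (form N \<beta> \<beta> div 2)
       \<diamondop> ser_const (\<lambda>v. scale (ph powi (- form N (eps N j 1) \<beta> * r)) (mu_pow N p (eps N j (- r)) v)))"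

definition vu :: "nat \<Rightarrow> complex \<Rightarrow> complex \<Rightarrow> int \<Rightarrow> int \<Rightarrow> int \<Rightarrow> opser" where
  "vu N qh ph r i j =
    (let q = qh ^ 2; p = ph ^ 2 in
       ser_const (mu_pow N q (eps N i (j - i) - eps N j (j - i)))
       \<diamondop> ser_exp (\<lambda>k v. let n = - k in
           if n \<ge> 1 then scale ((q powi ((j - i) * n) - q powi ((i - j) * n)) / of_int n)
               (scale (qh powi ((j - i) * n)) (heis N i n v)
                - scale (p powi (- n * r) * qh powi ((i - j) * n)) (heis N j n v))
           else 0))"

definition vv :: "nat \<Rightarrow> complex \<Rightarrow> complex \<Rightarrow> int \<Rightarrow> int \<Rightarrow> int \<Rightarrow> opser" where
  "vv N qh ph r i j =
    (let q = qh ^ 2; p = ph ^ 2 in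
       ser_const (mu_pow N q (eps N i (i - j) - eps N j (i - j)))
       \<diamondop> ser_exp (\<lambda>n v.
           if n \<ge> 1 then scale ((q powi ((i - j) * n) - q powi ((j - i) * n)) / of_int n)
               (scale (qh powi ((j - i) * n)) (heis N i (- n) v)
                - scale (p powi (n * r) * qh powi ((i - j) * n)) (heis N j (- n) v))
           else 0))"

definition opE :: "nat \<Rightarrow> (lattice \<Rightarrow> lattice \<Rightarrow> int) \<Rightarrow> complex \<Rightarrow> complex \<Rightarrow> complex \<Rightarrow> nat \<Rightarrow> opser" where
  "opE N \<epsilon> qh ph d i =
    (if i = 0 then ser_subst (inverse ph) (vX N \<epsilon> qh ph 1 0 1)
     else ser_subst (ph * d ^ i) (vX N \<epsilon> qh ph 0 (int i) (int i + 1)))"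

definition opF :: "nat \<Rightarrow> (lattice \<Rightarrow> lattice \<Rightarrow> int) \<Rightarrow> complex \<Rightarrow> complex \<Rightarrow> complex \<Rightarrow> nat \<Rightarrow> opser" where
  "opF N \<epsilon> qh ph d i =
    (if i = 0 then ser_subst ph (vX N \<epsilon> qh ph (-1) 1 0)
     else ser_subst (ph * d ^ i) (vX N \<epsilon> qh ph 0 (int i + 1) (int i)))"

text \<open>\<open>opK N qh ph d s i\<close> is $K_i^{\pm}(z)$ for $s = \pm 1$, and \<open>opK0\<close> is $K_i^{\pm}$.\<close>

definition opK :: "nat \<Rightarrow> complex \<Rightarrow> complex \<Rightarrow> complex \<Rightarrow> int \<Rightarrow> nat \<Rightarrow> opser" where
  "opK N qh ph d s i =
    (let w = (if s = 1 then vu else vv) in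
     if i = 0 then ser_subst (inverse ph) (w N qh ph 1 0 1)
     else ser_subst (ph * d ^ i) (w N qh ph 0 (int i) (int i + 1)))"

definition opK0 :: "nat \<Rightarrow> complex \<Rightarrow> int \<Rightarrow> nat \<Rightarrow> fock \<Rightarrow> fock" where
  "opK0 N qh s i = mu_pow N (qh ^ 2) (eps N (int i) s - eps N (int i + 1) s)"


section \<open>The algebra generated by the vertex operators\<close>

definition endo_ring :: "nat \<Rightarrow> (fock \<Rightarrow> fock) ring" where
  "endo_ring N = (let V = fock_space N in
     \<lparr>carrier = {T \<in> V \<rightarrow>\<^sub>E V. \<forall>v\<in>V. \<forall>w\<in>V. \<forall>x. T (v + w) = T v + T w \<and> T (scale x v) = scale x (T v)},
      monoid.mult = compose V, monoid.one = (\<lambda>v\<in>V. v), ring.zero = (\<lambda>v\<in>V. 0), ring.add = (\<lambda>S T. \<lambda>v\<in>V. S v + T v)\<rparr>)"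

definition scalar_op :: "nat \<Rightarrow> complex \<Rightarrow> fock \<Rightarrow> fock" where
  "scalar_op N x = restrict (scale x) (fock_space N)"

definition vertex_coeffs ::
  "nat \<Rightarrow> (lattice \<Rightarrow> lattice \<Rightarrow> int) \<Rightarrow> complex \<Rightarrow> complex \<Rightarrow> complex \<Rightarrow> (fock \<Rightarrow> fock) set" where
  "vertex_coeffs N \<epsilon> qh ph d = (\<Union>i<N. \<Union>k::int.
     {restrict (T k) (fock_space N) | T.
        T \<in> {opE N \<epsilon> qh ph d i, opF N \<epsilon> qh ph d i, opK N qh ph d 1 i, opK N qh ph d (-1) i}})"

text \<open>Adjoining the scalar operators makes the generated subring a complex subalgebra.\<close>

definition vertex_algebra ::
  "nat \<Rightarrow> (lattice \<Rightarrow> lattice \<Rightarrow> int) \<Rightarrow> complex \<Rightarrow> complex \<Rightarrow> complex \<Rightarrow> (fock \<Rightarrow> fock) ring" where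
  "vertex_algebra N \<epsilon> qh ph d = (endo_ring N)\<lparr>carrier :=
     generate_ring (endo_ring N) (range (scalar_op N) \<union> vertex_coeffs N \<epsilon> qh ph d)\<rparr>"

definition csubspace :: "fock set \<Rightarrow> bool" where
  "csubspace W \<longleftrightarrow> 0 \<in> W \<and> (\<forall>v\<in>W. \<forall>w\<in>W. v + w \<in> W) \<and> (\<forall>x. \<forall>v\<in>W. scale x v \<in> W)"

definition irreducible_under :: "nat \<Rightarrow> (fock \<Rightarrow> fock) set \<Rightarrow> bool" where
  "irreducible_under N \<A> \<longleftrightarrow> \<A> \<subseteq> carrier (endo_ring N) \<and> fock_space N \<noteq> {0} \<and>
     (\<forall>W. csubspace W \<and> W \<subseteq> fock_space N \<and> (\<forall>T\<in>\<A>. T ` W \<subseteq> W) \<longrightarrow> W = {0} \<or> W = fock_space N)"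

text \<open>The map $\pi$. Every generating series is mapped coefficientwise; \<open>Egen i k\<close> and \<open>Fgen i k\<close> are the
  coefficients of $z^{-k}$.

  The sign in front of $F_i(z)$ is forced. Since $\varepsilon(\beta,-\beta) = \varepsilon(\beta,\beta) = -1$
  for $\beta = \epsilon_i - \epsilon_{i+1}$, one has $e_\beta e_{-\beta} = -1$ and hence
    $[E_i(z), F_i(w)] = -\frac{1}{q - q^{-1}}
      (\delta(q^{-1}\frac zw) K_i^+(q^{1/2}w) - \delta(q\frac zw) K_i^-(q^{1/2}z))$,
  the negative of the \<open>ef\<close> relation; every other relation is insensitive to the sign of $f_i$.\<close>

definition toroidal_map ::
  "nat \<Rightarrow> (lattice \<Rightarrow> lattice \<Rightarrow> int) \<Rightarrow> complex \<Rightarrow> complex \<Rightarrow> complex \<Rightarrow> (falg set \<Rightarrow> fock \<Rightarrow> fock) \<Rightarrow> bool" where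
  "toroidal_map N \<epsilon> qh ph d \<pi> \<longleftrightarrow>
    (let V = fock_space N; cl = tclass N (qh ^ 2) d in
      \<pi> \<in> ring_hom (toroidal N (qh ^ 2) d) (vertex_algebra N \<epsilon> qh ph d) \<and>
      (\<forall>x. \<pi> (cl (const x)) = scalar_op N x) \<and>
      (\<forall>i<N. \<forall>k. \<pi> (cl (gen (Egen i k))) = restrict (opE N \<epsilon> qh ph d i (- k)) V) \<and>
      (\<forall>i<N. \<forall>k. \<pi> (cl (gen (Fgen i k))) = (\<lambda>v\<in>V. - opF N \<epsilon> qh ph d i (- k) v)) \<and>
      (\<forall>i<N. \<forall>s\<in>{1, -1}. \<forall>n. \<pi> (cl (k_coeff (qh ^ 2) s i n)) = restrict (opK N qh ph d s i (- s * n)) V) \<and>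
      (\<forall>i<N. \<pi> (cl (gen (Kgen i))) = restrict (opK0 N qh 1 i) V \<and>
             \<pi> (cl (gen (Kinv i))) = restrict (opK0 N qh (-1) i) V) \<and>
      \<pi> (cl (gen Cgen)) = scalar_op N qh)"

end

theory Submission
  imports Defs
begin

text \<open>
  Each current is a vertex operator: it is homogeneous, its commutators with the Heisenberg modes are
  multiples of itself, and it sends \<open>e\<^sup>\<alpha>\<close> to a multiple of an exponential applied to \<open>e\<^bsup>\<alpha>+\<beta>\<^esup>\<close>.
  Hence a combination of products of currents of the same kind vanishes as soon as its matrix
  coefficients between the vectors \<open>e\<^sup>\<alpha>\<close> do. These are scalar contraction series, so every relation
  of the quantum toroidal algebra reduces to an identity between power series in one or two variables.

  For irreducibility, an invariant subspace is stable under the modes of the \<open>K\<^sub>i\<^sup>\<plusminus>(z)\<close>, which are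
  combinations of \<open>\<epsilon>\<^sub>i(n)\<close> and \<open>\<epsilon>\<^bsub>i+1\<^esub>(n)\<close>. The cyclic system they form is invertible exactly because
  \<open>p q\<^sup>N\<close> and \<open>p q\<^sup>-\<^sup>N\<close> are not roots of unity, so the subspace is stable under the whole Heisenberg
  algebra. Lowering the degree and separating lattice weights with \<open>K\<^sub>i\<close> yields some \<open>e\<^sup>\<alpha>\<close>; the leading
  coefficients of \<open>E\<^sub>i(z)\<close> and \<open>F\<^sub>i(z)\<close> then reach every \<open>e\<^sup>\<beta>\<close>, and the creation operators the rest.
\<close>

section \<open>Linear operators on the Fock space\<close>

text \<open>Operator exponentials are never multiplied out. Euler's identity for
  \<open>z d/dz\<close> turns \<open>exp\<close> into the recursion
  \<open>k e_k = sum of n x_n e_(k-n)\<close>, which determines the coefficients from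
  \<open>e_0\<close>; commutators, products and normal ordering follow by induction on
  \<open>k\<close>. The scalar contractions are defined by the same recursion, so the two sides
  match term by term. \<open>Sum_any\<close> is 0 on an infinite support, so every product of series
  needs a finiteness proof. These rest largely on the weight
  \<open>2 * degm m + (\<alpha>, \<alpha>)\<close>, which is nonnegative; the same weight drives the
  vanishing criterion. The commutators of \<open>F_i\<close> and \<open>K_i\<close> with each
  Heisenberg mode are scalar multiples of those of \<open>E_i\<close>, so one inner product per pair
  of nodes yields all contractions, and \<open>p = d^(-N)\<close> makes its formula uniform around
  the cycle, node 0 included. The delta functions in \<open>[E_i, F_i]\<close> arise because its two
  orders expand one rational function in opposite regions; the Serre relations reduce to recurrences
  for geometric series.\<close>

lemma lookup_scale: "Poly_Mapping.lookup (scale x v) b = x * Poly_Mapping.lookup v b"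
  by (simp add: scale_def Poly_Mapping.map.rep_eq when_def)

interpretation fock: vector_space scale
  by unfold_locales (auto intro!: poly_mapping_eqI simp: lookup_scale lookup_add algebra_simps)

lemma scale_single: "scale x (Poly_Mapping.single b y) = Poly_Mapping.single b (x * y)"
  by (rule poly_mapping_eqI) (simp add: lookup_scale lookup_single when_def)

lemma single_eq_scale: "Poly_Mapping.single b y = scale y (Poly_Mapping.single b (1::complex))"
  by (simp add: scale_single)

lemma keys_scale: "Poly_Mapping.keys (scale x v) \<subseteq> Poly_Mapping.keys v"
  by (auto simp: in_keys_iff lookup_scale)

text \<open>Linearity on the whole type \<open>fock\<close>. Restriction to
  \<open>fock_space N\<close> is imposed only when operators enter \<open>endo_ring\<close>, so
  composition needs no side conditions before that.\<close>

definition lin :: "(fock \<Rightarrow> fock) \<Rightarrow> bool" where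
  "lin T \<longleftrightarrow> (\<forall>v w. T (v + w) = T v + T w) \<and> (\<forall>x v. T (scale x v) = scale x (T v))"

lemma linI: "(\<And>v w. T (v + w) = T v + T w) \<Longrightarrow> (\<And>x v. T (scale x v) = scale x (T v)) \<Longrightarrow> lin T"
  by (simp add: lin_def)

lemma lin_add: "lin T \<Longrightarrow> T (v + w) = T v + T w"
  and lin_scale: "lin T \<Longrightarrow> T (scale x v) = scale x (T v)"
  by (simp_all add: lin_def)

lemma lin_0: "lin T \<Longrightarrow> T 0 = 0"
  using lin_scale[of T 0 0] by simp

lemma lin_uminus: "lin T \<Longrightarrow> T (- v) = - T v"
  using lin_scale[of T "-1" v] by simp

lemma lin_sum: "lin T \<Longrightarrow> T (sum f A) = (\<Sum>a\<in>A. T (f a))"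
  by (induction A rule: infinite_finite_induct) (simp_all add: lin_0 lin_add)

lemma lin_zero: "lin (\<lambda>v. 0)"
  and lin_id: "lin (\<lambda>v. v)"
  and lin_comp: "lin S \<Longrightarrow> lin T \<Longrightarrow> lin (\<lambda>v. S (T v))"
  and lin_plus: "lin S \<Longrightarrow> lin T \<Longrightarrow> lin (\<lambda>v. S v + T v)"
  and lin_smult: "lin T \<Longrightarrow> lin (\<lambda>v. scale x (T v))"
  by (simp_all add: lin_def algebra_simps)

lemma lin_setsum: "(\<And>a. a \<in> A \<Longrightarrow> lin (T a)) \<Longrightarrow> lin (\<lambda>v. \<Sum>a\<in>A. T a v)"
  by (induction A rule: infinite_finite_induct) (auto intro: lin_zero lin_plus)

lemma fock_expand: "v = (\<Sum>b\<in>Poly_Mapping.keys v. scale (Poly_Mapping.lookup v b) (Poly_Mapping.single b 1))"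
proof (rule poly_mapping_eqI)
  fix b
  show "Poly_Mapping.lookup v b = Poly_Mapping.lookup
      (\<Sum>b\<in>Poly_Mapping.keys v. scale (Poly_Mapping.lookup v b) (Poly_Mapping.single b 1)) b"
    by (cases "b \<in> Poly_Mapping.keys v")
      (simp_all add: lookup_sum lookup_scale lookup_single when_def if_distrib sum.delta sum.delta' in_keys_iff cong: if_cong)
qed

lemma linext_superset:
  assumes "finite A" "Poly_Mapping.keys v \<subseteq> A"
  shows "linext f v = (\<Sum>b\<in>A. scale (Poly_Mapping.lookup v b) (f b))"
  unfolding linext_def using assms
  by (intro sum.mono_neutral_left) (auto simp: in_keys_iff)

lemma lin_linext: "lin (linext f)"
proof (rule linI)
  fix v w :: fock
  let ?A = "Poly_Mapping.keys v \<union> Poly_Mapping.keys w"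
  have "linext f (v + w) = (\<Sum>b\<in>?A. scale (Poly_Mapping.lookup (v + w) b) (f b))"
    using keys_add[of v w] by (intro linext_superset) auto
  also have "\<dots> = linext f v + linext f w"
    by (subst (1 2) linext_superset[of ?A])
      (auto simp: lookup_add fock.scale_left_distrib sum.distrib)
  finally show "linext f (v + w) = linext f v + linext f w" .
next
  fix x and v :: fock
  show "linext f (scale x v) = scale x (linext f v)"
    by (subst (1 2) linext_superset[of "Poly_Mapping.keys v"])
      (auto simp: lookup_scale keys_scale fock.scale_sum_right intro: subsetD[OF keys_scale])
qed

lemma linext_single [simp]: "linext f (Poly_Mapping.single b c) = scale c (f b)"
  by (subst linext_superset[of "{b}"]) auto

lemma lin_eqI:
  assumes "lin S" "lin T" "\<And>b. b \<in> Poly_Mapping.keys v \<Longrightarrow> S (Poly_Mapping.single b 1) = T (Poly_Mapping.single b 1)"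
  shows "S v = T v"
  by (subst (1 2) fock_expand[of v]) (simp add: lin_sum lin_scale assms)

lemma keys_sum_subset:
  fixes f :: "'a \<Rightarrow> fock"
  shows "(\<And>a. a \<in> A \<Longrightarrow> Poly_Mapping.keys (f a) \<subseteq> K) \<Longrightarrow> Poly_Mapping.keys (sum f A) \<subseteq> K"
proof (induction A rule: infinite_finite_induct)
  case (insert a A)
  then show ?case using keys_add[of "f a" "sum f A"] by (simp, blast)
qed simp_all

lemma keys_lin_subset:
  assumes "lin T" "Poly_Mapping.keys v \<subseteq> K"
    and "\<And>b. b \<in> K \<Longrightarrow> Poly_Mapping.keys (T (Poly_Mapping.single b 1)) \<subseteq> K'"
  shows "Poly_Mapping.keys (T v) \<subseteq> K'"
proof -
  have "T v = (\<Sum>b\<in>Poly_Mapping.keys v. scale (Poly_Mapping.lookup v b) (T (Poly_Mapping.single b 1)))"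
    by (subst fock_expand[of v]) (simp add: lin_sum lin_scale assms)
  moreover have "Poly_Mapping.keys (\<Sum>b\<in>Poly_Mapping.keys v. scale (Poly_Mapping.lookup v b) (T (Poly_Mapping.single b 1))) \<subseteq> K'"
    using assms(2,3) by (intro keys_sum_subset order_trans[OF keys_scale]) blast
  ultimately show ?thesis by simp
qed


section \<open>Series of operators\<close>

definition linser :: "opser \<Rightarrow> bool" where
  "linser S \<longleftrightarrow> (\<forall>k. lin (S k))"

definition finser :: "opser \<Rightarrow> bool" where
  "finser S \<longleftrightarrow> (\<forall>v. finite {k. S k v \<noteq> 0})"

definition lbser :: "opser \<Rightarrow> bool" where
  "lbser S \<longleftrightarrow> (\<forall>v. \<exists>M. \<forall>k<M. S k v = 0)"

text \<open>Since \<open>Sum_any\<close> is 0 on an infinite support, \<open>summ\<close> is what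
  makes \<open>A \<diamondop> B\<close> the actual product. It has two sources: a series of
  nonnegative powers times one bounded below (\<open>summ_cre\<close>), and a linear series times a
  finitely supported one (\<open>summ_fin\<close>).\<close>

definition summ :: "opser \<Rightarrow> opser \<Rightarrow> bool" where
  "summ A B \<longleftrightarrow> (\<forall>k v. finite {a. A a (B (k - a) v) \<noteq> 0})"

text \<open>\<open>K\<close> is a family of sets of basis vectors indexed by a degree; \<open>z\<^sup>k\<close> carries degree \<open>2k\<close>.\<close>

definition gr :: "(int \<Rightarrow> (mono \<times> lattice) set) \<Rightarrow> opser \<Rightarrow> bool" where
  "gr K S \<longleftrightarrow> (\<forall>k D v. Poly_Mapping.keys v \<subseteq> K D \<longrightarrow> Poly_Mapping.keys (S k v) \<subseteq> K (D + 2 * k))"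

text \<open>Coefficientwise form of \<open>[h, S(z)] = c z^n S(z)\<close>: Heisenberg modes act on
  vertex operators by multiplication with a monomial.\<close>

definition comm :: "(fock \<Rightarrow> fock) \<Rightarrow> int \<Rightarrow> complex \<Rightarrow> opser \<Rightarrow> bool" where
  "comm h n c S \<longleftrightarrow> (\<forall>k v. h (S k v) = S k (h v) + scale c (S (k - n) v))"

lemma linserD: "linser S \<Longrightarrow> lin (S k)"
  by (simp add: linser_def)

lemma summ_cre:
  assumes "\<And>k v. k < 0 \<Longrightarrow> A k v = 0" "linser A" "lbser B"
  shows "summ A B"
  unfolding summ_def
proof (intro allI)
  fix k v
  obtain M where M: "\<And>k. k < M \<Longrightarrow> B k v = 0" using assms(3) unfolding lbser_def by blast
  have "{a. A a (B (k - a) v) \<noteq> 0} \<subseteq> {0..k - M}"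
    using assms(1) M lin_0[OF linserD[OF assms(2)]] by (force simp: not_less[symmetric])
  then show "finite {a. A a (B (k - a) v) \<noteq> 0}" by (rule finite_subset) simp
qed

lemma summ_fin:
  assumes "linser A" "finser B"
  shows "summ A B"
  unfolding summ_def
proof (intro allI)
  fix k v
  have "{a. A a (B (k - a) v) \<noteq> 0} \<subseteq> (\<lambda>b. k - b) ` {b. B b v \<noteq> 0}"
  proof
    fix a assume "a \<in> {a. A a (B (k - a) v) \<noteq> 0}"
    then have "B (k - a) v \<noteq> 0" using lin_0[OF linserD[OF assms(1)]] by auto
    then show "a \<in> (\<lambda>b. k - b) ` {b. B b v \<noteq> 0}" by (intro image_eqI[of _ _ "k - a"]) auto
  qed
  then show "finite {a. A a (B (k - a) v) \<noteq> 0}"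
    by (rule finite_subset) (use assms(2) in \<open>auto simp: finser_def\<close>)
qed

lemma summD: "summ A B \<Longrightarrow> finite {a. A a (B (k - a) v) \<noteq> 0}"
  by (simp add: summ_def)

lemma ser_mult_sum:
  assumes "finite F" "{a. A a (B (k - a) v) \<noteq> 0} \<subseteq> F"
  shows "(A \<diamondop> B) k v = (\<Sum>a\<in>F. A a (B (k - a) v))"
  unfolding ser_mult_def using assms by (rule Sum_any.expand_superset)

lemma ser_mult_shift:
  "(A \<diamondop> B) (k - n) v = Sum_any (\<lambda>a. A (a - n) (B (k - a) v))"
  unfolding ser_mult_def
  by (rule Sum_any.reindex_cong[of "\<lambda>a. a - n"]) (auto simp: bij_def inj_def surj_def algebra_simps o_def intro: exI[of _ "_ + n"])

lemma lin_Sum_any: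
  assumes "lin T" "finite {a. g a \<noteq> 0}"
  shows "T (Sum_any g) = Sum_any (\<lambda>a. T (g a))"
proof -
  have "Sum_any (\<lambda>a. T (g a)) = (\<Sum>a\<in>{a. g a \<noteq> 0}. T (g a))"
    using assms by (intro Sum_any.expand_superset) (auto simp: lin_0)
  then show ?thesis by (simp add: Sum_any.expand_set lin_sum assms)
qed

lemma scale_Sum_any: "scale c (Sum_any g) = Sum_any (\<lambda>a. scale c (g a))"
proof (cases "c = 0")
  case False
  then have "{a. scale c (g a) \<noteq> 0} = {a. g a \<noteq> 0}" by auto
  then show ?thesis by (simp add: Sum_any.expand_set fock.scale_sum_right)
qed simp

lemma linser_mult:
  assumes "linser A" "linser B" "summ A B"
  shows "linser (A \<diamondop> B)"
  unfolding linser_def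
proof (intro allI linI)
  fix k v w
  show "(A \<diamondop> B) k (v + w) = (A \<diamondop> B) k v + (A \<diamondop> B) k w"
    unfolding ser_mult_def using assms
    by (simp add: lin_add[OF linserD] Sum_any.distrib summD)
next
  fix k x v
  show "(A \<diamondop> B) k (scale x v) = scale x ((A \<diamondop> B) k v)"
    unfolding ser_mult_def using assms
    by (simp add: lin_scale[OF linserD] scale_Sum_any)
qed

lemma keys_Sum_any_subset:
  fixes g :: "'a \<Rightarrow> fock"
  assumes "\<And>a. Poly_Mapping.keys (g a) \<subseteq> K"
  shows "Poly_Mapping.keys (Sum_any g) \<subseteq> K"
  by (cases "finite {a. g a \<noteq> 0}") (simp_all add: Sum_any.expand_set keys_sum_subset assms)

lemma gr_mult:
  assumes "gr K A" "gr K B"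
  shows "gr K (A \<diamondop> B)"
  unfolding gr_def
proof (intro allI impI)
  fix k D and v :: fock
  assume v: "Poly_Mapping.keys v \<subseteq> K D"
  have "Poly_Mapping.keys (A a (B (k - a) v)) \<subseteq> K (D + 2 * k)" for a
  proof -
    have "Poly_Mapping.keys (B (k - a) v) \<subseteq> K (D + 2 * (k - a))"
      using assms(2) v unfolding gr_def by blast
    then have "Poly_Mapping.keys (A a (B (k - a) v)) \<subseteq> K (D + 2 * (k - a) + 2 * a)"
      using assms(1) unfolding gr_def by blast
    then show ?thesis by (simp add: algebra_simps)
  qed
  then show "Poly_Mapping.keys ((A \<diamondop> B) k v) \<subseteq> K (D + 2 * k)"
    unfolding ser_mult_def by (rule keys_Sum_any_subset)
qed

text \<open>Leibniz rule: each factor contributes a multiple of \<open>z^n\<close>, so the constants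
  add.\<close>

lemma comm_mult:
  assumes "lin h" "linser A" "linser B" "summ A B" "comm h n c A" "comm h n c' B"
  shows "comm h n (c + c') (A \<diamondop> B)"
  unfolding comm_def
proof (intro allI)
  fix k v
  have A: "h (A k v) = A k (h v) + scale c (A (k - n) v)" for k v
    using assms(5) unfolding comm_def by blast
  have B: "h (B k v) = B k (h v) + scale c' (B (k - n) v)" for k v
    using assms(6) unfolding comm_def by blast
  have lA: "lin (A k)" for k by (rule linserD[OF assms(2)])
  have f1: "finite {a. A a (B (k - a) (h v)) \<noteq> 0}" by (rule summD[OF assms(4)])
  have f2: "finite {a. scale c' (A a (B (k - n - a) v)) \<noteq> 0}"
    by (rule finite_subset[OF _ summD[OF assms(4), of "k - n" v]]) auto
  \<comment> \<open>Here the shift lands in the first factor, so the support is that of the product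
    at exponent \<open>k - n\<close>, translated by \<open>n\<close>.\<close>
  have f3: "finite {a. scale c (A (a - n) (B (k - a) v)) \<noteq> 0}"
  proof (rule finite_subset)
    show "{a. scale c (A (a - n) (B (k - a) v)) \<noteq> 0} \<subseteq> (\<lambda>a. a + n) ` {a. A a (B (k - n - a) v) \<noteq> 0}"
    proof
      fix a assume "a \<in> {a. scale c (A (a - n) (B (k - a) v)) \<noteq> 0}"
      then show "a \<in> (\<lambda>a. a + n) ` {a. A a (B (k - n - a) v) \<noteq> 0}"
        by (intro image_eqI[of _ _ "a - n"]) auto
    qed
  qed (simp add: summD[OF assms(4)])
  have "h ((A \<diamondop> B) k v) = Sum_any (\<lambda>a. h (A a (B (k - a) v)))"
    unfolding ser_mult_def by (rule lin_Sum_any[OF assms(1) summD[OF assms(4)]])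
  also have "\<dots> = Sum_any (\<lambda>a. A a (B (k - a) (h v)) + (scale c' (A a (B (k - n - a) v))
      + scale c (A (a - n) (B (k - a) v))))"
    by (simp add: A B lin_add[OF lA] lin_scale[OF lA] algebra_simps)
  also have "\<dots> = Sum_any (\<lambda>a. A a (B (k - a) (h v))) + (Sum_any (\<lambda>a. scale c' (A a (B (k - n - a) v)))
      + Sum_any (\<lambda>a. scale c (A (a - n) (B (k - a) v))))"
    using f1 f2 f3
    by (subst Sum_any.distrib, simp_all add: Sum_any.distrib)
      (rule finite_subset[OF _ finite_UnI[OF f2 f3]], auto)
  also have "\<dots> = (A \<diamondop> B) k (h v) + scale (c + c') ((A \<diamondop> B) (k - n) v)"
    by (simp add: fock.scale_left_distrib ser_mult_def[of A B k "h v"] scale_Sum_any[symmetric] ser_mult_shift[symmetric])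
      (simp add: ser_mult_def)
  finally show "h ((A \<diamondop> B) k v) = (A \<diamondop> B) k (h v) + scale (c + c') ((A \<diamondop> B) (k - n) v)" .
qed

lemma linser_subst: "linser S \<Longrightarrow> linser (ser_subst \<mu> S)"
  by (simp add: linser_def ser_subst_def[abs_def] lin_smult)

lemma gr_subst: "gr K S \<Longrightarrow> gr K (ser_subst \<mu> S)"
  unfolding gr_def ser_subst_def by (meson keys_scale order_trans)

lemma comm_subst: "comm h n c S \<Longrightarrow> lin h \<Longrightarrow> \<mu> \<noteq> 0 \<Longrightarrow> comm h n (c * \<mu> powi n) (ser_subst \<mu> S)"
  by (simp add: comm_def ser_subst_def lin_scale fock.scale_right_distrib power_int_diff field_simps)

lemma linser_const: "lin T \<Longrightarrow> linser (ser_const T)"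
  by (auto simp: lin_def linser_def ser_const_def)

lemma const_mult [simp]: "lin T \<Longrightarrow> (ser_const T \<diamondop> B) k v = T (B k v)"
  by (subst ser_mult_sum[of "{0}"]) (auto simp: ser_const_def)

lemma mult_const [simp]: "linser A \<Longrightarrow> (A \<diamondop> ser_const T) k v = A k (T v)"
  by (subst ser_mult_sum[of "{k}"]) (auto simp: ser_const_def lin_0[OF linserD])


section \<open>Exponentials\<close>

text \<open>The series \<open>sum of x_n z^(s n)\<close> over \<open>n \<ge> 1\<close>. The sign
  \<open>s\<close> lets creation series (positive powers) and annihilation series (negative powers)
  share one theory.\<close>

definition ebuild :: "int \<Rightarrow> (nat \<Rightarrow> fock \<Rightarrow> fock) \<Rightarrow> opser" where
  "ebuild s x k v = (if s * k \<ge> 1 then x (nat (s * k)) v else 0)"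

text \<open>Coefficient of \<open>z^m\<close> in the \<open>r\<close>-th power of
  \<open>sum of x_n z^n\<close>, indexed by naturals so that the sum over \<open>n\<close> is finite
  without any support argument.\<close>

primrec pw :: "(nat \<Rightarrow> fock \<Rightarrow> fock) \<Rightarrow> nat \<Rightarrow> nat \<Rightarrow> fock \<Rightarrow> fock" where
  "pw x 0 m v = (if m = 0 then v else 0)"
| "pw x (Suc r) m v = (\<Sum>n=1..m. x n (pw x r (m - n) v))"

text \<open>Truncating the exponential at \<open>r \<le> k\<close> is exact, since a series without
  constant term has no \<open>r\<close>-th power in degrees below \<open>r\<close>. The value 0 at
  negative indices spares case splits in convolutions.\<close>

definition exi :: "(nat \<Rightarrow> fock \<Rightarrow> fock) \<Rightarrow> int \<Rightarrow> fock \<Rightarrow> fock" where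
  "exi x k v = (if k < 0 then 0 else \<Sum>r\<le>nat k. scale (1 / fact r) (pw x r (nat k) v))"

definition cmodes :: "(nat \<Rightarrow> fock \<Rightarrow> fock) \<Rightarrow> bool" where
  "cmodes x \<longleftrightarrow> (\<forall>n. lin (x n)) \<and> (\<forall>m n v. x m (x n v) = x n (x m v))"

lemma cmodes_lin: "cmodes x \<Longrightarrow> lin (x n)"
  and cmodes_commute: "cmodes x \<Longrightarrow> x m (x n v) = x n (x m v)"
  by (auto simp: cmodes_def)

lemma exi_neg [simp]: "k < 0 \<Longrightarrow> exi x k v = 0"
  by (simp add: exi_def)

lemma exi_0 [simp]: "exi x 0 v = v"
  by (simp add: exi_def)

lemma pw_small: "(\<And>n. lin (x n)) \<Longrightarrow> m < r \<Longrightarrow> pw x r m v = 0"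
proof (induction r arbitrary: m)
  case (Suc r)
  have "x n (pw x r (m - n) v) = 0" if "n \<in> {1..m}" for n
  proof -
    have "m - n < r" using Suc.prems(2) that by auto
    then show ?thesis using Suc.IH[of "m - n"] Suc.prems(1) by (simp add: lin_0)
  qed
  then show ?case by (simp add: sum.neutral)
qed simp

lemma lin_pw: "(\<And>n. lin (x n)) \<Longrightarrow> lin (pw x r m)"
proof (induction r arbitrary: m)
  case 0
  then show ?case by (auto simp: lin_def)
next
  case (Suc r)
  have "lin (\<lambda>v. \<Sum>n=1..m. x n (pw x r (m - n) v))"
    by (rule lin_setsum, rule lin_comp[OF Suc.prems Suc.IH[OF Suc.prems]])
  then show ?case by (simp add: lin_def)
qed

lemma lin_exi: "(\<And>n. lin (x n)) \<Longrightarrow> lin (exi x k)"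
proof -
  assume L: "\<And>n. lin (x n)"
  have "lin (\<lambda>v. \<Sum>r\<le>nat k. scale (1 / fact r) (pw x r (nat k) v))"
    by (rule lin_setsum, rule lin_smult, rule lin_pw, rule L)
  then show ?thesis by (auto simp: lin_def exi_def)
qed

lemma triangle_swap:
  fixes g :: "nat \<Rightarrow> nat \<Rightarrow> 'a::comm_monoid_add"
  shows "(\<Sum>n=1..m. \<Sum>l=1..m - n. g n l) = (\<Sum>l=1..m. \<Sum>n=1..m - l. g n l)"
proof -
  have "(\<Sum>n=1..m. \<Sum>l=1..m - n. g n l) = (\<Sum>(n, l)\<in>Sigma {1..m} (\<lambda>n. {1..m - n}). g n l)"
    by (simp add: sum.Sigma)
  also have "\<dots> = (\<Sum>(l, n)\<in>Sigma {1..m} (\<lambda>l. {1..m - l}). g n l)"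
    by (rule sum.reindex_bij_witness[of _ "\<lambda>(l, n). (n, l)" "\<lambda>(n, l). (l, n)"]) auto
  also have "\<dots> = (\<Sum>l=1..m. \<Sum>n=1..m - l. g n l)"
    by (simp add: sum.Sigma)
  finally show ?thesis .
qed

text \<open>\<open>z d/dz (X^(r+1)) = (r + 1) (z d/dz X) X^r\<close> for commuting modes. The
  induction splits \<open>m = n + (m - n)\<close>, where \<open>n\<close> is the degree taken by the
  outermost factor.\<close>

lemma pw_euler:
  assumes "cmodes x"
  shows "scale (of_nat m) (pw x (Suc r) m v)
    = scale (of_nat (Suc r)) (\<Sum>n=1..m. scale (of_nat n) (x n (pw x r (m - n) v)))"
proof (induction r arbitrary: m)
  case 0
  show ?case
  proof (cases "m = 0")
    case False
    have "(\<Sum>n=1..m. x n (pw x 0 (m - n) v)) = (\<Sum>n\<in>{m}. x n (pw x 0 (m - n) v))"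
      using False by (intro sum.mono_neutral_right) (auto simp: lin_0 cmodes_lin[OF assms])
    moreover have "(\<Sum>n=1..m. scale (of_nat n) (x n (pw x 0 (m - n) v)))
        = (\<Sum>n\<in>{m}. scale (of_nat n) (x n (pw x 0 (m - n) v)))"
      using False by (intro sum.mono_neutral_right) (auto simp: lin_0 cmodes_lin[OF assms])
    ultimately show ?thesis by simp
  qed simp
next
  case (Suc r)
  note L = cmodes_lin[OF assms]
  let ?P = "pw x"
  have "scale (of_nat m) (?P (Suc (Suc r)) m v) = (\<Sum>n=1..m. scale (of_nat m) (x n (?P (Suc r) (m - n) v)))"
    by (simp add: fock.scale_sum_right del: pw.simps(2) add: pw.simps(2)[of x "Suc r"])
  also have "\<dots> = (\<Sum>n=1..m. scale (of_nat n) (x n (?P (Suc r) (m - n) v))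
      + x n (scale (of_nat (m - n)) (?P (Suc r) (m - n) v)))"
  proof (rule sum.cong)
    fix n assume "n \<in> {1..m}"
    then have "(of_nat m :: complex) = of_nat n + of_nat (m - n)"
      by (simp add: of_nat_diff)
    then show "scale (of_nat m) (x n (?P (Suc r) (m - n) v)) = scale (of_nat n) (x n (?P (Suc r) (m - n) v))
      + x n (scale (of_nat (m - n)) (?P (Suc r) (m - n) v))"
      by (simp only: lin_scale[OF L] fock.scale_left_distrib)
  qed simp
  also have "\<dots> = (\<Sum>n=1..m. scale (of_nat n) (x n (?P (Suc r) (m - n) v)))
     + (\<Sum>n=1..m. \<Sum>l=1..m - n. scale (of_nat (Suc r)) (scale (of_nat l) (x n (x l (?P r (m - n - l) v)))))"
    unfolding Suc by (simp only: sum.distrib lin_scale[OF L] lin_sum[OF L] fock.scale_sum_right)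
  also have "(\<Sum>n=1..m. \<Sum>l=1..m - n. scale (of_nat (Suc r)) (scale (of_nat l) (x n (x l (?P r (m - n - l) v)))))
     = (\<Sum>l=1..m. \<Sum>n=1..m - l. scale (of_nat (Suc r)) (scale (of_nat l) (x n (x l (?P r (m - n - l) v)))))"
    by (rule triangle_swap)
  also have "\<dots> = (\<Sum>l=1..m. scale (of_nat (Suc r)) (scale (of_nat l) (x l (?P (Suc r) (m - l) v))))"
  proof (rule sum.cong)
    fix l assume "l \<in> {1..m}"
    have "x n (x l (?P r (m - n - l) v)) = x l (x n (?P r (m - l - n) v))" for n
      by (simp add: cmodes_commute[OF assms, of n l] add.commute)
    then show "(\<Sum>n=1..m - l. scale (of_nat (Suc r)) (scale (of_nat l) (x n (x l (?P r (m - n - l) v)))))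
      = scale (of_nat (Suc r)) (scale (of_nat l) (x l (?P (Suc r) (m - l) v)))"
      by (simp only: pw.simps(2) lin_sum[OF L] fock.scale_sum_right)
  qed simp
  also have "(\<Sum>n=1..m. scale (of_nat n) (x n (?P (Suc r) (m - n) v))) + \<dots>
     = scale (of_nat (Suc (Suc r))) (\<Sum>n=1..m. scale (of_nat n) (x n (?P (Suc r) (m - n) v)))"
    by (simp only: fock.scale_sum_right[symmetric] of_nat_Suc[of "Suc r"] fock.scale_left_distrib fock.scale_one)
  finally show ?case .
qed

text \<open>\<open>z d/dz exp X = (z d/dz X) exp X\<close>. Any upper bound \<open>M \<ge> k\<close>
  is allowed because terms with \<open>n > k\<close> vanish, so recursions at different
  \<open>k\<close> can be summed over one range.\<close>

lemma exi_euler: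
  assumes "cmodes x" "k \<le> int M"
  shows "scale (of_int k) (exi x k v) = (\<Sum>n=1..M. scale (of_nat n) (x n (exi x (k - int n) v)))"
proof (cases "k < 0")
  case True
  then show ?thesis by (simp add: lin_0 cmodes_lin[OF assms(1)])
next
  case False
  note L = cmodes_lin[OF assms(1)]
  define m where "m = nat k"
  have k: "k = int m" using False by (simp add: m_def)
  have "scale (of_int k) (exi x k v) = (\<Sum>r\<le>m. scale (1 / fact r) (scale (of_nat m) (pw x r m v)))"
    by (simp add: exi_def k fock.scale_sum_right mult.commute)
  \<comment> \<open>The term \<open>r = 0\<close> drops out: \<open>pw x 0 m v\<close> is 0 unless
    \<open>m = 0\<close>, and then the factor \<open>m\<close> is.\<close>
  also have "\<dots> = (\<Sum>r<m. scale (1 / fact (Suc r)) (scale (of_nat m) (pw x (Suc r) m v)))"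
    by (cases m) (simp_all add: sum.atMost_shift del: fact_Suc pw.simps(2))
  also have "\<dots> = (\<Sum>r<m. scale (1 / fact r) (\<Sum>n=1..m. scale (of_nat n) (x n (pw x r (m - n) v))))"
    unfolding pw_euler[OF assms(1)] by (simp add: field_simps del: of_nat_Suc)
  also have "\<dots> = (\<Sum>n=1..m. scale (of_nat n) (x n (\<Sum>r<m. scale (1 / fact r) (pw x r (m - n) v))))"
    by (simp only: fock.scale_sum_right lin_sum[OF L] lin_scale[OF L])
      (subst sum.swap, simp add: mult.commute)
  also have "\<dots> = (\<Sum>n=1..m. scale (of_nat n) (x n (exi x (k - int n) v)))"
  proof (rule sum.cong)
    fix n assume n: "n \<in> {1..m}"
    have "(\<Sum>r<m. scale (1 / fact r) (pw x r (m - n) v)) = (\<Sum>r\<le>m - n. scale (1 / fact r) (pw x r (m - n) v))"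
      using n by (intro sum.mono_neutral_right) (auto simp: pw_small[OF L])
    moreover have "nat (k - int n) = m - n" "\<not> k - int n < 0" using n k by auto
    ultimately show "scale (of_nat n) (x n (\<Sum>r<m. scale (1 / fact r) (pw x r (m - n) v)))
      = scale (of_nat n) (x n (exi x (k - int n) v))"
      by (simp add: exi_def)
  qed simp
  also have "\<dots> = (\<Sum>n=1..M. scale (of_nat n) (x n (exi x (k - int n) v)))"
    using assms(2) k by (intro sum.mono_neutral_left) (auto simp: lin_0[OF L])
  finally show ?thesis .
qed

lemma scale_cancel_int: "k \<noteq> 0 \<Longrightarrow> scale (of_int k) v = scale (of_int k) w \<Longrightarrow> v = w"
  using fock.scale_left_imp_eq by (metis of_int_eq_0_iff)

text \<open>For \<open>k > 0\<close> the left side can be divided by \<open>k\<close>, so the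
  recursion determines \<open>t k\<close> from \<open>t 0\<close>. Identities between exponentials
  are proved by showing that both sides satisfy the same recursion.\<close>

lemma euler_unique:
  assumes "cmodes x" "\<And>k. k < 0 \<Longrightarrow> t k = 0"
    and "\<And>k. k > 0 \<Longrightarrow> scale (of_int k) (t k) = (\<Sum>n=1..nat k. scale (of_nat n) (x n (t (k - int n))))"
  shows "t k = exi x k (t 0)"
proof (cases "k < 0")
  case False
  then show ?thesis
  proof (induction "nat k" arbitrary: k rule: less_induct)
    case less
    show ?case
    proof (cases "k = 0")
      case False
      then have k: "k > 0" using less.prems by simp
      have "scale (of_int k) (t k) = (\<Sum>n=1..nat k. scale (of_nat n) (x n (t (k - int n))))"
        by (rule assms(3)[OF k])
      also have "\<dots> = (\<Sum>n=1..nat k. scale (of_nat n) (x n (exi x (k - int n) (t 0))))"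
      proof (rule sum.cong[OF refl])
        fix n assume "n \<in> {1..nat k}"
        then have "t (k - int n) = exi x (k - int n) (t 0)"
          using less.hyps[of "k - int n"] by auto
        then show "scale (of_nat n) (x n (t (k - int n))) = scale (of_nat n) (x n (exi x (k - int n) (t 0)))"
          by simp
      qed
      also have "\<dots> = scale (of_int k) (exi x k (t 0))"
        by (rule exi_euler[OF assms(1), symmetric]) simp
      finally show ?thesis using k scale_cancel_int[of k] by simp
    qed simp
  qed
qed (simp add: assms(2))

lemma exi_kill:
  assumes "cmodes x" "\<And>n. n \<ge> 1 \<Longrightarrow> x n v = 0"
  shows "exi x k v = (if k = 0 then v else 0)"
proof -
  have "(if k = 0 then v else 0) = exi x k (if (0::int) = 0 then v else 0)"
  proof (rule euler_unique[OF assms(1), where t = "\<lambda>k. if k = 0 then v else 0"])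
    fix k :: int assume "k > 0"
    have "scale (of_nat n) (x n (if k - int n = 0 then v else 0)) = 0" if "n \<in> {1..nat k}" for n
      using that assms(2) by (simp add: lin_0[OF cmodes_lin[OF assms(1)]])
    then show "scale (of_int k) (if k = 0 then v else 0)
        = (\<Sum>n=1..nat k. scale (of_nat n) (x n (if k - int n = 0 then v else 0)))"
      using \<open>k > 0\<close> by (subst sum.neutral) auto
  qed simp
  then show ?thesis by simp
qed

lemma cmodes_scale: "cmodes x \<Longrightarrow> cmodes (\<lambda>n v. scale (c n) (x n v))"
  unfolding cmodes_def
  by (auto intro: lin_smult simp: lin_scale)

text \<open>Replacing \<open>z\<close> by \<open>\<mu> z\<close> rescales the \<open>n\<close>-th
  mode by \<open>\<mu>^n\<close>, which is compatible with Euler's recursion.\<close>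

lemma exi_subst:
  assumes "cmodes x" "\<mu> \<noteq> 0"
  shows "scale (\<mu> powi k) (exi x k v) = exi (\<lambda>n v. scale (\<mu> ^ n) (x n v)) k v"
proof -
  note L = cmodes_lin[OF assms(1)]
  have "scale (\<mu> powi k) (exi x k v) = exi (\<lambda>n v. scale (\<mu> ^ n) (x n v)) k (scale (\<mu> powi 0) (exi x 0 v))"
  proof (rule euler_unique[OF cmodes_scale[OF assms(1)]])
    fix k :: int assume "k > 0"
    have "scale (of_int k) (scale (\<mu> powi k) (exi x k v)) = scale (\<mu> powi k) (scale (of_int k) (exi x k v))"
      by (simp add: mult.commute)
    also have "\<dots> = (\<Sum>n=1..nat k. scale (\<mu> powi k) (scale (of_nat n) (x n (exi x (k - int n) v))))"
      by (subst exi_euler[OF assms(1), of _ "nat k"]) (simp_all add: fock.scale_sum_right)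
    also have "\<dots> = (\<Sum>n=1..nat k. scale (of_nat n) (scale (\<mu> ^ n) (x n (scale (\<mu> powi (k - int n)) (exi x (k - int n) v)))))"
      using assms(2) by (intro sum.cong[OF refl]) (auto simp: lin_scale[OF L] power_int_diff)
    finally show "scale (of_int k) (scale (\<mu> powi k) (exi x k v)) = \<dots>" .
  qed simp
  then show ?thesis by simp
qed

text \<open>The formula for \<open>[h, exp X]\<close> with a central commutator: only the mode
  \<open>n0\<close> sees \<open>h\<close>, so the commutator is the exponential shifted by
  \<open>z^n0\<close>. With \<open>c = 0\<close> the same lemma says that \<open>h\<close> commutes
  with the exponential.\<close>

lemma exi_comm:
  assumes "cmodes x" "lin h" "n0 > 0 \<or> c = 0"
    and "\<And>n v. n \<ge> 1 \<Longrightarrow> h (x n v) = x n (h v) + (if int n = n0 then scale c v else 0)"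
  shows "h (exi x k v) = exi x k (h v) + scale c (exi x (k - n0) v)"
proof (cases "k < 0")
  case True
  then show ?thesis using assms(3) by (auto simp: lin_0[OF assms(2)])
next
  case False
  note L = cmodes_lin[OF assms(1)]
  from False show ?thesis
  proof (induction "nat k" arbitrary: k rule: less_induct)
    case less
    show ?case
    proof (cases "k = 0")
      case True
      then show ?thesis using assms(3) by auto
    next
      case False
      then have k: "k > 0" using less.prems by simp
      have "scale (of_int k) (h (exi x k v)) = h (scale (of_int k) (exi x k v))"
        by (simp add: lin_scale[OF assms(2)])
      also have "\<dots> = (\<Sum>n=1..nat k. scale (of_nat n) (h (x n (exi x (k - int n) v))))"
        by (subst exi_euler[OF assms(1), of _ "nat k"]) (simp_all add: lin_sum[OF assms(2)] lin_scale[OF assms(2)])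
      also have "\<dots> = (\<Sum>n=1..nat k. scale (of_nat n) (x n (exi x (k - int n) (h v)))
          + scale c (scale (of_nat n) (x n (exi x (k - n0 - int n) v)))
          + (if int n = n0 then scale (of_int n0 * c) (exi x (k - n0) v) else 0))"
      proof (rule sum.cong)
        fix n assume n: "n \<in> {1..nat k}"
        then have "h (exi x (k - int n) v) = exi x (k - int n) (h v) + scale c (exi x (k - n0 - int n) v)"
          by (subst less.hyps) (auto simp: algebra_simps)
        then show "scale (of_nat n) (h (x n (exi x (k - int n) v))) = scale (of_nat n) (x n (exi x (k - int n) (h v)))
          + scale c (scale (of_nat n) (x n (exi x (k - n0 - int n) v)))
          + (if int n = n0 then scale (of_int n0 * c) (exi x (k - n0) v) else 0)"
          using n by (auto simp: assms(4) lin_add[OF L] lin_scale[OF L] fock.scale_right_distrib mult.commute)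
      qed simp
      also have "\<dots> = scale (of_int k) (exi x k (h v)) + scale c (scale (of_int (k - n0)) (exi x (k - n0) v))
          + scale (of_int n0 * c) (exi x (k - n0) v)"
      proof -
        have 1: "(\<Sum>n=1..nat k. scale (of_nat n) (x n (exi x (k - int n) (h v)))) = scale (of_int k) (exi x k (h v))"
          using k by (subst exi_euler[OF assms(1), of _ "nat k"]) auto
        have 2: "(\<Sum>n=1..nat k. scale c (scale (of_nat n) (x n (exi x (k - n0 - int n) v)))) = scale c (scale (of_int (k - n0)) (exi x (k - n0) v))"
        proof (cases "c = 0")
          case False
          then show ?thesis using assms(3) k
            by (subst exi_euler[OF assms(1), of "k - n0" "nat k"]) (auto simp: fock.scale_sum_right)
        qed simp
        have 3: "(\<Sum>n=1..nat k. if int n = n0 then scale (of_int n0 * c) (exi x (k - n0) v) else 0) = scale (of_int n0 * c) (exi x (k - n0) v)"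
        proof (cases "1 \<le> n0 \<and> n0 \<le> k")
          case True
          then have "(\<Sum>n=1..nat k. if int n = n0 then scale (of_int n0 * c) (exi x (k - n0) v) else 0)
            = (\<Sum>n=1..nat k. if n = nat n0 then scale (of_int n0 * c) (exi x (k - n0) v) else 0)"
            by (intro sum.cong) auto
          then show ?thesis using True by (subst (asm) sum.delta) auto
        next
          case False
          then have z: "scale (of_int n0 * c) (exi x (k - n0) v) = 0" using assms(3) by force
          show ?thesis unfolding z by simp
        qed
        show ?thesis by (simp only: sum.distrib 1 2 3)
      qed
      \<comment> \<open>Derivative of the monomial plus derivative of the exponential:
        \<open>n0 + (k - n0) = k\<close>.\<close>
      also have "\<dots> = scale (of_int k) (exi x k (h v) + scale c (exi x (k - n0) v))"
      proof -
        have "c * of_int (k - n0) + of_int n0 * c = of_int k * c" by (simp add: algebra_simps)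
        then show ?thesis
          by (simp only: fock.scale_right_distrib fock.scale_scale add.assoc fock.scale_left_distrib[symmetric])
      qed
      finally show ?thesis using k scale_cancel_int[of k] by simp
    qed
  qed
qed

lemma cmodes_plus:
  assumes "cmodes x" "cmodes y" "\<And>m n v. x m (y n v) = y n (x m v)"
  shows "cmodes (\<lambda>n v. x n v + y n v)"
  using assms unfolding cmodes_def
  by (auto intro: lin_plus simp: lin_add add_ac)

text \<open>\<open>exp X exp Y = exp (X + Y)\<close> for commuting families: by the product rule,
  the Cauchy product satisfies Euler's recursion for the modes \<open>x_n + y_n\<close>.\<close>

lemma exi_add:
  assumes "cmodes x" "cmodes y" "\<And>m n v. x m (y n v) = y n (x m v)"
  shows "(\<Sum>a=0..k. exi x a (exi y (k - a) v)) = exi (\<lambda>n v. x n v + y n v) k v"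
proof -
  note Lx = cmodes_lin[OF assms(1)] and Ly = cmodes_lin[OF assms(2)]
  have yx: "y n (exi x a v) = exi x a (y n v)" for n a v
    using exi_comm[OF assms(1) Ly, of 0 0 n a v] assms(3) by simp
  let ?t = "\<lambda>k. \<Sum>a=0..k. exi x a (exi y (k - a) v)"
  have "?t k = exi (\<lambda>n v. x n v + y n v) k (?t 0)"
  proof (rule euler_unique[OF cmodes_plus[OF assms]])
    fix k :: int assume k: "k > 0"
    have "scale (of_int k) (?t k) = (\<Sum>a=0..k. scale (of_int a) (exi x a (exi y (k - a) v)))
       + (\<Sum>a=0..k. exi x a (scale (of_int (k - a)) (exi y (k - a) v)))"
      by (simp add: fock.scale_sum_right sum.distrib[symmetric] lin_scale[OF lin_exi[OF Lx]]
          fock.scale_left_distrib[symmetric] del: of_int_diff add: of_int_add[symmetric])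
    also have "(\<Sum>a=0..k. scale (of_int a) (exi x a (exi y (k - a) v)))
       = (\<Sum>a=0..k. \<Sum>n=1..nat k. scale (of_nat n) (x n (exi x (a - int n) (exi y (k - a) v))))"
      by (rule sum.cong[OF refl], rule exi_euler[OF assms(1)]) auto
    also have "\<dots> = (\<Sum>n=1..nat k. scale (of_nat n) (x n (\<Sum>a=0..k. exi x (a - int n) (exi y (k - a) v))))"
      by (subst sum.swap) (simp add: lin_sum[OF Lx] fock.scale_sum_right)
    also have "\<dots> = (\<Sum>n=1..nat k. scale (of_nat n) (x n (?t (k - int n))))"
    proof (rule sum.cong[OF refl])
      fix n assume n: "n \<in> {1..nat k}"
      have "(\<Sum>a=0..k. exi x (a - int n) (exi y (k - a) v)) = (\<Sum>a=int n..k. exi x (a - int n) (exi y (k - a) v))"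
        by (rule sum.mono_neutral_right) auto
      also have "\<dots> = ?t (k - int n)"
        by (rule sum.reindex_bij_witness[of _ "\<lambda>a. a + int n" "\<lambda>a. a - int n"]) (auto simp: algebra_simps)
      finally show "scale (of_nat n) (x n (\<Sum>a=0..k. exi x (a - int n) (exi y (k - a) v)))
        = scale (of_nat n) (x n (?t (k - int n)))" by simp
    qed
    also have "(\<Sum>a=0..k. exi x a (scale (of_int (k - a)) (exi y (k - a) v)))
       = (\<Sum>a=0..k. exi x a (\<Sum>n=1..nat k. scale (of_nat n) (y n (exi y (k - a - int n) v))))"
      by (rule sum.cong[OF refl]) (subst exi_euler[OF assms(2), of _ "nat k"], auto)
    also have "\<dots> = (\<Sum>n=1..nat k. scale (of_nat n) (y n (\<Sum>a=0..k. exi x a (exi y (k - a - int n) v))))"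
      by (simp add: lin_sum[OF lin_exi[OF Lx]] lin_scale[OF lin_exi[OF Lx]] yx[symmetric])
        (subst sum.swap, simp add: lin_sum[OF Ly] fock.scale_sum_right)
    also have "\<dots> = (\<Sum>n=1..nat k. scale (of_nat n) (y n (?t (k - int n))))"
    proof (rule sum.cong[OF refl])
      fix n assume n: "n \<in> {1..nat k}"
      have "(\<Sum>a=0..k. exi x a (exi y (k - a - int n) v)) = ?t (k - int n)"
        by (rule sum.mono_neutral_cong_right)
          (auto simp: algebra_simps lin_0[OF lin_exi[OF Lx]])
      then show "scale (of_nat n) (y n (\<Sum>a=0..k. exi x a (exi y (k - a - int n) v)))
        = scale (of_nat n) (y n (?t (k - int n)))" by simp
    qed
    finally show "scale (of_int k) (?t k) = (\<Sum>n=1..nat k. scale (of_nat n) (x n (?t (k - int n)) + y n (?t (k - int n))))"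
      by (simp add: sum.distrib fock.scale_right_distrib)
  qed simp
  then show ?thesis by simp
qed

text \<open>Bridge from the \<open>Sum_any\<close> powers to the finite sums \<open>pw\<close>: only
  exponents \<open>a = s n\<close> with \<open>1 \<le> n \<le> s k\<close> can contribute.\<close>

lemma ser_power_ebuild:
  assumes "\<And>n. lin (x n)" "s \<in> {1, -1}"
  shows "ser_power (ebuild s x) r k v = (if s * k \<ge> 0 then pw x r (nat (s * k)) v else 0)"
proof (induction r arbitrary: k)
  case 0
  then show ?case using assms(2) by (auto simp: ser_const_def)
next
  case (Suc r)
  let ?F = "(\<lambda>n. s * int n) ` {1..nat (s * k)}"
  have ss: "s * s = 1" using assms(2) by auto
  have "(ebuild s x \<diamondop> ser_power (ebuild s x) r) k v
    = (\<Sum>a\<in>?F. ebuild s x a (ser_power (ebuild s x) r (k - a) v))"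
  proof (rule ser_mult_sum)
    show "{a. ebuild s x a (ser_power (ebuild s x) r (k - a) v) \<noteq> 0} \<subseteq> ?F"
    proof
      fix a assume a: "a \<in> {a. ebuild s x a (ser_power (ebuild s x) r (k - a) v) \<noteq> 0}"
      then have "s * a \<ge> 1" by (auto simp: ebuild_def split: if_splits)
      moreover have "s * (k - a) \<ge> 0" using a
        by (auto simp: ebuild_def Suc lin_0[OF assms(1)] split: if_splits)
      ultimately show "a \<in> ?F" using ss
        by (intro image_eqI[of _ _ "nat (s * a)"]) (auto simp: algebra_simps mult.assoc[symmetric])
    qed
  qed simp
  also have "\<dots> = (\<Sum>n=1..nat (s * k). ebuild s x (s * int n) (ser_power (ebuild s x) r (k - s * int n) v))"
    using assms(2) by (subst sum.reindex) (auto simp: inj_on_def)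
  also have "\<dots> = (\<Sum>n=1..nat (s * k). x n (pw x r (nat (s * k) - n) v))"
  proof (rule sum.cong)
    fix n assume n: "n \<in> {1..nat (s * k)}"
    have e: "s * (s * int n) = int n" "s * (k - s * int n) = s * k - int n"
      using ss by (auto simp: algebra_simps mult.assoc[symmetric])
    then show "ebuild s x (s * int n) (ser_power (ebuild s x) r (k - s * int n) v) = x n (pw x r (nat (s * k) - n) v)"
      using n by (auto simp: ebuild_def Suc e nat_diff_distrib)
  qed simp
  finally show ?case by (cases "s * k \<ge> 0") (auto simp: sum.neutral)
qed

lemma ser_exp_ebuild:
  assumes "\<And>n. lin (x n)" "s \<in> {1, -1}"
  shows "ser_exp (ebuild s x) k v = exi x (s * k) v"
proof (cases "s * k \<ge> 0")
  case True
  have "ser_exp (ebuild s x) k v = (\<Sum>r\<le>nat (s * k). scale (1 / fact r) (ser_power (ebuild s x) r k v))"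
    unfolding ser_exp_def
    by (rule Sum_any.expand_superset, simp, auto simp: ser_power_ebuild[OF assms] split: if_splits)
      (meson assms(1) not_le pw_small)
  then show ?thesis using True by (simp add: ser_power_ebuild[OF assms] exi_def)
next
  case False
  then show ?thesis by (simp add: ser_exp_def ser_power_ebuild[OF assms])
qed

lemma exi_keys:
  assumes "cmodes x" and "\<And>n D v. n \<ge> 1 \<Longrightarrow> Poly_Mapping.keys v \<subseteq> K D \<Longrightarrow> Poly_Mapping.keys (x n v) \<subseteq> K (D + 2 * s * int n)"
    and "Poly_Mapping.keys v \<subseteq> K D"
  shows "Poly_Mapping.keys (exi x k v) \<subseteq> K (D + 2 * s * k)"
proof (cases "k < 0")
  case False
  then show ?thesis
  proof (induction "nat k" arbitrary: k rule: less_induct)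
    case less
    show ?case
    proof (cases "k = 0")
      case True
      then show ?thesis using assms(3) by simp
    next
      case False
      then have k: "k > 0" using less.prems by simp
      have "exi x k v = scale (1 / of_int k) (scale (of_int k) (exi x k v))" using k by simp
      also have "\<dots> = scale (1 / of_int k) (\<Sum>n=1..nat k. scale (of_nat n) (x n (exi x (k - int n) v)))"
        by (subst exi_euler[OF assms(1), of _ "nat k"]) auto
      finally have e: "exi x k v = \<dots>" .
      have "Poly_Mapping.keys (x n (exi x (k - int n) v)) \<subseteq> K (D + 2 * s * k)" if "n \<in> {1..nat k}" for n
      proof -
        have "Poly_Mapping.keys (exi x (k - int n) v) \<subseteq> K (D + 2 * s * (k - int n))"
          using that by (intro less.hyps) auto
        from assms(2)[OF _ this, of n] that show ?thesis by (simp add: algebra_simps)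
      qed
      then show ?thesis unfolding e
        by (intro order_trans[OF keys_scale] keys_sum_subset) blast
    qed
  qed
qed simp


section \<open>The Heisenberg action\<close>

text \<open>The vector \<open>1 \<otimes> e^\<alpha>\<close>, annihilated by all positive
  modes.\<close>

abbreviation vc :: "lattice \<Rightarrow> fock" where
  "vc \<alpha> \<equiv> Poly_Mapping.single (0, \<alpha>) 1"

lemma lin_heis: "lin (heis N i n)"
  by (simp add: heis_def lin_linext)

lemma idx_range: "N \<ge> 1 \<Longrightarrow> idx N i \<in> {1..N}"
proof -
  assume "N \<ge> 1"
  then have "0 \<le> (i - 1) mod int N" "(i - 1) mod int N < int N" by simp_all
  then have "nat ((i - 1) mod int N) < N" by linarith
  then show ?thesis by (simp add: idx_def)
qed

lemma idx_id: "j \<in> {1..N} \<Longrightarrow> idx N (int j) = j"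
  by (auto simp: idx_def)

lemma heis_idx: "N \<ge> 1 \<Longrightarrow> heis N i n = heis N (int (idx N i)) n"
  unfolding heis_def by (simp only: idx_id[OF idx_range])

lemma heis_neg_single:
  "n < 0 \<Longrightarrow> heis N i n (Poly_Mapping.single (m, \<alpha>) 1) =
    Poly_Mapping.single (m + Poly_Mapping.single (idx N i, nat (- n)) 1, \<alpha>) 1"
  by (simp add: heis_def)

lemma heis_pos_single:
  "n > 0 \<Longrightarrow> heis N i n (Poly_Mapping.single (m, \<alpha>) 1) =
    scale (of_int n * of_nat (Poly_Mapping.lookup m (idx N i, nat n)))
      (Poly_Mapping.single (m - Poly_Mapping.single (idx N i, nat n) 1, \<alpha>) 1)"
  by (simp add: heis_def scale_single)

lemma heis_neg_neg:
  assumes "m < 0" "n < 0"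
  shows "heis N i m (heis N j n v) = heis N j n (heis N i m v)"
  by (rule lin_eqI[OF lin_comp[OF lin_heis lin_heis] lin_comp[OF lin_heis lin_heis]])
    (auto simp: heis_neg_single assms add_ac split: prod.splits)

lemma heis_pos_pos:
  assumes "m > 0" "n > 0"
  shows "heis N i m (heis N j n v) = heis N j n (heis N i m v)"
proof (rule lin_eqI[OF lin_comp[OF lin_heis lin_heis] lin_comp[OF lin_heis lin_heis]])
  fix b :: "mono \<times> lattice"
  obtain M \<alpha> where b: "b = (M, \<alpha>)" by (cases b)
  show "heis N i m (heis N j n (Poly_Mapping.single b 1)) = heis N j n (heis N i m (Poly_Mapping.single b 1))"
    using assms
    by (cases "(idx N i, nat m) = (idx N j, nat n)")
      (auto simp: b heis_pos_single lin_scale[OF lin_heis] lookup_minus lookup_single when_def diff_diff_add add_ac)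
qed

lemma heis_pos_neg:
  assumes "m > 0" "n < 0"
  shows "heis N i m (heis N j n v) = heis N j n (heis N i m v)
    + (if idx N i = idx N j \<and> m + n = 0 then scale (of_int m) v else 0)"
proof (rule lin_eqI[OF lin_comp[OF lin_heis lin_heis] lin_plus[OF lin_comp[OF lin_heis lin_heis]]])
  show "lin (\<lambda>v. if idx N i = idx N j \<and> m + n = 0 then scale (of_int m) v else 0)"
    by (auto simp: lin_def fock.scale_right_distrib mult.commute)
  fix b :: "mono \<times> lattice"
  obtain M \<alpha> where b: "b = (M, \<alpha>)" by (cases b)
  let ?x = "(idx N i, nat m)" and ?y = "(idx N j, nat (- n))"
  let ?sx = "Poly_Mapping.single ?x (1::nat)" and ?sy = "Poly_Mapping.single ?y (1::nat)"
  have l: "heis N i m (heis N j n (Poly_Mapping.single b 1)) =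
     scale (of_int m * of_nat (Poly_Mapping.lookup (M + ?sy) ?x)) (Poly_Mapping.single (M + ?sy - ?sx, \<alpha>) 1)"
    by (simp add: b heis_neg_single heis_pos_single assms)
  have r: "heis N j n (heis N i m (Poly_Mapping.single b 1)) =
     scale (of_int m * of_nat (Poly_Mapping.lookup M ?x)) (Poly_Mapping.single (M - ?sx + ?sy, \<alpha>) 1)"
    by (simp add: b heis_neg_single heis_pos_single assms lin_scale[OF lin_heis])
  have xy: "?x = ?y \<longleftrightarrow> idx N i = idx N j \<and> m + n = 0" using assms by auto
  \<comment> \<open>Subtraction of exponents is truncated, so it commutes with raising only when the
    variable occurs in \<open>M\<close>; otherwise the coefficient in front is 0.\<close>
  have pm: "M + ?sy - ?sx = M - ?sx + ?sy" if "Poly_Mapping.lookup M ?x \<noteq> 0"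
    by (rule poly_mapping_eqI) (use that in \<open>auto simp: lookup_add lookup_minus lookup_single when_def\<close>)
  show "heis N i m (heis N j n (Poly_Mapping.single b 1)) = heis N j n (heis N i m (Poly_Mapping.single b 1))
    + (if idx N i = idx N j \<and> m + n = 0 then scale (of_int m) (Poly_Mapping.single b 1) else 0)"
  proof (cases "?x = ?y")
    case True
    have "M + ?sy - ?sx = M" unfolding True by simp
    moreover have "scale (of_int m * of_nat (Poly_Mapping.lookup M ?x)) (Poly_Mapping.single (M - ?sx + ?sy, \<alpha>) 1)
      = scale (of_int m * of_nat (Poly_Mapping.lookup M ?x)) (Poly_Mapping.single (M, \<alpha>) (1::complex))"
      using pm calculation by (cases "Poly_Mapping.lookup M ?x = 0") auto
    moreover have "Poly_Mapping.lookup (M + ?sy) ?x = Poly_Mapping.lookup M ?x + 1"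
      unfolding True by (simp add: lookup_add)
    ultimately show ?thesis unfolding l r using True xy
      by (auto simp add: b fock.scale_left_distrib distrib_left)
  next
    case False
    then have "Poly_Mapping.lookup (M + ?sy) ?x = Poly_Mapping.lookup M ?x"
      by (auto simp: lookup_add lookup_single when_def)
    then show ?thesis unfolding l r using False xy pm
      by (cases "Poly_Mapping.lookup M ?x = 0") auto
  qed
qed

lemma heis_comm:
  assumes "m \<noteq> 0" "n \<noteq> 0"
  shows "heis N i m (heis N j n v) = heis N j n (heis N i m v)
    + (if idx N i = idx N j \<and> m + n = 0 then scale (of_int m) v else 0)"
proof -
  consider "m < 0" "n < 0" | "m > 0" "n > 0" | "m > 0" "n < 0" | "m < 0" "n > 0" using assms by linarith
  then show ?thesis
  proof cases
    case 4
    have "heis N j n (heis N i m v) = heis N i m (heis N j n v)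
      + (if idx N j = idx N i \<and> n + m = 0 then scale (of_int n) v else 0)"
      by (rule heis_pos_neg[OF 4(2,1)])
    moreover have "scale (of_int n) v + scale (of_int m) v = 0" if "n + m = 0"
      using that by (simp add: fock.scale_left_distrib[symmetric] of_int_add[symmetric] del: of_int_add)
    ultimately show ?thesis by (auto simp: add_ac)
  qed (auto simp: heis_neg_neg heis_pos_pos heis_pos_neg)
qed

lemma vac_heis_neg: "n < 0 \<Longrightarrow> Poly_Mapping.lookup (heis N i n v) (0, \<alpha>) = 0"
proof -
  assume n: "n < 0"
  have "Poly_Mapping.keys (heis N i n v) \<subseteq> {b. fst b \<noteq> 0}"
  proof (rule keys_lin_subset[OF lin_heis subset_UNIV])
    fix b :: "mono \<times> lattice"
    have "M + Poly_Mapping.single x (Suc 0) \<noteq> 0" for M :: mono and x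
      by (metis lookup_add lookup_single_eq lookup_zero add_is_0 nat.distinct(1))
    then show "Poly_Mapping.keys (heis N i n (Poly_Mapping.single b 1)) \<subseteq> {b. fst b \<noteq> 0}"
      using n by (cases b) (simp add: heis_neg_single)
  qed
  then show ?thesis by (force simp: in_keys_iff)
qed

lemma heis_pos_vc: "n > 0 \<Longrightarrow> heis N i n (vc \<alpha>) = 0"
  by (simp add: heis_pos_single)


section \<open>Gradings\<close>

definition degm :: "mono \<Rightarrow> int" where
  "degm m = (\<Sum>x\<in>Poly_Mapping.keys m. int (snd x) * int (Poly_Mapping.lookup m x))"

lemma degm_add: "degm (m + m') = degm m + degm m'"
  unfolding degm_def by (rule setsum_keys_plus_distrib) (simp_all add: distrib_left)

lemma degm_single: "degm (Poly_Mapping.single x 1) = int (snd x)"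
  by (simp add: degm_def)

lemma degm_nonneg: "degm m \<ge> 0"
  by (simp add: degm_def sum_nonneg)

lemma mono_minus_single:
  fixes m :: mono
  shows "Poly_Mapping.lookup m x \<noteq> 0 \<Longrightarrow> m - Poly_Mapping.single x 1 + Poly_Mapping.single x 1 = m"
  by (rule poly_mapping_eqI) (auto simp: lookup_add lookup_minus lookup_single when_def)

lemma degm_minus: "Poly_Mapping.lookup m x \<noteq> 0 \<Longrightarrow> degm (m - Poly_Mapping.single x 1) = degm m - int (snd x)"
  using degm_add[of "m - Poly_Mapping.single x 1" "Poly_Mapping.single x 1"]
  by (simp add: mono_minus_single degm_single del: One_nat_def)

text \<open>Basis vectors of twice the conformal weight \<open>D\<close>. Doubling keeps
  \<open>(\<alpha>, \<alpha>) / 2\<close> integral on the whole lattice type, hence the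
  \<open>2 * k\<close> in \<open>gr\<close>.\<close>

definition K1 :: "nat \<Rightarrow> int \<Rightarrow> (mono \<times> lattice) set" where
  "K1 N D = {(m, \<alpha>). 2 * degm m + form N \<alpha> \<alpha> = D}"

text \<open>A family constant in the degree: for it, \<open>gr\<close> states that the coefficients
  preserve \<open>fock_space N\<close>, so grading and stability are proved by the same
  lemmas.\<close>

definition K2 :: "nat \<Rightarrow> int \<Rightarrow> (mono \<times> lattice) set" where
  "K2 N D = {(m, \<alpha>). Poly_Mapping.keys m \<subseteq> {1..N} \<times> {1..} \<and> \<alpha> \<in> root_lattice N}"

lemma fock_space_K2: "v \<in> fock_space N \<longleftrightarrow> Poly_Mapping.keys v \<subseteq> K2 N D"
  by (auto simp: fock_space_def K2_def)

definition hgr :: "nat \<Rightarrow> (int \<Rightarrow> (mono \<times> lattice) set) \<Rightarrow> bool" where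
  "hgr N K \<longleftrightarrow> (\<forall>i n D v. n \<noteq> 0 \<longrightarrow> Poly_Mapping.keys v \<subseteq> K D \<longrightarrow> Poly_Mapping.keys (heis N i n v) \<subseteq> K (D - 2 * n))"

lemma hgrI:
  assumes "\<And>i n D m \<alpha>. n > 0 \<Longrightarrow> (m, \<alpha>) \<in> K D \<Longrightarrow> (m + Poly_Mapping.single (idx N i, nat n) 1, \<alpha>) \<in> K (D + 2 * n)"
    and "\<And>i n D m \<alpha>. n > 0 \<Longrightarrow> (m, \<alpha>) \<in> K D \<Longrightarrow> Poly_Mapping.lookup m (idx N i, nat n) \<noteq> 0 \<Longrightarrow>
      (m - Poly_Mapping.single (idx N i, nat n) 1, \<alpha>) \<in> K (D - 2 * n)"
  shows "hgr N K"
  unfolding hgr_def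
proof (intro allI impI)
  fix i n D :: int and v :: fock
  assume n: "n \<noteq> 0" and v: "Poly_Mapping.keys v \<subseteq> K D"
  show "Poly_Mapping.keys (heis N i n v) \<subseteq> K (D - 2 * n)"
  proof (rule keys_lin_subset[OF lin_heis v])
    fix b assume b: "b \<in> K D"
    obtain m \<alpha> where bm: "b = (m, \<alpha>)" by (cases b)
    show "Poly_Mapping.keys (heis N i n (Poly_Mapping.single b 1)) \<subseteq> K (D - 2 * n)"
    proof (cases "n < 0")
      case True
      then show ?thesis using assms(1)[of "- n" m \<alpha> D i] b by (simp add: bm heis_neg_single)
    next
      case False
      then show ?thesis using assms(2)[of n m \<alpha> D i] b n
        by (cases "Poly_Mapping.lookup m (idx N i, nat n) = 0") (simp_all add: bm heis_pos_single scale_single)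
    qed
  qed
qed

lemma hgr_K1: "hgr N (K1 N)"
  by (rule hgrI) (auto simp: K1_def degm_add degm_single degm_minus simp del: One_nat_def)

lemma hgr_K2: "N \<ge> 1 \<Longrightarrow> hgr N (K2 N)"
proof (rule hgrI)
  fix i n D :: int and m \<alpha>
  assume N: "N \<ge> 1" and n: "n > 0" and m: "(m, \<alpha>) \<in> K2 N D"
  show "(m + Poly_Mapping.single (idx N i, nat n) 1, \<alpha>) \<in> K2 N (D + 2 * n)"
    using m n idx_range[OF N, of i] keys_add[of m "Poly_Mapping.single (idx N i, nat n) 1"]
    by (auto simp: K2_def)
  have "Poly_Mapping.keys (m - Poly_Mapping.single (idx N i, nat n) 1) \<subseteq> Poly_Mapping.keys m"
    by (auto simp: in_keys_iff lookup_minus)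
  then show "(m - Poly_Mapping.single (idx N i, nat n) 1, \<alpha>) \<in> K2 N (D - 2 * n)"
    using m by (auto simp: K2_def)
qed

lemma form_self_nonneg: "form N \<alpha> \<alpha> \<ge> 0"
  by (simp add: form_def sum_nonneg)

lemma form_add_left: "form N (\<alpha> + \<beta>) \<gamma> = form N \<alpha> \<gamma> + form N \<beta> \<gamma>"
  and form_add_right: "form N \<alpha> (\<beta> + \<gamma>) = form N \<alpha> \<beta> + form N \<alpha> \<gamma>"
  and form_diff_left: "form N (\<alpha> - \<beta>) \<gamma> = form N \<alpha> \<gamma> - form N \<beta> \<gamma>"
  by (simp_all add: form_def lookup_add lookup_minus algebra_simps sum.distrib sum_subtractf)

lemma form_zero [simp]: "form N \<gamma> 0 = 0"
  by (simp_all add: form_def)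

lemma form_uminus [simp]: "form N (- \<alpha>) \<gamma> = - form N \<alpha> \<gamma>" "form N \<gamma> (- \<alpha>) = - form N \<gamma> \<alpha>"
  by (simp_all add: form_def sum_negf)

lemma form_sym: "form N \<alpha> \<beta> = form N \<beta> \<alpha>"
  by (simp add: form_def mult.commute)

lemma form_eps: "N \<ge> 1 \<Longrightarrow> form N (eps N i x) \<alpha> = x * Poly_Mapping.lookup \<alpha> (idx N i)"
proof -
  assume "N \<ge> 1"
  have "form N (eps N i x) \<alpha> = (\<Sum>j=1..N. if j = idx N i then x * Poly_Mapping.lookup \<alpha> j else 0)"
    unfolding form_def eps_def by (rule sum.cong) (auto simp: lookup_single when_def)
  then show ?thesis using idx_range[OF \<open>N \<ge> 1\<close>, of i] by (simp add: sum.delta)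
qed

lemma K1_neg: "D < 0 \<Longrightarrow> K1 N D = {}"
proof -
  assume D: "D < 0"
  have "2 * degm m + form N \<alpha> \<alpha> \<noteq> D" for m \<alpha>
    using degm_nonneg[of m] form_self_nonneg[of N \<alpha>] D by linarith
  then show ?thesis by (auto simp: K1_def)
qed

text \<open>Weights are nonnegative, so a homogeneous series cannot lower a vector
  indefinitely.\<close>

lemma gr_lb:
  assumes "gr (K1 N) S" "linser S"
  shows "lbser S"
  unfolding lbser_def
proof
  fix v :: fock
  define d where "d b = 2 * degm (fst b) + form N (snd b) (snd b)" for b :: "mono \<times> lattice"
  have d0: "d b \<ge> 0" for b unfolding d_def by (simp add: degm_nonneg form_self_nonneg)
  \<comment> \<open>The sum bounds each weight in the support and avoids a maximum over a possibly
    empty set.\<close>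
  let ?M = "- (\<Sum>b\<in>Poly_Mapping.keys v. d b)"
  have "S k v = 0" if k: "k < ?M" for k
  proof -
    have "S k (Poly_Mapping.single b 1) = 0" if b: "b \<in> Poly_Mapping.keys v" for b
    proof -
      have "Poly_Mapping.keys (Poly_Mapping.single b (1::complex)) \<subseteq> K1 N (d b)"
        by (cases b) (simp add: K1_def d_def)
      then have "Poly_Mapping.keys (S k (Poly_Mapping.single b 1)) \<subseteq> K1 N (d b + 2 * k)"
        using assms(1) unfolding gr_def by blast
      moreover have "d b \<le> (\<Sum>b\<in>Poly_Mapping.keys v. d b)"
        using b by (intro member_le_sum) (auto simp: d0)
      then have "d b + 2 * k < 0" using k d0[of b] by linarith
      ultimately show ?thesis by (simp add: K1_neg)
    qed
    then show ?thesis
      by (subst lin_eqI[OF linserD[OF assms(2)] lin_zero]) auto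
  qed
  then show "\<exists>M. \<forall>k<M. S k v = 0" by blast
qed

text \<open>Annihilation parts only lower exponents, so the exponents of the product are bounded
  above by those of \<open>B\<close>; the weight bounds them below.\<close>

lemma finser_mult_annih:
  assumes "gr (K1 N) A" "linser A" "gr (K1 N) B" "linser B" "finser B" "\<And>k v. k > 0 \<Longrightarrow> A k v = 0"
  shows "finser (A \<diamondop> B)"
  unfolding finser_def
proof
  fix v
  have S: "summ A B" by (rule summ_fin[OF assms(2,5)])
  obtain M where M: "\<And>k. k < M \<Longrightarrow> (A \<diamondop> B) k v = 0"
    using gr_lb[OF gr_mult[OF assms(1,3)] linser_mult[OF assms(2,4) S]] unfolding lbser_def by blast
  have f: "finite {k. B k v \<noteq> 0}" using assms(5) by (simp add: finser_def)
  obtain U where U: "\<And>k. B k v \<noteq> 0 \<Longrightarrow> k \<le> U"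
    using Max_ge[OF f] by blast
  have "(A \<diamondop> B) k v = 0" if "k > U" for k
  proof -
    have "A a (B (k - a) v) = 0" for a
    proof (cases "a > 0")
      case False
      then have "B (k - a) v = 0" using U[of "k - a"] that by force
      then show ?thesis by (simp add: lin_0[OF linserD[OF assms(2)]])
    qed (simp add: assms(6))
    then show ?thesis by (simp add: ser_mult_def)
  qed
  with M have "{k. (A \<diamondop> B) k v \<noteq> 0} \<subseteq> {M..U}" by (force simp: not_less[symmetric])
  then show "finite {k. (A \<diamondop> B) k v \<noteq> 0}" by (rule finite_subset) simp
qed


section \<open>Exponentials of Heisenberg modes\<close>

text \<open>The factor \<open>1 / n\<close> cancels the \<open>n\<close> of the Heisenberg bracket,
  so that \<open>f j n\<close> itself appears, up to sign, as the commutator of the exponential with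
  a mode of \<open>\<epsilon>_j\<close>. \<open>\<sigma> = -1\<close> gives creation modes,
  \<open>\<sigma> = 1\<close> annihilation modes.\<close>

definition gmode :: "nat \<Rightarrow> int \<Rightarrow> (nat \<Rightarrow> nat \<Rightarrow> complex) \<Rightarrow> nat \<Rightarrow> fock \<Rightarrow> fock" where
  "gmode N \<sigma> f n v = scale (1 / of_nat n) (\<Sum>j=1..N. scale (f j n) (heis N (int j) (\<sigma> * int n) v))"

text \<open>The mode \<open>\<epsilon>_j(\<sigma> n)\<close> comes with
  \<open>z^(-\<sigma> n)\<close>, whence the index \<open>- \<sigma> * k\<close>.\<close>

definition gexp :: "nat \<Rightarrow> int \<Rightarrow> (nat \<Rightarrow> nat \<Rightarrow> complex) \<Rightarrow> opser" where
  "gexp N \<sigma> f k = exi (gmode N \<sigma> f) (- \<sigma> * k)"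

lemma lin_gmode: "lin (gmode N \<sigma> f n)"
  unfolding gmode_def[abs_def] by (intro lin_smult lin_setsum lin_heis)

lemma gmode_0 [simp]: "gmode N \<sigma> f 0 v = 0"
  by (simp add: gmode_def)

lemma gmode_commute:
  assumes "\<sigma> \<in> {1, -1}"
  shows "gmode N \<sigma> f m (gmode N \<sigma> g n v) = gmode N \<sigma> g n (gmode N \<sigma> f m v)"
proof (cases "m = 0 \<or> n = 0")
  case False
  have h: "heis N i (\<sigma> * int m) (heis N j (\<sigma> * int n) v) = heis N j (\<sigma> * int n) (heis N i (\<sigma> * int m) v)" for i j
    using assms False by (subst heis_comm) auto
  show ?thesis
    by (simp add: gmode_def lin_sum[OF lin_heis] lin_scale[OF lin_heis] fock.scale_sum_right h mult_ac)
      (subst sum.swap, simp add: mult_ac)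
qed (auto simp: lin_0[OF lin_gmode])

lemma cmodes_gmode: "\<sigma> \<in> {1, -1} \<Longrightarrow> cmodes (gmode N \<sigma> f)"
  unfolding cmodes_def using lin_gmode gmode_commute by blast

lemma gmode_comm:
  assumes "\<sigma> \<in> {1, -1}" "j \<in> {1..N}" "m \<noteq> 0" "n \<ge> 1"
  shows "heis N (int j) m (gmode N \<sigma> f n v) = gmode N \<sigma> f n (heis N (int j) m v)
    + (if int n = - \<sigma> * m then scale (- of_int \<sigma> * f j n) v else 0)"
proof -
  have sn: "\<sigma> * int n \<noteq> 0" using assms by auto
  have "heis N (int j) m (gmode N \<sigma> f n v) = scale (1 / of_nat n) (\<Sum>i=1..N. scale (f i n)
      (heis N (int i) (\<sigma> * int n) (heis N (int j) m v) + (if j = i \<and> m + \<sigma> * int n = 0 then scale (of_int m) v else 0)))"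
    using assms(2)
    by (simp add: gmode_def lin_sum[OF lin_heis] lin_scale[OF lin_heis] heis_comm[OF assms(3) sn] idx_id cong: if_cong)
  also have "\<dots> = gmode N \<sigma> f n (heis N (int j) m v) + scale (1 / of_nat n)
      (\<Sum>i=1..N. scale (f i n) (if j = i \<and> m + \<sigma> * int n = 0 then scale (of_int m) v else 0))"
    by (simp only: gmode_def fock.scale_right_distrib sum.distrib)
  also have "(\<Sum>i=1..N. scale (f i n) (if j = i \<and> m + \<sigma> * int n = 0 then scale (of_int m) v else 0))
     = (\<Sum>i=1..N. if i = j then (if m + \<sigma> * int n = 0 then scale (f j n * of_int m) v else 0) else 0)"
    by (rule sum.cong) auto
  also have "\<dots> = (if m + \<sigma> * int n = 0 then scale (f j n * of_int m) v else 0)"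
    using assms(2) by (simp add: sum.delta)
  also have "scale (1 / of_nat n) \<dots> = (if int n = - \<sigma> * m then scale (- of_int \<sigma> * f j n) v else 0)"
  proof -
    have iff: "m + \<sigma> * int n = 0 \<longleftrightarrow> int n = - \<sigma> * m" using assms(1) by auto
    have "(of_int m :: complex) = - of_int \<sigma> * of_nat n" if "int n = - \<sigma> * m"
    proof -
      have "m = - \<sigma> * int n" using that assms(1) by auto
      then show ?thesis by simp
    qed
    then show ?thesis using assms(4) iff by (auto simp: mult_ac)
  qed
  finally show ?thesis .
qed

lemma linser_gexp: "linser (gexp N \<sigma> f)"
  unfolding linser_def gexp_def by (intro allI lin_exi lin_gmode)

lemma gexp_cre: "k < 0 \<Longrightarrow> gexp N (- 1) f k v = 0"
  and gexp_annih: "k > 0 \<Longrightarrow> gexp N 1 f k v = 0"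
  by (simp_all add: gexp_def)

lemma gr_gexp:
  assumes "hgr N K" "\<sigma> \<in> {1, -1}"
  shows "gr K (gexp N \<sigma> f)"
  unfolding gr_def
proof (intro allI impI)
  fix k D and v :: fock
  assume v: "Poly_Mapping.keys v \<subseteq> K D"
  have "Poly_Mapping.keys (exi (gmode N \<sigma> f) (- \<sigma> * k) v) \<subseteq> K (D + 2 * (- \<sigma>) * (- \<sigma> * k))"
  proof (rule exi_keys[where K = K and s = "- \<sigma>" and D = D, OF cmodes_gmode[OF assms(2)] _ v])
    fix n :: nat and D and v :: fock
    assume n: "n \<ge> 1" and v: "Poly_Mapping.keys v \<subseteq> K D"
    have "\<sigma> * int n \<noteq> 0" using n assms(2) by auto
    then have "Poly_Mapping.keys (heis N i (\<sigma> * int n) v) \<subseteq> K (D - 2 * (\<sigma> * int n))" for i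
      using assms(1) v unfolding hgr_def by blast
    then have "Poly_Mapping.keys (gmode N \<sigma> f n v) \<subseteq> K (D - 2 * (\<sigma> * int n))"
      unfolding gmode_def by (intro order_trans[OF keys_scale] keys_sum_subset) blast
    then show "Poly_Mapping.keys (gmode N \<sigma> f n v) \<subseteq> K (D + 2 * (- \<sigma>) * int n)"
      by (simp add: algebra_simps)
  qed
  then show "Poly_Mapping.keys (gexp N \<sigma> f k v) \<subseteq> K (D + 2 * k)"
    using assms(2) by (auto simp: gexp_def)
qed

text \<open>Only modes opposite to those in the exponent fail to commute with it, which is the case
  \<open>- \<sigma> * m > 0\<close>.\<close>

lemma comm_gexp:
  assumes "\<sigma> \<in> {1, -1}" "j \<in> {1..N}" "m \<noteq> 0"
  shows "comm (heis N (int j) m) m (if - \<sigma> * m > 0 then - of_int \<sigma> * f j (nat (- \<sigma> * m)) else 0) (gexp N \<sigma> f)"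
  unfolding comm_def gexp_def
proof (intro allI)
  fix k v
  let ?c = "if - \<sigma> * m > 0 then - of_int \<sigma> * f j (nat (- \<sigma> * m)) else 0"
  have "heis N (int j) m (exi (gmode N \<sigma> f) (- \<sigma> * k) v) = exi (gmode N \<sigma> f) (- \<sigma> * k) (heis N (int j) m v)
    + scale ?c (exi (gmode N \<sigma> f) (- \<sigma> * k - (- \<sigma> * m)) v)"
  proof (rule exi_comm[OF cmodes_gmode[OF assms(1)] lin_heis])
    fix n v assume n: "(n::nat) \<ge> 1"
    show "heis N (int j) m (gmode N \<sigma> f n v) = gmode N \<sigma> f n (heis N (int j) m v)
      + (if int n = - \<sigma> * m then scale ?c v else 0)"
    proof (cases "int n = - \<sigma> * m")
      case True
      then have "nat (- \<sigma> * m) = n" by (metis nat_int)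
      then show ?thesis using True n by (subst gmode_comm[OF assms n]) simp
    next
      case False
      then show ?thesis by (subst gmode_comm[OF assms n]) simp
    qed
  qed auto
  then show "heis N (int j) m (exi (gmode N \<sigma> f) (- \<sigma> * k) v) = exi (gmode N \<sigma> f) (- \<sigma> * k) (heis N (int j) m v)
    + scale ?c (exi (gmode N \<sigma> f) (- \<sigma> * (k - m)) v)"
    by (simp add: algebra_simps)
qed

lemma gexp_annih_vc: "gexp N 1 f k (vc \<alpha>) = (if k = 0 then vc \<alpha> else 0)"
proof -
  have "gmode N 1 f n (vc \<alpha>) = 0" if "n \<ge> 1" for n
    using that by (simp add: gmode_def heis_pos_vc)
  then show ?thesis unfolding gexp_def by (subst exi_kill[OF cmodes_gmode]) auto
qed

lemma gmode_add: "gmode N \<sigma> f n v + gmode N \<sigma> g n v = gmode N \<sigma> (\<lambda>j n. f j n + g j n) n v"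
  by (simp add: gmode_def fock.scale_right_distrib[symmetric] sum.distrib[symmetric] fock.scale_left_distrib)

lemma gexp_subst:
  assumes "\<mu> \<noteq> 0" "\<sigma> \<in> {1, -1}"
  shows "ser_subst \<mu> (gexp N \<sigma> f) = gexp N \<sigma> (\<lambda>j n. \<mu> powi (- \<sigma> * int n) * f j n)"
proof (intro ext)
  fix k v
  have ss: "\<sigma> * (\<sigma> * k) = k" for k using assms(2) by auto
  have "ser_subst \<mu> (gexp N \<sigma> f) k v = scale ((\<mu> powi (- \<sigma>)) powi (- \<sigma> * k)) (exi (gmode N \<sigma> f) (- \<sigma> * k) v)"
    unfolding ser_subst_def gexp_def power_int_mult[symmetric] by (simp add: ss)
  also have "\<dots> = exi (\<lambda>n v. scale ((\<mu> powi (- \<sigma>)) ^ n) (gmode N \<sigma> f n v)) (- \<sigma> * k) v"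
    by (rule exi_subst[OF cmodes_gmode[OF assms(2)]]) (simp add: assms)
  also have "(\<lambda>n v. scale ((\<mu> powi (- \<sigma>)) ^ n) (gmode N \<sigma> f n v)) = gmode N \<sigma> (\<lambda>j n. \<mu> powi (- \<sigma> * int n) * f j n)"
  proof (intro ext)
    fix n v
    have "(\<mu> powi (- \<sigma>)) ^ n = \<mu> powi (- \<sigma> * int n)"
      unfolding power_int_mult[of \<mu> "- \<sigma>" "int n"] by simp
    then show "scale ((\<mu> powi (- \<sigma>)) ^ n) (gmode N \<sigma> f n v) = gmode N \<sigma> (\<lambda>j n. \<mu> powi (- \<sigma> * int n) * f j n) n v"
      by (simp add: gmode_def fock.scale_sum_right mult_ac)
  qed
  finally show "ser_subst \<mu> (gexp N \<sigma> f) k v = gexp N \<sigma> (\<lambda>j n. \<mu> powi (- \<sigma> * int n) * f j n) k v"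
    by (simp only: gexp_def[of N \<sigma> "\<lambda>j n. \<mu> powi (- \<sigma> * int n) * f j n"])
qed

text \<open>Stated on a fixed vector, with the offset \<open>\<zeta>\<close> of a zero mode built
  in, so that it can be iterated over the creation factors of \<open>vX\<close>.\<close>

lemma gexp_mult_cre:
  assumes "\<And>k. B k v = exi (gmode N (- 1) g) (k - \<zeta>) u"
  shows "(gexp N (- 1) f \<diamondop> B) k v = exi (gmode N (- 1) (\<lambda>j n. f j n + g j n)) (k - \<zeta>) u"
proof -
  have L: "lin (exi (gmode N (- 1) f) a)" for a by (intro lin_exi lin_gmode)
  have "(gexp N (- 1) f \<diamondop> B) k v = (\<Sum>a=0..k - \<zeta>. exi (gmode N (- 1) f) a (exi (gmode N (- 1) g) (k - \<zeta> - a) u))"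
    by (subst ser_mult_sum[of "{0..k - \<zeta>}"])
      (auto simp: gexp_def assms algebra_simps lin_0[OF L] not_less[symmetric] intro: ccontr)
  also have "\<dots> = exi (\<lambda>n v. gmode N (- 1) f n v + gmode N (- 1) g n v) (k - \<zeta>) u"
    by (rule exi_add) (simp_all add: cmodes_gmode gmode_commute)
  finally show ?thesis by (simp add: gmode_add)
qed


section \<open>Vertex operators\<close>

text \<open>Lattice shift, power of \<open>z\<close> and scalar factor of a vertex operator in one
  series. The zero modes of \<open>E_i\<close> and \<open>F_i\<close> and the lattice parts of the
  \<open>K_i\<close> are all of this form.\<close>

definition zser :: "lattice \<Rightarrow> (lattice \<Rightarrow> int) \<Rightarrow> (lattice \<Rightarrow> complex) \<Rightarrow> opser" where
  "zser \<beta> \<zeta> \<tau> k = linext (\<lambda>(m, \<alpha>). if \<zeta> \<alpha> = k then Poly_Mapping.single (m, \<alpha> + \<beta>) (\<tau> \<alpha>) else 0)"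

lemma linser_zser: "linser (zser \<beta> \<zeta> \<tau>)"
  by (simp add: linser_def zser_def lin_linext)

lemma zser_single: "zser \<beta> \<zeta> \<tau> k (Poly_Mapping.single (m, \<alpha>) 1) =
    (if \<zeta> \<alpha> = k then Poly_Mapping.single (m, \<alpha> + \<beta>) (\<tau> \<alpha>) else 0)"
  by (simp add: zser_def)

lemma finser_zser: "finser (zser \<beta> \<zeta> \<tau>)"
  unfolding finser_def
proof
  fix v
  have "{k. zser \<beta> \<zeta> \<tau> k v \<noteq> 0} \<subseteq> (\<lambda>b. \<zeta> (snd b)) ` Poly_Mapping.keys v"
  proof (intro subsetI, rule ccontr)
    fix k assume k: "k \<in> {k. zser \<beta> \<zeta> \<tau> k v \<noteq> 0}" "k \<notin> (\<lambda>b. \<zeta> (snd b)) ` Poly_Mapping.keys v"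
    have "zser \<beta> \<zeta> \<tau> k v = 0"
    proof (rule lin_eqI[OF linserD[OF linser_zser] lin_zero])
      fix b assume b: "b \<in> Poly_Mapping.keys v"
      obtain m \<alpha> where bm: "b = (m, \<alpha>)" by (cases b)
      have "\<zeta> \<alpha> \<noteq> k" using b k(2) bm by force
      then show "zser \<beta> \<zeta> \<tau> k (Poly_Mapping.single b 1) = 0" by (simp add: bm zser_single)
    qed
    with k show False by simp
  qed
  then show "finite {k. zser \<beta> \<zeta> \<tau> k v \<noteq> 0}" by (rule finite_subset) simp
qed

lemma comm_zser: "n \<noteq> 0 \<Longrightarrow> comm (heis N i n) n 0 (zser \<beta> \<zeta> \<tau>)"
  unfolding comm_def
proof (intro allI)
  fix k v
  assume n: "n \<noteq> 0"
  have "heis N i n (zser \<beta> \<zeta> \<tau> k v) = zser \<beta> \<zeta> \<tau> k (heis N i n v)"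
  proof (rule lin_eqI[of "\<lambda>v. heis N i n (zser \<beta> \<zeta> \<tau> k v)" "\<lambda>v. zser \<beta> \<zeta> \<tau> k (heis N i n v)"])
    fix b :: "mono \<times> lattice"
    obtain m \<alpha> where b: "b = (m, \<alpha>)" by (cases b)
    show "heis N i n (zser \<beta> \<zeta> \<tau> k (Poly_Mapping.single b 1)) = zser \<beta> \<zeta> \<tau> k (heis N i n (Poly_Mapping.single b 1))"
      using n unfolding b zser_single
      by (cases "n > 0")
        (simp_all add: heis_pos_single heis_neg_single zser_single single_eq_scale[of _ "\<tau> \<alpha>"] lin_0[OF lin_heis]
           lin_scale[OF lin_heis] lin_scale[OF linserD[OF linser_zser]] mult_ac)
  qed (simp_all add: lin_comp lin_heis linserD[OF linser_zser])
  then show "heis N i n (zser \<beta> \<zeta> \<tau> k v) = zser \<beta> \<zeta> \<tau> k (heis N i n v) + scale 0 (zser \<beta> \<zeta> \<tau> (k - n) v)"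
    by simp
qed

lemma gr_zser:
  assumes "\<And>D m \<alpha>. (m, \<alpha>) \<in> K D \<Longrightarrow> (m, \<alpha> + \<beta>) \<in> K (D + 2 * \<zeta> \<alpha>)"
  shows "gr K (zser \<beta> \<zeta> \<tau>)"
  unfolding gr_def
proof (intro allI impI)
  fix k D and v :: fock
  assume v: "Poly_Mapping.keys v \<subseteq> K D"
  show "Poly_Mapping.keys (zser \<beta> \<zeta> \<tau> k v) \<subseteq> K (D + 2 * k)"
  proof (rule keys_lin_subset[OF linserD[OF linser_zser] v])
    fix b assume "b \<in> K D"
    then show "Poly_Mapping.keys (zser \<beta> \<zeta> \<tau> k (Poly_Mapping.single b 1)) \<subseteq> K (D + 2 * k)"
      using assms by (cases b) (auto simp: zser_single split: if_splits)
  qed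
qed

lemma root_lattice_iff_add: "\<alpha> \<in> root_lattice N \<Longrightarrow> \<beta> \<in> root_lattice N \<Longrightarrow> \<alpha> + \<beta> \<in> root_lattice N"
proof -
  assume "\<alpha> \<in> root_lattice N" "\<beta> \<in> root_lattice N"
  then obtain x y where "\<alpha> = (\<Sum>i=1..<N. eps N (int i) (x i) - eps N (int i + 1) (x i))"
    "\<beta> = (\<Sum>i=1..<N. eps N (int i) (y i) - eps N (int i + 1) (y i))"
    unfolding root_lattice_def by blast
  then have "\<alpha> + \<beta> = (\<Sum>i=1..<N. eps N (int i) (x i + y i) - eps N (int i + 1) (x i + y i))"
    by (simp add: sum.distrib[symmetric] eps_def single_add algebra_simps)
  then show ?thesis unfolding root_lattice_def by (intro CollectI exI[of _ "\<lambda>i. x i + y i"]) simp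
qed

lemma zmode_eq:
  "ser_const (e_shift \<epsilon> \<beta>) \<diamondop> z_pow N \<beta> s \<diamondop> ser_const (\<lambda>v. scale c (mu_pow N \<mu> \<gamma> v))
    = zser \<beta> (\<lambda>\<alpha>. form N \<beta> \<alpha> + s) (\<lambda>\<alpha>. of_int (\<epsilon> \<beta> \<alpha>) * c * \<mu> powi form N \<gamma> \<alpha>)"
proof (intro ext)
  fix k v
  have l1: "lin (e_shift \<epsilon> \<beta>)" by (simp add: e_shift_def lin_linext)
  have l2: "lin (z_pow N \<beta> s k)" for k by (simp add: z_pow_def lin_linext)
  have l3: "lin (mu_pow N \<mu> \<gamma>)" by (simp add: mu_pow_def lin_linext)
  have "(ser_const (e_shift \<epsilon> \<beta>) \<diamondop> z_pow N \<beta> s \<diamondop> ser_const (\<lambda>v. scale c (mu_pow N \<mu> \<gamma> v))) k v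
    = e_shift \<epsilon> \<beta> (z_pow N \<beta> s k (scale c (mu_pow N \<mu> \<gamma> v)))"
    by (simp add: l1 l2 linser_def)
  also have "\<dots> = zser \<beta> (\<lambda>\<alpha>. form N \<beta> \<alpha> + s) (\<lambda>\<alpha>. of_int (\<epsilon> \<beta> \<alpha>) * c * \<mu> powi form N \<gamma> \<alpha>) k v"
  proof (rule lin_eqI[OF lin_comp[OF l1 lin_comp[OF l2 lin_smult[OF l3]]] linserD[OF linser_zser]])
    fix b :: "mono \<times> lattice"
    show "e_shift \<epsilon> \<beta> (z_pow N \<beta> s k (scale c (mu_pow N \<mu> \<gamma> (Poly_Mapping.single b 1))))
      = zser \<beta> (\<lambda>\<alpha>. form N \<beta> \<alpha> + s) (\<lambda>\<alpha>. of_int (\<epsilon> \<beta> \<alpha>) * c * \<mu> powi form N \<gamma> \<alpha>) k (Poly_Mapping.single b 1)"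
      by (cases b) (auto simp: zser_single mu_pow_def z_pow_def e_shift_def scale_single mult_ac lin_0[OF lin_linext])
  qed
  finally show "(ser_const (e_shift \<epsilon> \<beta>) \<diamondop> z_pow N \<beta> s \<diamondop> ser_const (\<lambda>v. scale c (mu_pow N \<mu> \<gamma> v))) k v = \<dots>" .
qed

lemma mu_pow_zser: "ser_const (mu_pow N \<mu> \<gamma>) = zser 0 (\<lambda>_. 0) (\<lambda>\<alpha>. \<mu> powi form N \<gamma> \<alpha>)"
proof (intro ext)
  fix k v
  have "ser_const (mu_pow N \<mu> \<gamma>) k v = zser 0 (\<lambda>_. 0) (\<lambda>\<alpha>. \<mu> powi form N \<gamma> \<alpha>) k v"
    by (rule lin_eqI[of "ser_const (mu_pow N \<mu> \<gamma>) k"])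
      (auto simp: linserD[OF linser_zser] linserD[OF linser_const] mu_pow_def lin_linext ser_const_def zser_single)
  then show "ser_const (mu_pow N \<mu> \<gamma>) k v = zser 0 (\<lambda>_. 0) (\<lambda>\<alpha>. \<mu> powi form N \<gamma> \<alpha>) k v" .
qed

text \<open>The commutators with the annihilation modes \<open>n > 0\<close> fix the creation
  exponential of a vertex operator; these are the modes of that exponential.\<close>

abbreviation cmode :: "nat \<Rightarrow> (nat \<Rightarrow> int \<Rightarrow> complex) \<Rightarrow> nat \<Rightarrow> fock \<Rightarrow> fock" where
  "cmode N a \<equiv> gmode N (- 1) (\<lambda>j n. a j (int n))"

text \<open>A vertex operator is determined by its commutators \<open>a\<close> with the Heisenberg algebra and by its
  zero mode \<open>e\<^sup>\<alpha> \<mapsto> \<tau> \<alpha> z\<^sup>\<zeta>\<^sup>\<alpha> e\<^bsup>\<alpha>+\<beta>\<^esup>\<close>.\<close>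

definition vop :: "nat \<Rightarrow> (nat \<Rightarrow> int \<Rightarrow> complex) \<Rightarrow> lattice \<Rightarrow> (lattice \<Rightarrow> int) \<Rightarrow> (lattice \<Rightarrow> complex) \<Rightarrow> opser \<Rightarrow> bool" where
  "vop N a \<beta> \<zeta> \<tau> Y \<longleftrightarrow> linser Y \<and> gr (K1 N) Y \<and> gr (K2 N) Y \<and>
    (\<forall>j\<in>{1..N}. \<forall>n. n \<noteq> 0 \<longrightarrow> comm (heis N (int j) n) n (a j n) Y) \<and>
    (\<forall>\<alpha> k. Y k (vc \<alpha>) = scale (\<tau> \<alpha>) (exi (cmode N a) (k - \<zeta> \<alpha>) (vc (\<alpha> + \<beta>))))"

lemma vop_lin: "vop N a \<beta> \<zeta> \<tau> Y \<Longrightarrow> lin (Y k)"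
  and vop_gr1: "vop N a \<beta> \<zeta> \<tau> Y \<Longrightarrow> gr (K1 N) Y"
  and vop_gr2: "vop N a \<beta> \<zeta> \<tau> Y \<Longrightarrow> gr (K2 N) Y"
  and vop_comm: "vop N a \<beta> \<zeta> \<tau> Y \<Longrightarrow> j \<in> {1..N} \<Longrightarrow> n \<noteq> 0 \<Longrightarrow>
    heis N (int j) n (Y k v) = Y k (heis N (int j) n v) + scale (a j n) (Y (k - n) v)"
  and vop_vc: "vop N a \<beta> \<zeta> \<tau> Y \<Longrightarrow> Y k (vc \<alpha>) = scale (\<tau> \<alpha>) (exi (cmode N a) (k - \<zeta> \<alpha>) (vc (\<alpha> + \<beta>)))"
  unfolding vop_def comm_def linser_def by blast+

lemma cmode_cong:
  assumes "\<And>j n. j \<in> {1..N} \<Longrightarrow> n \<noteq> 0 \<Longrightarrow> f j n = g j n"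
  shows "gmode N \<sigma> f = gmode N \<sigma> g"
proof (intro ext)
  fix n v show "gmode N \<sigma> f n v = gmode N \<sigma> g n v"
    by (cases "n = 0") (auto simp: gmode_def assms intro!: arg_cong[of _ _ "scale _"] sum.cong)
qed

lemma vop_cong:
  assumes "vop N a \<beta> \<zeta> \<tau> Y" "\<And>j n. j \<in> {1..N} \<Longrightarrow> n \<noteq> 0 \<Longrightarrow> a j n = a' j n"
    and "\<And>\<alpha>. \<zeta> \<alpha> = \<zeta>' \<alpha>" "\<And>\<alpha>. \<tau> \<alpha> = \<tau>' \<alpha>"
  shows "vop N a' \<beta> \<zeta>' \<tau>' Y"
proof -
  have "cmode N a = cmode N a'" by (rule cmode_cong) (simp add: assms(2))
  then show ?thesis using assms(1) unfolding vop_def assms(3)[symmetric] assms(4)[symmetric]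
    by (auto simp flip: assms(2))
qed

lemma vop_subst:
  assumes Y: "vop N a \<beta> \<zeta> \<tau> Y" and \<mu>: "\<mu> \<noteq> 0"
  shows "vop N (\<lambda>j n. \<mu> powi n * a j n) \<beta> \<zeta> (\<lambda>\<alpha>. \<mu> powi \<zeta> \<alpha> * \<tau> \<alpha>) (ser_subst \<mu> Y)"
  unfolding vop_def
proof (intro conjI ballI allI impI)
  show "linser (ser_subst \<mu> Y)" "gr (K1 N) (ser_subst \<mu> Y)" "gr (K2 N) (ser_subst \<mu> Y)"
    using Y by (simp_all add: vop_def linser_subst gr_subst)
next
  fix j n assume "j \<in> {1..N}" "(n::int) \<noteq> 0"
  then have "comm (heis N (int j) n) n (a j n) Y" using Y by (simp add: vop_def)
  from comm_subst[OF this lin_heis \<mu>] show "comm (heis N (int j) n) n (\<mu> powi n * a j n) (ser_subst \<mu> Y)"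
    by (simp add: mult.commute)
next
  fix \<alpha> k
  let ?e = "exi (cmode N a) (k - \<zeta> \<alpha>) (vc (\<alpha> + \<beta>))"
  have "ser_subst \<mu> Y k (vc \<alpha>) = scale (\<mu> powi k) (scale (\<tau> \<alpha>) ?e)"
    by (simp add: ser_subst_def vop_vc[OF Y])
  also have "\<dots> = scale (\<mu> powi \<zeta> \<alpha> * \<tau> \<alpha>) (scale (\<mu> powi (k - \<zeta> \<alpha>)) ?e)"
    using \<mu> by (simp add: power_int_diff)
  also have "scale (\<mu> powi (k - \<zeta> \<alpha>)) ?e = exi (\<lambda>n v. scale (\<mu> ^ n) (cmode N a n v)) (k - \<zeta> \<alpha>) (vc (\<alpha> + \<beta>))"
    by (rule exi_subst) (simp_all add: cmodes_gmode \<mu>)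
  also have "(\<lambda>n v. scale (\<mu> ^ n) (cmode N a n v)) = cmode N (\<lambda>j n. \<mu> powi n * a j n)"
    by (intro ext) (simp add: gmode_def fock.scale_sum_right mult_ac)
  finally show "ser_subst \<mu> Y k (vc \<alpha>) = scale (\<mu> powi \<zeta> \<alpha> * \<tau> \<alpha>)
    (exi (cmode N (\<lambda>j n. \<mu> powi n * a j n)) (k - \<zeta> \<alpha>) (vc (\<alpha> + \<beta>)))" .
qed

lemma gexp_mult_annih_vc:
  assumes "\<And>k. B k v = (if k = \<zeta> then scale t (vc \<gamma>) else 0)"
  shows "(gexp N 1 g \<diamondop> B) k v = (if k = \<zeta> then scale t (vc \<gamma>) else 0)"
  by (subst ser_mult_sum[of "{k - \<zeta>}"])
    (auto simp: assms lin_0[OF linserD[OF linser_gexp]] lin_scale[OF linserD[OF linser_gexp]] gexp_annih_vc split: if_splits)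

lemma exi_zero_mode: "exi (gmode N (- 1) (\<lambda>_ _. 0)) k v = (if k = 0 then v else 0)"
  by (rule exi_kill) (simp_all add: cmodes_gmode gmode_def)

text \<open>Summability of a product depends on what stands to its right, so the five factors are
  assembled from the right. The zero mode, and its product with one annihilation exponential, are
  finitely supported, which admits the second one; the creation exponentials then need only the
  lower bound given by the weight. The hypothesis on \<open>\<zeta>\<close> says that the zero mode
  is homogeneous for \<open>K1\<close>.\<close>

lemma vop_X:
  assumes N: "N \<ge> 1" and \<beta>: "\<beta> \<in> root_lattice N"
    and \<zeta>: "\<And>\<alpha>. form N (\<alpha> + \<beta>) (\<alpha> + \<beta>) = form N \<alpha> \<alpha> + 2 * \<zeta> \<alpha>"
  shows "vop N (\<lambda>j n. if n > 0 then f1 j (nat n) + f2 j (nat n) else - (g1 j (nat (- n)) + g2 j (nat (- n)))) \<beta> \<zeta> \<tau>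
    (gexp N (- 1) f1 \<diamondop> gexp N (- 1) f2 \<diamondop> gexp N 1 g1 \<diamondop> gexp N 1 g2 \<diamondop> zser \<beta> \<zeta> \<tau>)" (is "vop N ?a \<beta> \<zeta> \<tau> _")
proof -
  let ?A1 = "gexp N (- 1) f1" and ?A2 = "gexp N (- 1) f2" and ?B1 = "gexp N 1 g1" and ?B2 = "gexp N 1 g2"
  let ?Z = "zser \<beta> \<zeta> \<tau>"
  have grZ1: "gr (K1 N) ?Z" by (rule gr_zser) (simp add: K1_def \<zeta>)
  have grZ2: "gr (K2 N) ?Z" by (rule gr_zser) (simp add: K2_def root_lattice_iff_add \<beta>)
  have G: "gr (K1 N) (gexp N \<sigma> f)" "gr (K2 N) (gexp N \<sigma> f)" if "\<sigma> \<in> {1, -1}" for \<sigma> f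
    using gr_gexp[OF hgr_K1 that] gr_gexp[OF hgr_K2[OF N] that] by blast+
  note L = linser_gexp linser_zser
  let ?S1 = "?B2 \<diamondop> ?Z" let ?S2 = "?B1 \<diamondop> ?S1" let ?S3 = "?A2 \<diamondop> ?S2" let ?S4 = "?A1 \<diamondop> ?S3"
  have g1: "gr (K1 N) ?S1" "gr (K2 N) ?S1" using gr_mult G(1)[of 1] G(2)[of 1] grZ1 grZ2 by blast+
  have s1: "summ ?B2 ?Z" by (rule summ_fin[OF linser_gexp finser_zser])
  have l1: "linser ?S1" by (rule linser_mult[OF L s1])
  have f1: "finser ?S1" by (rule finser_mult_annih[where N = N]) (simp_all add: G grZ1 L finser_zser gexp_annih)
  have g2: "gr (K1 N) ?S2" "gr (K2 N) ?S2" using gr_mult G(1)[of 1] G(2)[of 1] g1 by blast+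
  have s2: "summ ?B1 ?S1" by (rule summ_fin[OF linser_gexp f1])
  have l2: "linser ?S2" by (rule linser_mult[OF linser_gexp l1 s2])
  have g3: "gr (K1 N) ?S3" "gr (K2 N) ?S3" using gr_mult G(1)[of "-1"] G(2)[of "-1"] g2 by blast+
  have s3: "summ ?A2 ?S2" by (rule summ_cre[OF gexp_cre linser_gexp gr_lb[OF g2(1) l2]])
  have l3: "linser ?S3" by (rule linser_mult[OF linser_gexp l2 s3])
  have g4: "gr (K1 N) ?S4" "gr (K2 N) ?S4" using gr_mult G(1)[of "-1"] G(2)[of "-1"] g3 by blast+
  have s4: "summ ?A1 ?S3" by (rule summ_cre[OF gexp_cre linser_gexp gr_lb[OF g3(1) l3]])
  have l4: "linser ?S4" by (rule linser_mult[OF linser_gexp l3 s4])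
  have cm: "comm (heis N (int j) n) n (?a j n) ?S4" if j: "j \<in> {1..N}" and n: "n \<noteq> 0" for j n
  proof -
    let ?c = "\<lambda>\<sigma> f. if - \<sigma> * n > 0 then - of_int \<sigma> * f j (nat (- \<sigma> * n)) else (0::complex)"
    have c: "comm (heis N (int j) n) n (?c \<sigma> f) (gexp N \<sigma> f)" if "\<sigma> \<in> {1, -1}" for \<sigma> f
      by (rule comm_gexp[OF that j n])
    have "comm (heis N (int j) n) n (?c (-1) f1 + (?c (-1) f2 + (?c 1 g1 + (?c 1 g2 + 0)))) ?S4"
      by (intro comm_mult lin_heis l1 l2 l3 s1 s2 s3 s4 L c comm_zser n) auto
    moreover have "?c (-1) f1 + (?c (-1) f2 + (?c 1 g1 + (?c 1 g2 + 0))) = ?a j n"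
      using n by auto
    ultimately show ?thesis by simp
  qed
  have st: "?S4 k (vc \<alpha>) = scale (\<tau> \<alpha>) (exi (cmode N ?a) (k - \<zeta> \<alpha>) (vc (\<alpha> + \<beta>)))" for k \<alpha>
  proof -
    have "?Z k (vc \<alpha>) = (if k = \<zeta> \<alpha> then scale (\<tau> \<alpha>) (vc (\<alpha> + \<beta>)) else 0)" for k
      by (auto simp: zser_single scale_single)
    then have "?S2 k (vc \<alpha>) = (if k = \<zeta> \<alpha> then scale (\<tau> \<alpha>) (vc (\<alpha> + \<beta>)) else 0)" for k
      by (intro gexp_mult_annih_vc)
    \<comment> \<open>Written as a creation exponential with zero coefficients, the form to which
      \<open>gexp_mult_cre\<close> applies.\<close>
    then have "?S2 k (vc \<alpha>) = exi (gmode N (- 1) (\<lambda>_ _. 0)) (k - \<zeta> \<alpha>) (scale (\<tau> \<alpha>) (vc (\<alpha> + \<beta>)))" for k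
      by (simp add: exi_zero_mode)
    then have "?S4 k (vc \<alpha>) = exi (gmode N (- 1) (\<lambda>j n. f1 j n + (f2 j n + 0))) (k - \<zeta> \<alpha>) (scale (\<tau> \<alpha>) (vc (\<alpha> + \<beta>)))"
      by (intro gexp_mult_cre)
    also have "gmode N (- 1) (\<lambda>j n. f1 j n + (f2 j n + 0)) = cmode N ?a"
      by (rule cmode_cong) simp
    finally show ?thesis by (simp add: lin_scale[OF lin_exi[OF lin_gmode]])
  qed
  show ?thesis unfolding vop_def using l4 g4 cm st by blast
qed

text \<open>On \<open>e^\<alpha>\<close> an annihilation exponential is the identity, while a
  creation exponential commutes with the diagonal lattice operator; both cases fit the general form
  with trivial lattice shift.\<close>

lemma vop_K:
  assumes N: "N \<ge> 1" and \<sigma>: "\<sigma> \<in> {1, -1}"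
  shows "vop N (\<lambda>j n. if - \<sigma> * n > 0 then - of_int \<sigma> * f j (nat (- \<sigma> * n)) else 0) 0 (\<lambda>_. 0) (\<lambda>\<alpha>. \<mu> powi form N \<gamma> \<alpha>)
    (ser_const (mu_pow N \<mu> \<gamma>) \<diamondop> gexp N \<sigma> f)" (is "vop N ?a 0 _ ?\<tau> ?Y")
proof -
  let ?Z = "zser 0 (\<lambda>_. 0) ?\<tau>"
  have Y: "?Y = ?Z \<diamondop> gexp N \<sigma> f" by (simp add: mu_pow_zser)
  have l: "lin (mu_pow N \<mu> \<gamma>)" by (simp add: mu_pow_def lin_linext)
  have Yk: "?Y k v = mu_pow N \<mu> \<gamma> (gexp N \<sigma> f k v)" for k v by (simp add: l)
  have gZ: "gr (K1 N) ?Z" "gr (K2 N) ?Z" by (rule gr_zser, simp add: K1_def K2_def)+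
  have gE: "gr (K1 N) (gexp N \<sigma> f)" "gr (K2 N) (gexp N \<sigma> f)"
    using gr_gexp[OF hgr_K1 \<sigma>] gr_gexp[OF hgr_K2[OF N] \<sigma>] by blast+
  have s: "summ ?Z (gexp N \<sigma> f)"
    by (rule summ_cre[OF _ linser_zser gr_lb[OF gE(1) linser_gexp]])
      (simp add: mu_pow_zser[symmetric] ser_const_def)
  have mv: "mu_pow N \<mu> \<gamma> (vc \<alpha>) = scale (?\<tau> \<alpha>) (vc \<alpha>)" for \<alpha>
    by (simp add: mu_pow_def scale_single)
  have cm: "heis N (int j) n (mu_pow N \<mu> \<gamma> v) = mu_pow N \<mu> \<gamma> (heis N (int j) n v)" if "n \<noteq> 0" for j n v
    using comm_zser[OF that, of N "int j" 0 "\<lambda>_. 0" ?\<tau>, unfolded comm_def mu_pow_zser[symmetric], rule_format, of 0 v]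
    by (simp add: ser_const_def)
  have st: "?Y k (vc \<alpha>) = scale (?\<tau> \<alpha>) (exi (cmode N ?a) (k - 0) (vc (\<alpha> + 0)))" for k \<alpha>
  proof (cases "\<sigma> = 1")
    case True
    have "cmode N ?a = gmode N (- 1) (\<lambda>_ _. 0)" by (rule cmode_cong) (simp add: True)
    then show ?thesis unfolding Yk by (simp add: True gexp_annih_vc exi_zero_mode mv lin_0[OF l])
  next
    case False
    then have \<sigma>1: "\<sigma> = -1" using \<sigma> by simp
    have c: "cmode N ?a = gmode N (- 1) f" by (rule cmode_cong) (simp add: \<sigma>1)
    have cc: "mu_pow N \<mu> \<gamma> (gmode N (- 1) f n v) = gmode N (- 1) f n (mu_pow N \<mu> \<gamma> v)" for n v
      by (cases "n = 0") (simp_all add: gmode_def lin_0[OF l] lin_scale[OF l] lin_sum[OF l] cm)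
    have "mu_pow N \<mu> \<gamma> (exi (gmode N (- 1) f) k (vc \<alpha>)) = exi (gmode N (- 1) f) k (mu_pow N \<mu> \<gamma> (vc \<alpha>))"
      using exi_comm[OF cmodes_gmode l, of "-1" 0 0 N f k "vc \<alpha>"] by (simp add: cc)
    then show ?thesis unfolding Yk c by (simp add: gexp_def \<sigma>1 mv lin_scale[OF lin_exi[OF lin_gmode]])
  qed
  show ?thesis unfolding vop_def
  proof (intro conjI ballI allI impI)
    show "linser ?Y" "gr (K1 N) ?Y" "gr (K2 N) ?Y"
      unfolding Y by (rule linser_mult[OF linser_zser linser_gexp s], rule gr_mult[OF gZ(1) gE(1)], rule gr_mult[OF gZ(2) gE(2)])
  next
    fix j n assume "j \<in> {1..N}" "(n::int) \<noteq> 0"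
    from comm_mult[OF lin_heis linser_zser linser_gexp s comm_zser[OF this(2)] comm_gexp[OF \<sigma> this]]
    show "comm (heis N (int j) n) n (?a j n) ?Y" unfolding Y by simp
  qed (rule st)
qed


section \<open>Contractions\<close>

text \<open>Coefficients of \<open>exp (sum of c_n x^n / n)\<close>, defined by Euler's recursion so
  that they match \<open>exi\<close> step by step.\<close>

fun fx :: "(nat \<Rightarrow> complex) \<Rightarrow> nat \<Rightarrow> complex" where
  "fx c m = (if m = 0 then 1 else (\<Sum>n=1..m. c n * fx c (m - n)) / of_nat m)"

declare fx.simps [simp del]

lemma fx_0 [simp]: "fx c 0 = 1"
  by (simp add: fx.simps)

lemma fx_rec: "of_nat m * fx c m = (\<Sum>n=1..m. c n * fx c (m - n))"
  by (cases "m = 0") (simp_all add: fx.simps[of c m])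

definition fxi :: "(nat \<Rightarrow> complex) \<Rightarrow> int \<Rightarrow> complex" where
  "fxi c k = (if k < 0 then 0 else fx c (nat k))"

text \<open>The two-point function of vertex operators with commutators \<open>a\<close> and
  \<open>b\<close> is \<open>exp (sum of contr_n (w/z)^n / n)\<close> times zero modes: the creation
  modes of the second operator are moved through the first, each giving
  \<open>-a(-n)\<close>.\<close>

definition contr :: "nat \<Rightarrow> (nat \<Rightarrow> int \<Rightarrow> complex) \<Rightarrow> (nat \<Rightarrow> int \<Rightarrow> complex) \<Rightarrow> nat \<Rightarrow> complex" where
  "contr N a b n = - (\<Sum>j=1..N. b j (int n) * a j (- int n))"

lemma vop_cmode:
  assumes Y: "vop N a \<beta> \<zeta> \<tau> Y" and n: "n \<ge> 1"
  shows "scale (of_nat n) (Y k (cmode N b n v)) = scale (of_nat n) (cmode N b n (Y k v)) + scale (contr N a b n) (Y (k + int n) v)"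
proof -
  note L = vop_lin[OF Y]
  have "scale (of_nat n) (Y k (cmode N b n v)) = (\<Sum>j=1..N. scale (b j (int n)) (Y k (heis N (int j) (- int n) v)))"
    using n by (simp add: gmode_def lin_scale[OF L] lin_sum[OF L])
  also have "\<dots> = (\<Sum>j=1..N. scale (b j (int n)) (heis N (int j) (- int n) (Y k v))
      - scale (b j (int n) * a j (- int n)) (Y (k + int n) v))"
    using n by (intro sum.cong refl) (simp add: vop_comm[OF Y] fock.scale_right_distrib)
  also have "\<dots> = scale (of_nat n) (cmode N b n (Y k v)) + scale (contr N a b n) (Y (k + int n) v)"
    using n by (simp add: gmode_def contr_def sum_subtractf fock.scale_sum_left)
  finally show ?thesis .
qed

lemma conv_reindex:
  fixes h :: "nat \<Rightarrow> nat \<Rightarrow> 'a::comm_monoid_add"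
  assumes "\<And>n m. n + m > L \<Longrightarrow> h n m = 0"
  shows "(\<Sum>n=1..L. \<Sum>m=0..L. h n m) = (\<Sum>s=0..L. \<Sum>n=1..s. h n (s - n))"
proof -
  have "(\<Sum>n=1..L. \<Sum>m=0..L. h n m) = (\<Sum>(n, m)\<in>{1..L} \<times> {0..L}. h n m)"
    by (simp add: sum.cartesian_product)
  also have "\<dots> = (\<Sum>(n, m)\<in>{(n, m). n \<ge> 1 \<and> n + m \<le> L}. h n m)"
    by (rule sum.mono_neutral_right) (auto intro!: leI dest: assms)
  also have "\<dots> = (\<Sum>(s, n)\<in>Sigma {0..L} (\<lambda>s. {1..s}). h n (s - n))"
    by (rule sum.reindex_bij_witness[of _ "\<lambda>(s, n). (n, s - n)" "\<lambda>(n, m). (n + m, n)"]) auto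
  finally show ?thesis by (simp add: sum.Sigma)
qed

text \<open>Normal ordering. Euler's recursion for the exponential peels off one mode; moving it
  through \<open>Y\<close> costs \<open>contr\<close> and raises the exponent of \<open>Y\<close>.
  Collected by total degree, the scalar side closes up by the recursion of
  \<open>fx\<close>.\<close>

lemma contraction:
  assumes Y: "vop N a \<beta> \<zeta> \<tau> Y"
  shows "Y k (exi (cmode N b) (int l) v)
    = (\<Sum>m=0..l. scale (fx (contr N a b) m) (exi (cmode N b) (int l - int m) (Y (k + int m) v)))"
proof (induction l arbitrary: k rule: less_induct)
  case (less l)
  note L = vop_lin[OF Y]
  let ?X = "cmode N b" and ?c = "contr N a b"
  have X: "cmodes ?X" by (simp add: cmodes_gmode)
  note LX = lin_gmode[of N "-1" "\<lambda>j n. b j (int n)"]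
  note Le = lin_exi[of ?X, OF LX]
  let ?g = "\<lambda>s. exi ?X (int l - int s) (Y (k + int s) v)"
  have IH: "Y k (exi ?X (int l - int n) v) = (\<Sum>m=0..l. scale (fx ?c m) (exi ?X (int l - int n - int m) (Y (k + int m) v)))"
    if "n \<in> {1..l}" for n k
  proof -
    have e1: "int l - int n = int (l - n)" using that by auto
    have "Y k (exi ?X (int (l - n)) v) = (\<Sum>m=0..l-n. scale (fx ?c m) (exi ?X (int (l - n) - int m) (Y (k + int m) v)))"
      using that by (intro less.IH) auto
    also have "\<dots> = (\<Sum>m=0..l. scale (fx ?c m) (exi ?X (int (l - n) - int m) (Y (k + int m) v)))"
      by (rule sum.mono_neutral_left) auto
    finally show ?thesis by (simp only: e1)
  qed
  show ?case
  proof (cases "l = 0")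
    case False
    have "scale (of_nat l) (Y k (exi ?X (int l) v)) = Y k (scale (of_int (int l)) (exi ?X (int l) v))"
      by (simp add: lin_scale[OF L])
    also have "\<dots> = (\<Sum>n=1..l. scale (of_nat n) (Y k (?X n (exi ?X (int l - int n) v))))"
      by (subst exi_euler[OF X, of _ l]) (simp_all add: lin_sum[OF L] lin_scale[OF L])
    also have "\<dots> = (\<Sum>n=1..l. scale (of_nat n) (?X n (Y k (exi ?X (int l - int n) v)))
        + scale (?c n) (Y (k + int n) (exi ?X (int l - int n) v)))"
      by (intro sum.cong refl vop_cmode[OF Y]) simp
    also have "\<dots> = (\<Sum>n=1..l. scale (of_nat n) (?X n (\<Sum>m=0..l. scale (fx ?c m) (exi ?X (int l - int n - int m) (Y (k + int m) v)))))
        + (\<Sum>n=1..l. scale (?c n) (\<Sum>m=0..l. scale (fx ?c m) (exi ?X (int l - int n - int m) (Y (k + int n + int m) v))))"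
      by (simp add: sum.distrib IH)
    also have "(\<Sum>n=1..l. scale (of_nat n) (?X n (\<Sum>m=0..l. scale (fx ?c m) (exi ?X (int l - int n - int m) (Y (k + int m) v)))))
       = (\<Sum>m=0..l. scale (fx ?c m) (\<Sum>n=1..l. scale (of_nat n) (?X n (exi ?X (int l - int m - int n) (Y (k + int m) v)))))"
      by (simp add: lin_sum[OF LX] lin_scale[OF LX] fock.scale_sum_right mult_ac)
        (subst sum.swap, simp add: algebra_simps)
    also have "\<dots> = (\<Sum>m=0..l. scale (fx ?c m) (scale (of_int (int l - int m)) (?g m)))"
      by (intro sum.cong refl arg_cong[of _ _ "scale _"] exi_euler[OF X, symmetric]) simp
    also have "(\<Sum>n=1..l. scale (?c n) (\<Sum>m=0..l. scale (fx ?c m) (exi ?X (int l - int n - int m) (Y (k + int n + int m) v))))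
       = (\<Sum>n=1..l. \<Sum>m=0..l. scale (?c n * fx ?c m) (?g (n + m)))"
      by (simp add: fock.scale_sum_right algebra_simps)
    also have "\<dots> = (\<Sum>s=0..l. \<Sum>n=1..s. scale (?c n * fx ?c (s - n)) (?g (n + (s - n))))"
      by (rule conv_reindex) simp
    also have "\<dots> = (\<Sum>s=0..l. scale (of_nat s * fx ?c s) (?g s))"
      by (intro sum.cong refl) (simp add: fx_rec fock.scale_sum_left)
    also have "(\<Sum>m=0..l. scale (fx ?c m) (scale (of_int (int l - int m)) (?g m))) + \<dots>
       = scale (of_nat l) (\<Sum>m=0..l. scale (fx ?c m) (?g m))"
      by (simp only: sum.distrib[symmetric] fock.scale_sum_right fock.scale_scale fock.scale_left_distrib[symmetric])
        (rule sum.cong[OF refl], simp add: algebra_simps)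
    finally show ?thesis using False scale_cancel_int[of "int l"] by simp
  qed simp
qed

lemma vac_exi_cmode:
  "Poly_Mapping.lookup (exi (cmode N b) l u) (0, \<alpha>) = (if l = 0 then Poly_Mapping.lookup u (0, \<alpha>) else 0)"
proof (cases "l > 0")
  case True
  let ?X = "cmode N b"
  have z: "Poly_Mapping.lookup (?X n w) (0, \<alpha>) = 0" for n w
    by (cases "n = 0") (simp_all add: gmode_def lookup_scale lookup_sum vac_heis_neg)
  have "of_int l * Poly_Mapping.lookup (exi ?X l u) (0, \<alpha>) = Poly_Mapping.lookup (scale (of_int l) (exi ?X l u)) (0, \<alpha>)"
    by (simp add: lookup_scale)
  also have "\<dots> = 0"
    by (subst exi_euler[of _ _ "nat l"]) (simp_all add: cmodes_gmode lookup_sum lookup_scale z)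
  finally show ?thesis using True by simp
next
  case False
  then show ?thesis by (cases "l = 0") auto
qed

lemma vac_contraction:
  assumes Y: "vop N a \<beta> \<zeta> \<tau> Y"
  shows "Poly_Mapping.lookup (Y k (exi (cmode N b) l v)) (0, \<alpha>)
    = fxi (contr N a b) l * Poly_Mapping.lookup (Y (k + l) v) (0, \<alpha>)"
proof (cases "l < 0")
  case True
  then show ?thesis by (simp add: fxi_def lin_0[OF vop_lin[OF Y]])
next
  case False
  define m where "m = nat l"
  have l: "l = int m" using False by (simp add: m_def)
  have "Poly_Mapping.lookup (Y k (exi (cmode N b) l v)) (0, \<alpha>)
    = (\<Sum>n=0..m. if n = m then fx (contr N a b) m * Poly_Mapping.lookup (Y (k + int m) v) (0, \<alpha>) else 0)"
    unfolding l contraction[OF Y] lookup_sum lookup_scale vac_exi_cmode by (rule sum.cong) auto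
  then show ?thesis by (simp add: l fxi_def)
qed

lemma vac_one:
  assumes "vop N a \<beta> \<zeta> \<tau> Y"
  shows "Poly_Mapping.lookup (Y k (vc \<alpha>)) (0, \<gamma>) = (if k = \<zeta> \<alpha> \<and> \<gamma> = \<alpha> + \<beta> then \<tau> \<alpha> else 0)"
  by (auto simp: vop_vc[OF assms] lookup_scale vac_exi_cmode lookup_single when_def)

text \<open>The vacuum component keeps only the term of the normally ordered product without
  creation modes, which leaves zero modes times one contraction coefficient.\<close>

lemma vac_two:
  assumes "vop N a \<beta> \<zeta> \<tau> Y" "vop N a' \<beta>' \<zeta>' \<tau>' Y'"
  shows "Poly_Mapping.lookup (Y k (Y' l (vc \<alpha>))) (0, \<gamma>) =
    (if k + l = \<zeta> (\<alpha> + \<beta>') + \<zeta>' \<alpha> \<and> \<gamma> = \<alpha> + \<beta>' + \<beta>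
     then \<tau> (\<alpha> + \<beta>') * \<tau>' \<alpha> * fxi (contr N a a') (l - \<zeta>' \<alpha>) else 0)"
  by (auto simp: vop_vc[OF assms(2)] lin_scale[OF vop_lin[OF assms(1)]] lookup_scale vac_contraction[OF assms(1)]
      vac_one[OF assms(1)] algebra_simps)

text \<open>The creation exponential of the third operator spends \<open>m\<close> units of degree
  on the second operator and the rest on the first, hence a convolution of two contractions, with
  the contraction between the first two operators shifted by \<open>m\<close>.\<close>

lemma vac_three:
  assumes "vop N a \<beta> \<zeta> \<tau> Y" "vop N a' \<beta>' \<zeta>' \<tau>' Y'" "vop N a'' \<beta>'' \<zeta>'' \<tau>'' Y''"
  shows "Poly_Mapping.lookup (Y k (Y' l (Y'' i (vc \<alpha>)))) (0, \<gamma>) =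
    (if k + l + i = \<zeta> (\<alpha> + \<beta>'' + \<beta>') + \<zeta>' (\<alpha> + \<beta>'') + \<zeta>'' \<alpha> \<and> \<gamma> = \<alpha> + \<beta>'' + \<beta>' + \<beta>
     then \<tau> (\<alpha> + \<beta>'' + \<beta>') * \<tau>' (\<alpha> + \<beta>'') * \<tau>'' \<alpha> *
       (\<Sum>m=0..nat (i - \<zeta>'' \<alpha>). fxi (contr N a' a'') (int m) * fxi (contr N a a'') (i - \<zeta>'' \<alpha> - int m)
          * fxi (contr N a a') (l + int m - \<zeta>' (\<alpha> + \<beta>''))) else 0)"
proof -
  define x where "x = i - \<zeta>'' \<alpha>"
  note L = vop_lin[OF assms(1)]
  have "Poly_Mapping.lookup (Y k (Y' l (Y'' i (vc \<alpha>)))) (0, \<gamma>) =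
    \<tau>'' \<alpha> * Poly_Mapping.lookup (Y k (Y' l (exi (cmode N a'') x (vc (\<alpha> + \<beta>''))))) (0, \<gamma>)"
    by (simp add: vop_vc[OF assms(3)] lin_scale[OF vop_lin[OF assms(2)]] lin_scale[OF L] lookup_scale x_def)
  also have "Poly_Mapping.lookup (Y k (Y' l (exi (cmode N a'') x (vc (\<alpha> + \<beta>''))))) (0, \<gamma>)
    = (\<Sum>m=0..nat x. fxi (contr N a' a'') (int m) * (fxi (contr N a a'') (x - int m) *
      (Poly_Mapping.lookup (Y (k + x - int m) (Y' (l + int m) (vc (\<alpha> + \<beta>'')))) (0, \<gamma>))))"
  proof (cases "x < 0")
    case True
    then show ?thesis by (simp add: lin_0[OF L] lin_0[OF vop_lin[OF assms(2)]] fxi_def)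
  next
    case False
    then have "exi (cmode N a'') x (vc (\<alpha> + \<beta>'')) = exi (cmode N a'') (int (nat x)) (vc (\<alpha> + \<beta>''))" by simp
    then show ?thesis using False
      by (simp only: contraction[OF assms(2)] lin_sum[OF L] lin_scale[OF L] lookup_sum lookup_scale vac_contraction[OF assms(1)])
        (auto simp: fxi_def algebra_simps intro!: sum.cong)
  qed
  also have "\<dots> = (if k + l + i = \<zeta> (\<alpha> + \<beta>'' + \<beta>') + \<zeta>' (\<alpha> + \<beta>'') + \<zeta>'' \<alpha> \<and> \<gamma> = \<alpha> + \<beta>'' + \<beta>' + \<beta>
     then \<tau> (\<alpha> + \<beta>'' + \<beta>') * \<tau>' (\<alpha> + \<beta>'') *
       (\<Sum>m=0..nat x. fxi (contr N a' a'') (int m) * fxi (contr N a a'') (x - int m)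
          * fxi (contr N a a') (l + int m - \<zeta>' (\<alpha> + \<beta>''))) else 0)"
    by (auto simp: vac_two[OF assms(1,2)] x_def sum_distrib_left mult_ac intro!: sum.cong sum.neutral)
  finally show ?thesis by (simp add: x_def mult_ac)
qed


section \<open>Families of operators vanish with their vacuum expectations\<close>

text \<open>Coefficients of a formal expression in \<open>r\<close> variables on which
  \<open>\<epsilon>_j(n)\<close> acts by multiplication with \<open>sum of a_s z_s^n\<close>. All
  orderings of a given product of currents share the same \<open>a\<close>, so their linear
  combinations are again of this kind.\<close>

definition cfam :: "nat \<Rightarrow> nat \<Rightarrow> (nat \<Rightarrow> nat \<Rightarrow> int \<Rightarrow> complex) \<Rightarrow> ((nat \<Rightarrow> int) \<Rightarrow> fock \<Rightarrow> fock) \<Rightarrow> bool" where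
  "cfam N r a R \<longleftrightarrow> (\<forall>k. lin (R k)) \<and>
    (\<forall>k D v. Poly_Mapping.keys v \<subseteq> K1 N D \<longrightarrow> Poly_Mapping.keys (R k v) \<subseteq> K1 N (D + 2 * (\<Sum>s<r. k s))) \<and>
    (\<forall>k v. v \<in> fock_space N \<longrightarrow> R k v \<in> fock_space N) \<and>
    (\<forall>j\<in>{1..N}. \<forall>n. n \<noteq> 0 \<longrightarrow> (\<forall>k v. heis N (int j) n (R k v) = R k (heis N (int j) n v)
      + (\<Sum>s<r. scale (a s j n) (R (k(s := k s - n)) v))))"

lemma cfam_lin: "cfam N r a R \<Longrightarrow> lin (R k)"
  and cfam_gr: "cfam N r a R \<Longrightarrow> Poly_Mapping.keys v \<subseteq> K1 N D \<Longrightarrow> Poly_Mapping.keys (R k v) \<subseteq> K1 N (D + 2 * (\<Sum>s<r. k s))"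
  and cfam_space: "cfam N r a R \<Longrightarrow> v \<in> fock_space N \<Longrightarrow> R k v \<in> fock_space N"
  and cfam_comm: "cfam N r a R \<Longrightarrow> j \<in> {1..N} \<Longrightarrow> n \<noteq> 0 \<Longrightarrow>
    heis N (int j) n (R k v) = R k (heis N (int j) n v) + (\<Sum>s<r. scale (a s j n) (R (k(s := k s - n)) v))"
  unfolding cfam_def by blast+

lemma fock_space_0: "0 \<in> fock_space N"
  by (simp add: fock_space_def)

lemma fock_space_add: "v \<in> fock_space N \<Longrightarrow> w \<in> fock_space N \<Longrightarrow> v + w \<in> fock_space N"
  using keys_add[of v w] unfolding fock_space_def by blast

lemma fock_space_scale: "v \<in> fock_space N \<Longrightarrow> scale x v \<in> fock_space N"
  using keys_scale[of x v] unfolding fock_space_def by blast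

lemma fock_space_uminus: "v \<in> fock_space N \<Longrightarrow> - v \<in> fock_space N"
  using fock_space_scale[of v N "-1"] by simp

lemma fock_space_sum: "(\<And>a. a \<in> A \<Longrightarrow> f a \<in> fock_space N) \<Longrightarrow> sum f A \<in> fock_space N"
  by (induction A rule: infinite_finite_induct) (auto simp: fock_space_0 fock_space_add)

lemma fock_space_single: "Poly_Mapping.keys m \<subseteq> {1..N} \<times> {1..} \<Longrightarrow> \<alpha> \<in> root_lattice N \<Longrightarrow>
    Poly_Mapping.single (m, \<alpha>) c \<in> fock_space N"
  by (simp add: fock_space_def)

lemma fock_space_singleI: "v \<in> fock_space N \<Longrightarrow> b \<in> Poly_Mapping.keys v \<Longrightarrow> Poly_Mapping.single b 1 \<in> fock_space N"
  unfolding fock_space_def by auto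

lemma gr_space: "gr (K2 N) S \<Longrightarrow> v \<in> fock_space N \<Longrightarrow> S k v \<in> fock_space N"
  unfolding gr_def fock_space_K2[of _ N 0] by (fastforce simp: K2_def)

lemma vop_space: "vop N a \<beta> \<zeta> \<tau> Y \<Longrightarrow> v \<in> fock_space N \<Longrightarrow> Y k v \<in> fock_space N"
  using gr_space vop_gr2 by blast

lemma lookup_heis_pos:
  assumes "n > 0"
  shows "Poly_Mapping.lookup (heis N i n v) (m, \<alpha>) = of_int n * of_nat (Poly_Mapping.lookup m (idx N i, nat n) + 1)
    * Poly_Mapping.lookup v (m + Poly_Mapping.single (idx N i, nat n) 1, \<alpha>)"
proof -
  let ?s = "Poly_Mapping.single (idx N i, nat n) (1::nat)"
  let ?c = "of_int n * of_nat (Poly_Mapping.lookup m (idx N i, nat n) + 1) :: complex"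
  have "Poly_Mapping.lookup (heis N i n (Poly_Mapping.single b 1)) (m, \<alpha>) = (if b = (m + ?s, \<alpha>) then ?c else 0)" for b
  proof -
    obtain M \<gamma> where b: "b = (M, \<gamma>)" by (cases b)
    show ?thesis
    proof (cases "Poly_Mapping.lookup M (idx N i, nat n) = 0")
      case True
      then have "M \<noteq> m + ?s" by (auto simp: lookup_add)
      then show ?thesis using True assms by (simp add: b heis_pos_single)
    next
      case False
      then have "M - ?s = m \<longleftrightarrow> M = m + ?s" using mono_minus_single[OF False] by auto
      then show ?thesis using assms by (auto simp: b heis_pos_single lookup_scale lookup_single lookup_add when_def)
    qed
  qed
  then have "Poly_Mapping.lookup (heis N i n v) (m, \<alpha>) = (\<Sum>b\<in>Poly_Mapping.keys v.
      Poly_Mapping.lookup v b * (if b = (m + ?s, \<alpha>) then ?c else 0))"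
    by (subst fock_expand[of v]) (simp add: lin_sum[OF lin_heis] lin_scale[OF lin_heis] lookup_sum lookup_scale)
  also have "\<dots> = (\<Sum>b\<in>Poly_Mapping.keys v. if b = (m + ?s, \<alpha>) then Poly_Mapping.lookup v (m + ?s, \<alpha>) * ?c else 0)"
    by (rule sum.cong) auto
  also have "\<dots> = ?c * Poly_Mapping.lookup v (m + ?s, \<alpha>)"
    by (auto simp: sum.delta in_keys_iff mult.commute)
  finally show ?thesis .
qed

text \<open>For fixed \<open>(j, n)\<close>, lowering is injective on the monomials containing that
  variable, so nothing cancels: a nontrivial monomial of \<open>u\<close> leaves a nonzero
  coefficient in some \<open>heis N (int j) (int n) u\<close>.\<close>

lemma heis_kernel:
  assumes "u \<in> fock_space N" "\<And>j n. j \<in> {1..N} \<Longrightarrow> n > 0 \<Longrightarrow> heis N (int j) n u = 0"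
    and "(m, \<alpha>) \<in> Poly_Mapping.keys u"
  shows "m = 0"
proof (rule ccontr)
  assume "m \<noteq> 0"
  then obtain j n where jn: "(j, n) \<in> Poly_Mapping.keys m" by (metis keys_eq_empty ex_in_conv surj_pair)
  moreover have "Poly_Mapping.keys m \<subseteq> {1..N} \<times> {1..}"
    using assms(1,3) by (auto simp: fock_space_def dest!: bspec)
  ultimately have jN: "j \<in> {1..N}" and n: "n \<ge> 1" by auto
  let ?s = "Poly_Mapping.single (j, n) (1::nat)"
  have "Poly_Mapping.lookup (heis N (int j) (int n) u) (m - ?s, \<alpha>) =
     of_int (int n) * of_nat (Poly_Mapping.lookup (m - ?s) (j, n) + 1) * Poly_Mapping.lookup u (m, \<alpha>)"
    using jn n mono_minus_single[of m "(j, n)"] by (subst lookup_heis_pos) (simp_all add: idx_id[OF jN] in_keys_iff)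
  moreover have "Poly_Mapping.lookup u (m, \<alpha>) \<noteq> 0" using assms(3) by (simp add: in_keys_iff)
  ultimately show False using assms(2)[OF jN, of "int n"] n by (simp del: of_nat_Suc of_nat_add)
qed

lemma sum_fun_upd_diff: "s < (r::nat) \<Longrightarrow> (\<Sum>t<r. (k(s := k s - n)) t) = (\<Sum>t<r. k t) - (n::int)"
proof -
  assume "s < r"
  then have "(\<Sum>t<r. (k(s := k s - n)) t) = (k s - n) + (\<Sum>t\<in>{..<r} - {s}. (k(s := k s - n)) t)"
    by (subst sum.remove[of _ s]) auto
  also have "(\<Sum>t\<in>{..<r} - {s}. (k(s := k s - n)) t) = (\<Sum>t\<in>{..<r} - {s}. k t)" by (rule sum.cong) auto
  also have "k s - n + \<dots> = (\<Sum>t<r. k t) - n" using \<open>s < r\<close> by (subst (2) sum.remove[of _ s]) auto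
  finally show ?thesis .
qed

text \<open>Annihilation operators lower the degree of \<open>R k e\<^sup>\<alpha>\<close>, so by induction on the degree it is a vacuum
  vector; creation operators then carry the vanishing from \<open>e\<^sup>\<alpha>\<close> to the whole Fock space.\<close>

lemma cfam_zero:
  assumes R: "cfam N r a R"
    and vac: "\<And>k \<alpha> \<gamma>. \<alpha> \<in> root_lattice N \<Longrightarrow> Poly_Mapping.lookup (R k (vc \<alpha>)) (0, \<gamma>) = 0"
    and v: "v \<in> fock_space N"
  shows "R k v = 0"
proof -
  note L = cfam_lin[OF R]
  have vcz: "R k (vc \<alpha>) = 0" if \<alpha>: "\<alpha> \<in> root_lattice N" for k \<alpha>
  proof (induction "nat (form N \<alpha> \<alpha> + 2 * (\<Sum>s<r. k s) + 1)" arbitrary: k rule: less_induct)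
    case less
    let ?D = "form N \<alpha> \<alpha> + 2 * (\<Sum>s<r. k s)"
    have vK: "Poly_Mapping.keys (vc \<alpha>) \<subseteq> K1 N (form N \<alpha> \<alpha>)" by (simp add: K1_def degm_def)
    have keys: "Poly_Mapping.keys (R k (vc \<alpha>)) \<subseteq> K1 N ?D" by (rule cfam_gr[OF R vK])
    show ?case
    proof (cases "?D < 0")
      case True
      then show ?thesis using keys by (simp add: K1_neg)
    next
      case False
      have sp: "R k (vc \<alpha>) \<in> fock_space N"
        by (rule cfam_space[OF R]) (simp add: fock_space_single \<alpha>)
      have "heis N (int j) n (R k (vc \<alpha>)) = 0" if j: "j \<in> {1..N}" and n: "n > 0" for j n
      proof -
        have "R (k(s := k s - n)) (vc \<alpha>) = 0" if "s < r" for s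
          by (rule less.hyps) (use False n sum_fun_upd_diff[OF that, of k n] in simp)
        then show ?thesis using n
          by (simp add: cfam_comm[OF R j] heis_pos_vc lin_0[OF L])
      qed
      then have "m = 0" if "(m, \<gamma>) \<in> Poly_Mapping.keys (R k (vc \<alpha>))" for m \<gamma>
        using heis_kernel[OF sp] that by blast
      then have "b \<notin> Poly_Mapping.keys (R k (vc \<alpha>))" for b
        using vac[OF \<alpha>, of k "snd b"] by (cases b) (auto simp: in_keys_iff)
      then have "Poly_Mapping.keys (R k (vc \<alpha>)) = {}" by blast
      then show ?thesis by simp
    qed
  qed
  have mz: "R k (Poly_Mapping.single (m, \<alpha>) 1) = 0"
    if "Poly_Mapping.keys m \<subseteq> {1..N} \<times> {1..}" "\<alpha> \<in> root_lattice N" for k m \<alpha>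
    using that
  proof (induction "nat (degm m)" arbitrary: k m rule: less_induct)
    case less
    show ?case
    proof (cases "m = 0")
      case True
      then show ?thesis using vcz less.prems by simp
    next
      case False
      then obtain j n where jn: "(j, n) \<in> Poly_Mapping.keys m" by (metis keys_eq_empty ex_in_conv surj_pair)
      then have jN: "j \<in> {1..N}" and n: "n \<ge> 1" using less.prems by auto
      let ?m = "m - Poly_Mapping.single (j, n) 1"
      have lm: "Poly_Mapping.lookup m (j, n) \<noteq> 0" using jn by (simp add: in_keys_iff)
      have "degm ?m = degm m - int n" using degm_minus[OF lm] by simp
      moreover have "degm ?m \<ge> 0" by (rule degm_nonneg)
      ultimately have d: "nat (degm ?m) < nat (degm m)" using n by auto
      have "Poly_Mapping.keys ?m \<subseteq> Poly_Mapping.keys m" by (auto simp: in_keys_iff lookup_minus)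
      then have IH: "R k (Poly_Mapping.single (?m, \<alpha>) 1) = 0" for k
        using less.hyps[OF d] less.prems by blast
      have "R k (Poly_Mapping.single (m, \<alpha>) 1) = R k (heis N (int j) (- int n) (Poly_Mapping.single (?m, \<alpha>) 1))"
        using n mono_minus_single[OF lm] by (simp add: heis_neg_single idx_id[OF jN])
      also have "\<dots> = 0"
        using cfam_comm[OF R jN, of "- int n" k "Poly_Mapping.single (?m, \<alpha>) 1"] n
        by (simp add: IH[simplified] lin_0[OF lin_heis])
      finally show ?thesis .
    qed
  qed
  show ?thesis
    by (rule lin_eqI[OF L lin_zero]) (use v mz in \<open>auto simp: fock_space_def\<close>)
qed

lemma cfam_add:
  assumes "cfam N r a R" "cfam N r a S"
  shows "cfam N r a (\<lambda>k v. R k v + S k v)"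
  unfolding cfam_def
proof (intro conjI allI impI ballI)
  fix k D and v :: fock
  assume v: "Poly_Mapping.keys v \<subseteq> K1 N D"
  show "Poly_Mapping.keys (R k v + S k v) \<subseteq> K1 N (D + 2 * (\<Sum>s<r. k s))"
    using keys_add[of "R k v" "S k v"] cfam_gr[OF assms(1) v, of k] cfam_gr[OF assms(2) v, of k] by blast
qed (simp_all add: lin_plus cfam_lin[OF assms(1)] cfam_lin[OF assms(2)] cfam_space[OF assms(1)] cfam_space[OF assms(2)]
   fock_space_add lin_add[OF lin_heis] cfam_comm[OF assms(1)] cfam_comm[OF assms(2)] fock.scale_right_distrib sum.distrib)

lemma cfam_scale:
  assumes "cfam N r a R"
  shows "cfam N r a (\<lambda>k v. scale c (R k v))"
  unfolding cfam_def
proof (intro conjI allI impI ballI)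
  fix k D and v :: fock
  assume v: "Poly_Mapping.keys v \<subseteq> K1 N D"
  show "Poly_Mapping.keys (scale c (R k v)) \<subseteq> K1 N (D + 2 * (\<Sum>s<r. k s))"
    using keys_scale[of c "R k v"] cfam_gr[OF assms v, of k] by blast
qed (simp_all add: lin_smult cfam_lin[OF assms] cfam_space[OF assms]
   fock_space_scale lin_scale[OF lin_heis] cfam_comm[OF assms] fock.scale_right_distrib fock.scale_sum_right mult_ac)

lemma cfam_diff:
  assumes "cfam N r a R" "cfam N r a S"
  shows "cfam N r a (\<lambda>k v. R k v - S k v)"
  using cfam_add[OF assms(1) cfam_scale[OF assms(2), of "-1"]] by simp

text \<open>The range of summation depends on the exponents, and Heisenberg modes shift the
  exponents. Since terms beyond \<open>B\<close> vanish, all sums involved can be extended to one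
  common range.\<close>

lemma cfam_sum:
  fixes B :: "(nat \<Rightarrow> int) \<Rightarrow> nat"
  assumes G: "\<And>n. cfam N r a (G n)" and B: "\<And>k n v. n > B k \<Longrightarrow> G n k v = 0"
  shows "cfam N r a (\<lambda>k v. \<Sum>n\<le>B k. G n k v)"
proof -
  have ext: "(\<Sum>n\<le>B k. G n k v) = (\<Sum>n\<le>M. G n k v)" if "B k \<le> M" for k v M
    by (rule sum.mono_neutral_left) (use that B in \<open>auto simp: not_le\<close>)
  show ?thesis
    unfolding cfam_def
  proof (intro conjI allI impI ballI)
    fix k show "lin (\<lambda>v. \<Sum>n\<le>B k. G n k v)" by (rule lin_setsum, rule cfam_lin[OF G])
  next
    fix k D and v :: fock
    assume v: "Poly_Mapping.keys v \<subseteq> K1 N D"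
    show "Poly_Mapping.keys (\<Sum>n\<le>B k. G n k v) \<subseteq> K1 N (D + 2 * (\<Sum>s<r. k s))"
      by (rule keys_sum_subset, rule cfam_gr[OF G v])
  next
    fix k v assume "v \<in> fock_space N"
    then show "(\<Sum>n\<le>B k. G n k v) \<in> fock_space N" by (intro fock_space_sum cfam_space[OF G])
  next
    fix j n k v assume j: "j \<in> {1..N}" and n: "(n::int) \<noteq> 0"
    define M where "M = B k + (\<Sum>s<r. B (k(s := k s - n)))"
    have M: "B (k(s := k s - n)) \<le> M" if "s < r" for s
      using member_le_sum[of s "{..<r}" "\<lambda>s. B (k(s := k s - n))"] that by (simp add: M_def)
    have "heis N (int j) n (\<Sum>m\<le>B k. G m k v) = (\<Sum>m\<le>M. heis N (int j) n (G m k v))"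
      by (subst ext[of _ M]) (simp_all add: M_def lin_sum[OF lin_heis])
    also have "\<dots> = (\<Sum>m\<le>M. G m k (heis N (int j) n v)) + (\<Sum>s<r. scale (a s j n) (\<Sum>m\<le>M. G m (k(s := k s - n)) v))"
      by (simp add: cfam_comm[OF G j n] sum.distrib fock.scale_sum_right) (rule sum.swap)
    also have "\<dots> = (\<Sum>m\<le>B k. G m k (heis N (int j) n v)) + (\<Sum>s<r. scale (a s j n) (\<Sum>m\<le>B (k(s := k s - n)). G m (k(s := k s - n)) v))"
      using M by (simp add: ext[of k M] M_def ext[of "k(_ := _)" M])
    finally show "heis N (int j) n (\<Sum>m\<le>B k. G m k v) = \<dots>" .
  qed
qed

text \<open>The offset \<open>c\<close> accounts for multiplication by \<open>(w/z)^c\<close>;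
  assigning the variables \<open>s\<close>, \<open>s'\<close> to the factors freely allows both
  orders of the product in one list of variables.\<close>

lemma cfam_two:
  assumes Y: "vop N a \<beta> \<zeta> \<tau> Y" "vop N a' \<beta>' \<zeta>' \<tau>' Y'"
    and s: "{..<2} = {s, s'}" "s \<noteq> s'" and A: "A s = a" "A s' = a'"
  shows "cfam N 2 A (\<lambda>k v. Y (k s + c) (Y' (k s' - c) v))"
proof -
  have S2: "(\<Sum>t<2. f t) = f s + f s'" for f :: "nat \<Rightarrow> 'x::comm_monoid_add"
    unfolding s(1) using s(2) by simp
  note L = vop_lin[OF Y(1)]
  show ?thesis
    unfolding cfam_def
  proof (intro conjI allI impI ballI)
    fix k show "lin (\<lambda>v. Y (k s + c) (Y' (k s' - c) v))"
      by (rule lin_comp[OF L vop_lin[OF Y(2)]])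
  next
    fix k D and v :: fock
    assume v: "Poly_Mapping.keys v \<subseteq> K1 N D"
    have "Poly_Mapping.keys (Y (k s + c) (Y' (k s' - c) v)) \<subseteq> K1 N (D + 2 * (k s' - c) + 2 * (k s + c))"
      using vop_gr1[OF Y(1)] vop_gr1[OF Y(2)] v unfolding gr_def by blast
    then show "Poly_Mapping.keys (Y (k s + c) (Y' (k s' - c) v)) \<subseteq> K1 N (D + 2 * (\<Sum>t<2. k t))"
      by (simp add: S2 algebra_simps)
  next
    fix k v assume "v \<in> fock_space N"
    then show "Y (k s + c) (Y' (k s' - c) v) \<in> fock_space N" by (intro vop_space[OF Y(1)] vop_space[OF Y(2)])
  next
    fix j n k v assume "j \<in> {1..N}" "(n::int) \<noteq> 0"
    then show "heis N (int j) n (Y (k s + c) (Y' (k s' - c) v)) = Y (k s + c) (Y' (k s' - c) (heis N (int j) n v)) +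
      (\<Sum>t<2. scale (A t j n) (Y ((k(t := k t - n)) s + c) (Y' ((k(t := k t - n)) s' - c) v)))"
      using s(2) by (simp add: S2 A vop_comm[OF Y(1)] vop_comm[OF Y(2)] lin_add[OF L] lin_scale[OF L] algebra_simps)
  qed
qed

lemma cfam_three:
  assumes Y: "vop N a \<beta> \<zeta> \<tau> Y" "vop N a' \<beta>' \<zeta>' \<tau>' Y'" "vop N a'' \<beta>'' \<zeta>'' \<tau>'' Y''"
    and s: "{..<3} = {s, s', s''}" "s \<noteq> s'" "s \<noteq> s''" "s' \<noteq> s''" and A: "A s = a" "A s' = a'" "A s'' = a''"
  shows "cfam N 3 A (\<lambda>k v. Y (k s) (Y' (k s') (Y'' (k s'') v)))"
proof -
  have S3: "(\<Sum>t<3. f t) = f s + (f s' + f s'')" for f :: "nat \<Rightarrow> 'x::comm_monoid_add"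
    unfolding s(1) using s(2-4) by simp
  note L = vop_lin[OF Y(1)] and L' = vop_lin[OF Y(2)]
  show ?thesis
    unfolding cfam_def
  proof (intro conjI allI impI ballI)
    fix k show "lin (\<lambda>v. Y (k s) (Y' (k s') (Y'' (k s'') v)))"
      by (rule lin_comp[OF L lin_comp[OF L' vop_lin[OF Y(3)]]])
  next
    fix k D and v :: fock
    assume v: "Poly_Mapping.keys v \<subseteq> K1 N D"
    have "Poly_Mapping.keys (Y (k s) (Y' (k s') (Y'' (k s'') v))) \<subseteq> K1 N (D + 2 * k s'' + 2 * k s' + 2 * k s)"
      using vop_gr1[OF Y(1)] vop_gr1[OF Y(2)] vop_gr1[OF Y(3)] v unfolding gr_def by blast
    then show "Poly_Mapping.keys (Y (k s) (Y' (k s') (Y'' (k s'') v))) \<subseteq> K1 N (D + 2 * (\<Sum>t<3. k t))"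
      by (simp add: S3 algebra_simps)
  next
    fix k v assume "v \<in> fock_space N"
    then show "Y (k s) (Y' (k s') (Y'' (k s'') v)) \<in> fock_space N"
      by (intro vop_space[OF Y(1)] vop_space[OF Y(2)] vop_space[OF Y(3)])
  next
    fix j n k v assume "j \<in> {1..N}" "(n::int) \<noteq> 0"
    then show "heis N (int j) n (Y (k s) (Y' (k s') (Y'' (k s'') v))) = Y (k s) (Y' (k s') (Y'' (k s'') (heis N (int j) n v))) +
      (\<Sum>t<3. scale (A t j n) (Y ((k(t := k t - n)) s) (Y' ((k(t := k t - n)) s') (Y'' ((k(t := k t - n)) s'') v))))"
      using s(2-4) by (simp add: S3 A vop_comm[OF Y(1)] vop_comm[OF Y(2)] vop_comm[OF Y(3)] lin_add[OF L] lin_scale[OF L]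
          lin_add[OF L'] lin_scale[OF L'] algebra_simps)
  qed
qed

text \<open>Coefficients of a delta function times \<open>Y\<close>, a two-variable series on which
  \<open>z\<close> and \<open>w\<close> differ by a scalar. Both variables act through the single
  series \<open>Y\<close>, so \<open>b\<close> must be the matching combination of the two
  commutators.\<close>

lemma cfam_delta:
  assumes Y: "vop N b \<beta> \<zeta> \<tau> Y" and h: "h \<noteq> 0"
    and b: "\<And>j n. j \<in> {1..N} \<Longrightarrow> n \<noteq> 0 \<Longrightarrow> b j n = h powi n * A 0 j n + h powi (- n) * A 1 j n"
  shows "cfam N 2 A (\<lambda>k v. scale (h powi (k 1 - k 0)) (Y (k 0 + k 1) v))"
proof -
  have S2: "(\<Sum>t<2. f t) = f 0 + f (1::nat)" for f :: "nat \<Rightarrow> 'x::comm_monoid_add"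
    by (simp add: numeral_2_eq_2)
  show ?thesis
    unfolding cfam_def
  proof (intro conjI allI impI ballI)
    fix k :: "nat \<Rightarrow> int" show "lin (\<lambda>v. scale (h powi (k 1 - k 0)) (Y (k 0 + k 1) v))"
      by (rule lin_smult[OF vop_lin[OF Y]])
  next
    fix k :: "nat \<Rightarrow> int" and D and v :: fock
    assume v: "Poly_Mapping.keys v \<subseteq> K1 N D"
    have "Poly_Mapping.keys (Y (k 0 + k 1) v) \<subseteq> K1 N (D + 2 * (k 0 + k 1))"
      using vop_gr1[OF Y] v unfolding gr_def by blast
    then show "Poly_Mapping.keys (scale (h powi (k 1 - k 0)) (Y (k 0 + k 1) v)) \<subseteq> K1 N (D + 2 * (\<Sum>t<2. k t))"
      unfolding S2 by (rule order_trans[OF keys_scale])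
  next
    fix k :: "nat \<Rightarrow> int" and v assume "v \<in> fock_space N"
    then show "scale (h powi (k 1 - k 0)) (Y (k 0 + k 1) v) \<in> fock_space N"
      by (intro fock_space_scale vop_space[OF Y])
  next
    fix j n and k :: "nat \<Rightarrow> int" and v assume j: "j \<in> {1..N}" and n: "(n::int) \<noteq> 0"
    have e: "h powi (k 1 - (k 0 - n)) = h powi (k 1 - k 0) * h powi n" "h powi (k 1 - n - k 0) = h powi (k 1 - k 0) * h powi (- n)"
      using h power_int_add[of h "k 1 - k 0" n] power_int_add[of h "k 1 - k 0" "- n"] by (simp_all add: algebra_simps)
    have e3: "k 0 - n + k 1 = k 0 + k 1 - n" "k 0 + (k 1 - n) = k 0 + k 1 - n" by simp_all
    have "heis N (int j) n (scale (h powi (k 1 - k 0)) (Y (k 0 + k 1) v)) =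
      scale (h powi (k 1 - k 0)) (Y (k 0 + k 1) (heis N (int j) n v)) + scale (h powi (k 1 - k 0) * b j n) (Y (k 0 + k 1 - n) v)"
      by (simp add: lin_scale[OF lin_heis] vop_comm[OF Y j n] fock.scale_right_distrib)
    then show "heis N (int j) n (scale (h powi (k 1 - k 0)) (Y (k 0 + k 1) v)) =
      scale (h powi (k 1 - k 0)) (Y (k 0 + k 1) (heis N (int j) n v)) +
      (\<Sum>t<2. scale (A t j n) (scale (h powi ((k(t := k t - n)) 1 - (k(t := k t - n)) 0)) (Y ((k(t := k t - n)) 0 + (k(t := k t - n)) 1) v)))"
      unfolding S2 b[OF j n] by (simp add: e e3 fock.scale_left_distrib distrib_left mult_ac del: One_nat_def)
  qed
qed


section \<open>Contraction series\<close>

lemma fx_unique: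
  assumes "g 0 = 1" "\<And>m. m > 0 \<Longrightarrow> of_nat m * g m = (\<Sum>n=1..m. c n * g (m - n))"
  shows "fx c m = g m"
proof (induction m rule: less_induct)
  case (less m)
  show ?case
  proof (cases "m = 0")
    case False
    then have "of_nat m * fx c m = (\<Sum>n=1..m. c n * g (m - n))"
      using less by (auto simp: fx_rec intro!: sum.cong)
    with assms(2)[of m] False have "of_nat m * fx c m = of_nat m * g m" by simp
    then show ?thesis using False by simp
  qed (simp add: assms)
qed

lemma fx_cong: "(\<And>n. n \<ge> 1 \<Longrightarrow> c n = c' n) \<Longrightarrow> fx c = fx c'"
  by (rule ext, rule fx_unique) (auto simp: fx_rec[of _ c'] intro!: sum.cong)

lemma fx_scale: "fx (\<lambda>n. s ^ n * c n) m = s ^ m * fx c m"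
proof (rule fx_unique)
  fix m :: nat
  have "(\<Sum>n=1..m. s ^ n * c n * (s ^ (m - n) * fx c (m - n))) = s ^ m * (\<Sum>n=1..m. c n * fx c (m - n))"
    unfolding sum_distrib_left
  proof (rule sum.cong[OF refl])
    fix n assume "n \<in> {1..m}"
    then have "s ^ m = s ^ n * s ^ (m - n)" by (simp add: power_add[symmetric])
    then show "s ^ n * c n * (s ^ (m - n) * fx c (m - n)) = s ^ m * (c n * fx c (m - n))" by simp
  qed
  then show "of_nat m * (s ^ m * fx c m) = (\<Sum>n=1..m. s ^ n * c n * (s ^ (m - n) * fx c (m - n)))"
    by (simp only: fx_rec[symmetric]) (simp add: mult_ac)
qed simp

lemma fx_zero: "(\<And>n. n \<ge> 1 \<Longrightarrow> c n = 0) \<Longrightarrow> fx c m = (if m = 0 then 1 else 0)"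
  by (rule fx_unique) (auto intro!: sum.neutral)

lemma fx_geom: "fx (\<lambda>n. x ^ n) m = x ^ m"
  by (rule fx_unique) (simp_all add: power_add[symmetric])

definition cexp :: "(nat \<Rightarrow> complex) \<Rightarrow> complex fps" where
  "cexp c = Abs_fps (fx c)"

lemma cexp_nth [simp]: "fps_nth (cexp c) n = fx c n"
  by (simp add: cexp_def)

text \<open>A series with constant term 1 is determined by its logarithmic derivative.\<close>

lemma cexp_unique:
  assumes "fps_nth F 0 = 1" "fps_XD F = Abs_fps (\<lambda>n. if n = 0 then 0 else c n) * F"
  shows "cexp c = F"
proof (rule fps_ext)
  fix n
  show "fps_nth (cexp c) n = fps_nth F n" unfolding cexp_nth
  proof (rule fx_unique)
    fix m :: nat
    have "of_nat m * fps_nth F m = fps_nth (fps_XD F) m" by (simp add: fps_XD_def fps_mult_fps_X_deriv_shift)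
    also have "\<dots> = (\<Sum>n=0..m. (if n = 0 then 0 else c n) * fps_nth F (m - n))"
      unfolding assms(2) by (simp add: fps_mult_nth)
    also have "\<dots> = (\<Sum>n=1..m. c n * fps_nth F (m - n))"
      by (rule sum.mono_neutral_cong_right) auto
    finally show "of_nat m * fps_nth F m = (\<Sum>n=1..m. c n * fps_nth F (m - n))" .
  qed (rule assms(1))
qed

lemma cexp_XD: "fps_XD (cexp c) = Abs_fps (\<lambda>n. if n = 0 then 0 else c n) * cexp c"
proof (rule fps_ext)
  fix m
  have "fps_nth (fps_XD (cexp c)) m = (\<Sum>n=1..m. c n * fx c (m - n))"
    by (simp add: fps_XD_def fps_mult_fps_X_deriv_shift fx_rec)
  also have "\<dots> = (\<Sum>n=0..m. (if n = 0 then 0 else c n) * fx c (m - n))"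
    by (rule sum.mono_neutral_cong_left) auto
  finally show "fps_nth (fps_XD (cexp c)) m = fps_nth (Abs_fps (\<lambda>n. if n = 0 then 0 else c n) * cexp c) m"
    by (simp add: fps_mult_nth)
qed

text \<open>Logarithmic derivatives of products add.\<close>

lemma cexp_add: "cexp (\<lambda>n. c n + c' n) = cexp c * cexp c'"
proof (rule cexp_unique)
  have "fps_XD (cexp c * cexp c') = fps_XD (cexp c) * cexp c' + cexp c * fps_XD (cexp c')"
    by (simp add: fps_XD_def algebra_simps)
  also have "\<dots> = (Abs_fps (\<lambda>n. if n = 0 then 0 else c n) + Abs_fps (\<lambda>n. if n = 0 then 0 else c' n)) * (cexp c * cexp c')"
    unfolding cexp_XD by (simp add: algebra_simps)
  also have "Abs_fps (\<lambda>n. if n = 0 then 0 else c n) + Abs_fps (\<lambda>n. if n = 0 then 0 else c' n)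
     = Abs_fps (\<lambda>n. if n = 0 then 0 else c n + c' n)"
    by (rule fps_ext) simp
  finally show "fps_XD (cexp c * cexp c') = Abs_fps (\<lambda>n. if n = 0 then 0 else c n + c' n) * (cexp c * cexp c')" .
qed simp

lemma nth_mult_one_minus:
  "fps_nth (F * (1 - fps_const x * fps_X)) n = fps_nth F n - (if n = 0 then 0 else x * fps_nth F (n - 1))"
  for F :: "complex fps"
proof -
  have "F * (1 - fps_const x * fps_X) = F - fps_const x * (fps_X * F)"
    by (simp add: right_diff_distrib mult_ac)
  then show ?thesis by simp
qed

text \<open>\<open>-log (1 - x X) = sum of x^n X^n / n\<close>.\<close>

lemma cexp_geom: "cexp (\<lambda>n. x ^ n) * (1 - fps_const x * fps_X) = 1"
proof (rule fps_ext)
  fix n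
  show "fps_nth (cexp (\<lambda>n. x ^ n) * (1 - fps_const x * fps_X)) n = fps_nth 1 n"
    unfolding nth_mult_one_minus by (cases n) (simp_all add: fx_geom)
qed

lemma cexp_lin: "cexp (\<lambda>n. - (x ^ n)) = 1 - fps_const x * fps_X"
proof -
  have "cexp (\<lambda>n. x ^ n + - (x ^ n)) = 1"
    by (rule fps_ext) (simp add: fx_zero)
  then have "cexp (\<lambda>n. x ^ n) * cexp (\<lambda>n. - (x ^ n)) = cexp (\<lambda>n. x ^ n) * (1 - fps_const x * fps_X)"
    by (simp only: cexp_add cexp_geom)
  moreover have "cexp (\<lambda>n. x ^ n) \<noteq> 0"
  proof
    assume "cexp (\<lambda>n. x ^ n) = 0"
    then have "fps_nth (cexp (\<lambda>n. x ^ n)) 0 = 0" by simp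
    then show False by simp
  qed
  ultimately show ?thesis by simp
qed

lemma fx_lin: "fx (\<lambda>n. - (x ^ n)) m = (if m = 0 then 1 else if m = 1 then - x else 0)"
  unfolding cexp_nth[symmetric] cexp_lin by (auto simp: fps_X_def)

lemma fx_quad: "fx (\<lambda>n. - (1 + x ^ n)) m = (if m = 0 then 1 else if m = 1 then - (1 + x) else if m = 2 then x else 0)"
proof -
  have "cexp (\<lambda>n. - (1 + x ^ n)) = cexp (\<lambda>n. - (1 ^ n) + - (x ^ n))"
    by (simp add: add.commute)
  also have "\<dots> = (1 - fps_X) * (1 - fps_const x * fps_X)"
    unfolding cexp_add cexp_lin by simp
  also have "\<dots> = 1 - fps_const (1 + x) * fps_X + fps_const x * fps_X ^ 2"
    by (simp add: algebra_simps power2_eq_square flip: fps_const_add)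
  finally show ?thesis unfolding cexp_nth[symmetric] by (simp add: fps_X_power_nth)
qed

text \<open>Expansion of \<open>1 / ((1 - x X) (1 - X / x))\<close>, whose coefficients are the
  quantum integers \<open>[m + 1]\<close> at \<open>x\<close>; these are the contractions of
  \<open>E_i\<close> with \<open>F_i\<close>.\<close>

lemma fx_inv_quad:
  assumes "x \<noteq> 0" "x \<noteq> inverse x"
  shows "fx (\<lambda>n. x ^ n + inverse x ^ n) m = (x powi (int m + 1) - x powi (- (int m + 1))) / (x - inverse x)"
proof -
  define G where "G = Abs_fps (\<lambda>m. (x powi (int m + 1) - x powi (- (int m + 1))) / (x - inverse x))"
  define y where "y = inverse x"
  have d: "x - y \<noteq> 0" using assms by (simp add: y_def)
  have g: "fps_nth G m = (x ^ (m + 1) - y ^ (m + 1)) / (x - y)" for m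
  proof -
    have "int m + 1 = int (m + 1)" by simp
    then show ?thesis by (simp only: G_def fps_nth_Abs_fps power_int_minus power_int_of_nat y_def power_inverse)
  qed
  have "G * (1 - fps_const x * fps_X) = cexp (\<lambda>n. y ^ n)"
  proof (rule fps_ext)
    fix n
    show "fps_nth (G * (1 - fps_const x * fps_X)) n = fps_nth (cexp (\<lambda>n. y ^ n)) n"
      unfolding nth_mult_one_minus g cexp_nth fx_geom
    proof (cases n)
      case (Suc k)
      have "(x ^ (n + 1) - y ^ (n + 1)) / (x - y) - x * ((x ^ n - y ^ n) / (x - y)) = (y ^ n * (x - y)) / (x - y)"
        by (simp add: diff_divide_distrib[symmetric] algebra_simps)
      then show "(x ^ (n + 1) - y ^ (n + 1)) / (x - y) - (if n = 0 then 0 else x * ((x ^ (n - 1 + 1) - y ^ (n - 1 + 1)) / (x - y))) = y ^ n"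
        using d Suc by simp
    qed (use d in simp)
  qed
  then have "cexp (\<lambda>n. x ^ n + inverse x ^ n) = cexp (\<lambda>n. x ^ n) * (1 - fps_const x * fps_X) * G"
    by (simp add: cexp_add y_def mult_ac)
  then have "cexp (\<lambda>n. x ^ n + inverse x ^ n) = G" by (simp add: cexp_geom)
  then show ?thesis unfolding cexp_nth[symmetric] by (simp add: G_def)
qed

text \<open>\<open>\<theta>_m(z) = q^(-m) (1 - q^m z) / (1 - q^(-m) z)\<close>, so theta factors and
  contractions can be compared through their logarithms.\<close>

lemma theta_cexp:
  assumes "q \<noteq> 0"
  shows "theta q m = fps_const (q powi (- m)) * cexp (\<lambda>n. (q powi (- m)) ^ n - (q powi m) ^ n)"
proof -
  define P R where "P = fps_const (q powi m)" and "R = fps_const (q powi (- m))"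
  define g where "g = cexp (\<lambda>n. (q powi (- m)) ^ n)"
  have PR: "P * R = 1" using assms by (simp add: P_def R_def power_int_minus)
  have f: "fps_X - P = - (P * (1 - R * fps_X))"
    using PR by (simp add: right_diff_distrib mult.assoc[symmetric])
  have gR: "g * (1 - R * fps_X) = 1" unfolding g_def R_def by (rule cexp_geom)
  have e: "cexp (\<lambda>n. (q powi (- m)) ^ n - (q powi m) ^ n) = g * (1 - P * fps_X)"
    using cexp_add[of "\<lambda>n. (q powi (- m)) ^ n" "\<lambda>n. - ((q powi m) ^ n)"] by (simp add: cexp_lin g_def P_def)
  have "R * (g * (1 - P * fps_X)) * (fps_X - P) = - (P * R * (g * (1 - R * fps_X)) * (1 - P * fps_X))"
    unfolding f by (simp only: mult_minus_right mult_ac)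
  also have "\<dots> = P * fps_X - 1" by (simp add: gR PR)
  finally have r: "P * fps_X - 1 = R * (g * (1 - P * fps_X)) * (fps_X - P)" ..
  have "fps_nth (fps_X - P) 0 \<noteq> 0" using assms by (simp add: P_def)
  then have "fps_X - P \<noteq> 0" by (metis fps_zero_nth)
  then show ?thesis unfolding theta_def e P_def[symmetric] R_def[symmetric] r by simp
qed


section \<open>Relations between vertex operators\<close>

definition apair :: "(nat \<Rightarrow> int \<Rightarrow> complex) \<Rightarrow> (nat \<Rightarrow> int \<Rightarrow> complex) \<Rightarrow> nat \<Rightarrow> nat \<Rightarrow> int \<Rightarrow> complex" where
  "apair a b s = (if s = 0 then a else b)"

lemma apair_simps [simp]: "apair a b 0 = a" "apair a b (Suc s) = b"
  by (simp_all add: apair_def)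

lemma cfam_pair:
  assumes "vop N a \<beta> \<zeta> \<tau> Y" "vop N a' \<beta>' \<zeta>' \<tau>' Y'"
  shows "cfam N 2 (apair a a') (\<lambda>k v. Y (k 0 + c) (Y' (k 1 - c) v))"
    and "cfam N 2 (apair a a') (\<lambda>k v. Y' (k 1 - c) (Y (k 0 + c) v))"
proof -
  show "cfam N 2 (apair a a') (\<lambda>k v. Y (k 0 + c) (Y' (k 1 - c) v))"
    by (rule cfam_two[OF assms, of 0 1]) (auto simp: numeral_2_eq_2)
  have "cfam N 2 (apair a a') (\<lambda>k v. Y' (k 1 + - c) (Y (k 0 - - c) v))"
    by (rule cfam_two[OF assms(2,1), of 1 0]) (auto simp: numeral_2_eq_2)
  then show "cfam N 2 (apair a a') (\<lambda>k v. Y' (k 1 - c) (Y (k 0 + c) v))" by simp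
qed

lemma fxi_neg [simp]: "l < 0 \<Longrightarrow> fxi c l = 0"
  by (simp add: fxi_def)

lemma fxi_of_nat [simp]: "fxi c (int n) = fx c n"
  by (simp add: fxi_def)

text \<open>Here \<open>f\<close> is the inner product of the two momenta.\<close>

lemma vops_commute:
  assumes Y: "vop N a \<beta> \<zeta> \<tau> Y" "vop N a' \<beta>' \<zeta>' \<tau>' Y'"
    and \<zeta>: "\<And>\<alpha>. \<zeta> (\<alpha> + \<beta>') = \<zeta> \<alpha> + f" "\<And>\<alpha>. \<zeta>' (\<alpha> + \<beta>) = \<zeta>' \<alpha> + f"
    and F: "\<And>\<alpha> l. \<alpha> \<in> root_lattice N \<Longrightarrow> \<tau> (\<alpha> + \<beta>') * \<tau>' \<alpha> * fxi (contr N a a') l = \<tau>' (\<alpha> + \<beta>) * \<tau> \<alpha> * fxi (contr N a' a) (f - l)"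
    and v: "v \<in> fock_space N"
  shows "Y x (Y' y v) = Y' y (Y x v)"
proof -
  let ?R = "\<lambda>k v. Y (k 0 + 0) (Y' (k 1 - 0) v) - Y' (k 1 - 0) (Y (k 0 + 0) v)"
  have "?R (\<lambda>s. if s = (0::nat) then x else y) v = 0"
  proof (rule cfam_zero[OF cfam_diff[OF cfam_pair[OF Y] ] _ v])
    fix k :: "nat \<Rightarrow> int" and \<alpha> \<gamma>
    assume \<alpha>: "\<alpha> \<in> root_lattice N"
    let ?l = "k 1 - \<zeta>' \<alpha>"
    show "Poly_Mapping.lookup (?R k (vc \<alpha>)) (0, \<gamma>) = 0"
    proof (cases "k 0 + k 1 = \<zeta> \<alpha> + f + \<zeta>' \<alpha>")
      case True
      then have "f - ?l = k 0 - \<zeta> \<alpha>" by simp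
      then show ?thesis using True F[OF \<alpha>, of ?l]
        by (auto simp: lookup_minus vac_two[OF Y] vac_two[OF Y(2,1)] \<zeta> add_ac)
    next
      case False
      then show ?thesis by (auto simp: lookup_minus vac_two[OF Y] vac_two[OF Y(2,1)] \<zeta> add_ac)
    qed
  qed
  then show ?thesis by simp
qed

text \<open>The relation reads \<open>(D - A w/z) Y(z) Y'(w) = (A D - w/z) Y'(w) Y(z)\<close>.
  \<open>F\<close> is its coefficient identity on \<open>e^\<alpha>\<close>, where \<open>l\<close>
  counts the power of \<open>w/z\<close> in the first order and \<open>f - l\<close> that of
  \<open>z/w\<close> in the second.\<close>

lemma vops_quadratic:
  assumes Y: "vop N a \<beta> \<zeta> \<tau> Y" "vop N a' \<beta>' \<zeta>' \<tau>' Y'"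
    and \<zeta>: "\<And>\<alpha>. \<zeta> (\<alpha> + \<beta>') = \<zeta> \<alpha> + f" "\<And>\<alpha>. \<zeta>' (\<alpha> + \<beta>) = \<zeta>' \<alpha> + f"
    and F: "\<And>\<alpha> l. \<alpha> \<in> root_lattice N \<Longrightarrow>
       \<tau> (\<alpha> + \<beta>') * \<tau>' \<alpha> * (D * fxi (contr N a a') l - A * fxi (contr N a a') (l - 1))
       = \<tau>' (\<alpha> + \<beta>) * \<tau> \<alpha> * (A * D * fxi (contr N a' a) (f - l) - fxi (contr N a' a) (f - l + 1))"
    and v: "v \<in> fock_space N"
  shows "scale D (Y x (Y' y v)) - scale A (Y (x + 1) (Y' (y - 1) v))
    = scale (A * D) (Y' y (Y x v)) - Y' (y - 1) (Y (x + 1) v)"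
proof -
  let ?R = "\<lambda>k v. (scale D (Y (k 0 + 0) (Y' (k 1 - 0) v)) - scale A (Y (k 0 + 1) (Y' (k 1 - 1) v)))
    - (scale (A * D) (Y' (k 1 - 0) (Y (k 0 + 0) v)) - Y' (k 1 - 1) (Y (k 0 + 1) v))"
  have "cfam N 2 (apair a a') ?R"
    by (intro cfam_diff cfam_scale cfam_pair[OF Y])
  then have "?R (\<lambda>s. if s = (0::nat) then x else y) v = 0"
  proof (rule cfam_zero[OF _ _ v])
    fix k :: "nat \<Rightarrow> int" and \<alpha> \<gamma>
    assume \<alpha>: "\<alpha> \<in> root_lattice N"
    let ?l = "k 1 - \<zeta>' \<alpha>"
    show "Poly_Mapping.lookup (?R k (vc \<alpha>)) (0, \<gamma>) = 0"
    proof (cases "k 0 + k 1 = \<zeta> \<alpha> + f + \<zeta>' \<alpha> \<and> \<gamma> = \<alpha> + \<beta> + \<beta>'")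
      case True
      then have l: "k 0 - \<zeta> \<alpha> = f - ?l" "k 0 + 1 - \<zeta> \<alpha> = f - ?l + 1" "k 1 - 1 - \<zeta>' \<alpha> = ?l - 1" by simp_all
      have t: "k 0 + 0 + (k 1 - 0) = \<zeta> (\<alpha> + \<beta>') + \<zeta>' \<alpha>" "k 0 + 1 + (k 1 - 1) = \<zeta> (\<alpha> + \<beta>') + \<zeta>' \<alpha>"
        "k 1 - 0 + (k 0 + 0) = \<zeta>' (\<alpha> + \<beta>) + \<zeta> \<alpha>" "k 1 - 1 + (k 0 + 1) = \<zeta>' (\<alpha> + \<beta>) + \<zeta> \<alpha>"
        "\<gamma> = \<alpha> + \<beta> + \<beta>'" "\<gamma> = \<alpha> + \<beta>' + \<beta>"
        using True by (auto simp: \<zeta> add_ac)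
      have "Poly_Mapping.lookup (?R k (vc \<alpha>)) (0, \<gamma>) =
         (D * (\<tau> (\<alpha> + \<beta>') * \<tau>' \<alpha> * fxi (contr N a a') ?l) - A * (\<tau> (\<alpha> + \<beta>') * \<tau>' \<alpha> * fxi (contr N a a') (?l - 1)))
         - (A * D * (\<tau>' (\<alpha> + \<beta>) * \<tau> \<alpha> * fxi (contr N a' a) (f - ?l)) - \<tau>' (\<alpha> + \<beta>) * \<tau> \<alpha> * fxi (contr N a' a) (f - ?l + 1))"
        unfolding lookup_minus lookup_scale vac_two[OF Y] vac_two[OF Y(2,1)] if_P[OF conjI[OF t(1) t(6)]]
          if_P[OF conjI[OF t(2) t(6)]] if_P[OF conjI[OF t(3) t(5)]] if_P[OF conjI[OF t(4) t(5)]] by (simp add: l del: One_nat_def)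
      also have "\<dots> = 0" using F[OF \<alpha>, of ?l] by (simp add: algebra_simps)
      finally show ?thesis .
    next
      case False
      then show ?thesis
        by (auto simp: lookup_minus lookup_scale vac_two[OF Y] vac_two[OF Y(2,1)] \<zeta> add_ac)
    qed
  qed
  then show ?thesis by simp
qed

text \<open>All relations involving the currents \<open>k\<^sub>i\<^sup>\<plusminus>(z)\<close> are of the following shape. Here \<open>B x y\<close> bounds
  the range of nonzero summands.\<close>

lemma vops_exchange:
  assumes Y: "vop N a \<beta> \<zeta> \<tau> Y" "vop N a' \<beta>' \<zeta>' \<tau>' Y'"
    and \<zeta>: "\<And>\<alpha>. \<zeta> (\<alpha> + \<beta>') = \<zeta> \<alpha>" "\<And>\<alpha>. \<zeta>' (\<alpha> + \<beta>) = \<zeta>' \<alpha>"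
    and c: "\<And>n. n \<ge> 1 \<Longrightarrow> contr N a' a n = 0"
    and F: "\<And>\<alpha> l. \<alpha> \<in> root_lattice N \<Longrightarrow> \<tau> (\<alpha> + \<beta>') * \<tau>' \<alpha> * fps_nth (t * cexp (contr N a a')) l
      = \<tau>' (\<alpha> + \<beta>) * \<tau> \<alpha> * fps_nth t' l"
    and B: "\<And>x y n v. n > B x y \<Longrightarrow> scale (fps_nth t n) (Y (x + int n) (Y' (y - int n) v)) = 0"
      "\<And>x y n v. n > B x y \<Longrightarrow> scale (fps_nth t' n) (Y' (y - int n) (Y (x + int n) v)) = 0"
    and v: "v \<in> fock_space N"
  shows "(\<Sum>n\<le>B x y. scale (fps_nth t n) (Y (x + int n) (Y' (y - int n) v)))
    = (\<Sum>n\<le>B x y. scale (fps_nth t' n) (Y' (y - int n) (Y (x + int n) v)))"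
proof -
  let ?G = "\<lambda>n k v. scale (fps_nth t n) (Y (k 0 + int n) (Y' (k 1 - int n) v))
    - scale (fps_nth t' n) (Y' (k 1 - int n) (Y (k 0 + int n) v))"
  let ?R = "\<lambda>k v. \<Sum>n\<le>B (k 0) (k 1). ?G n k v"
  have G0: "?G n k v = 0" if "n > B (k 0) (k 1)" for n k v
    by (simp only: B(1)[OF that] B(2)[OF that] diff_self)
  have "cfam N 2 (apair a a') ?R"
    by (rule cfam_sum) (intro cfam_diff cfam_scale cfam_pair[OF Y], rule G0)
  then have "?R (\<lambda>s. if s = (0::nat) then x else y) v = 0"
  proof (rule cfam_zero[OF _ _ v])
    fix k :: "nat \<Rightarrow> int" and \<alpha> \<gamma>
    assume \<alpha>: "\<alpha> \<in> root_lattice N"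
    define l where "l = k 1 - \<zeta>' \<alpha>"
    define M where "M = B (k 0) (k 1) + nat l"
    let ?T = "\<tau> (\<alpha> + \<beta>') * \<tau>' \<alpha>" and ?T' = "\<tau>' (\<alpha> + \<beta>) * \<tau> \<alpha>"
    have "?R k (vc \<alpha>) = (\<Sum>n\<le>M. ?G n k (vc \<alpha>))"
      by (rule sum.mono_neutral_left, simp, simp add: M_def, rule ballI, rule G0, simp)
    then have R: "Poly_Mapping.lookup (?R k (vc \<alpha>)) (0, \<gamma>) = (\<Sum>n\<le>M. Poly_Mapping.lookup (?G n k (vc \<alpha>)) (0, \<gamma>))"
      by (simp only: lookup_sum)
    show "Poly_Mapping.lookup (?R k (vc \<alpha>)) (0, \<gamma>) = 0"
    proof (cases "k 0 + k 1 = \<zeta> \<alpha> + \<zeta>' \<alpha> \<and> \<gamma> = \<alpha> + \<beta> + \<beta>'")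
      case True
      have f': "fxi (contr N a' a) (int n - l) = (if int n = l then 1 else 0)" for n
        by (auto simp: fxi_def fx_zero[OF c])
      have "Poly_Mapping.lookup (?G n k (vc \<alpha>)) (0, \<gamma>)
          = ?T * (fps_nth t n * fxi (contr N a a') (l - int n)) - ?T' * (fps_nth t' n * (if int n = l then 1 else 0))" for n
      proof -
        have l1: "k 1 - int n - \<zeta>' \<alpha> = l - int n" "k 0 + int n - \<zeta> \<alpha> = int n - l" using True by (simp_all add: l_def)
        have t: "k 0 + int n + (k 1 - int n) = \<zeta> (\<alpha> + \<beta>') + \<zeta>' \<alpha> \<and> \<gamma> = \<alpha> + \<beta>' + \<beta>"
          "k 1 - int n + (k 0 + int n) = \<zeta>' (\<alpha> + \<beta>) + \<zeta> \<alpha> \<and> \<gamma> = \<alpha> + \<beta> + \<beta>'"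
          using True by (auto simp: \<zeta> add_ac)
        show ?thesis
          unfolding lookup_minus lookup_scale vac_two[OF Y] vac_two[OF Y(2,1)] if_P[OF t(1)] if_P[OF t(2)] l1 f' by (simp add: mult_ac)
      qed
      then have "Poly_Mapping.lookup (?R k (vc \<alpha>)) (0, \<gamma>) =
         ?T * (\<Sum>n\<le>M. fps_nth t n * fxi (contr N a a') (l - int n)) - ?T' * (\<Sum>n\<le>M. fps_nth t' n * (if int n = l then 1 else 0))"
        unfolding R by (simp only: sum_subtractf sum_distrib_left)
      also have "\<dots> = 0"
      proof (cases "l < 0")
        case False
        define m where "m = nat l"
        have l: "l = int m" using False by (simp add: m_def)
        have "(\<Sum>n\<le>M. fps_nth t n * fxi (contr N a a') (l - int n)) = (\<Sum>n=0..m. fps_nth t n * fx (contr N a a') (m - n))"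
        proof (rule sum.mono_neutral_cong_right)
          fix n assume "n \<in> {0..m}"
          then have "l - int n = int (m - n)" by (simp add: l)
          then show "fps_nth t n * fxi (contr N a a') (l - int n) = fps_nth t n * fx (contr N a a') (m - n)" by simp
        qed (auto simp: M_def l)
        also have "\<dots> = fps_nth (t * cexp (contr N a a')) m" by (simp add: fps_mult_nth)
        finally have 1: "(\<Sum>n\<le>M. fps_nth t n * fxi (contr N a a') (l - int n)) = fps_nth (t * cexp (contr N a a')) m" .
        have "(\<Sum>n\<le>M. fps_nth t' n * (if int n = l then 1 else 0)) = (\<Sum>n\<in>{m}. fps_nth t' n)"
          by (rule sum.mono_neutral_cong_right) (auto simp: M_def l)
        then show ?thesis unfolding 1 using F[OF \<alpha>, of m] by simp
      qed simp
      finally show ?thesis .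
    next
      case False
      have "Poly_Mapping.lookup (?G n k (vc \<alpha>)) (0, \<gamma>) = 0" for n
        using False by (auto simp: lookup_minus lookup_scale vac_two[OF Y] vac_two[OF Y(2,1)] \<zeta> add_ac)
      then show ?thesis unfolding R by simp
    qed
  qed
  then show ?thesis by (simp add: sum_subtractf)
qed

text \<open>The two orders expand one rational function in opposite regions, so their difference is
  supported on two lines \<open>z/w = const\<close>. The hypotheses \<open>b\<close> say that on
  these lines the commutators of \<open>Y\<close> and \<open>Y'\<close> add up to those of
  \<open>K\<close> and \<open>K'\<close>.\<close>

lemma vops_delta_commutator:
  assumes Y: "vop N a \<beta> \<zeta> \<tau> Y" "vop N a' (- \<beta>) \<zeta>' \<tau>' Y'"
    and K: "vop N b 0 (\<lambda>_. 0) (\<lambda>\<alpha>. q powi f \<alpha>) K" "vop N b' 0 (\<lambda>_. 0) (\<lambda>\<alpha>. q powi (- f \<alpha>)) K'"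
    and b: "\<And>j n. j \<in> {1..N} \<Longrightarrow> n \<noteq> 0 \<Longrightarrow> b j n = h powi n * a j n + h powi (- n) * a' j n"
      "\<And>j n. j \<in> {1..N} \<Longrightarrow> n \<noteq> 0 \<Longrightarrow> b' j n = inverse h powi n * a j n + inverse h powi (- n) * a' j n"
    and h: "h ^ 2 = q" "h \<noteq> 0" "q \<noteq> inverse q"
    and \<zeta>: "\<And>\<alpha>. \<zeta> \<alpha> = f \<alpha> + 1" "\<And>\<alpha>. \<zeta>' \<alpha> = - f \<alpha> + 1" "\<And>\<alpha>. f (\<alpha> - \<beta>) = f \<alpha> - 2" "\<And>\<alpha>. f (\<alpha> + \<beta>) = f \<alpha> + 2"
    and c: "\<And>n. n \<ge> 1 \<Longrightarrow> contr N a a' n = q ^ n + inverse q ^ n" "\<And>n. n \<ge> 1 \<Longrightarrow> contr N a' a n = q ^ n + inverse q ^ n"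
    and \<tau>: "\<And>\<alpha>. \<alpha> \<in> root_lattice N \<Longrightarrow> \<tau> (\<alpha> - \<beta>) * \<tau>' \<alpha> = - 1" "\<And>\<alpha>. \<alpha> \<in> root_lattice N \<Longrightarrow> \<tau>' (\<alpha> + \<beta>) * \<tau> \<alpha> = - 1"
    and v: "v \<in> fock_space N"
  shows "Y x (Y' y v) - Y' y (Y x v) = - scale (1 / (q - inverse q))
    (scale (h powi (y - x)) (K (x + y) v) - scale (h powi (x - y)) (K' (x + y) v))"
proof -
  have q: "q \<noteq> 0" using h by auto
  let ?R = "\<lambda>k v. (Y (k 0 + 0) (Y' (k 1 - 0) v) - Y' (k 1 - 0) (Y (k 0 + 0) v)) +
    scale (1 / (q - inverse q)) (scale (h powi (k 1 - k 0)) (K (k 0 + k 1) v) - scale (inverse h powi (k 1 - k 0)) (K' (k 0 + k 1) v))"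
  have "cfam N 2 (apair a a') ?R"
    by (intro cfam_diff cfam_scale cfam_add cfam_pair[OF Y] cfam_delta[OF K(1)] cfam_delta[OF K(2)]) (simp_all add: h(2) b)
  then have "?R (\<lambda>s. if s = (0::nat) then x else y) v = 0"
  proof (rule cfam_zero[OF _ _ v])
    fix k :: "nat \<Rightarrow> int" and \<alpha> \<gamma>
    assume \<alpha>: "\<alpha> \<in> root_lattice N"
    define l where "l = k 1 - \<zeta>' \<alpha>"
    have fq: "fxi C l = (if l < 0 then 0 else (q powi (l + 1) - q powi (- (l + 1))) / (q - inverse q))"
      if "\<And>n. n \<ge> 1 \<Longrightarrow> C n = q ^ n + inverse q ^ n" for C l
      using fx_cong[of C "\<lambda>n. q ^ n + inverse q ^ n"] that fx_inv_quad[OF q h(3), of "nat l"] by (simp add: fxi_def)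
    show "Poly_Mapping.lookup (?R k (vc \<alpha>)) (0, \<gamma>) = 0"
    proof (cases "k 0 + k 1 = 0 \<and> \<gamma> = \<alpha>")
      case True
      then have k0: "k 0 = - k 1" by simp
      have hq: "h powi (2 * n) = q powi n" for n
        unfolding power_int_mult h(1)[symmetric] by simp
      have K1: "Poly_Mapping.lookup (K (k 0 + k 1) (vc \<alpha>)) (0, \<gamma>) = q powi f \<alpha>"
        "Poly_Mapping.lookup (K' (k 0 + k 1) (vc \<alpha>)) (0, \<gamma>) = q powi (- f \<alpha>)"
        using True by (simp_all add: vac_one[OF K(1)] vac_one[OF K(2)])
      have e1: "h powi (k 1 - k 0) * q powi f \<alpha> = q powi (l + 1)"
        using hq[of "k 1"] q by (simp add: k0 l_def \<zeta> power_int_add)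
      have e2: "inverse h powi (k 1 - k 0) * q powi (- f \<alpha>) = q powi (- (l + 1))"
      proof -
        have "inverse h powi (k 1 - k 0) * q powi (- f \<alpha>) = inverse (h powi (k 1 - k 0) * q powi f \<alpha>)"
          by (simp add: power_int_inverse power_int_minus)
        then show ?thesis unfolding e1 by (simp only: power_int_minus)
      qed
      have l2: "k 0 - \<zeta> \<alpha> = - 2 - l" using True by (simp add: l_def \<zeta>)
      have YY: "Poly_Mapping.lookup (Y (k 0 + 0) (Y' (k 1 - 0) (vc \<alpha>))) (0, \<gamma>) = - fxi (contr N a a') l"
        using True \<tau>(1)[OF \<alpha>] by (simp add: vac_two[OF Y] \<zeta> l_def)
      have YY': "Poly_Mapping.lookup (Y' (k 1 - 0) (Y (k 0 + 0) (vc \<alpha>))) (0, \<gamma>) = - fxi (contr N a' a) (- 2 - l)"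
        unfolding l2[symmetric] using True \<tau>(2)[OF \<alpha>] by (simp add: vac_two[OF Y(2,1)] \<zeta>)
      have "fxi (contr N a a') l - fxi (contr N a' a) (- 2 - l) = (q powi (l + 1) - q powi (- (l + 1))) / (q - inverse q)"
      proof -
        define X Z where "X = q powi (l + 1)" and "Z = q powi (- (l + 1))"
        have e: "- 2 - l + 1 = - (l + 1)" "- (- 2 - l + 1) = l + 1" by simp_all
        have f1: "fxi (contr N a a') l = (if l < 0 then 0 else (X - Z) / (q - inverse q))"
          unfolding X_def Z_def by (rule fq) (rule c(1))
        have f2: "fxi (contr N a' a) (- 2 - l) = (if - 2 - l < 0 then 0 else (Z - X) / (q - inverse q))"
        proof -
          have "fxi (contr N a' a) (- 2 - l) = (if - 2 - l < 0 then 0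
            else (q powi (- 2 - l + 1) - q powi (- (- 2 - l + 1))) / (q - inverse q))"
            by (rule fq) (rule c(2))
          then show ?thesis unfolding X_def Z_def by (simp only: e(1) minus_minus)
        qed
        \<comment> \<open>Quantum integers satisfy \<open>[-n] = -[n]\<close>, so the ranges
          \<open>l \<ge> 0\<close> and \<open>l \<le> -2\<close> of the two expansions complement
          each other, and \<open>[0] = 0\<close> fills the gap at \<open>l = -1\<close>.\<close>
        consider "l \<ge> 0" | "l = -1" | "l \<le> -2" by linarith
        then have "fxi (contr N a a') l - fxi (contr N a' a) (- 2 - l) = (X - Z) / (q - inverse q)"
        proof cases
          case 2
          then show ?thesis by (simp add: X_def Z_def)
        next
          case 3
          then show ?thesis unfolding f1 f2 by (simp add: diff_divide_distrib)
        qed (simp add: f1 f2)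
        then show ?thesis by (simp only: X_def Z_def)
      qed
      then have "1 / (q - inverse q) * (q powi (l + 1) - q powi (- (l + 1))) = fxi (contr N a a') l - fxi (contr N a' a) (- 2 - l)"
        by (simp only: times_divide_eq_left mult_1_left)
      then show ?thesis
        unfolding lookup_add lookup_minus lookup_scale YY YY' K1 e1 e2 by simp
    next
      case False
      then show ?thesis
        by (auto simp: lookup_minus lookup_add lookup_scale vac_two[OF Y] vac_two[OF Y(2,1)] vac_one[OF K(1)] vac_one[OF K(2)] \<zeta>)
    qed
  qed
  moreover have "inverse h powi (y - x) = h powi (x - y)"
    by (simp add: power_int_inverse flip: power_int_minus)
  ultimately show ?thesis by (simp add: eq_neg_iff_add_eq_0)
qed

lemma pick_sum:
  fixes h :: "int \<Rightarrow> complex"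
  assumes "\<And>x. x < 0 \<or> x > l \<Longrightarrow> h x = 0"
  shows "(\<Sum>m=0..nat l. if int m = x then h (int m) else 0) = h x"
proof (cases "0 \<le> x \<and> x \<le> l")
  case True
  then have "(\<Sum>m=0..nat l. if int m = x then h (int m) else 0) = (\<Sum>m\<in>{nat x}. h (int m))"
    by (intro sum.mono_neutral_cong_right) auto
  then show ?thesis using True by simp
next
  case False
  then have "h x = 0" using assms[of x] by force
  then show ?thesis by (auto intro!: sum.neutral)
qed

text \<open>In the three orders of a Serre monomial the quadratic contraction \<open>P\<close> of
  the two equal currents sits in a different slot of the convolution; having only three
  coefficients, it collapses each sum to three terms.\<close>

lemma three_term_sums:
  fixes P F G :: "int \<Rightarrow> complex"
  assumes P: "\<And>s. s \<notin> {0, 1, 2} \<Longrightarrow> P s = 0" and F: "\<And>s. s < 0 \<Longrightarrow> F s = 0" and G: "\<And>s. s < 0 \<Longrightarrow> G s = 0"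
  shows "(\<Sum>m=0..nat l. F (int m) * G (l - int m) * P (c + int m))
      = P 0 * F (- c) * G (l + c) + P 1 * F (1 - c) * G (l + c - 1) + P 2 * F (2 - c) * G (l + c - 2)" (is ?A)
    and "(\<Sum>m=0..nat l. F (int m) * P (l - int m) * G (c + int m))
      = P 0 * F l * G (c + l) + P 1 * F (l - 1) * G (c + l - 1) + P 2 * F (l - 2) * G (c + l - 2)" (is ?B)
    and "(\<Sum>m=0..nat l. P (int m) * F (l - int m) * G (c + int m))
      = P 0 * F l * G c + P 1 * F (l - 1) * G (c + 1) + P 2 * F (l - 2) * G (c + 2)" (is ?C)
proof -
  have Pe: "P s = (if s = 0 then P 0 else 0) + (if s = 1 then P 1 else 0) + (if s = 2 then P 2 else 0)" for s
    using P[of s] by auto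
  have E: "(\<Sum>m=0..nat l. H (int m) * P (g (int m))) = P 0 * H x0 + P 1 * H x1 + P 2 * H x2"
    if H: "\<And>x. x < 0 \<or> x > l \<Longrightarrow> H x = 0" and g: "\<And>m. g m = 0 \<longleftrightarrow> m = x0" "\<And>m. g m = 1 \<longleftrightarrow> m = x1" "\<And>m. g m = 2 \<longleftrightarrow> m = x2"
    for H g x0 x1 x2
  proof -
    have "(\<Sum>m=0..nat l. H (int m) * P (g (int m))) = (\<Sum>m=0..nat l. (if int m = x0 then P 0 * H (int m) else 0)
      + (if int m = x1 then P 1 * H (int m) else 0) + (if int m = x2 then P 2 * H (int m) else 0))"
      by (subst Pe) (auto simp: g algebra_simps intro!: sum.cong)
    also have "\<dots> = P 0 * H x0 + P 1 * H x1 + P 2 * H x2"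
      using H by (simp add: sum.distrib pick_sum[of l "\<lambda>x. P 0 * H x"] pick_sum[of l "\<lambda>x. P 1 * H x"] pick_sum[of l "\<lambda>x. P 2 * H x"])
    finally show ?thesis .
  qed
  have "(\<Sum>m=0..nat l. F (int m) * G (l - int m) * P (c + int m))
      = P 0 * (F (- c) * G (l - (- c))) + P 1 * (F (1 - c) * G (l - (1 - c))) + P 2 * (F (2 - c) * G (l - (2 - c)))"
    by (rule E[of "\<lambda>x. F x * G (l - x)" "\<lambda>m. c + m"]) (use F G in auto)
  then show ?A by (simp add: algebra_simps)
  have H2: "F x * G (c + x) * P (l - x) = (if x \<le> l then F x * G (c + x) else 0) * P (l - x)" for x
    using P[of "l - x"] by auto
  have "(\<Sum>m=0..nat l. F (int m) * P (l - int m) * G (c + int m)) =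
     (\<Sum>m=0..nat l. (if int m \<le> l then F (int m) * G (c + int m) else 0) * P (l - int m))"
    unfolding H2[symmetric] by (simp add: mult_ac)
  also have "\<dots> = P 0 * F l * G (c + l) + P 1 * F (l - 1) * G (c + l - 1) + P 2 * F (l - 2) * G (c + l - 2)"
    using F by (subst E[of "\<lambda>x. if x \<le> l then F x * G (c + x) else 0" "\<lambda>m. l - m" l "l - 1" "l - 2"]) (auto simp: algebra_simps)
  finally show ?B .
  have H3: "F (l - x) * G (c + x) * P x = (if 0 \<le> x then F (l - x) * G (c + x) else 0) * P x" for x
    using P[of x] by auto
  have "(\<Sum>m=0..nat l. P (int m) * F (l - int m) * G (c + int m)) =
     (\<Sum>m=0..nat l. (if 0 \<le> int m then F (l - int m) * G (c + int m) else 0) * P (int m))"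
    unfolding H3[symmetric] by (simp add: mult_ac)
  also have "\<dots> = P 0 * F l * G c + P 1 * F (l - 1) * G (c + 1) + P 2 * F (l - 2) * G (c + 2)"
    using F by (subst E[of "\<lambda>x. if 0 \<le> x then F (l - x) * G (c + x) else 0" "\<lambda>m. m" 0 1 2]) (auto simp: algebra_simps)
  finally show ?C .
qed

text \<open>The matrix coefficients of the three orders of a Serre relation, expressed through the geometric
  expansions \<open>U\<close>, \<open>V\<close> of the contractions; \<open>D T\<^sub>1\<close>, \<open>- T\<^sub>2\<close>, \<open>D\<^sup>-\<^sup>1 T\<^sub>3\<close> carry equal zero modes.\<close>

lemma serre_scalar:
  fixes U V P :: "int \<Rightarrow> complex"
  assumes U: "\<And>k. U k = A * U (k - 1) + (if k = 0 then 1 else 0)"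
    and V: "\<And>k. V k = B * V (k - 1) + (if k = 0 then 1 else 0)"
    and AD: "A * D = Q" "B = Q * D" "Q * W = 1"
    and P: "P 0 = 1" "P 1 = - (1 + Q ^ 2)" "P 2 = Q ^ 2"
    and T1: "\<And>p r. T1 p r = P 0 * U (- 1 - r) * U (1 - p) + P 1 * U (- r) * U (- p) + P 2 * U (1 - r) * U (- 1 - p)"
    and T2: "\<And>p r. T2 p r = - D * (P 0 * V r * U (1 - p) + P 1 * V (r - 1) * U (- p) + P 2 * V (r - 2) * U (- 1 - p))"
    and T3: "\<And>p r. T3 p r = D ^ 2 * (P 0 * V r * V (p - 2) + P 1 * V (r - 1) * V (p - 1) + P 2 * V (r - 2) * V p)"
  shows "T1 p r - (Q + W) * T2 p r + T3 p r + (T1 r p - (Q + W) * T2 r p + T3 r p) = 0"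
proof -
  define d where "d x y = (if x = (y::int) then 1 else (0::complex))" for x y
  have U1: "U (- x) = A * U (- 1 - x) + d x 0" for x
  proof -
    have e: "- x - 1 = - 1 - x" by simp
    show ?thesis using U[of "- x", unfolded e] by (simp add: d_def)
  qed
  have U2: "U (1 - x) = A * (A * U (- 1 - x) + d x 0) + d x 1" for x using U[of "1 - x"] U1[of x] by (auto simp add: d_def)
  have V1: "V (x - 1) = B * V (x - 2) + d x 1" for x using V[of "x - 1"] by (simp add: d_def)
  have V2: "V x = B * (B * V (x - 2) + d x 1) + d x 0" for x using V[of x] V1[of x] by (simp add: d_def)
  \<comment> \<open>These are the lowest indices that occur, so the recurrences express every other
    value through them and Kronecker deltas.\<close>
  define a b c e where "a = U (- 1 - p)" and "b = U (- 1 - r)" and "c = V (p - 2)" and "e = V (r - 2)"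
  have Q: "Q = A * D" using AD by simp
  have B: "B = A * D * D" using AD by simp
  have W: "A * D * W = 1" using AD by simp
  \<comment> \<open>The common factor: after symmetrisation the middle order gives
    \<open>Q K\<close> and the two outer orders together \<open>(1 + Q^2) K\<close>, and
    \<open>(Q + W) Q = 1 + Q^2\<close>.\<close>
  define K where "K = D ^ 2 * (e * d p 0 + c * d r 0) - A * D ^ 4 * (e * d p 1 + c * d r 1) + (a * d r 1 + b * d p 1)
    - 2 * D ^ 2 * d r 1 * d p 1 - A * (a * d r 0 + b * d p 0) - 2 * d r 0 * d p 0"
  note defs = P U2 U1 V1 V2[of p] V2[of r] a_def[symmetric] b_def[symmetric] c_def[symmetric] e_def[symmetric] Q B K_def
  have 2: "T2 p r + T2 r p = A * D * K"
    unfolding T2 defs by (simp add: algebra_simps power2_eq_square power4_eq_xxxx)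
  have 1: "T1 p r + T3 p r + T1 r p + T3 r p = A * D * (A * D * K) + K"
    unfolding T1 T3 defs by (simp add: algebra_simps power2_eq_square power4_eq_xxxx)
  have "T1 p r - (Q + W) * T2 p r + T3 p r + (T1 r p - (Q + W) * T2 r p + T3 r p)
    = (T1 p r + T3 p r + T1 r p + T3 r p) - Q * (T2 p r + T2 r p) - W * (T2 p r + T2 r p)"
    by (simp add: algebra_simps)
  also have "\<dots> = K - (A * D * W) * K" unfolding 1 2 Q by (simp add: algebra_simps)
  finally show ?thesis unfolding W by simp
qed

text \<open>Moving the neighbour past one of the equal currents multiplies the zero mode by
  \<open>-D\<close>, so the three orders carry \<open>X\<close>, \<open>-D X\<close> and
  \<open>D^2 X\<close>; what remains is \<open>serre_scalar\<close>.\<close>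

lemma vops_serre:
  assumes Y: "vop N a \<beta> \<zeta> \<tau> Y" "vop N a' \<beta>' \<zeta>' \<tau>' Y'"
    and \<beta>: "\<beta> \<in> root_lattice N" "\<beta>' \<in> root_lattice N"
    and \<zeta>: "\<And>\<alpha>. \<zeta> (\<alpha> + \<beta>) = \<zeta> \<alpha> + 2" "\<And>\<alpha>. \<zeta> (\<alpha> + \<beta>') = \<zeta> \<alpha> - 1" "\<And>\<alpha>. \<zeta>' (\<alpha> + \<beta>) = \<zeta>' \<alpha> - 1"
    and \<tau>: "\<And>\<alpha>. \<alpha> \<in> root_lattice N \<Longrightarrow> \<tau> (\<alpha> + \<beta>) = \<tau> \<alpha> * x" "\<And>\<alpha>. \<alpha> \<in> root_lattice N \<Longrightarrow> \<tau> (\<alpha> + \<beta>') = \<tau> \<alpha> * y"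
      "\<And>\<alpha>. \<alpha> \<in> root_lattice N \<Longrightarrow> \<tau>' (\<alpha> + \<beta>) = \<tau>' \<alpha> * y'"
    and y: "y' = - D * y" "D \<noteq> 0" "Q \<noteq> 0"
    and c: "\<And>n. n \<ge> 1 \<Longrightarrow> contr N a a n = - (1 + (Q ^ 2) ^ n)" "\<And>n. n \<ge> 1 \<Longrightarrow> contr N a a' n = (Q / D) ^ n"
      "\<And>n. n \<ge> 1 \<Longrightarrow> contr N a' a n = (Q * D) ^ n"
    and v: "v \<in> fock_space N"
  shows "(Y x1 (Y x2 (Y' w v)) - scale (Q + inverse Q) (Y x1 (Y' w (Y x2 v))) + Y' w (Y x1 (Y x2 v)))
    + (Y x2 (Y x1 (Y' w v)) - scale (Q + inverse Q) (Y x2 (Y' w (Y x1 v))) + Y' w (Y x2 (Y x1 v))) = 0"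
proof -
  \<comment> \<open>Variables 0 and 1 carry the two equal currents, variable 2 the neighbouring
    one.\<close>
  let ?A = "\<lambda>s. if s = (2::nat) then a' else a"
  define S where "S s s' k v = Y (k s) (Y (k s') (Y' (k 2) v)) - scale (Q + inverse Q) (Y (k s) (Y' (k 2) (Y (k s') v)))
     + Y' (k 2) (Y (k s) (Y (k s') v))" for s s' :: nat and k :: "nat \<Rightarrow> int" and v
  have cS: "cfam N 3 ?A (S s s')" if s: "{..<3} = {s, s', 2}" "s \<noteq> s'" "s \<noteq> 2" "s' \<noteq> 2" for s s'
    unfolding S_def[abs_def] using s
    by (intro cfam_add cfam_diff cfam_scale cfam_three[OF Y(1) Y(1) Y(2)] cfam_three[OF Y(1) Y(2) Y(1)] cfam_three[OF Y(2) Y(1) Y(1)]) auto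
  have "cfam N 3 ?A (\<lambda>k v. S 0 1 k v + S 1 0 k v)"
    by (intro cfam_add cS) auto
  then have "S 0 1 k v + S 1 0 k v = 0" for k
  proof (rule cfam_zero[OF _ _ v])
    fix k :: "nat \<Rightarrow> int" and \<alpha> \<gamma>
    assume \<alpha>: "\<alpha> \<in> root_lattice N"
    define U V P where "U = fxi (contr N a a')" and "V = fxi (contr N a' a)" and "P = fxi (contr N a a)"
    have U: "U k = (if k < 0 then 0 else (Q / D) ^ nat k)" for k
      unfolding U_def fxi_def using fx_cong[of "contr N a a'" "\<lambda>n. (Q / D) ^ n"] c(2) by (simp add: fx_geom)
    have V: "V k = (if k < 0 then 0 else (Q * D) ^ nat k)" for k
      unfolding V_def fxi_def using fx_cong[of "contr N a' a" "\<lambda>n. (Q * D) ^ n"] c(3) by (simp add: fx_geom)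
    have P: "P k = (if k = 0 then 1 else if k = 1 then - (1 + Q ^ 2) else if k = 2 then Q ^ 2 else 0)" for k
      unfolding P_def fxi_def using fx_cong[of "contr N a a" "\<lambda>n. - (1 + (Q ^ 2) ^ n)"] c(1) fx_quad[of "Q ^ 2" "nat k"]
      by (auto simp: nat_eq_iff)
    have geo: "f k = z * f (k - 1) + (if k = 0 then 1 else 0)"
      if "\<And>k. f k = (if k < 0 then 0 else z ^ nat k)" for f :: "int \<Rightarrow> complex" and z k
    proof -
      consider "k < 0" | "k = 0" | "k > 0" by linarith
      then show ?thesis
      proof cases
        case 3
        then have "nat k = Suc (nat (k - 1))" by simp
        then show ?thesis using 3 by (simp add: that)
      qed (simp_all add: that)
    qed
    have P0: "P s = 0" if "s \<notin> {0, 1, 2}" for s using that by (simp add: P)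
    have UV0: "U s = 0" "V s = 0" if "s < 0" for s using that by (simp_all add: U V)
    define X where "X = \<tau> \<alpha> * \<tau> \<alpha> * \<tau>' \<alpha> * x * y * y"
    define T1 where "T1 p r = P 0 * U (- 1 - r) * U (1 - p) + P 1 * U (- r) * U (- p) + P 2 * U (1 - r) * U (- 1 - p)" for p r
    define T2 where "T2 p r = - D * (P 0 * V r * U (1 - p) + P 1 * V (r - 1) * U (- p) + P 2 * V (r - 2) * U (- 1 - p))" for p r
    define T3 where "T3 p r = D ^ 2 * (P 0 * V r * V (p - 2) + P 1 * V (r - 1) * V (p - 1) + P 2 * V (r - 2) * V p)" for p r
    have add\<alpha>: "\<alpha> + \<beta> \<in> root_lattice N" "\<alpha> + \<beta>' \<in> root_lattice N" using root_lattice_iff_add \<alpha> \<beta> by blast+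
    let ?tot = "k 0 + k 1 + k 2 = \<zeta> \<alpha> + \<zeta> \<alpha> + \<zeta>' \<alpha> \<and> \<gamma> = \<alpha> + \<beta> + \<beta> + \<beta>'"
    let ?p = "\<lambda>s. k s - \<zeta> \<alpha>"
    have vS: "Poly_Mapping.lookup (S s s' k (vc \<alpha>)) (0, \<gamma>) =
       (if ?tot then X * (T1 (?p s) (?p s') - (Q + inverse Q) * T2 (?p s) (?p s') + T3 (?p s) (?p s')) else 0)"
      if s: "k s + k s' = k 0 + k 1" for s s'
    proof -
      define p r l where "p = ?p s" and "r = ?p s'" and "l = k 2 - \<zeta>' \<alpha>"
      have g: "\<alpha> + \<beta>' + \<beta> + \<beta> = \<alpha> + \<beta> + \<beta> + \<beta>'" "\<alpha> + \<beta> + \<beta>' + \<beta> = \<alpha> + \<beta> + \<beta> + \<beta>'" by (simp_all only: add_ac)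
      have c1: "k s + k s' + k 2 = \<zeta> (\<alpha> + \<beta>' + \<beta>) + \<zeta> (\<alpha> + \<beta>') + \<zeta>' \<alpha> \<and> \<gamma> = \<alpha> + \<beta>' + \<beta> + \<beta> \<longleftrightarrow> ?tot"
        unfolding \<zeta> g using s by (intro conj_cong refl iffI) linarith+
      have c2: "k s + k 2 + k s' = \<zeta> (\<alpha> + \<beta> + \<beta>') + \<zeta>' (\<alpha> + \<beta>) + \<zeta> \<alpha> \<and> \<gamma> = \<alpha> + \<beta> + \<beta>' + \<beta> \<longleftrightarrow> ?tot"
        unfolding \<zeta> g using s by (intro conj_cong refl iffI) linarith+
      have c3: "k 2 + k s + k s' = \<zeta>' (\<alpha> + \<beta> + \<beta>) + \<zeta> (\<alpha> + \<beta>) + \<zeta> \<alpha> \<and> \<gamma> = \<alpha> + \<beta> + \<beta> + \<beta>' \<longleftrightarrow> ?tot"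
        unfolding \<zeta> g using s by (intro conj_cong refl iffI) linarith+
      have t1: "\<tau> (\<alpha> + \<beta>' + \<beta>) * \<tau> (\<alpha> + \<beta>') * \<tau>' \<alpha> = X"
        unfolding \<tau>(1)[OF add\<alpha>(2)] \<tau>(2)[OF \<alpha>] X_def by (simp add: mult_ac)
      have t2: "\<tau> (\<alpha> + \<beta> + \<beta>') * \<tau>' (\<alpha> + \<beta>) * \<tau> \<alpha> = X * (- D)"
        unfolding \<tau>(2)[OF add\<alpha>(1)] \<tau>(1,3)[OF \<alpha>] X_def y(1) by (simp add: mult_ac)
      have t3: "\<tau>' (\<alpha> + \<beta> + \<beta>) * \<tau> (\<alpha> + \<beta>) * \<tau> \<alpha> = X * D ^ 2"
        unfolding \<tau>(3)[OF add\<alpha>(1)] \<tau>(1,3)[OF \<alpha>] X_def y(1) by (simp add: mult_ac power2_eq_square)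
      show ?thesis
      proof (cases ?tot)
        case True
        \<comment> \<open>The normalised exponents sum to zero, which eliminates \<open>l\<close> in
          favour of the pair \<open>p\<close>, \<open>r\<close> that the symmetrisation
          exchanges.\<close>
        have prl: "p + r + l = 0" using True s unfolding p_def r_def l_def by linarith
        have 1: "Poly_Mapping.lookup (Y (k s) (Y (k s') (Y' (k 2) (vc \<alpha>)))) (0, \<gamma>) = X * T1 p r"
        proof -
          have e: "k s' + int m - \<zeta> (\<alpha> + \<beta>') = (r + 1) + int m" for m by (simp add: r_def \<zeta>)
          have e2: "- (r + 1) = - 1 - r" "l + (r + 1) = 1 - p" "1 - (r + 1) = - r" "2 - (r + 1) = 1 - r" "1 - p - 1 = - p" "1 - p - 2 = - 1 - p"
            using prl by auto
          have "(\<Sum>m=0..nat l. U (int m) * U (l - int m) * P (r + 1 + int m)) = T1 p r"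
            unfolding T1_def by (subst three_term_sums(1)[of P U U l "r + 1"]) (erule P0, erule UV0, simp only: e2)
          then show ?thesis
            unfolding vac_three[OF Y(1) Y(1) Y(2)] c1 if_P[OF True] t1 l_def[symmetric] e U_def[symmetric] P_def[symmetric] by simp
        qed
        have 2: "Poly_Mapping.lookup (Y (k s) (Y' (k 2) (Y (k s') (vc \<alpha>)))) (0, \<gamma>) = X * T2 p r"
        proof -
          have e: "k 2 + int m - \<zeta>' (\<alpha> + \<beta>) = (l + 1) + int m" for m by (simp add: l_def \<zeta>)
          have e2: "l + 1 + r = 1 - p" "1 - p - 1 = - p" "1 - p - 2 = - 1 - p"
            using prl by auto
          have ts: "- D * (\<Sum>m=0..nat r. V (int m) * P (r - int m) * U (l + 1 + int m)) = T2 p r"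
            unfolding T2_def by (subst three_term_sums(2)[of P V U r "l + 1"]) (erule P0, erule UV0, erule UV0, simp only: e2)
          show ?thesis
            unfolding vac_three[OF Y(1) Y(2) Y(1)] c2 if_P[OF True] t2 r_def[symmetric] e U_def[symmetric] P_def[symmetric] V_def[symmetric]
              ts[symmetric] by (simp only: mult.assoc)
        qed
        have 3: "Poly_Mapping.lookup (Y' (k 2) (Y (k s) (Y (k s') (vc \<alpha>)))) (0, \<gamma>) = X * T3 p r"
        proof -
          have e: "k s + int m - \<zeta> (\<alpha> + \<beta>) = (p - 2) + int m" for m by (simp add: p_def \<zeta>)
          have e2: "p - 2 + 1 = p - 1" "p - 2 + 2 = p" by simp_all
          have "D ^ 2 * (\<Sum>m=0..nat r. P (int m) * V (r - int m) * V (p - 2 + int m)) = T3 p r"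
            unfolding T3_def by (subst three_term_sums(3)[of P V V r "p - 2"]) (erule P0, erule UV0, simp only: e2)
          then show ?thesis
            unfolding vac_three[OF Y(2) Y(1) Y(1)] c3 if_P[OF True] t3 r_def[symmetric] e U_def[symmetric] P_def[symmetric] V_def[symmetric]
            by (simp add: mult.assoc)
        qed
        show ?thesis unfolding S_def lookup_add lookup_minus lookup_scale 1 2 3 p_def[symmetric] r_def[symmetric] if_P[OF True]
          by (simp add: algebra_simps)
      next
        case False
        show ?thesis unfolding S_def lookup_add lookup_minus lookup_scale vac_three[OF Y(1) Y(1) Y(2)]
          vac_three[OF Y(1) Y(2) Y(1)] vac_three[OF Y(2) Y(1) Y(1)] c1 c2 c3 if_not_P[OF False] by simp
      qed
    qed
    have sc: "T1 p r - (Q + inverse Q) * T2 p r + T3 p r + (T1 r p - (Q + inverse Q) * T2 r p + T3 r p) = 0" for p r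
      by (rule serre_scalar[where U = U and V = V and P = P and A = "Q / D" and B = "Q * D" and D = D])
        (rule geo[OF U], rule geo[OF V], simp_all add: y P T1_def T2_def T3_def)
    show "Poly_Mapping.lookup (S 0 1 k (vc \<alpha>) + S 1 0 k (vc \<alpha>)) (0, \<gamma>) = 0"
      using sc[of "?p 0" "?p 1"] by (simp add: lookup_add vS distrib_left[symmetric] del: One_nat_def)
  qed
  from this[of "\<lambda>s. if s = 0 then x1 else if s = 1 then x2 else w"] show ?thesis by (simp add: S_def)
qed


section \<open>The root lattice\<close>

lemma sum_telescope_single:
  fixes x :: "nat \<Rightarrow> int"
  assumes "N \<ge> 1"
  shows "Poly_Mapping.lookup (\<Sum>i=1..<N. eps N (int i) (x i) - eps N (int i + 1) (x i)) k
    = (if 1 \<le> k \<and> k < N then x k else 0) - (if 2 \<le> k \<and> k \<le> N then x (k - 1) else 0)"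
proof -
  have i: "idx N (int i) = i" "idx N (int i + 1) = i + 1" if "i \<in> {1..<N}" for i
    using that idx_id[of i N] idx_id[of "i + 1" N] by (simp_all add: add.commute)
  have "Poly_Mapping.lookup (\<Sum>i=1..<N. eps N (int i) (x i) - eps N (int i + 1) (x i)) k
    = (\<Sum>i=1..<N. (if i = k then x i else 0) - (if i = k - 1 then (if k = 0 then 0 else x i) else 0))"
    unfolding lookup_sum lookup_minus eps_def
    by (rule sum.cong) (auto simp: i lookup_single when_def)
  also have "\<dots> = (if 1 \<le> k \<and> k < N then x k else 0) - (if 2 \<le> k \<and> k \<le> N then x (k - 1) else 0)"
    by (auto simp: sum_subtractf)
  finally show ?thesis .
qed

lemma root_lattice_iff:
  assumes N: "N \<ge> 1"
  shows "\<alpha> \<in> root_lattice N \<longleftrightarrow> Poly_Mapping.keys \<alpha> \<subseteq> {1..N} \<and> (\<Sum>i=1..N. Poly_Mapping.lookup \<alpha> i) = 0"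
proof
  assume "\<alpha> \<in> root_lattice N"
  then obtain x where \<alpha>: "\<alpha> = (\<Sum>i=1..<N. eps N (int i) (x i) - eps N (int i + 1) (x i))"
    unfolding root_lattice_def by blast
  have l: "Poly_Mapping.lookup \<alpha> k = (if 1 \<le> k \<and> k < N then x k else 0) - (if 2 \<le> k \<and> k \<le> N then x (k - 1) else 0)" for k
    unfolding \<alpha> by (rule sum_telescope_single[OF N])
  have "(\<Sum>k=1..N. Poly_Mapping.lookup \<alpha> k) = (\<Sum>k=1..N. if 1 \<le> k \<and> k < N then x k else 0) - (\<Sum>k=1..N. if 2 \<le> k \<and> k \<le> N then x (k - 1) else 0)"
    unfolding l sum_subtractf ..
  also have "(\<Sum>k=1..N. if 1 \<le> k \<and> k < N then x k else 0) = (\<Sum>k=1..<N. x k)"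
    by (rule sum.mono_neutral_cong_right) auto
  also have "(\<Sum>k=1..N. if 2 \<le> k \<and> k \<le> N then x (k - 1) else 0) = (\<Sum>k=2..N. x (k - 1))"
    by (rule sum.mono_neutral_cong_right) auto
  also have "\<dots> = (\<Sum>k=1..<N. x k)"
    by (rule sum.reindex_bij_witness[of _ Suc "\<lambda>k. k - 1"]) auto
  finally have "(\<Sum>k=1..N. Poly_Mapping.lookup \<alpha> k) = 0" by simp
  moreover have "Poly_Mapping.keys \<alpha> \<subseteq> {1..N}"
    by (auto simp: in_keys_iff l split: if_splits)
  ultimately show "Poly_Mapping.keys \<alpha> \<subseteq> {1..N} \<and> (\<Sum>i=1..N. Poly_Mapping.lookup \<alpha> i) = 0" by simp
next
  assume a: "Poly_Mapping.keys \<alpha> \<subseteq> {1..N} \<and> (\<Sum>i=1..N. Poly_Mapping.lookup \<alpha> i) = 0"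
  \<comment> \<open>Partial sums are the coordinates in the simple roots; the vanishing total gives
    \<open>x N = 0\<close>.\<close>
  define x where "x k = (\<Sum>i=1..k. Poly_Mapping.lookup \<alpha> i)" for k
  have xk: "x k - x (k - 1) = Poly_Mapping.lookup \<alpha> k" if "k \<ge> 1" for k
    using that by (cases k) (simp_all add: x_def)
  have "\<alpha> = (\<Sum>i=1..<N. eps N (int i) (x i) - eps N (int i + 1) (x i))"
  proof (rule poly_mapping_eqI)
    fix k
    have x: "x 0 = 0" "x N = 0" using a by (simp_all add: x_def)
    show "Poly_Mapping.lookup \<alpha> k = Poly_Mapping.lookup (\<Sum>i=1..<N. eps N (int i) (x i) - eps N (int i + 1) (x i)) k"
    proof (cases "k \<in> {1..N}")
      case True
      have "k = 1 \<or> k \<ge> 2" using True by auto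
      then show ?thesis unfolding sum_telescope_single[OF N] using True xk[of k] x
        by (cases "k = N") auto
    next
      case False
      then have "Poly_Mapping.lookup \<alpha> k = 0" using a by (auto simp: in_keys_iff)
      then show ?thesis unfolding sum_telescope_single[OF N] using False by auto
    qed
  qed
  then show "\<alpha> \<in> root_lattice N" unfolding root_lattice_def by blast
qed

lemma root_lattice_0: "N \<ge> 1 \<Longrightarrow> 0 \<in> root_lattice N"
  by (simp add: root_lattice_iff)

lemma root_lattice_uminus: "N \<ge> 1 \<Longrightarrow> \<alpha> \<in> root_lattice N \<Longrightarrow> - \<alpha> \<in> root_lattice N"
  by (simp add: root_lattice_iff sum_negf keys_minus)

lemma root_lattice_eps: "N \<ge> 1 \<Longrightarrow> eps N i x - eps N j x \<in> root_lattice N"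
proof -
  assume N: "N \<ge> 1"
  have "Poly_Mapping.keys (eps N i x - eps N j x) \<subseteq> {1..N}"
    using idx_range[OF N] by (auto simp: in_keys_iff lookup_minus eps_def lookup_single when_def split: if_splits)
  moreover have "(\<Sum>k=1..N. Poly_Mapping.lookup (eps N i x) k) = x" for i
    using idx_range[OF N, of i] by (simp add: eps_def lookup_single when_def)
  ultimately show ?thesis using N by (simp add: root_lattice_iff lookup_minus sum_subtractf)
qed

text \<open>Polarisation: expand \<open>\<epsilon> (\<alpha> + \<beta>) (\<alpha> + \<beta>)\<close>
  bimultiplicatively and compare with the quadratic form. The listed values of the form keep the
  exponent \<open>2 + form N \<alpha> \<beta>\<close> nonnegative under \<open>nat\<close>.\<close>

lemma cocycle_sym:
  assumes "cocycle N \<epsilon>" "\<alpha> \<in> root_lattice N" "\<beta> \<in> root_lattice N"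
    and "form N \<alpha> \<alpha> = 2" "form N \<beta> \<beta> = 2" "form N \<alpha> \<beta> \<in> {2, -1, 0}"
  shows "\<epsilon> \<alpha> \<beta> = (-1) ^ nat \<bar>form N \<alpha> \<beta>\<bar> * \<epsilon> \<beta> \<alpha>"
proof -
  note C = assms(1)[unfolded cocycle_def]
  have s: "\<alpha> + \<beta> \<in> root_lattice N" by (rule root_lattice_iff_add[OF assms(2,3)])
  have pm: "\<epsilon> \<alpha> \<beta> \<in> {1, -1}" "\<epsilon> \<beta> \<alpha> \<in> {1, -1}" using C assms(2,3) by blast+
  have e: "\<epsilon> \<alpha> \<alpha> = -1" "\<epsilon> \<beta> \<beta> = -1" using C assms(2-5) by auto
  have "\<epsilon> (\<alpha> + \<beta>) (\<alpha> + \<beta>) = \<epsilon> \<alpha> \<alpha> * \<epsilon> \<alpha> \<beta> * (\<epsilon> \<beta> \<alpha> * \<epsilon> \<beta> \<beta>)"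
  proof -
    have l: "\<epsilon> (x + y) z = \<epsilon> x z * \<epsilon> y z" and r: "\<epsilon> x (y + z) = \<epsilon> x y * \<epsilon> x z"
      if "x \<in> root_lattice N" "y \<in> root_lattice N" "z \<in> root_lattice N" for x y z
      using C that by blast+
    show ?thesis
      unfolding l[OF assms(2,3) s] r[OF assms(2,2,3)] r[OF assms(3,2,3)] ..
  qed
  moreover have "\<epsilon> (\<alpha> + \<beta>) (\<alpha> + \<beta>) = (-1) ^ nat (form N (\<alpha> + \<beta>) (\<alpha> + \<beta>) div 2)"
    using C s by blast
  moreover have "form N (\<alpha> + \<beta>) (\<alpha> + \<beta>) div 2 = 2 + form N \<alpha> \<beta>"
    using assms(4,5) by (simp add: form_add_left form_add_right form_sym[of N \<beta> \<alpha>])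
  ultimately have "\<epsilon> \<alpha> \<beta> * \<epsilon> \<beta> \<alpha> = (-1) ^ nat (2 + form N \<alpha> \<beta>)" using e by simp
  then show ?thesis using assms(6) pm by (auto simp: power_numeral_even eval_nat_numeral)
qed


section \<open>Vertex operators as exponentials\<close>

lemma E_minus_gexp:
  assumes N: "N \<ge> 1"
  shows "E_minus N s i = gexp N (- 1) (\<lambda>j n. if j = idx N i then of_int s else 0)"
proof (intro ext)
  fix k v
  let ?x = "gmode N (- 1) (\<lambda>j n. if j = idx N i then of_int s else 0)"
  have x: "?x n v = scale (of_int s / of_nat n) (heis N i (- int n) v)" for n v
  proof -
    have "(\<Sum>j=1..N. scale (if j = idx N i then of_int s else 0) (heis N (int j) (- 1 * int n) v))
      = (\<Sum>j=1..N. if j = idx N i then scale (of_int s) (heis N i (- int n) v) else 0)"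
      by (rule sum.cong) (auto simp: heis_idx[OF N, of i])
    then show ?thesis using idx_range[OF N, of i] unfolding gmode_def by simp
  qed
  have "(\<lambda>k v. if k \<ge> 1 then scale (of_int s / of_int k) (heis N i (- k) v) else 0) = ebuild 1 ?x"
    by (intro ext) (simp add: ebuild_def x)
  then show "E_minus N s i k v = gexp N (- 1) (\<lambda>j n. if j = idx N i then of_int s else 0) k v"
    unfolding E_minus_def by (simp add: ser_exp_ebuild lin_gmode gexp_def)
qed

lemma E_plus_gexp:
  assumes N: "N \<ge> 1"
  shows "E_plus N s i = gexp N 1 (\<lambda>j n. if j = idx N i then - of_int s else 0)"
proof (intro ext)
  fix k v
  let ?x = "gmode N 1 (\<lambda>j n. if j = idx N i then - of_int s else 0)"
  have x: "?x n v = scale (- of_int s / of_nat n) (heis N i (int n) v)" for n v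
  proof -
    have "(\<Sum>j=1..N. scale (if j = idx N i then - of_int s else 0) (heis N (int j) (1 * int n) v))
      = (\<Sum>j=1..N. if j = idx N i then scale (- of_int s) (heis N i (int n) v) else 0)"
      by (rule sum.cong) (auto simp: heis_idx[OF N, of i])
    then show ?thesis using idx_range[OF N, of i] unfolding gmode_def by simp
  qed
  have "(\<lambda>k v. if k \<le> -1 then scale (- (of_int s / of_int (- k))) (heis N i (- k) v) else 0) = ebuild (- 1) ?x"
    by (intro ext) (auto simp add: ebuild_def x)
  then show "E_plus N s i k v = gexp N 1 (\<lambda>j n. if j = idx N i then - of_int s else 0) k v"
    unfolding E_plus_def by (simp add: ser_exp_ebuild lin_gmode gexp_def)
qed

lemma lookup_eps: "Poly_Mapping.lookup (eps N i x) j = (if j = idx N i then x else 0)"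
  by (auto simp: eps_def lookup_single when_def)

text \<open>For \<open>-\<epsilon>_j\<close> the creation and annihilation parts sit at
  \<open>z q^(i-j) p^r\<close> and \<open>z q^(j-i) p^r\<close>, whence the case split on the sign
  of \<open>n\<close>. The half power of \<open>p\<close> becomes \<open>ph powi r\<close> because
  \<open>(\<epsilon>_j, \<epsilon>_i - \<epsilon>_j) = -1\<close>.\<close>

lemma vop_vX:
  assumes N: "N \<ge> 1" and ij: "idx N i \<noteq> idx N j" and nz: "qh \<noteq> 0" "ph \<noteq> 0"
  shows "vop N (\<lambda>l n. if l = idx N i then 1 else if l = idx N j
      then - ((if n > 0 then (qh ^ 2) powi (i - j) * (ph ^ 2) powi r else (qh ^ 2) powi (j - i) * (ph ^ 2) powi r) powi n) else 0)
    (eps N i 1 - eps N j 1) (\<lambda>\<alpha>. Poly_Mapping.lookup \<alpha> (idx N i) - Poly_Mapping.lookup \<alpha> (idx N j) + 1)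
    (\<lambda>\<alpha>. of_int (\<epsilon> (eps N i 1 - eps N j 1) \<alpha>) * ph powi r * (ph ^ 2) powi (- r * Poly_Mapping.lookup \<alpha> (idx N j)))
    (vX N \<epsilon> qh ph r i j)"
proof -
  define \<beta> where "\<beta> = eps N i 1 - eps N j 1"
  let ?\<mu> = "(qh ^ 2) powi (i - j) * (ph ^ 2) powi r" and ?\<nu> = "(qh ^ 2) powi (j - i) * (ph ^ 2) powi r"
  have f: "form N \<beta> \<alpha> = Poly_Mapping.lookup \<alpha> (idx N i) - Poly_Mapping.lookup \<alpha> (idx N j)" for \<alpha>
    by (simp add: \<beta>_def form_diff_left form_eps[OF N])
  have l\<beta>: "Poly_Mapping.lookup \<beta> (idx N i) = 1" "Poly_Mapping.lookup \<beta> (idx N j) = -1"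
    using ij by (simp_all add: \<beta>_def lookup_minus lookup_eps)
  have ff: "form N \<beta> \<beta> = 2" by (simp add: f l\<beta>)
  have fj: "form N (eps N j x) \<alpha> = x * Poly_Mapping.lookup \<alpha> (idx N j)" for x \<alpha> by (rule form_eps[OF N])
  have X: "vX N \<epsilon> qh ph r i j = gexp N (- 1) (\<lambda>l n. if l = idx N i then of_int 1 else 0)
     \<diamondop> gexp N (- 1) (\<lambda>l n. ?\<mu> powi (- (- 1) * int n) * (if l = idx N j then of_int (- 1) else 0))
     \<diamondop> gexp N 1 (\<lambda>l n. if l = idx N i then - of_int 1 else 0)
     \<diamondop> gexp N 1 (\<lambda>l n. ?\<nu> powi (- 1 * int n) * (if l = idx N j then - of_int (- 1) else 0))
     \<diamondop> zser \<beta> (\<lambda>\<alpha>. form N \<beta> \<alpha> + 1) (\<lambda>\<alpha>. of_int (\<epsilon> \<beta> \<alpha>) * ph powi r * (ph ^ 2) powi (- r * Poly_Mapping.lookup \<alpha> (idx N j)))"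
  proof -
    have mu: "?\<mu> \<noteq> 0" "?\<nu> \<noteq> 0" using nz by simp_all
    have e: "- form N (eps N j 1) \<beta> * r = r" "form N \<beta> \<beta> div 2 = 1" by (simp_all add: fj l\<beta> ff)
    have m1: "- 1 \<in> {1, - 1 :: int}" "1 \<in> {1, - 1 :: int}" by simp_all
    show ?thesis
      unfolding vX_def Let_def \<beta>_def[symmetric] zmode_eq E_minus_gexp[OF N] E_plus_gexp[OF N]
        gexp_subst[OF mu(1) m1(1)] gexp_subst[OF mu(2) m1(2)] e unfolding fj by (rule refl)
  qed
  have b: "\<beta> \<in> root_lattice N" by (simp add: \<beta>_def root_lattice_eps[OF N])
  have z: "form N (\<alpha> + \<beta>) (\<alpha> + \<beta>) = form N \<alpha> \<alpha> + 2 * (form N \<beta> \<alpha> + 1)" for \<alpha>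
    using form_sym[of N \<alpha> \<beta>] by (simp add: form_add_left form_add_right ff)
  show ?thesis unfolding X \<beta>_def[symmetric]
  proof (rule vop_cong[OF vop_X[OF N b z]], goal_cases)
    case (1 l n)
    then show ?case using ij by (cases "n > 0") simp_all
  qed (simp_all only: f)
qed

lemma gmode_two:
  assumes N: "N \<ge> 1" and ij: "idx N i \<noteq> idx N j"
  shows "gmode N \<sigma> (\<lambda>l n. if l = idx N i then x n else if l = idx N j then y n else 0) n v
    = scale (1 / of_nat n) (scale (x n) (heis N i (\<sigma> * int n) v) + scale (y n) (heis N j (\<sigma> * int n) v))"
proof -
  have "(\<Sum>l=1..N. scale (if l = idx N i then x n else if l = idx N j then y n else 0) (heis N (int l) (\<sigma> * int n) v))
    = (\<Sum>l=1..N. (if l = idx N i then scale (x n) (heis N i (\<sigma> * int n) v) else 0)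
      + (if l = idx N j then scale (y n) (heis N j (\<sigma> * int n) v) else 0))"
    using ij by (intro sum.cong) (auto simp: heis_idx[OF N, of i] heis_idx[OF N, of j])
  also have "\<dots> = scale (x n) (heis N i (\<sigma> * int n) v) + scale (y n) (heis N j (\<sigma> * int n) v)"
    using idx_range[OF N, of i] idx_range[OF N, of j] by (simp add: sum.distrib)
  finally show ?thesis by (simp add: gmode_def)
qed

lemma vu_gexp:
  assumes N: "N \<ge> 1" and ij: "idx N i \<noteq> idx N j"
  shows "vu N qh ph r i j = ser_const (mu_pow N (qh ^ 2) (eps N i (j - i) - eps N j (j - i))) \<diamondop>
    gexp N 1 (\<lambda>l n. if l = idx N i then ((qh ^ 2) powi ((j - i) * int n) - (qh ^ 2) powi ((i - j) * int n)) * qh powi ((j - i) * int n)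
      else if l = idx N j then - (((qh ^ 2) powi ((j - i) * int n) - (qh ^ 2) powi ((i - j) * int n)) * ((ph ^ 2) powi (- int n * r) * qh powi ((i - j) * int n)))
      else 0)" (is "_ = _ \<diamondop> gexp N 1 ?f")
proof -
  have "(\<lambda>k v. let n = - k in if n \<ge> 1 then scale (((qh ^ 2) powi ((j - i) * n) - (qh ^ 2) powi ((i - j) * n)) / of_int n)
      (scale (qh powi ((j - i) * n)) (heis N i n v) - scale ((ph ^ 2) powi (- n * r) * qh powi ((i - j) * n)) (heis N j n v)) else 0)
    = ebuild (- 1) (gmode N 1 ?f)"
    by (intro ext) (auto simp add: ebuild_def gmode_two[OF N ij] Let_def fock.scale_right_diff_distrib)
  then have "ser_exp (\<lambda>k v. let n = - k in if n \<ge> 1 then scale (((qh ^ 2) powi ((j - i) * n) - (qh ^ 2) powi ((i - j) * n)) / of_int n)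
      (scale (qh powi ((j - i) * n)) (heis N i n v) - scale ((ph ^ 2) powi (- n * r) * qh powi ((i - j) * n)) (heis N j n v)) else 0)
    = gexp N 1 ?f"
    by (intro ext) (simp add: ser_exp_ebuild lin_gmode gexp_def)
  then show ?thesis unfolding vu_def by (simp add: Let_def)
qed

lemma vv_gexp:
  assumes N: "N \<ge> 1" and ij: "idx N i \<noteq> idx N j"
  shows "vv N qh ph r i j = ser_const (mu_pow N (qh ^ 2) (eps N i (i - j) - eps N j (i - j))) \<diamondop>
    gexp N (- 1) (\<lambda>l n. if l = idx N i then ((qh ^ 2) powi ((i - j) * int n) - (qh ^ 2) powi ((j - i) * int n)) * qh powi ((j - i) * int n)
      else if l = idx N j then - (((qh ^ 2) powi ((i - j) * int n) - (qh ^ 2) powi ((j - i) * int n)) * ((ph ^ 2) powi (int n * r) * qh powi ((i - j) * int n)))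
      else 0)" (is "_ = _ \<diamondop> gexp N (- 1) ?f")
proof -
  have "(\<lambda>n v. if n \<ge> 1 then scale (((qh ^ 2) powi ((i - j) * n) - (qh ^ 2) powi ((j - i) * n)) / of_int n)
      (scale (qh powi ((j - i) * n)) (heis N i (- n) v) - scale ((ph ^ 2) powi (n * r) * qh powi ((i - j) * n)) (heis N j (- n) v)) else 0)
    = ebuild 1 (gmode N (- 1) ?f)"
    by (intro ext) (auto simp add: ebuild_def gmode_two[OF N ij] fock.scale_right_diff_distrib)
  then have "ser_exp (\<lambda>n v. if n \<ge> 1 then scale (((qh ^ 2) powi ((i - j) * n) - (qh ^ 2) powi ((j - i) * n)) / of_int n)
      (scale (qh powi ((j - i) * n)) (heis N i (- n) v) - scale ((ph ^ 2) powi (n * r) * qh powi ((i - j) * n)) (heis N j (- n) v)) else 0)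
    = gexp N (- 1) ?f"
    by (intro ext) (simp add: ser_exp_ebuild lin_gmode gexp_def)
  then show ?thesis unfolding vv_def by (simp add: Let_def)
qed


section \<open>The generating currents\<close>

locale toroidal_fock =
  fixes N :: nat and \<epsilon> :: "lattice \<Rightarrow> lattice \<Rightarrow> int" and qh ph d :: complex
  assumes N3: "N \<ge> 3" and generic: "generic (qh ^ 2)" and d0: "d \<noteq> 0"
    and ph: "ph ^ 2 = d powi (- int N)" and coc: "cocycle N \<epsilon>"
begin

abbreviation "q \<equiv> qh ^ 2"

text \<open>Representative of \<open>\<epsilon>_i\<close> among \<open>1..N\<close>: node 0 uses
  \<open>\<epsilon>_0 = \<epsilon>_N\<close>.\<close>

definition ix :: "nat \<Rightarrow> nat" where "ix i = (if i = 0 then N else i)"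

text \<open>Spectral parameter attached to \<open>\<epsilon>_j\<close>. With it node 0 and the nodes
  \<open>i > 0\<close> obey one formula, since \<open>cc N = p^(-1/2)\<close>.\<close>

definition cc :: "nat \<Rightarrow> complex" where "cc j = ph * d ^ j"

definition bt :: "nat \<Rightarrow> lattice" where "bt i = eps N (int i) 1 - eps N (int i + 1) 1"

definition pf :: "nat \<Rightarrow> lattice \<Rightarrow> int" where
  "pf i \<alpha> = Poly_Mapping.lookup \<alpha> (ix i) - Poly_Mapping.lookup \<alpha> (Suc i)"

text \<open>\<open>[\<epsilon>_j(n), E_i(z)] = ae i j n z^n E_i(z)\<close>, uniformly in
  \<open>i\<close>: \<open>\<epsilon>_i\<close> is evaluated at \<open>cc (ix i)\<close> and
  \<open>\<epsilon>_(i+1)\<close> at \<open>cc (Suc i) / d\<close>, the latter with the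
  \<open>q\<close>-shift of \<open>vX\<close>.\<close>

definition ae :: "nat \<Rightarrow> nat \<Rightarrow> int \<Rightarrow> complex" where
  "ae i j n = (if j = ix i then cc (ix i) powi n
     else if j = Suc i then - ((cc (Suc i) / d) powi n * q powi (- \<bar>n\<bar>)) else 0)"

text \<open>Character of the lattice that collects the powers of the spectral parameters coming from
  \<open>z^\<beta>\<close> and from \<open>p^(-r \<epsilon>_j)\<close>.\<close>

definition psi :: "nat \<Rightarrow> lattice \<Rightarrow> complex" where
  "psi i \<alpha> = cc (ix i) powi Poly_Mapping.lookup \<alpha> (ix i) * (cc (Suc i) / d) powi (- Poly_Mapping.lookup \<alpha> (Suc i))"

text \<open>What remains of the spectral parameter from the \<open>+ 1\<close> in the exponent of
  \<open>z\<close>; at node 0 it is cancelled by the half power of \<open>p\<close> in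
  \<open>vX\<close>.\<close>

definition kap :: "nat \<Rightarrow> complex" where "kap i = (if i = 0 then 1 else cc i)"

text \<open>Ratio of the commutators of \<open>K_i\<close> to those of \<open>E_i\<close> on the
  modes where \<open>K_i\<close> has any; it does not depend on the node.\<close>

definition lamK :: "int \<Rightarrow> complex" where
  "lamK n = - ((q powi \<bar>n\<bar> - q powi (- \<bar>n\<bar>)) * qh powi \<bar>n\<bar>)"

text \<open>Being scalar multiples of \<open>ae\<close> mode by mode, \<open>aF\<close> and
  \<open>aK\<close> share the pairing computation done for \<open>ae\<close>.\<close>

definition aF :: "nat \<Rightarrow> nat \<Rightarrow> int \<Rightarrow> complex" where "aF i j n = - (q powi \<bar>n\<bar>) * ae i j n"
definition aK :: "int \<Rightarrow> nat \<Rightarrow> nat \<Rightarrow> int \<Rightarrow> complex" where "aK s i j n = (if s * n < 0 then lamK n * ae i j n else 0)"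

definition tE :: "nat \<Rightarrow> lattice \<Rightarrow> complex" where "tE i \<alpha> = of_int (\<epsilon> (bt i) \<alpha>) * kap i * psi i \<alpha>"
definition tF :: "nat \<Rightarrow> lattice \<Rightarrow> complex" where "tF i \<alpha> = of_int (\<epsilon> (- bt i) \<alpha>) * kap i * inverse (psi i \<alpha>)"

lemma N1: "N \<ge> 1" using N3 by simp

lemma q0: "q \<noteq> 0" and qh0: "qh \<noteq> 0"
  using generic by (auto simp: generic_def)

lemma ph0: "ph \<noteq> 0"
  using ph d0 by (metis power_int_not_zero zero_power2)

lemma cc0: "cc j \<noteq> 0"
  by (simp add: cc_def ph0 d0)

lemma q_power_ne_1: "n > 0 \<Longrightarrow> q ^ n \<noteq> 1"
  using generic unfolding generic_def root_of_unity_def by blast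

lemma q_powi_ne_1: "n \<noteq> 0 \<Longrightarrow> q powi n \<noteq> 1"
proof -
  assume n: "n \<noteq> 0"
  have "q powi n = q ^ nat n \<or> q powi n = inverse (q ^ nat (- n))"
    by (simp add: power_int_def power_inverse)
  moreover have "n > 0 \<or> - n > 0" using n by linarith
  ultimately show ?thesis using q_power_ne_1[of "nat n"] q_power_ne_1[of "nat (- n)"] n
    by (cases "n > 0") (auto simp: power_int_def power_inverse)
qed

lemma qq_ne: "q \<noteq> inverse q"
proof
  assume e: "q = inverse q"
  have "q ^ 2 = q * q" by (rule power2_eq_square)
  also have "\<dots> = 1" using e q0 by (metis right_inverse)
  finally show False using q_power_ne_1[of 2] by simp
qed

lemma idx_ix: "i < N \<Longrightarrow> idx N (int i) = ix i"
  using idx_id[of i N] by (auto simp: ix_def idx_def nat_diff_distrib zmod_minus1)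

lemma idx_Suc: "i < N \<Longrightarrow> idx N (int i + 1) = Suc i"
  using idx_id[of "Suc i" N] by (simp add: add.commute)

lemma ix_range: "i < N \<Longrightarrow> ix i \<in> {1..N}" "i < N \<Longrightarrow> Suc i \<in> {1..N}"
  by (auto simp: ix_def)

lemma ix_ne_Suc: "i < N \<Longrightarrow> ix i \<noteq> Suc i"
  using N3 by (auto simp: ix_def)

text \<open>Here \<open>p = d^(-N)\<close> enters: it closes the cycle of spectral
  parameters.\<close>

lemma cc_N: "cc N = inverse ph"
proof -
  have "ph * (ph * d ^ N) = ph ^ 2 * d ^ N" by (simp add: power2_eq_square)
  also have "\<dots> = 1" using d0 by (simp add: ph power_int_minus)
  finally have "ph * cc N = 1" by (simp add: cc_def)
  then show ?thesis using ph0 by (simp add: field_simps)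
qed

lemma cc_Suc: "cc (Suc i) / d = ph * d ^ i"
  using d0 by (simp add: cc_def)

lemma bt_lattice: "bt i \<in> root_lattice N"
  unfolding bt_def by (rule root_lattice_eps[OF N1])

lemma form_bt: "i < N \<Longrightarrow> form N (bt i) \<alpha> = pf i \<alpha>"
  by (simp add: bt_def pf_def form_diff_left form_eps[OF N1] idx_ix idx_Suc)

lemma pf_add: "pf i (\<alpha> + \<beta>) = pf i \<alpha> + pf i \<beta>" and pf_diff: "pf i (\<alpha> - \<beta>) = pf i \<alpha> - pf i \<beta>"
  and pf_uminus: "pf i (- \<alpha>) = - pf i \<alpha>"
  by (simp_all add: pf_def lookup_add lookup_minus)

lemma lookup_bt: "i < N \<Longrightarrow> Poly_Mapping.lookup (bt i) l = (if l = ix i then 1 else 0) - (if l = Suc i then 1 else 0)"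
  by (simp add: bt_def lookup_minus lookup_eps idx_ix idx_Suc)

text \<open>For \<open>N \<ge> 3\<close> distinct nodes are adjacent on at most one side, so
  \<open>cartan\<close> and \<open>mskew\<close> take only these four pairs of values.\<close>

lemma pair_cases:
  assumes "i < N" "j < N"
  obtains (same) "i = j" "cartan N i j = 2" "mskew N i j = 0"
  | (right) "i \<noteq> j" "ix j = Suc i" "ix i \<noteq> Suc j" "cartan N i j = -1" "mskew N i j = -1"
  | (left) "i \<noteq> j" "ix i = Suc j" "ix j \<noteq> Suc i" "cartan N i j = -1" "mskew N i j = 1"
  | (far) "i \<noteq> j" "ix j \<noteq> Suc i" "ix i \<noteq> Suc j" "cartan N i j = 0" "mskew N i j = 0"
proof -
  have m: "(x + 1) mod N = (if x = N - 1 then 0 else x + 1)" if "x < N" for x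
    using that by (auto simp: mod_if)
  have r: "ix j = Suc i \<longleftrightarrow> j mod N = (i + 1) mod N" and l: "ix i = Suc j \<longleftrightarrow> i mod N = (j + 1) mod N"
    using assms N3 m[of i] m[of j] by (auto simp: ix_def split: if_splits)
  have ne: "\<not> (i mod N = (i + 1) mod N)" using assms N3 m[of i] by auto
  have nb: "\<not> (j mod N = (i + 1) mod N \<and> i mod N = (j + 1) mod N)"
    using assms N3 m[of i] m[of j] by (auto split: if_splits)
  have c: "cartan N i j = 2 * of_bool (i = j) - of_bool (ix i = Suc j) - of_bool (ix j = Suc i)"
    "mskew N i j = of_bool (ix i = Suc j) - of_bool (ix j = Suc i)"
    using assms unfolding cartan_def mskew_def r l by (auto simp: eq_commute)
  consider "i = j" | "i \<noteq> j" "ix j = Suc i" | "i \<noteq> j" "ix j \<noteq> Suc i" "ix i = Suc j" | "i \<noteq> j" "ix j \<noteq> Suc i" "ix i \<noteq> Suc j"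
    by blast
  then show ?thesis
  proof cases
    case 1
    have "ix i \<noteq> Suc i" by (rule ix_ne_Suc[OF assms(1)])
    with 1 c show ?thesis by (intro same) simp_all
  next
    case 2
    then have "ix i \<noteq> Suc j" using nb r l by blast
    with 2 c show ?thesis by (intro right) simp_all
  next
    case 3
    with c show ?thesis by (intro left) simp_all
  next
    case 4
    with c show ?thesis by (intro far) simp_all
  qed
qed

lemma ix_eq_iff: "i < N \<Longrightarrow> j < N \<Longrightarrow> ix i = ix j \<longleftrightarrow> i = j"
  by (auto simp: ix_def split: if_splits)

lemma pf_bt:
  assumes "i < N" "j < N"
  shows "pf i (bt j) = cartan N i j"
proof -
  note ne = ix_ne_Suc[OF assms(1)] ix_ne_Suc[OF assms(2)] ix_eq_iff[OF assms]
  show ?thesis using assms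
    by (cases rule: pair_cases) (use ne assms in \<open>auto simp: pf_def lookup_bt\<close>)
qed

lemma cartan_sym: "i < N \<Longrightarrow> j < N \<Longrightarrow> cartan N j i = cartan N i j"
  and mskew_sym: "mskew N j i = - mskew N i j"
  by (auto simp: cartan_def mskew_def)

text \<open>Only \<open>\<epsilon>_i\<close> and \<open>\<epsilon>_(i+1)\<close> contribute. Equal
  nodes share both, which gives \<open>q^n + q^(-n)\<close>; adjacent nodes share one, at which
  their spectral parameters differ by \<open>d\<close>, whence the power of
  \<open>d\<close>.\<close>

lemma pairing:
  assumes "i < N" "j < N" "n \<ge> 1"
  shows "(\<Sum>l=1..N. ae j l (int n) * ae i l (- int n)) = q powi (- int n) * (d powi (- mskew N i j)) ^ n *
     (if cartan N i j = 2 then q ^ n + inverse q ^ n else if cartan N i j = -1 then -1 else 0)"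
proof -
  have "(\<Sum>l=1..N. ae j l (int n) * ae i l (- int n)) = (\<Sum>l\<in>{ix i, Suc i}. ae j l (int n) * ae i l (- int n))"
    using ix_range[OF assms(1)] by (intro sum.mono_neutral_right) (auto simp: ae_def)
  also have "\<dots> = ae j (ix i) (int n) * ae i (ix i) (- int n) + ae j (Suc i) (int n) * ae i (Suc i) (- int n)"
    using ix_ne_Suc[OF assms(1)] by simp
  finally have S: "(\<Sum>l=1..N. ae j l (int n) * ae i l (- int n)) = \<dots>" .
  have c: "cc j ^ n \<noteq> 0" for j using cc0 by simp
  have dn: "d ^ n \<noteq> 0" "q ^ n \<noteq> 0" using d0 q0 by simp_all
  note ne = ix_ne_Suc[OF assms(1)] ix_ne_Suc[OF assms(2)] ix_eq_iff[OF assms(1,2)]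
  have "ae j (ix i) (int n) * ae i (ix i) (- int n) + ae j (Suc i) (int n) * ae i (Suc i) (- int n)
    = q powi (- int n) * (d powi (- mskew N i j)) ^ n *
     (if cartan N i j = 2 then q ^ n + inverse q ^ n else if cartan N i j = -1 then -1 else 0)"
    using assms(1,2)
  proof (cases rule: pair_cases)
    case same
    then show ?thesis using c dn ne qh0
      by (auto simp: ae_def power_int_minus power_divide field_simps power_inverse)
  next
    case right
    then show ?thesis using c dn ne qh0
      by (auto simp: ae_def power_int_minus power_divide field_simps)
  next
    case left
    then show ?thesis using c dn ne qh0
      by (auto simp: ae_def power_int_minus power_divide field_simps)
  next
    case far
    then show ?thesis using ne by (auto simp: ae_def)
  qed
  then show ?thesis unfolding S .
qed

lemma contr_scaled:
  assumes "\<And>l n. a l n = x n * ae i l n" "\<And>l n. b l n = y n * ae j l n"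
  shows "contr N a b n = - (y (int n) * x (- int n)) * (\<Sum>l=1..N. ae j l (int n) * ae i l (- int n))"
  unfolding contr_def assms by (simp add: sum_distrib_left mult_ac sum_negf)

lemma psi_add: "psi i (\<alpha> + \<beta>) = psi i \<alpha> * psi i \<beta>"
  using cc0 d0 by (simp add: psi_def lookup_add power_int_add power_int_diff field_simps power_int_minus)

lemma psi_uminus: "psi i (- \<alpha>) = inverse (psi i \<alpha>)"
  by (simp add: psi_def power_int_minus)

lemma psi0: "psi i \<alpha> \<noteq> 0"
  using cc0 d0 by (simp add: psi_def)

text \<open>At a shared coordinate one node uses \<open>cc\<close> and the other
  \<open>cc / d\<close>. This asymmetry is the source of the powers of \<open>d\<close> on the zero
  modes.\<close>

lemma psi_sym:
  assumes "i < N" "j < N"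
  shows "psi j (bt i) = psi i (bt j) * d powi mskew N i j"
proof -
  note ne = ix_ne_Suc[OF assms(1)] ix_ne_Suc[OF assms(2)] ix_eq_iff[OF assms]
  show ?thesis using assms
    by (cases rule: pair_cases) (use ne assms d0 cc0 in \<open>auto simp: psi_def lookup_bt power_int_minus field_simps\<close>)
qed

lemma eps_bt_sym:
  assumes "i < N" "j < N"
  shows "\<epsilon> (bt j) (bt i) = (if cartan N i j = -1 then - \<epsilon> (bt i) (bt j) else \<epsilon> (bt i) (bt j))"
proof -
  have c2: "cartan N k k = 2" if "k < N" for k using that by (cases rule: pair_cases[OF that that]) auto
  have f: "form N (bt k) (bt k) = 2" if "k < N" for k using that by (simp add: form_bt pf_bt c2)
  have a: "form N (bt j) (bt i) = cartan N i j" using assms by (simp add: form_bt pf_bt cartan_sym)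
  have "cartan N i j \<in> {2, -1, 0}" using assms by (cases rule: pair_cases) auto
  then show ?thesis
    using cocycle_sym[OF coc bt_lattice bt_lattice f f, of j i] assms a by auto
qed

lemma vop_opE:
  assumes i: "i < N"
  shows "vop N (ae i) (bt i) (\<lambda>\<alpha>. pf i \<alpha> + 1) (tE i) (opE N \<epsilon> qh ph d i)"
proof (cases "i = 0")
  case True
  have ne: "idx N 0 \<noteq> idx N 1" using ix_ne_Suc[OF i] idx_ix[OF i] idx_Suc[OF i] True by simp
  have id: "idx N 0 = N" "idx N 1 = Suc 0" using idx_ix[OF i] idx_Suc[OF i] True by (simp_all add: ix_def)
  have N2: "N \<noteq> Suc 0" using N3 by simp
  have op: "opE N \<epsilon> qh ph d i = ser_subst (inverse ph) (vX N \<epsilon> qh ph 1 0 1)" by (simp add: opE_def True)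
  have b: "eps N 0 1 - eps N 1 1 = bt i" by (simp add: bt_def True)
  have iph: "inverse ph \<noteq> 0" using ph0 by simp
  show ?thesis unfolding op
  proof (rule vop_cong[OF vop_subst[OF vop_vX[OF N1 ne qh0 ph0] iph, unfolded b]], goal_cases)
    case (1 l n)
    \<comment> \<open>The substitution \<open>z p^(-1/2)\<close> meets the \<open>p\<close> of
      \<open>r = 1\<close>: the product \<open>p^(1/2)\<close> is \<open>cc 1 / d\<close>.\<close>
    have h: "inverse ph * (A * ph ^ 2) = ph * A" for A using ph0 by (simp add: field_simps power2_eq_square)
    have "inverse ph powi n * (inverse q * ph ^ 2) powi n = ph powi n * inverse q powi n" "inverse ph powi n * (q * ph ^ 2) powi n = ph powi n * q powi n"
      by (simp_all only: power_int_mult_distrib[symmetric] h)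
    then show ?case using N2 1
      by (auto simp: id True ae_def ix_def cc_N cc_Suc power_int_inverse power_int_minus mult.assoc)
  next
    case (2 \<alpha>)
    show ?case by (simp add: pf_def id True ix_def)
  next
    case (3 \<alpha>)
    let ?x = "Poly_Mapping.lookup \<alpha> N" and ?y = "Poly_Mapping.lookup \<alpha> (Suc 0)"
    have "inverse ph powi (?x - ?y + 1) * (ph powi 1 * (ph ^ 2) powi (- 1 * ?y)) = inverse ph powi ?x * ph powi (- ?y)"
      using ph0 by (simp add: power_int_inverse power_int_add power_int_diff power_int_minus power2_eq_square power_int_mult_distrib field_simps)
    then show ?case
      by (simp add: id True tE_def kap_def psi_def ix_def cc_N cc_Suc mult_ac)
  qed
next
  case False
  have ix: "ix i = i" using False by (simp add: ix_def)
  have ne: "idx N (int i) \<noteq> idx N (int i + 1)" unfolding idx_ix[OF i] idx_Suc[OF i] by (rule ix_ne_Suc[OF i])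
  have op: "opE N \<epsilon> qh ph d i = ser_subst (ph * d ^ i) (vX N \<epsilon> qh ph 0 (int i) (int i + 1))" using False by (simp add: opE_def)
  have mu: "ph * d ^ i \<noteq> 0" using ph0 d0 by simp
  show ?thesis unfolding op
  proof (rule vop_cong[OF vop_subst[OF vop_vX[OF N1 ne qh0 ph0] mu, folded bt_def]], goal_cases)
    case (1 l n)
    then show ?case using ix_ne_Suc[OF i]
      by (auto simp: idx_ix[OF i] idx_Suc[OF i] ix ae_def cc_Suc power_int_inverse power_int_minus cc_def[of i])
  next
    case (2 \<alpha>)
    show ?case by (simp add: pf_def idx_ix[OF i] idx_Suc[OF i])
  next
    case (3 \<alpha>)
    show ?case using mu False unfolding tE_def kap_def psi_def cc_Suc
      by (simp add: idx_ix[OF i] idx_Suc[OF i] ix cc_def[of i] power_int_add power_int_diff power_int_minus divide_inverse mult_ac)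
  qed
qed

text \<open>Compared with \<open>E_i\<close>, the roles of \<open>\<epsilon>_i\<close> and
  \<open>\<epsilon>_(i+1)\<close> are exchanged and the \<open>q\<close>-shift is inverted; both
  changes together amount to the factor \<open>-q^|n|\<close>.\<close>

lemma vop_opF:
  assumes i: "i < N"
  shows "vop N (aF i) (- bt i) (\<lambda>\<alpha>. - pf i \<alpha> + 1) (tF i) (opF N \<epsilon> qh ph d i)"
proof (cases "i = 0")
  case True
  have ne: "idx N 1 \<noteq> idx N 0" using ix_ne_Suc[OF i] idx_ix[OF i] idx_Suc[OF i] True by simp
  have id: "idx N 0 = N" "idx N 1 = Suc 0" using idx_ix[OF i] idx_Suc[OF i] True by (simp_all add: ix_def)
  have N2: "N \<noteq> Suc 0" using N3 by simp
  have op: "opF N \<epsilon> qh ph d i = ser_subst ph (vX N \<epsilon> qh ph (- 1) 1 0)" by (simp add: opF_def True)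
  have b: "eps N 1 1 - eps N 0 1 = - bt i" by (simp add: bt_def True)
  show ?thesis unfolding op
  proof (rule vop_cong[OF vop_subst[OF vop_vX[OF N1 ne qh0 ph0] ph0, unfolded b]], goal_cases)
    case (1 l n)
    have "ph powi n * (q * inverse (ph ^ 2)) powi n = inverse ph powi n * q powi n"
      "ph powi n * (inverse q * inverse (ph ^ 2)) powi n = inverse ph powi n * inverse q powi n"
    proof -
      have h: "ph * (A * inverse (ph ^ 2)) = inverse ph * A" for A using ph0 by (simp add: field_simps power2_eq_square)
      show "ph powi n * (q * inverse (ph ^ 2)) powi n = inverse ph powi n * q powi n"
        "ph powi n * (inverse q * inverse (ph ^ 2)) powi n = inverse ph powi n * inverse q powi n"
        by (simp_all only: power_int_mult_distrib[symmetric] h)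
    qed
    then show ?case using N2 1 qh0
      by (auto simp: id True aF_def ae_def ix_def cc_N cc_Suc power_int_inverse power_int_minus mult_ac)
  next
    case (2 \<alpha>)
    show ?case by (simp add: pf_def id True ix_def)
  next
    case (3 \<alpha>)
    let ?x = "Poly_Mapping.lookup \<alpha> N" and ?y = "Poly_Mapping.lookup \<alpha> (Suc 0)"
    have "ph powi (?y - ?x + 1) * (ph powi (- 1) * (ph ^ 2) powi (- (- 1) * ?x)) = inverse (inverse ph powi ?x * ph powi (- ?y))"
      using ph0 by (simp add: power_int_inverse power_int_add power_int_diff power_int_minus power2_eq_square power_int_mult_distrib field_simps)
    then show ?case
      by (simp add: id True tF_def kap_def psi_def ix_def cc_N cc_Suc mult_ac)
  qed
next
  case False
  have ix: "ix i = i" using False by (simp add: ix_def)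
  have ne: "idx N (int i + 1) \<noteq> idx N (int i)" using ix_ne_Suc[OF i] by (simp only: idx_ix[OF i] idx_Suc[OF i])
  have op: "opF N \<epsilon> qh ph d i = ser_subst (ph * d ^ i) (vX N \<epsilon> qh ph 0 (int i + 1) (int i))" using False by (simp add: opF_def)
  have mu: "ph * d ^ i \<noteq> 0" using ph0 d0 by simp
  have b: "eps N (int i + 1) 1 - eps N (int i) 1 = - bt i" by (simp add: bt_def)
  show ?thesis unfolding op
  proof (rule vop_cong[OF vop_subst[OF vop_vX[OF N1 ne qh0 ph0] mu, unfolded b]], goal_cases)
    case (1 l n)
    then show ?case using ix_ne_Suc[OF i] qh0
      by (auto simp: idx_ix[OF i] idx_Suc[OF i] ix aF_def ae_def cc_Suc power_int_inverse power_int_minus cc_def[of i])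
  next
    case (2 \<alpha>)
    show ?case by (simp add: pf_def idx_ix[OF i] idx_Suc[OF i])
  next
    case (3 \<alpha>)
    show ?case using mu False unfolding tF_def kap_def psi_def cc_Suc
      by (simp add: idx_ix[OF i] idx_Suc[OF i] ix cc_def[of i] power_int_add power_int_diff power_int_minus divide_inverse mult_ac)
  qed
qed

lemma vop_opK:
  assumes i: "i < N" and s: "s \<in> {1, -1}"
  shows "vop N (aK s i) 0 (\<lambda>_. 0) (\<lambda>\<alpha>. q powi (s * pf i \<alpha>)) (opK N qh ph d s i)"
proof -
  \<comment> \<open>Common parameters for node 0, where \<open>r = 1\<close>, and the other nodes,
    where \<open>r = 0\<close>.\<close>
  define a b :: int where "a = (if i = 0 then 0 else int i)" and "b = a + 1"
  define \<mu> r where "\<mu> = (if i = 0 then inverse ph else ph * d ^ i)" and "r = (if i = 0 then 1 else (0::int))"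
  have mu: "\<mu> \<noteq> 0" using ph0 d0 by (simp add: \<mu>_def)
  have id: "idx N a = ix i" "idx N b = Suc i" using idx_ix[OF i] idx_Suc[OF i] by (auto simp: a_def b_def)
  have ne: "idx N a \<noteq> idx N b" using ix_ne_Suc[OF i] by (simp add: id)
  have ab: "b - a = 1" "a - b = -1" by (simp_all add: b_def)
  have f: "form N (eps N a x - eps N b x) \<alpha> = x * pf i \<alpha>" for x \<alpha>
    by (simp add: form_diff_left form_eps[OF N1] id pf_def right_diff_distrib)
  \<comment> \<open>The two summands of the exponent sit at the same spectral parameters as in
    \<open>E_i\<close>.\<close>
  have m1: "\<mu> = cc (ix i)" by (simp add: \<mu>_def ix_def cc_N cc_def[of i])
  have m2: "\<mu> * (ph ^ 2) powi r = cc (Suc i) / d"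
    using ph0 by (simp add: \<mu>_def r_def cc_Suc power2_eq_square)
  have m3: "\<mu> powi n * (ph ^ 2) powi (n * r) = (cc (Suc i) / d) powi n" for n
    unfolding m2[symmetric] power_int_mult_distrib by (simp add: power_int_mult[symmetric] mult.commute)
  show ?thesis
  proof (cases "s = 1")
    case True
    have op: "opK N qh ph d s i = ser_subst \<mu> (vu N qh ph r a b)"
      by (simp add: opK_def True \<mu>_def a_def b_def r_def)
    show ?thesis unfolding op vu_gexp[OF N1 ne]
    proof (rule vop_cong[OF vop_subst[OF vop_K[OF N1] mu]], goal_cases)
      case 1 show ?case by simp
    next
      case (2 l n)
      show ?case
      proof (cases "n < 0")
        case True
        then have n: "int (nat (- n)) = - n" "\<bar>n\<bar> = - n" by simp_all
        have "\<mu> powi n * (X * ((ph ^ 2) powi (n * r) * Y)) = X * (Y * (cc (Suc i) / d) powi n)" for X Y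
          unfolding m3[symmetric] by (simp add: mult_ac)
        moreover have "qh powi n = qh powi (- n) * q powi n"
          using qh0 by (simp add: power_int_minus power2_eq_square power_int_mult_distrib field_simps)
        ultimately show ?thesis using True \<open>s = 1\<close> ix_ne_Suc[OF i]
          by (auto simp: aK_def lamK_def ae_def id ab m1[symmetric] n)
      qed (simp add: aK_def \<open>s = 1\<close>)
    next
      case (4 \<alpha>)
      show ?case by (simp add: f ab True)
    qed simp
  next
    case False
    then have s: "s = -1" using s by simp
    have op: "opK N qh ph d s i = ser_subst \<mu> (vv N qh ph r a b)"
      by (simp add: opK_def s \<mu>_def a_def b_def r_def)
    show ?thesis unfolding op vv_gexp[OF N1 ne]
    proof (rule vop_cong[OF vop_subst[OF vop_K[OF N1] mu]], goal_cases)
      case 1 show ?case by simp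
    next
      case (2 l n)
      show ?case
      proof (cases "n > 0")
        case True
        then have n: "int (nat n) = n" "\<bar>n\<bar> = n" by simp_all
        have "qh powi (- n) = qh powi n * q powi (- n)"
          using qh0 by (simp add: power_int_minus power2_eq_square power_int_mult_distrib field_simps)
        then show ?thesis using True s ix_ne_Suc[OF i]
          by (auto simp: aK_def lamK_def ae_def id ab m1[symmetric] n m3[symmetric] algebra_simps)
      qed (simp add: aK_def s)
    next
      case (4 \<alpha>)
      show ?case by (simp add: f ab s)
    qed simp
  qed
qed

end


section \<open>The relations of the quantum toroidal algebra\<close>

lemma power_pair:
  fixes x y :: complex
  assumes "x * y = 1"
  shows "x ^ n * (x ^ n + y ^ n) = 1 + (x ^ 2) ^ n" "x ^ n * (y ^ n + x ^ n) = 1 + (x ^ 2) ^ n"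
proof -
  have "x ^ n * y ^ n = 1" by (simp only: power_mult_distrib[symmetric] assms power_one)
  then show "x ^ n * (x ^ n + y ^ n) = 1 + (x ^ 2) ^ n" "x ^ n * (y ^ n + x ^ n) = 1 + (x ^ 2) ^ n"
    by (simp_all add: distrib_left power2_eq_square power_mult_distrib)
qed

lemma power_pair_diff:
  fixes x :: complex
  assumes "x \<noteq> 0" "a \<in> {2, -1, 0}"
  shows "(x ^ n - inverse x ^ n) * (if a = 2 then x ^ n + inverse x ^ n else if a = -1 then -1 else 0) = (x powi a) ^ n - (x powi (- a)) ^ n"
  using assms by (auto simp: power_int_minus algebra_simps power2_eq_square power_mult_distrib power_inverse)

context toroidal_fock
begin

abbreviation "EE \<equiv> opE N \<epsilon> qh ph d"
abbreviation "FF \<equiv> opF N \<epsilon> qh ph d"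
abbreviation "KK \<equiv> opK N qh ph d"

section \<open>Contractions between the currents and their zero modes\<close>

definition br :: "nat \<Rightarrow> nat \<Rightarrow> nat \<Rightarrow> complex" where
  "br i j n = (if cartan N i j = 2 then q ^ n + inverse q ^ n else if cartan N i j = -1 then -1 else 0)"

lemma cartan_cases: "i < N \<Longrightarrow> j < N \<Longrightarrow> cartan N i j = 2 \<and> i = j \<and> mskew N i j = 0 \<or> cartan N i j = -1 \<and> i \<noteq> j \<or> cartan N i j = 0 \<and> mskew N i j = 0 \<and> i \<noteq> j"
  by (rule pair_cases[of i j]) auto

text \<open>The factor \<open>q^n - q^(-n)\<close> turns the pairing into
  \<open>q^(a n) - q^(-a n)\<close>, the logarithm of a theta factor; this is why the
  \<open>K_i\<close> produce \<open>\<theta>\<close> in the relations.\<close>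

lemma br_mult:
  assumes "i < N" "j < N"
  shows "(q ^ n - inverse q ^ n) * br i j n = (q powi cartan N i j) ^ n - (q powi (- cartan N i j)) ^ n"
  unfolding br_def by (rule power_pair_diff[OF q0]) (use cartan_cases[OF assms] in auto)

lemma pairing_br:
  assumes "i < N" "j < N" "n \<ge> 1"
  shows "(\<Sum>l=1..N. ae j l (int n) * ae i l (- int n)) = inverse q ^ n * (d powi (- mskew N i j)) ^ n * br i j n"
  unfolding pairing[OF assms] br_def by (simp add: power_int_minus power_inverse)

lemma contr_br:
  assumes "i < N" "j < N" "n \<ge> 1" "\<And>l n. a l n = x n * ae i l n" "\<And>l n. b l n = y n * ae j l n"
  shows "contr N a b n = - (y (int n) * x (- int n)) * (inverse q ^ n * (d powi (- mskew N i j)) ^ n * br i j n)"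
  unfolding contr_scaled[OF assms(4,5)] pairing_br[OF assms(1-3)] ..

lemma contr_EE: "i < N \<Longrightarrow> j < N \<Longrightarrow> n \<ge> 1 \<Longrightarrow> contr N (ae i) (ae j) n = - (inverse q ^ n * (d powi (- mskew N i j)) ^ n * br i j n)"
  by (subst contr_br[of i j n _ "\<lambda>_. 1" _ "\<lambda>_. 1"]) auto

lemma contr_FF: "i < N \<Longrightarrow> j < N \<Longrightarrow> n \<ge> 1 \<Longrightarrow> contr N (aF i) (aF j) n = - (q ^ n * (d powi (- mskew N i j)) ^ n * br i j n)"
  using qh0 by (subst contr_br[of i j n _ "\<lambda>n. - (q powi \<bar>n\<bar>)" _ "\<lambda>n. - (q powi \<bar>n\<bar>)"])
    (auto simp: aF_def power_inverse)

lemma contr_EF: "i < N \<Longrightarrow> j < N \<Longrightarrow> n \<ge> 1 \<Longrightarrow> contr N (ae i) (aF j) n = (d powi (- mskew N i j)) ^ n * br i j n"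
  using qh0 by (subst contr_br[of i j n _ "\<lambda>n. 1" _ "\<lambda>n. - (q powi \<bar>n\<bar>)"])
    (auto simp: aF_def power_inverse)

lemma contr_FE: "i < N \<Longrightarrow> j < N \<Longrightarrow> n \<ge> 1 \<Longrightarrow> contr N (aF i) (ae j) n = (d powi (- mskew N i j)) ^ n * br i j n"
  using qh0 by (subst contr_br[of i j n _ "\<lambda>n. - (q powi \<bar>n\<bar>)" _ "\<lambda>n. 1"])
    (auto simp: aF_def power_inverse)

lemma lamK_br:
  assumes "i < N" "j < N"
  shows "- lamK (int n) * (inverse q ^ n * D ^ n * br i j n)
    = (inverse qh * D) ^ n * ((q powi cartan N i j) ^ n - (q powi (- cartan N i j)) ^ n)"
proof -
  have "- lamK (int n) * (inverse q ^ n * D ^ n * br i j n) = (qh * inverse q * D) ^ n * ((q ^ n - inverse q ^ n) * br i j n)"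
    by (simp add: lamK_def power_int_minus power_mult_distrib power_inverse mult_ac)
  also have "qh * inverse q = inverse qh" using qh0 by (simp add: power2_eq_square field_simps)
  finally show ?thesis unfolding br_mult[OF assms] .
qed

lemma lamK_minus: "lamK (- n) = lamK n"
  by (simp add: lamK_def)

lemma contr_K_right:
  assumes "i < N" "j < N" "n \<ge> 1" "\<And>l n. b l n = y n * ae j l n"
  shows "contr N (aK 1 i) b n = y (int n) * ((inverse qh * d powi (- mskew N i j)) ^ n * ((q powi cartan N i j) ^ n - (q powi (- cartan N i j)) ^ n))"
proof -
  have "contr N (aK 1 i) b n = - (y (int n) * (if 1 * - int n < 0 then lamK (- int n) else 0)) * (inverse q ^ n * (d powi (- mskew N i j)) ^ n * br i j n)"
    by (rule contr_br[OF assms(1-3) _ assms(4)]) (simp add: aK_def)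
  also have "\<dots> = y (int n) * (- lamK (int n) * (inverse q ^ n * (d powi (- mskew N i j)) ^ n * br i j n))"
    using assms(3) by (simp add: lamK_minus)
  finally show ?thesis unfolding lamK_br[OF assms(1,2)] .
qed

lemma contr_K_left:
  assumes "i < N" "j < N" "n \<ge> 1" "\<And>l n. a l n = x n * ae i l n"
  shows "contr N a (aK (- 1) j) n = x (- int n) * ((inverse qh * d powi (- mskew N i j)) ^ n * ((q powi cartan N i j) ^ n - (q powi (- cartan N i j)) ^ n))"
proof -
  have "contr N a (aK (- 1) j) n = - ((if - 1 * int n < 0 then lamK (int n) else 0) * x (- int n)) * (inverse q ^ n * (d powi (- mskew N i j)) ^ n * br i j n)"
    by (rule contr_br[OF assms(1-4)]) (simp add: aK_def)
  also have "\<dots> = x (- int n) * (- lamK (int n) * (inverse q ^ n * (d powi (- mskew N i j)) ^ n * br i j n))"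
    using assms(3) by simp
  finally show ?thesis unfolding lamK_br[OF assms(1,2)] .
qed

text \<open>\<open>K_i^+\<close> contains annihilation modes only and \<open>K_i^-\<close> creation
  modes only, so one of the two orders is already normally ordered.\<close>

lemma contr_K_zero: "contr N a (aK 1 i) n = 0" "contr N (aK (- 1) i) a n = 0"
  by (simp_all add: contr_def aK_def)

text \<open>Factor by which the zero mode of \<open>E_i\<close> changes when the lattice vector is
  shifted by the root of node \<open>j\<close>.\<close>

definition chi :: "nat \<Rightarrow> nat \<Rightarrow> complex" where "chi i j = of_int (\<epsilon> (bt i) (bt j)) * psi i (bt j)"

lemma coc_left: "\<alpha> \<in> root_lattice N \<Longrightarrow> \<beta> \<in> root_lattice N \<Longrightarrow> \<gamma> \<in> root_lattice N \<Longrightarrow> \<epsilon> (\<alpha> + \<beta>) \<gamma> = \<epsilon> \<alpha> \<gamma> * \<epsilon> \<beta> \<gamma>"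
  and coc_right: "\<alpha> \<in> root_lattice N \<Longrightarrow> \<beta> \<in> root_lattice N \<Longrightarrow> \<gamma> \<in> root_lattice N \<Longrightarrow> \<epsilon> \<gamma> (\<alpha> + \<beta>) = \<epsilon> \<gamma> \<alpha> * \<epsilon> \<gamma> \<beta>"
  and coc_pm: "\<alpha> \<in> root_lattice N \<Longrightarrow> \<beta> \<in> root_lattice N \<Longrightarrow> \<epsilon> \<alpha> \<beta> \<in> {1, -1}"
  and coc_self: "\<alpha> \<in> root_lattice N \<Longrightarrow> \<epsilon> \<alpha> \<alpha> = (-1) ^ nat (form N \<alpha> \<alpha> div 2)"
  using coc unfolding cocycle_def by blast+

lemma coc_zero:
  assumes "\<alpha> \<in> root_lattice N"
  shows "\<epsilon> \<alpha> 0 = 1" "\<epsilon> 0 \<alpha> = 1"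
proof -
  have e: "x = 1" if "x \<in> {1, -1}" "x = x * x" for x :: int using that by (elim insertE) auto
  have z: "0 \<in> root_lattice N" by (rule root_lattice_0[OF N1])
  show "\<epsilon> \<alpha> 0 = 1" "\<epsilon> 0 \<alpha> = 1"
    using e[OF coc_pm[OF assms z]] e[OF coc_pm[OF z assms]] coc_right[OF z z assms] coc_left[OF z z assms] by simp_all
qed

lemma bt_uminus: "- bt i \<in> root_lattice N"
  by (rule root_lattice_uminus[OF N1 bt_lattice])

text \<open>The values \<plusminus>1 are their own inverses, so bimultiplicativity makes the cocycle
  insensitive to the signs of its arguments.\<close>

lemma coc_uminus:
  assumes "\<alpha> \<in> root_lattice N" "\<beta> \<in> root_lattice N"
  shows "\<epsilon> \<alpha> (- \<beta>) = \<epsilon> \<alpha> \<beta>" "\<epsilon> (- \<alpha>) \<beta> = \<epsilon> \<alpha> \<beta>"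
proof -
  have e: "y = x" if "x \<in> {1, -1}" "y \<in> {1, -1}" "x * y = 1" for x y :: int using that by (elim insertE) auto
  note m = root_lattice_uminus[OF N1 assms(1)] root_lattice_uminus[OF N1 assms(2)]
  have "\<epsilon> \<alpha> \<beta> * \<epsilon> \<alpha> (- \<beta>) = 1"
    unfolding coc_right[OF assms(2) m(2) assms(1), symmetric] by (simp add: coc_zero(1)[OF assms(1)])
  then show "\<epsilon> \<alpha> (- \<beta>) = \<epsilon> \<alpha> \<beta>"
    by (rule e[OF coc_pm[OF assms] coc_pm[OF assms(1) m(2)]])
  have "\<epsilon> \<alpha> \<beta> * \<epsilon> (- \<alpha>) \<beta> = 1"
    unfolding coc_left[OF assms(1) m(1) assms(2), symmetric] by (simp add: coc_zero(2)[OF assms(2)])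
  then show "\<epsilon> (- \<alpha>) \<beta> = \<epsilon> \<alpha> \<beta>"
    by (rule e[OF coc_pm[OF assms] coc_pm[OF m(1) assms(2)]])
qed

lemma chi0: "chi i j \<noteq> 0"
  using coc_pm[OF bt_lattice[of i] bt_lattice[of j]] psi0[of i "bt j"] by (auto simp: chi_def)

text \<open>Combines the sign of the cocycle with the \<open>d\<close>-asymmetry of
  \<open>psi\<close>; together they compensate the monomial factors between the two expansions of a
  contraction.\<close>

lemma chi_sym:
  assumes "i < N" "j < N"
  shows "chi j i = chi i j * d powi mskew N i j * (if cartan N i j = -1 then -1 else 1)"
  unfolding chi_def psi_sym[OF assms] eps_bt_sym[OF assms] by simp

lemma eps_inv: "\<alpha> \<in> root_lattice N \<Longrightarrow> \<beta> \<in> root_lattice N \<Longrightarrow> inverse (of_int (\<epsilon> \<alpha> \<beta>) :: complex) = of_int (\<epsilon> \<alpha> \<beta>)"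
  using coc_pm[of \<alpha> \<beta>] by auto

lemma tE_add: "\<alpha> \<in> root_lattice N \<Longrightarrow> tE i (\<alpha> + bt j) = tE i \<alpha> * chi i j"
  by (simp add: tE_def chi_def psi_add coc_right bt_lattice)

lemma tF_add: "\<alpha> \<in> root_lattice N \<Longrightarrow> tF i (\<alpha> + - bt j) = tF i \<alpha> * chi i j"
  using coc_right[of \<alpha> "- bt j" "- bt i"] psi_add[of i \<alpha> "- bt j"]
  by (simp add: tF_def chi_def psi_uminus bt_uminus coc_uminus bt_lattice)

lemma tE_diff: "\<alpha> \<in> root_lattice N \<Longrightarrow> tE i (\<alpha> + - bt j) = tE i \<alpha> * inverse (chi i j)"
  using coc_right[of \<alpha> "- bt j" "bt i"] psi_add[of i \<alpha> "- bt j"]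
  by (simp add: tE_def chi_def psi_uminus bt_uminus coc_uminus bt_lattice eps_inv)

lemma tF_diff: "\<alpha> \<in> root_lattice N \<Longrightarrow> tF i (\<alpha> + bt j) = tF i \<alpha> * inverse (chi i j)"
  using coc_right[of \<alpha> "bt j" "- bt i"] psi_add[of i \<alpha> "bt j"]
  by (simp add: tF_def chi_def bt_uminus coc_uminus bt_lattice eps_inv)

text \<open>One computation for \<open>E\<close> (\<open>Q = q^(-1)\<close>) and \<open>F\<close>
  (\<open>Q = q\<close>). The contraction is \<open>(1 - x)(1 - Q^2 x)\<close> on equal nodes,
  \<open>1 / (1 - Q x / D)\<close> on adjacent ones, where the linear factor cancels the pole, and 1
  otherwise.\<close>

lemma quad_scalar:
  assumes ij: "i < N" "j < N" and Q: "Q \<in> {q, inverse q}"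
    and c: "\<And>n. n \<ge> 1 \<Longrightarrow> c n = - (Q ^ n * (d powi (- mskew N i j)) ^ n * br i j n)"
      "\<And>n. n \<ge> 1 \<Longrightarrow> c' n = - (Q ^ n * (d powi mskew N i j) ^ n * br i j n)"
    and X: "X' = X * d powi mskew N i j * (if cartan N i j = -1 then -1 else 1)"
    and A: "A = Q powi (- cartan N i j)"
  shows "X * (d powi mskew N i j * fxi c l - A * fxi c (l - 1))
    = X' * (A * d powi mskew N i j * fxi c' (cartan N i j - l) - fxi c' (cartan N i j - l + 1))"
proof -
  have Q0: "Q \<noteq> 0" using Q qh0 by auto
  define D where "D = d powi mskew N i j"
  have D0: "D \<noteq> 0" using d0 by (simp add: D_def)
  have Dm: "d powi (- mskew N i j) = inverse D" by (simp add: D_def power_int_minus)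
  consider "cartan N i j = 2" "mskew N i j = 0" | "cartan N i j = -1" | "cartan N i j = 0" "mskew N i j = 0"
    using cartan_cases[OF ij] by blast
  then show ?thesis
  proof cases
    case 1
    have QQ: "Q ^ n * (q ^ n + inverse q ^ n) = 1 + (Q ^ 2) ^ n" for n
    proof -
      have "Q = q \<or> Q = inverse q" using Q by blast
      then show ?thesis
      proof
        assume Q: "Q = q"
        show ?thesis unfolding Q by (rule power_pair(1)) (rule right_inverse[OF q0])
      next
        assume Q: "Q = inverse q"
        show ?thesis unfolding Q by (rule power_pair(2)) (rule left_inverse[OF q0])
      qed
    qed
    have "fx c = fx (\<lambda>n. - (1 + (Q ^ 2) ^ n))" "fx c' = fx (\<lambda>n. - (1 + (Q ^ 2) ^ n))"
      by (rule fx_cong; simp add: c br_def 1 QQ)+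
    then have F: "fxi c k = (if k = 0 then 1 else if k = 1 then - (1 + Q ^ 2) else if k = 2 then Q ^ 2 else 0)"
      "fxi c' k = fxi c k" for k
      unfolding fxi_def using fx_quad[of "Q ^ 2" "nat k"] by (auto simp: nat_eq_iff)
    have A: "A = inverse (Q ^ 2)" using A 1 by (simp add: power_int_minus)
    show ?thesis unfolding F X A using Q0 by (auto simp: 1 field_simps)
  next
    case 2
    have "fx c = fx (\<lambda>n. (Q / D) ^ n)" "fx c' = fx (\<lambda>n. (Q * D) ^ n)"
      by (rule fx_cong; simp add: c br_def 2 Dm D_def[symmetric] power_mult_distrib power_divide power_inverse divide_inverse)+
    then have F: "fxi c k = (if k < 0 then 0 else (Q / D) ^ nat k)" "fxi c' k = (if k < 0 then 0 else (Q * D) ^ nat k)" for k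
      by (simp_all add: fxi_def fx_geom)
    have A: "A = Q" using A 2 by simp
    have nk: "nat k = Suc (nat (k - 1))" if "k > 0" for k using that by simp
    \<comment> \<open>\<open>(D - Q x) / (1 - Q x / D)\<close> is the constant
      \<open>D\<close>.\<close>
    have 3: "D * fxi c l - Q * fxi c (l - 1) = (if l = 0 then D else 0)"
    proof -
      consider "l < 0" | "l = 0" | "l > 0" by linarith
      then show ?thesis using nk[of l] D0 by cases (simp_all add: F)
    qed
    have 4: "Q * D * fxi c' (-1 - l) - fxi c' (-1 - l + 1) = (if l = 0 then -1 else 0)"
    proof -
      have e: "- l - 1 = -1 - l" by simp
      consider "l > 0" | "l = 0" | "l < 0" by linarith
      then show ?thesis using nk[of "- l"] e by cases (simp_all add: F)
    qed
    show ?thesis unfolding 2 A D_def[symmetric] 3 4 X by (simp add: 2 D_def)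
  next
    case 3
    have F: "fxi c k = (if k = 0 then 1 else 0)" "fxi c' k = (if k = 0 then 1 else 0)" for k
      unfolding fxi_def by (auto simp: fx_zero[of c] fx_zero[of c'] c br_def 3)
    have A: "A = 1" using A 3 by simp
    show ?thesis unfolding F X A by (auto simp: 3)
  qed
qed

section \<open>Relations among the currents \<open>E_i\<close> and \<open>F_i\<close>\<close>

lemma rel_ee:
  assumes "i < N" "j < N" "v \<in> fock_space N"
  shows "scale (d powi mskew N i j) (EE i x (EE j y v)) - scale (q powi cartan N i j) (EE i (x + 1) (EE j (y - 1) v))
    = scale (q powi cartan N i j * d powi mskew N i j) (EE j y (EE i x v)) - EE j (y - 1) (EE i (x + 1) v)"
proof (rule vops_quadratic[OF vop_opE[OF assms(1)] vop_opE[OF assms(2)] _ _ _ assms(3), where f = "cartan N i j"])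
  fix \<alpha> l assume \<alpha>: "\<alpha> \<in> root_lattice N"
  show "tE i (\<alpha> + bt j) * tE j \<alpha> * (d powi mskew N i j * fxi (contr N (ae i) (ae j)) l - q powi cartan N i j * fxi (contr N (ae i) (ae j)) (l - 1)) =
    tE j (\<alpha> + bt i) * tE i \<alpha> * (q powi cartan N i j * d powi mskew N i j * fxi (contr N (ae j) (ae i)) (cartan N i j - l) - fxi (contr N (ae j) (ae i)) (cartan N i j - l + 1))"
    by (rule quad_scalar[OF assms(1,2), of "inverse q"])
      (use assms in \<open>simp_all add: contr_EE br_def cartan_sym[of i j] mskew_sym[of j i] tE_add[OF \<alpha>] chi_sym[of i j] power_int_inverse power_int_minus mult_ac\<close>)
qed (simp_all add: pf_add pf_bt assms cartan_sym)

text \<open>The defining relation divided by \<open>q^a\<close>, the form that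
  \<open>vops_quadratic\<close> produces with \<open>A = q^(-a)\<close>.\<close>

lemma rel_ff:
  assumes "i < N" "j < N" "v \<in> fock_space N"
  shows "scale (d powi mskew N i j) (FF i x (FF j y v)) - scale (q powi (- cartan N i j)) (FF i (x + 1) (FF j (y - 1) v))
    = scale (q powi (- cartan N i j) * d powi mskew N i j) (FF j y (FF i x v)) - FF j (y - 1) (FF i (x + 1) v)"
proof (rule vops_quadratic[OF vop_opF[OF assms(1)] vop_opF[OF assms(2)] _ _ _ assms(3), where f = "cartan N i j"])
  fix \<alpha> l assume \<alpha>: "\<alpha> \<in> root_lattice N"
  show "tF i (\<alpha> + - bt j) * tF j \<alpha> * (d powi mskew N i j * fxi (contr N (aF i) (aF j)) l - q powi (- cartan N i j) * fxi (contr N (aF i) (aF j)) (l - 1)) =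
    tF j (\<alpha> + - bt i) * tF i \<alpha> * (q powi (- cartan N i j) * d powi mskew N i j * fxi (contr N (aF j) (aF i)) (cartan N i j - l) - fxi (contr N (aF j) (aF i)) (cartan N i j - l + 1))"
    by (rule quad_scalar[OF assms(1,2), of q])
      (use assms in \<open>simp_all add: contr_FF br_def cartan_sym[of i j] mskew_sym[of j i] tF_add[OF \<alpha>] chi_sym[of i j] mult_ac del: add_uminus_conv_diff\<close>)
qed (simp_all add: pf_add pf_uminus pf_diff pf_bt assms cartan_sym)

lemma delta_contr: "i < N \<Longrightarrow> j < N \<Longrightarrow> cartan N i j = 0 \<Longrightarrow> fxi (contr N (ae i) (ae j)) l = (if l = 0 then 1 else 0)"
  "i < N \<Longrightarrow> j < N \<Longrightarrow> cartan N i j = 0 \<Longrightarrow> fxi (contr N (aF i) (aF j)) l = (if l = 0 then 1 else 0)"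
  by (auto simp: fxi_def fx_zero contr_EE contr_FF br_def)

lemma rel_ee0:
  assumes "i < N" "j < N" "cartan N i j = 0" "v \<in> fock_space N"
  shows "EE i x (EE j y v) = EE j y (EE i x v)"
proof (rule vops_commute[OF vop_opE[OF assms(1)] vop_opE[OF assms(2)] _ _ _ assms(4), where f = 0])
  fix \<alpha> l assume \<alpha>: "\<alpha> \<in> root_lattice N"
  have "mskew N i j = 0" using cartan_cases[OF assms(1,2)] assms(3) by auto
  then have "chi j i = chi i j" using chi_sym[OF assms(1,2)] assms(3) by simp
  then show "tE i (\<alpha> + bt j) * tE j \<alpha> * fxi (contr N (ae i) (ae j)) l = tE j (\<alpha> + bt i) * tE i \<alpha> * fxi (contr N (ae j) (ae i)) (0 - l)"
    using assms cartan_sym[OF assms(1,2)] by (simp add: delta_contr tE_add[OF \<alpha>])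
qed (simp_all add: pf_add pf_bt assms cartan_sym)

lemma rel_ff0:
  assumes "i < N" "j < N" "cartan N i j = 0" "v \<in> fock_space N"
  shows "FF i x (FF j y v) = FF j y (FF i x v)"
proof (rule vops_commute[OF vop_opF[OF assms(1)] vop_opF[OF assms(2)] _ _ _ assms(4), where f = 0])
  fix \<alpha> l assume \<alpha>: "\<alpha> \<in> root_lattice N"
  have "mskew N i j = 0" using cartan_cases[OF assms(1,2)] assms(3) by auto
  then have "chi j i = chi i j" using chi_sym[OF assms(1,2)] assms(3) by simp
  then show "tF i (\<alpha> + - bt j) * tF j \<alpha> * fxi (contr N (aF i) (aF j)) l = tF j (\<alpha> + - bt i) * tF i \<alpha> * fxi (contr N (aF j) (aF i)) (0 - l)"
    using assms cartan_sym[OF assms(1,2)] by (simp add: delta_contr tF_add[OF \<alpha>] del: add_uminus_conv_diff)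
qed (simp_all add: pf_add pf_diff pf_uminus pf_bt assms cartan_sym)

text \<open>\<open>vops_serre\<close> with \<open>Q = q^(-1)\<close>; the coefficient
  \<open>Q + 1/Q\<close> does not distinguish \<open>q\<close> from its inverse.\<close>

lemma rel_serre_e:
  assumes "i < N" "j < N" "cartan N i j = -1" "v \<in> fock_space N"
  shows "(EE i x1 (EE i x2 (EE j w v)) - scale (q + inverse q) (EE i x1 (EE j w (EE i x2 v))) + EE j w (EE i x1 (EE i x2 v)))
    + (EE i x2 (EE i x1 (EE j w v)) - scale (q + inverse q) (EE i x2 (EE j w (EE i x1 v))) + EE j w (EE i x2 (EE i x1 v))) = 0"
proof -
  have c: "cartan N i i = 2" "mskew N i i = 0" using cartan_cases[OF assms(1,1)] by auto
  have Q: "inverse q + inverse (inverse q) = q + inverse q" by simp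
  have Q0: "inverse q \<noteq> 0" using qh0 by simp
  define D where "D = d powi mskew N i j"
  have D0: "D \<noteq> 0" using d0 by (simp add: D_def)
  have c1: "contr N (ae i) (ae i) n = - (1 + (inverse q ^ 2) ^ n)" if "n \<ge> 1" for n
    unfolding contr_EE[OF assms(1,1) that] br_def if_P[OF c(1)] c(2) by (simp only: minus_zero power_int_0_right power_one mult_1_right power_pair(2)[OF left_inverse[OF q0]])
  have c2: "contr N (ae i) (ae j) n = (inverse q / D) ^ n" if "n \<ge> 1" for n
    using assms(3) by (simp add: contr_EE[OF assms(1,2) that] br_def D_def power_int_minus power_mult_distrib power_inverse divide_inverse)
  have c3: "contr N (ae j) (ae i) n = (inverse q * D) ^ n" if "n \<ge> 1" for n
    using assms(3) by (simp add: contr_EE[OF assms(2,1) that] br_def D_def cartan_sym[OF assms(1,2)] mskew_sym[of j i] power_mult_distrib power_inverse)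
  have y: "chi j i = - D * chi i j" using assms(3) chi_sym[OF assms(1,2)] by (simp add: D_def)
  show ?thesis
    by (rule vops_serre[OF vop_opE[OF assms(1)] vop_opE[OF assms(2)] bt_lattice bt_lattice _ _ _ tE_add tE_add tE_add y D0 Q0 c1 c2 c3 assms(4), unfolded Q])
      (use assms in \<open>simp_all add: pf_add pf_diff pf_uminus pf_bt c cartan_sym[of i j]\<close>)
qed

lemma rel_serre_f:
  assumes "i < N" "j < N" "cartan N i j = -1" "v \<in> fock_space N"
  shows "(FF i x1 (FF i x2 (FF j w v)) - scale (q + inverse q) (FF i x1 (FF j w (FF i x2 v))) + FF j w (FF i x1 (FF i x2 v)))
    + (FF i x2 (FF i x1 (FF j w v)) - scale (q + inverse q) (FF i x2 (FF j w (FF i x1 v))) + FF j w (FF i x2 (FF i x1 v))) = 0"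
proof -
  have c: "cartan N i i = 2" "mskew N i i = 0" using cartan_cases[OF assms(1,1)] by auto
  have Q0: "q \<noteq> 0" using qh0 by simp
  define D where "D = d powi mskew N i j"
  have D0: "D \<noteq> 0" using d0 by (simp add: D_def)
  have c1: "contr N (aF i) (aF i) n = - (1 + (q ^ 2) ^ n)" if "n \<ge> 1" for n
    unfolding contr_FF[OF assms(1,1) that] br_def if_P[OF c(1)] c(2) by (simp only: minus_zero power_int_0_right power_one mult_1_right power_pair(1)[OF right_inverse[OF q0]])
  have c2: "contr N (aF i) (aF j) n = (q / D) ^ n" if "n \<ge> 1" for n
    using assms(3) by (simp add: contr_FF[OF assms(1,2) that] br_def D_def power_int_minus power_mult_distrib power_inverse divide_inverse)
  have c3: "contr N (aF j) (aF i) n = (q * D) ^ n" if "n \<ge> 1" for n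
    using assms(3) by (simp add: contr_FF[OF assms(2,1) that] br_def D_def cartan_sym[OF assms(1,2)] mskew_sym[of j i] power_mult_distrib power_inverse)
  have y: "chi j i = - D * chi i j" using assms(3) chi_sym[OF assms(1,2)] by (simp add: D_def)
  show ?thesis
    by (rule vops_serre[OF vop_opF[OF assms(1)] vop_opF[OF assms(2)] bt_uminus bt_uminus _ _ _ tF_add tF_add tF_add y D0 Q0 c1 c2 c3 assms(4)])
      (use assms in \<open>simp_all add: pf_add pf_diff pf_uminus pf_bt c cartan_sym[of i j]\<close>)
qed

text \<open>For adjacent nodes the contractions \<open>1 - w/(D z)\<close> and
  \<open>1 - D z/w\<close> are one Laurent polynomial up to a monomial, and \<open>chi_sym\<close>
  supplies the missing factor.\<close>

lemma rel_ef_ne: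
  assumes "i < N" "j < N" "i \<noteq> j" "v \<in> fock_space N"
  shows "EE i x (FF j y v) = FF j y (EE i x v)"
proof (rule vops_commute[OF vop_opE[OF assms(1)] vop_opF[OF assms(2)] _ _ _ assms(4), where f = "- cartan N i j"])
  fix \<alpha> l assume \<alpha>: "\<alpha> \<in> root_lattice N"
  define D where "D = d powi mskew N i j"
  have D0: "D \<noteq> 0" using d0 by (simp add: D_def)
  have Dm: "d powi (- mskew N i j) = inverse D" by (simp add: D_def power_int_minus)
  note chi = chi_sym[OF assms(1,2), folded D_def]
  consider "cartan N i j = -1" | "cartan N i j = 0" "mskew N i j = 0"
    using cartan_cases[OF assms(1,2)] assms(3) by blast
  then show "tE i (\<alpha> + - bt j) * tF j \<alpha> * fxi (contr N (ae i) (aF j)) l = tF j (\<alpha> + bt i) * tE i \<alpha> * fxi (contr N (aF j) (ae i)) (- cartan N i j - l)"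
  proof cases
    case 1
    have "fx (contr N (ae i) (aF j)) = fx (\<lambda>n. - (inverse D ^ n))" "fx (contr N (aF j) (ae i)) = fx (\<lambda>n. - (D ^ n))"
      by (rule fx_cong; use assms in \<open>simp add: contr_EF contr_FE br_def 1 cartan_sym[of i j] Dm mskew_sym[of j i] D_def[symmetric]\<close>)+
    then have F: "fxi (contr N (ae i) (aF j)) k = (if k = 0 then 1 else if k = 1 then - inverse D else 0)"
      "fxi (contr N (aF j) (ae i)) k = (if k = 0 then 1 else if k = 1 then - D else 0)" for k
      by (auto simp: fxi_def fx_lin nat_eq_iff)
    show ?thesis unfolding F tE_diff[OF \<alpha>] tF_diff[OF \<alpha>] chi using D0 chi0[of i j] by (auto simp: 1 field_simps)
  next
    case 2
    have F: "fxi (contr N (ae i) (aF j)) k = (if k = 0 then 1 else 0)" "fxi (contr N (aF j) (ae i)) k = (if k = 0 then 1 else 0)" for k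
      using assms 2 by (auto simp: fxi_def fx_zero contr_EF contr_FE br_def cartan_sym[of i j])
    show ?thesis unfolding F tE_diff[OF \<alpha>] tF_diff[OF \<alpha>] chi by (simp add: 2 D_def)
  qed
qed (simp_all add: pf_add pf_diff pf_uminus pf_bt assms cartan_sym)

lemma opK_zero: "i < N \<Longrightarrow> s \<in> {1, -1} \<Longrightarrow> s * k > 0 \<Longrightarrow> KK s i k v = 0"
proof -
  assume i: "i < N" and s: "s \<in> {1, -1}" and k: "s * k > 0"
  have l: "lin (mu_pow N q \<gamma>)" for \<gamma> by (simp add: mu_pow_def lin_linext)
  have ne: "idx N (int i) \<noteq> idx N (int i + 1)" unfolding idx_ix[OF i] idx_Suc[OF i] by (rule ix_ne_Suc[OF i])
  have "vu N qh ph r (int i) (int i + 1) k v = 0" if "s = 1" for r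
    using k that by (simp add: vu_gexp[OF N1 ne] l gexp_annih lin_0[OF l])
  moreover have "vv N qh ph r (int i) (int i + 1) k v = 0" if "s = -1" for r
    using k that by (simp add: vv_gexp[OF N1 ne] l gexp_cre lin_0[OF l])
  ultimately show ?thesis using s by (cases "i = 0") (auto simp: opK_def ser_subst_def)
qed

text \<open>The overall minus sign is \<open>\<epsilon> (bt i) (bt i) = -1\<close>; it is
  compensated in \<open>gop\<close>, which sends \<open>f_i\<close> to \<open>-F_i\<close>.\<close>

lemma rel_ef_eq:
  assumes i: "i < N" and v: "v \<in> fock_space N"
  shows "EE i x (FF i y v) - FF i y (EE i x v) = - scale (1 / (q - inverse q))
    (scale (qh powi (y - x)) (KK 1 i (x + y) v) - scale (qh powi (x - y)) (KK (- 1) i (x + y) v))"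
proof (rule vops_delta_commutator[OF vop_opE[OF i] vop_opF[OF i] vop_opK[OF i, of 1, simplified] vop_opK[OF i, of "-1", simplified]
    _ _ refl qh0 qq_ne _ _ _ _ _ _ _ _ v])
  have c: "cartan N i i = 2" "mskew N i i = 0" using cartan_cases[OF i i] by auto
  show "pf i (\<alpha> - bt i) = pf i \<alpha> - 2" "pf i (\<alpha> + bt i) = pf i \<alpha> + 2" for \<alpha>
    by (simp_all add: pf_add pf_diff pf_bt i c)
  show "contr N (ae i) (aF i) n = q ^ n + inverse q ^ n" "contr N (aF i) (ae i) n = q ^ n + inverse q ^ n" if "n \<ge> 1" for n
    using i that by (simp_all add: contr_EF contr_FE br_def c)
  have f: "form N (bt i) (bt i) = 2" by (simp add: form_bt pf_bt i c)
  have e: "\<epsilon> (bt i) (bt i) = -1" using coc_self[OF bt_lattice, of i] f by simp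
  \<comment> \<open>\<open>psi i (bt i)\<close> is the square of \<open>kap i\<close>, so the
    spectral parameters cancel in the zero mode.\<close>
  have k: "kap i * kap i * inverse (psi i (bt i)) = 1"
  proof -
    have p0: "psi i (bt i) = cc (ix i) * (cc (Suc i) / d)"
      using ix_ne_Suc[OF i] by (simp add: psi_def lookup_bt[OF i])
    have p: "psi i (bt i) = kap i * kap i"
      unfolding p0 using ph0 by (auto simp: kap_def ix_def cc_Suc cc_N) (simp add: cc_def)
    show ?thesis unfolding p[symmetric] by (rule right_inverse[OF psi0])
  qed
  fix \<alpha> assume \<alpha>: "\<alpha> \<in> root_lattice N"
  have e2: "of_int (\<epsilon> (bt i) \<alpha>) * of_int (\<epsilon> (bt i) \<alpha>) = (1::complex)"
    using coc_pm[OF bt_lattice \<alpha>, of i] by auto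
  have ch: "inverse (chi i i) = - inverse (psi i (bt i))" by (simp add: chi_def e)
  have t: "tE i \<alpha> * tF i \<alpha> * inverse (psi i (bt i)) = 1"
  proof -
    have "tE i \<alpha> * tF i \<alpha> * inverse (psi i (bt i)) = (of_int (\<epsilon> (bt i) \<alpha>) * of_int (\<epsilon> (bt i) \<alpha>)) * (kap i * kap i * inverse (psi i (bt i)))"
      using psi0[of i \<alpha>] by (simp add: tE_def tF_def coc_uminus bt_lattice \<alpha>)
    then show ?thesis by (simp only: e2 k mult_1)
  qed
  show "tE i (\<alpha> - bt i) * tF i \<alpha> = - 1"
    using tE_diff[OF \<alpha>, of i i] t by (simp add: ch mult_ac)
  show "tF i (\<alpha> + bt i) * tE i \<alpha> = - 1"
    using tF_diff[OF \<alpha>, of i i] t by (simp add: ch mult_ac)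
next
  fix j n assume "n \<noteq> (0::int)"
  have h: "qh powi n * qh powi n = q powi n" for n by (simp add: power2_eq_square power_int_mult_distrib)
  \<comment> \<open>On the support of a delta function the two currents sit at points in ratio
    \<open>q\<close> or its inverse; adding their commutators kills half of the modes and leaves
    those of \<open>K_i^+\<close> or \<open>K_i^-\<close>.\<close>
  have n: "aK 1 i j n = qh powi n * ae i j n + qh powi (- n) * aF i j n" "aK (-1) i j n = inverse qh powi n * ae i j n + inverse qh powi (- n) * aF i j n"
  proof -
    have "(if 1 * n < 0 then lamK n else 0) = qh powi n + qh powi (- n) * - (q powi \<bar>n\<bar>)"
      "(if - 1 * n < 0 then lamK n else 0) = inverse qh powi n + inverse qh powi (- n) * - (q powi \<bar>n\<bar>)"
      using \<open>n \<noteq> 0\<close> qh0 unfolding lamK_def h[symmetric]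
      by (auto simp: abs_if power_int_minus power_int_inverse field_simps)
    then show "aK 1 i j n = qh powi n * ae i j n + qh powi (- n) * aF i j n"
      "aK (-1) i j n = inverse qh powi n * ae i j n + inverse qh powi (- n) * aF i j n"
      unfolding aK_def aF_def by (metis (no_types, lifting) distrib_right mult.assoc mult_zero_left)+
  qed
  show "aK 1 i j n = qh powi n * ae i j n + qh powi (- n) * aF i j n" by (rule n(1))
  show "aK (-1) i j n = inverse qh powi n * ae i j n + inverse qh powi (- n) * aF i j n" by (rule n(2))
qed simp_all

section \<open>Relations with the Cartan currents\<close>

definition thS :: "int \<Rightarrow> complex \<Rightarrow> complex fps" where
  "thS m s = Abs_fps (\<lambda>n. fps_nth (theta q m) n * s ^ n)"

lemma thS_nth: "fps_nth (thS m s) n = fps_nth (theta q m) n * s ^ n"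
  by (simp add: thS_def)

lemma thS_cexp: "thS m s = fps_const (q powi (- m)) * cexp (\<lambda>n. s ^ n * ((q powi (- m)) ^ n - (q powi m) ^ n))"
  by (rule fps_ext) (simp only: thS_nth theta_cexp[OF q0] fps_mult_left_const_nth cexp_nth fx_scale mult_ac)

lemma cexp_cong: "(\<And>n. n \<ge> 1 \<Longrightarrow> c n = c' n) \<Longrightarrow> cexp c = cexp c'"
  using fx_cong[of c c'] by (simp add: cexp_def)

lemma cexp_zero: "(\<And>n. n \<ge> 1 \<Longrightarrow> c n = 0) \<Longrightarrow> cexp c = 1"
  by (rule fps_ext) (simp add: fx_zero)

lemma rel_kk:
  assumes i: "i < N" and j: "j < N" and s: "s \<in> {1, -1}" and v: "v \<in> fock_space N"
  shows "KK s i x (KK s j y v) = KK s j y (KK s i x v)"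
proof (rule vops_commute[OF vop_opK[OF i s] vop_opK[OF j s] _ _ _ v, where f = 0])
  fix \<alpha> l
  have "contr N (aK s i) (aK s j) n = 0" "contr N (aK s j) (aK s i) n = 0" for n
    using s contr_K_zero by auto
  then have "fxi (contr N (aK s i) (aK s j)) l = (if l = 0 then 1 else 0)" "fxi (contr N (aK s j) (aK s i)) l = (if l = 0 then 1 else 0)" for l
    by (auto simp: fxi_def fx_zero)
  then show "q powi (s * pf i (\<alpha> + 0)) * q powi (s * pf j \<alpha>) * fxi (contr N (aK s i) (aK s j)) l =
    q powi (s * pf j (\<alpha> + 0)) * q powi (s * pf i \<alpha>) * fxi (contr N (aK s j) (aK s i)) (0 - l)"
    by simp
qed simp_all

text \<open>\<open>X\<close> stands for a current \<open>e\<^sub>j\<close> (\<open>\<sigma> = 1\<close>) or \<open>f\<^sub>j\<close> (\<open>\<sigma> = - 1\<close>).\<close>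

lemma rel_k_plus:
  assumes i: "i < N" and j: "j < N" and v: "v \<in> fock_space N"
    and X: "vop N b \<beta> \<zeta> \<tau> X" and b: "\<And>l n. b l n = y n * ae j l n"
    and y: "\<And>n. n \<ge> 1 \<Longrightarrow> y (int n) * ((inverse qh) ^ n * ((q powi cartan N i j) ^ n - (q powi (- cartan N i j)) ^ n))
      = r ^ n * ((q powi (\<sigma> * cartan N i j)) ^ n - (q powi (- \<sigma> * cartan N i j)) ^ n)"
    and \<beta>: "\<And>\<alpha>. pf i (\<alpha> + \<beta>) = pf i \<alpha> + \<sigma> * cartan N i j"
    and \<zeta>: "\<And>\<alpha>. \<zeta> (\<alpha> + 0) = \<zeta> \<alpha>"
  shows "KK 1 i x (X z v) = (\<Sum>n\<le>nat (- x). scale (fps_nth (theta q (- \<sigma> * cartan N i j)) n * (r * d powi (- mskew N i j)) ^ n)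
    (X (z - int n) (KK 1 i (x + int n) v)))"
proof -
  let ?t' = "thS (- \<sigma> * cartan N i j) (r * d powi (- mskew N i j))"
  have K: "vop N (aK 1 i) 0 (\<lambda>_. 0) (\<lambda>\<alpha>. q powi pf i \<alpha>) (KK 1 i)"
    using vop_opK[OF i, of 1] by simp
  have "(\<Sum>n\<le>nat (- x). scale (fps_nth 1 n) (KK 1 i (x + int n) (X (z - int n) v)))
    = (\<Sum>n\<le>nat (- x). scale (fps_nth ?t' n) (X (z - int n) (KK 1 i (x + int n) v)))"
  proof (rule vops_exchange[OF K X _ \<zeta> _ _ _ _ v, where B = "\<lambda>x z. nat (- x)"])
    fix \<alpha> l
    have "cexp (contr N (aK 1 i) b) = cexp (\<lambda>n. (r * d powi (- mskew N i j)) ^ n * ((q powi (\<sigma> * cartan N i j)) ^ n - (q powi (- \<sigma> * cartan N i j)) ^ n))"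
    proof (rule cexp_cong)
      fix n :: nat assume n: "n \<ge> 1"
      have "contr N (aK 1 i) b n = (d powi (- mskew N i j)) ^ n * (y (int n) * ((inverse qh) ^ n * ((q powi cartan N i j) ^ n - (q powi (- cartan N i j)) ^ n)))"
        unfolding contr_K_right[OF i j n b] by (simp add: power_mult_distrib mult_ac)
      then show "contr N (aK 1 i) b n = (r * d powi (- mskew N i j)) ^ n * ((q powi (\<sigma> * cartan N i j)) ^ n - (q powi (- \<sigma> * cartan N i j)) ^ n)"
        unfolding y[OF n] by (simp add: power_mult_distrib mult_ac)
    qed
    then have "?t' = fps_const (q powi (\<sigma> * cartan N i j)) * cexp (contr N (aK 1 i) b)"
      by (simp add: thS_cexp)
    then show "q powi pf i (\<alpha> + \<beta>) * \<tau> \<alpha> * fps_nth (1 * cexp (contr N (aK 1 i) b)) l = \<tau> (\<alpha> + 0) * q powi pf i \<alpha> * fps_nth ?t' l"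
      using q0 by (simp add: \<beta> power_int_add)
  next
    fix x z n v assume "nat (- x) < n"
    then have "KK 1 i (x + int n) v = 0" for v using opK_zero[OF i, of 1 "x + int n"] by simp
    then show "scale (fps_nth 1 n) (KK 1 i (x + int n) (X (z - int n) v)) = 0"
      "scale (fps_nth ?t' n) (X (z - int n) (KK 1 i (x + int n) v)) = 0"
      by (simp_all add: lin_0[OF vop_lin[OF X]])
  qed (simp_all add: contr_K_zero)
  moreover have "(\<Sum>n\<le>nat (- x). scale (fps_nth 1 n) (KK 1 i (x + int n) (X (z - int n) v))) = (\<Sum>n\<in>{0}. scale (fps_nth 1 n) (KK 1 i (x + int n) (X (z - int n) v)))"
    by (rule sum.mono_neutral_right) auto
  ultimately show ?thesis by (simp add: thS_nth)
qed

text \<open>\<open>K_i^-\<close> has creation modes only, so the nontrivial contraction sits in the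
  order \<open>X K_i^-\<close>. There the theta factor cancels it, hence theta is the left
  multiplier of \<open>vops_exchange\<close> and 1 the right one.\<close>

lemma rel_k_minus:
  assumes i: "i < N" and j: "j < N" and v: "v \<in> fock_space N"
    and X: "vop N b \<beta> \<zeta> \<tau> X" and b: "\<And>l n. b l n = y n * ae j l n"
    and y: "\<And>n. n \<ge> 1 \<Longrightarrow> y (- int n) * ((inverse qh) ^ n * ((q powi cartan N i j) ^ n - (q powi (- cartan N i j)) ^ n))
      = r ^ n * ((q powi (\<sigma> * cartan N i j)) ^ n - (q powi (- \<sigma> * cartan N i j)) ^ n)"
    and \<beta>: "\<And>\<alpha>. pf i (\<alpha> + \<beta>) = pf i \<alpha> + \<sigma> * cartan N i j"
    and \<zeta>: "\<And>\<alpha>. \<zeta> (\<alpha> + 0) = \<zeta> \<alpha>"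
  shows "KK (- 1) i x (X z v) = (\<Sum>n\<le>nat x. scale (fps_nth (theta q (\<sigma> * cartan N i j)) n * (r * d powi mskew N i j) ^ n)
    (X (z + int n) (KK (- 1) i (x - int n) v)))"
proof -
  let ?t = "thS (\<sigma> * cartan N i j) (r * d powi mskew N i j)"
  have K: "vop N (aK (- 1) i) 0 (\<lambda>_. 0) (\<lambda>\<alpha>. q powi (- pf i \<alpha>)) (KK (- 1) i)"
    using vop_opK[OF i, of "-1"] by simp
  have "(\<Sum>n\<le>nat x. scale (fps_nth ?t n) (X (z + int n) (KK (- 1) i (x - int n) v)))
    = (\<Sum>n\<le>nat x. scale (fps_nth 1 n) (KK (- 1) i (x - int n) (X (z + int n) v)))"
  proof (rule vops_exchange[OF X K \<zeta> _ _ _ _ _ v, where B = "\<lambda>z x. nat x"])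
    fix \<alpha> l
    let ?c = "\<lambda>n. (r * d powi mskew N i j) ^ n * ((q powi (\<sigma> * cartan N i j)) ^ n - (q powi (- \<sigma> * cartan N i j)) ^ n)"
    have "cexp (contr N b (aK (- 1) i)) = cexp ?c"
    proof (rule cexp_cong)
      fix n :: nat assume n: "n \<ge> 1"
      have "contr N b (aK (- 1) i) n = (d powi mskew N i j) ^ n * (y (- int n) * ((inverse qh) ^ n * ((q powi cartan N i j) ^ n - (q powi (- cartan N i j)) ^ n)))"
        unfolding contr_K_left[OF j i n b] by (simp add: power_mult_distrib mult_ac cartan_sym[OF i j] mskew_sym[of j i])
      then show "contr N b (aK (- 1) i) n = ?c n"
        unfolding y[OF n] by (simp add: power_mult_distrib mult_ac)
    qed
    then have "?t * cexp (contr N b (aK (- 1) i)) = fps_const (q powi (- (\<sigma> * cartan N i j))) * cexp (\<lambda>n. (r * d powi mskew N i j) ^ n * ((q powi (- (\<sigma> * cartan N i j))) ^ n - (q powi (\<sigma> * cartan N i j)) ^ n) + ?c n)"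
      unfolding thS_cexp cexp_add by (simp add: mult.assoc)
    also have "cexp (\<lambda>n. (r * d powi mskew N i j) ^ n * ((q powi (- (\<sigma> * cartan N i j))) ^ n - (q powi (\<sigma> * cartan N i j)) ^ n) + ?c n) = 1"
      by (rule cexp_zero) (simp add: algebra_simps)
    finally have "?t * cexp (contr N b (aK (- 1) i)) = fps_const (q powi (- (\<sigma> * cartan N i j)))" by simp
    then show "\<tau> (\<alpha> + 0) * q powi (- pf i \<alpha>) * fps_nth (?t * cexp (contr N b (aK (- 1) i))) l = q powi (- pf i (\<alpha> + \<beta>)) * \<tau> \<alpha> * fps_nth 1 l"
      using q0 by (simp add: \<beta> power_int_diff power_int_minus field_simps)
  next
    fix z x n v assume "nat x < n"
    then have "KK (- 1) i (x - int n) v = 0" for v using opK_zero[OF i, of "-1" "x - int n"] by simp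
    then show "scale (fps_nth 1 n) (KK (- 1) i (x - int n) (X (z + int n) v)) = 0"
      "scale (fps_nth ?t n) (X (z + int n) (KK (- 1) i (x - int n) v)) = 0"
      by (simp_all add: lin_0[OF vop_lin[OF X]])
  qed (simp_all add: contr_K_zero)
  moreover have "(\<Sum>n\<le>nat x. scale (fps_nth 1 n) (KK (- 1) i (x - int n) (X (z + int n) v))) = (\<Sum>n\<in>{0}. scale (fps_nth 1 n) (KK (- 1) i (x - int n) (X (z + int n) v)))"
    by (rule sum.mono_neutral_right) auto
  ultimately show ?thesis by (simp add: thS_nth)
qed

lemma rel_ke_plus:
  assumes "i < N" "j < N" "v \<in> fock_space N"
  shows "KK 1 i x (EE j z v) = (\<Sum>n\<le>nat (- x). scale (fps_nth (theta q (- cartan N i j)) n * (inverse qh * d powi (- mskew N i j)) ^ n)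
    (EE j (z - int n) (KK 1 i (x + int n) v)))"
  using rel_k_plus[OF assms vop_opE[OF assms(2)], of "\<lambda>_. 1" "inverse qh" 1 x z] assms by (simp add: pf_add pf_bt)

lemma rel_ke_minus:
  assumes "i < N" "j < N" "v \<in> fock_space N"
  shows "KK (- 1) i x (EE j z v) = (\<Sum>n\<le>nat x. scale (fps_nth (theta q (cartan N i j)) n * (inverse qh * d powi mskew N i j) ^ n)
    (EE j (z + int n) (KK (- 1) i (x - int n) v)))"
  using rel_k_minus[OF assms vop_opE[OF assms(2)], of "\<lambda>_. 1" "inverse qh" 1 x z] assms by (simp add: pf_add pf_bt)

lemma qh_q_inverse: "q ^ n * inverse qh ^ n = qh ^ n"
proof -
  have "q * inverse qh = qh" using qh0 by (simp add: power2_eq_square)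
  then show ?thesis by (simp only: power_mult_distrib[symmetric])
qed

lemma rel_kf_plus:
  assumes "i < N" "j < N" "v \<in> fock_space N"
  shows "KK 1 i x (FF j z v) = (\<Sum>n\<le>nat (- x). scale (fps_nth (theta q (cartan N i j)) n * (qh * d powi (- mskew N i j)) ^ n)
    (FF j (z - int n) (KK 1 i (x + int n) v)))"
  using rel_k_plus[OF assms vop_opF[OF assms(2)], of "\<lambda>n. - (q powi \<bar>n\<bar>)" qh "-1" x z] assms
  by (simp add: pf_add pf_diff pf_bt aF_def mult.assoc[symmetric] qh_q_inverse right_diff_distrib)

lemma rel_kf_minus:
  assumes "i < N" "j < N" "v \<in> fock_space N"
  shows "KK (- 1) i x (FF j z v) = (\<Sum>n\<le>nat x. scale (fps_nth (theta q (- cartan N i j)) n * (qh * d powi mskew N i j) ^ n)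
    (FF j (z + int n) (KK (- 1) i (x - int n) v)))"
  using rel_k_minus[OF assms vop_opF[OF assms(2)], of "\<lambda>n. - (q powi \<bar>n\<bar>)" qh "-1" x z] assms
  by (simp add: pf_add pf_diff pf_bt aF_def mult.assoc[symmetric] qh_q_inverse right_diff_distrib)

text \<open>The contraction of \<open>K_i^+\<close> with \<open>K_j^-\<close> is the quotient of the
  theta factors at \<open>c^(-2)\<close> and \<open>c^2\<close>, here \<open>q^(-1)\<close> and
  \<open>q\<close>; multiplying it by the second gives the first.\<close>

lemma rel_kpkm:
  assumes i: "i < N" and j: "j < N" and v: "v \<in> fock_space N"
  shows "(\<Sum>n\<le>nat (min (- x) z). scale (fps_nth (theta q (- cartan N i j)) n * (q * d powi (- mskew N i j)) ^ n) (KK 1 i (x + int n) (KK (- 1) j (z - int n) v)))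
    = (\<Sum>n\<le>nat (min (- x) z). scale (fps_nth (theta q (- cartan N i j)) n * (inverse q * d powi (- mskew N i j)) ^ n) (KK (- 1) j (z - int n) (KK 1 i (x + int n) v)))"
proof -
  let ?D = "d powi (- mskew N i j)" and ?A = "\<lambda>n. (q powi cartan N i j) ^ n - (q powi (- cartan N i j)) ^ n"
  let ?t = "thS (- cartan N i j) (q * ?D)" and ?t' = "thS (- cartan N i j) (inverse q * ?D)"
  have K: "vop N (aK 1 i) 0 (\<lambda>_. 0) (\<lambda>\<alpha>. q powi pf i \<alpha>) (KK 1 i)" "vop N (aK (- 1) j) 0 (\<lambda>_. 0) (\<lambda>\<alpha>. q powi (- pf j \<alpha>)) (KK (- 1) j)"
    using vop_opK[OF i, of 1] vop_opK[OF j, of "-1"] by simp_all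
  have "(\<Sum>n\<le>nat (min (- x) z). scale (fps_nth ?t n) (KK 1 i (x + int n) (KK (- 1) j (z - int n) v)))
    = (\<Sum>n\<le>nat (min (- x) z). scale (fps_nth ?t' n) (KK (- 1) j (z - int n) (KK 1 i (x + int n) v)))"
  proof (rule vops_exchange[OF K _ _ _ _ _ _ v, where B = "\<lambda>x z. nat (min (- x) z)"])
    fix \<alpha> l
    have c: "contr N (aK 1 i) (aK (- 1) j) n = - (q ^ n - inverse q ^ n) * (?D ^ n * ?A n)" if n: "n \<ge> 1" for n
    proof -
      have "contr N (aK 1 i) (aK (- 1) j) n = (if - 1 * int n < 0 then lamK (int n) else 0) * ((inverse qh * ?D) ^ n * ?A n)"
        by (rule contr_K_right[OF i j n, where y = "\<lambda>n. if - 1 * n < 0 then lamK n else 0"]) (simp add: aK_def)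
      also have "\<dots> = - (q ^ n - inverse q ^ n) * (qh ^ n * inverse qh ^ n) * (?D ^ n * ?A n)"
        using n by (simp add: lamK_def power_mult_distrib power_int_minus power_inverse) (simp add: algebra_simps)
      also have "qh ^ n * inverse qh ^ n = 1" using qh0 by (simp add: power_mult_distrib[symmetric])
      finally show ?thesis by simp
    qed
    have "?t * cexp (contr N (aK 1 i) (aK (- 1) j)) = fps_const (q powi cartan N i j) * cexp (\<lambda>n. (q * ?D) ^ n * ?A n + contr N (aK 1 i) (aK (- 1) j) n)"
      unfolding thS_cexp cexp_add by (simp add: mult.assoc)
    also have "cexp (\<lambda>n. (q * ?D) ^ n * ?A n + contr N (aK 1 i) (aK (- 1) j) n) = cexp (\<lambda>n. (inverse q * ?D) ^ n * ?A n)"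
      by (rule cexp_cong) (simp add: c power_mult_distrib algebra_simps)
    finally have "?t * cexp (contr N (aK 1 i) (aK (- 1) j)) = ?t'" by (simp add: thS_cexp)
    then show "q powi pf i (\<alpha> + 0) * q powi (- pf j \<alpha>) * fps_nth (?t * cexp (contr N (aK 1 i) (aK (- 1) j))) l = q powi (- pf j (\<alpha> + 0)) * q powi pf i \<alpha> * fps_nth ?t' l"
      by simp
  next
    fix x z n v assume "nat (min (- x) z) < n"
    then have n: "x + int n > 0 \<or> z - int n < 0" by auto
    then have "KK 1 i (x + int n) (KK (- 1) j (z - int n) v) = 0" "KK (- 1) j (z - int n) (KK 1 i (x + int n) v) = 0"
      using opK_zero[OF i, of 1 "x + int n"] opK_zero[OF j, of "-1" "z - int n"]
      by (auto simp: lin_0[OF vop_lin[OF K(1)]] lin_0[OF vop_lin[OF K(2)]])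
    then show "scale (fps_nth ?t n) (KK 1 i (x + int n) (KK (- 1) j (z - int n) v)) = 0"
      "scale (fps_nth ?t' n) (KK (- 1) j (z - int n) (KK 1 i (x + int n) v)) = 0"
      by simp_all
  qed (simp_all add: contr_K_zero)
  then show ?thesis by (simp add: thS_nth)
qed

end


section \<open>The operators of the Cartan currents\<close>

lemma cfam_one_diff:
  assumes Y: "vop N a \<beta> \<zeta> \<tau> Y" and Y': "vop N a \<beta> \<zeta> \<tau> Y'"
  shows "cfam N 1 (\<lambda>_. a) (\<lambda>k v. Y (k 0) v - Y' (k 0) v)"
proof -
  have c: "cfam N 1 (\<lambda>_. a) (\<lambda>k v. Z (k 0) v)" if Z: "vop N a \<beta> \<zeta> \<tau> Z" for Z
    unfolding cfam_def
  proof (intro conjI allI impI ballI)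
    fix k :: "nat \<Rightarrow> int" and D and v :: fock
    assume "Poly_Mapping.keys v \<subseteq> K1 N D"
    then show "Poly_Mapping.keys (Z (k 0) v) \<subseteq> K1 N (D + 2 * (\<Sum>s<1. k s))"
      using vop_gr1[OF Z] unfolding gr_def by simp
  qed (simp_all add: vop_lin[OF Z] vop_space[OF Z] vop_comm[OF Z])
  show ?thesis by (rule cfam_diff[OF c[OF Y] c[OF Y']])
qed

text \<open>The difference of two vertex operators with the same data is a one-variable family with
  vanishing vacuum expectations.\<close>

lemma vop_unique:
  assumes Y: "vop N a \<beta> \<zeta> \<tau> Y" and Y': "vop N a \<beta> \<zeta> \<tau> Y'" and v: "v \<in> fock_space N"
  shows "Y k v = Y' k v"
  using cfam_zero[OF cfam_one_diff[OF Y Y'] _ v, of "\<lambda>_. k"]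
  by (simp add: vop_vc[OF Y] vop_vc[OF Y'])

context toroidal_fock
begin

text \<open>Coefficients of the exponent of \<open>K_i^\<plusminus>(z)\<close>, read off from its
  commutators; \<open>HM s i n\<close> is a multiple of the operator by which
  \<open>h_(i, s n)\<close> acts.\<close>

definition gK :: "int \<Rightarrow> nat \<Rightarrow> nat \<Rightarrow> nat \<Rightarrow> complex" where
  "gK s i j n = - of_int s * aK s i j (- s * int n)"

abbreviation "HM s i \<equiv> gmode N s (gK s i)"

text \<open>Both sides are vertex operators with the same data, so \<open>vop_unique\<close>
  identifies them for all nodes and both signs at once.\<close>

lemma opK_exi:
  assumes i: "i < N" and s: "s \<in> {1, -1}" and v: "v \<in> fock_space N"
  shows "KK s i k v = opK0 N qh s i (exi (HM s i) (- s * k) v)"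
proof -
  let ?\<gamma> = "eps N (int i) s - eps N (int i + 1) s"
  have f: "form N ?\<gamma> \<alpha> = s * pf i \<alpha>" for \<alpha>
    by (simp add: form_diff_left form_eps[OF N1] idx_ix[OF i] idx_Suc[OF i] pf_def right_diff_distrib)
  have l: "lin (mu_pow N q ?\<gamma>)" by (simp add: mu_pow_def lin_linext)
  have "vop N (aK s i) 0 (\<lambda>_. 0) (\<lambda>\<alpha>. q powi (s * pf i \<alpha>)) (ser_const (mu_pow N q ?\<gamma>) \<diamondop> gexp N s (gK s i))"
  proof (rule vop_cong[OF vop_K[OF N1 s]], goal_cases)
    case (1 j n)
    show ?case using s 1 by (auto simp: gK_def aK_def)
  qed (simp_all add: f)
  from vop_unique[OF vop_opK[OF i s] this v, of k] show ?thesis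
    by (simp add: l opK0_def gexp_def)
qed

lemma lin_opK0: "lin (opK0 N qh s i)"
  by (simp add: opK0_def mu_pow_def lin_linext)

lemma cmodes_HM: "s \<in> {1, -1} \<Longrightarrow> cmodes (HM s i)"
  by (rule cmodes_gmode)

lemma opK0_single: "i < N \<Longrightarrow> opK0 N qh s i (Poly_Mapping.single (m, \<alpha>) 1) = scale (q powi (s * pf i \<alpha>)) (Poly_Mapping.single (m, \<alpha>) 1)"
  by (simp add: opK0_def mu_pow_def form_diff_left form_eps[OF N1] idx_ix idx_Suc pf_def right_diff_distrib scale_single)

lemma opK0_inverse: "i < N \<Longrightarrow> opK0 N qh s i (opK0 N qh (- s) i v) = v"
  by (rule lin_eqI[OF lin_comp[OF lin_opK0 lin_opK0] lin_id])
    (use q0 in \<open>auto simp: opK0_single lin_scale[OF lin_opK0] power_int_minus split: prod.splits\<close>)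

lemma HM_space: "s \<in> {1, -1} \<Longrightarrow> n \<ge> 1 \<Longrightarrow> v \<in> fock_space N \<Longrightarrow> HM s i n v \<in> fock_space N"
proof -
  assume s: "s \<in> {1, -1}" and n: "n \<ge> 1" and v: "v \<in> fock_space N"
  have "s * int n \<noteq> 0" using s n by auto
  then have "heis N j (s * int n) v \<in> fock_space N" for j
    using hgr_K2[OF N1] v unfolding hgr_def fock_space_K2[of v N 0]
      fock_space_K2[of "heis N j (s * int n) v" N "0 - 2 * (s * int n)"] by blast
  then show ?thesis unfolding gmode_def by (intro fock_space_scale fock_space_sum)
qed

lemma opK0_space: "i < N \<Longrightarrow> v \<in> fock_space N \<Longrightarrow> opK0 N qh s i v \<in> fock_space N"
proof -
  assume i: "i < N" and v: "v \<in> fock_space N"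
  have "Poly_Mapping.keys (opK0 N qh s i v) \<subseteq> K2 N 0"
    by (rule keys_lin_subset[OF lin_opK0]) (use v in \<open>auto simp: fock_space_K2[of _ N 0] opK0_single[OF i] scale_single split: prod.splits if_splits\<close>)
  then show ?thesis by (simp add: fock_space_K2[of _ N 0])
qed

text \<open>The modes are recovered from the coefficients of the exponential through Euler's recursion.\<close>

lemma HM_generated:
  assumes i: "i < N" and s: "s \<in> {1, -1}" and n: "n \<ge> 1"
    and cong: "\<And>S T. good S \<Longrightarrow> (\<And>v. v \<in> fock_space N \<Longrightarrow> S v = T v) \<Longrightarrow> good T"
    and add: "\<And>S T. good S \<Longrightarrow> good T \<Longrightarrow> good (\<lambda>v. S v + T v)"
    and scl: "\<And>S x. good S \<Longrightarrow> good (\<lambda>v. scale x (S v))"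
    and comp: "\<And>S T. good S \<Longrightarrow> good T \<Longrightarrow> good (\<lambda>v. S (T v))"
    and K: "\<And>s k. s \<in> {1, -1} \<Longrightarrow> good (KK s i k)"
  shows "good (HM s i n)"
  using n
proof (induction n rule: less_induct)
  case (less n)
  have K0: "good (opK0 N qh s i)" if "s \<in> {1, -1}" for s
    by (rule cong[OF K[OF that, of 0]]) (simp add: opK_exi[OF i that])
  \<comment> \<open>A coefficient of the current \<open>KK s i\<close> with its zero mode stripped
    by the inverse lattice operator.\<close>
  have e: "good (exi (HM s i) (int m))" for m
  proof (rule cong[OF comp[OF K0 K[OF s]]])
    show "- s \<in> {1, -1}" using s by auto
    fix v assume v: "v \<in> fock_space N"
    have "opK0 N qh (- s) i (KK s i (- s * int m) v) = opK0 N qh (- s) i (opK0 N qh (- (- s)) i (exi (HM s i) (- s * (- s * int m)) v))"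
      by (simp add: opK_exi[OF i s v])
    also have "\<dots> = exi (HM s i) (- s * (- s * int m)) v" by (rule opK0_inverse[OF i])
    also have "- s * (- s * int m) = int m" using s by auto
    finally show "opK0 N qh (- s) i (KK s i (- s * int m) v) = exi (HM s i) (int m) v" .
  qed
  have sum: "good (\<lambda>v. \<Sum>a\<in>A. T a v)" if "finite A" "\<And>a. a \<in> A \<Longrightarrow> good (T a)" for A and T :: "nat \<Rightarrow> fock \<Rightarrow> fock"
    using that
  proof (induction A rule: finite_induct)
    case empty
    then show ?case using cong[OF scl[OF e[of 0], of 0], of "\<lambda>_. 0"] by simp
  next
    case (insert a A)
    then show ?case using add[of "T a" "\<lambda>v. \<Sum>a\<in>A. T a v"] by simp
  qed
  \<comment> \<open>Euler's recursion in degree \<open>n\<close>, solved for its top term, whose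
    exponential factor is the identity.\<close>
  let ?S = "\<lambda>v. exi (HM s i) (int n) v + scale (- 1 / of_nat n) (\<Sum>m\<in>{1..<n}. scale (of_nat m) (HM s i m (exi (HM s i) (int (n - m)) v)))"
  have "good ?S"
    by (rule add[OF e scl[OF sum]], simp, rule scl[OF comp[OF less.IH e]]) auto
  then show ?case
  proof (rule cong)
    fix v
    have "scale (of_int (int n)) (exi (HM s i) (int n) v) = (\<Sum>m=1..n. scale (of_nat m) (HM s i m (exi (HM s i) (int n - int m) v)))"
      by (rule exi_euler[OF cmodes_HM[OF s]]) simp
    also have "{1..n} = insert n {1..<n}" using less.prems by auto
    also have "(\<Sum>m\<in>insert n {1..<n}. scale (of_nat m) (HM s i m (exi (HM s i) (int n - int m) v)))
      = scale (of_nat n) (HM s i n v) + (\<Sum>m\<in>{1..<n}. scale (of_nat m) (HM s i m (exi (HM s i) (int n - int m) v)))"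
      by (subst sum.insert) auto
    also have "(\<Sum>m\<in>{1..<n}. scale (of_nat m) (HM s i m (exi (HM s i) (int n - int m) v)))
       = (\<Sum>m\<in>{1..<n}. scale (of_nat m) (HM s i m (exi (HM s i) (int (n - m)) v)))"
      by (rule sum.cong) (auto simp: of_nat_diff)
    finally have "exi (HM s i) (int n) v = scale (1 / of_nat n) (scale (of_nat n) (HM s i n v) + (\<Sum>m\<in>{1..<n}. scale (of_nat m) (HM s i m (exi (HM s i) (int (n - m)) v))))"
      using less.prems by (metis (no_types, lifting) fock.scale_scale fock.scale_one nonzero_divide_eq_eq of_int_of_nat_eq of_nat_0_eq_iff not_one_le_zero)
    then show "?S v = HM s i n v"
      using less.prems by (simp add: fock.scale_right_distrib)
  qed
qed


section \<open>The free algebra acts on the Fock space\<close>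

text \<open>The guard \<open>i < N\<close> makes the operator linear for every element of the
  generator type. The scalars at \<open>Hgen\<close> undo the prefactor
  \<open>\<plusminus>(q - q^(-1))\<close> in the exponent of \<open>k_series\<close>.\<close>

fun gop :: "gen \<Rightarrow> fock \<Rightarrow> fock" where
  "gop (Egen i k) v = (if i < N then EE i (- k) v else 0)"
| "gop (Fgen i k) v = (if i < N then - FF i (- k) v else 0)"
| "gop (Hgen i l) v = (if l > 0 then scale (1 / (q - inverse q)) (HM 1 i (nat l) v)
     else scale (- 1 / (q - inverse q)) (HM (- 1) i (nat (- l)) v))"
| "gop (Kgen i) v = opK0 N qh 1 i v"
| "gop (Kinv i) v = opK0 N qh (- 1) i v"
| "gop Cgen v = scale qh v"
| "gop Cinv v = scale (inverse qh) v"

lemma lin_gop: "lin (gop g)"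
proof (cases g)
  case (Egen i k)
  then show ?thesis using vop_lin[OF vop_opE[of i]] by (auto simp: lin_def)
next
  case (Fgen i k)
  then show ?thesis using vop_lin[OF vop_opF[of i]] by (auto simp: lin_def)
next
  case (Hgen i l)
  then show ?thesis using lin_gmode by (auto simp: lin_def fock.scale_right_distrib mult_ac)
qed (use lin_opK0 in \<open>auto simp: lin_def fock.scale_right_distrib mult_ac\<close>)

lemma gop_space: "g \<in> gens N \<Longrightarrow> v \<in> fock_space N \<Longrightarrow> gop g v \<in> fock_space N"
  by (cases g) (auto simp: gens_def opK0_space fock_space_scale fock_space_uminus HM_space vop_space[OF vop_opE] vop_space[OF vop_opF])

fun wop :: "gen list \<Rightarrow> fock \<Rightarrow> fock" where
  "wop [] v = v"
| "wop (g # gs) v = gop g (wop gs v)"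

lemma wop_append: "wop (xs @ ys) v = wop xs (wop ys v)"
  by (induction xs) simp_all

lemma lin_wop: "lin (wop gs)"
proof (induction gs)
  case Nil
  then show ?case by (simp add: lin_def)
next
  case (Cons g gs)
  then show ?case using lin_gop[of g] by (simp add: lin_def)
qed

lemma wop_space: "set gs \<subseteq> gens N \<Longrightarrow> v \<in> fock_space N \<Longrightarrow> wop gs v \<in> fock_space N"
  by (induction gs) (auto simp: gop_space)

definition rho :: "falg \<Rightarrow> fock \<Rightarrow> fock" where
  "rho x v = (\<Sum>w\<in>Poly_Mapping.keys x. scale (Poly_Mapping.lookup x w) (wop (letters w) v))"

lemma rho_superset:
  "finite A \<Longrightarrow> Poly_Mapping.keys x \<subseteq> A \<Longrightarrow> rho x v = (\<Sum>w\<in>A. scale (Poly_Mapping.lookup x w) (wop (letters w) v))"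
  unfolding rho_def by (rule sum.mono_neutral_left) (auto simp: in_keys_iff)

lemma rho_add: "rho (x + y) v = rho x v + rho y v"
proof -
  let ?A = "Poly_Mapping.keys x \<union> Poly_Mapping.keys y"
  have "rho (x + y) v = (\<Sum>w\<in>?A. scale (Poly_Mapping.lookup (x + y) w) (wop (letters w) v))"
    by (rule rho_superset) (use keys_add[of x y] in auto)
  then show ?thesis
    by (simp add: rho_superset[of ?A x] rho_superset[of ?A y] lookup_add fock.scale_left_distrib sum.distrib)
qed

lemma rho_single: "rho (Poly_Mapping.single w c) v = scale c (wop (letters w) v)"
  by (simp add: rho_superset[of "{w}"])

lemma rho_0 [simp]: "rho 0 v = 0"
  by (simp add: rho_def)

lemma rho_uminus: "rho (- x) v = - rho x v"
  using rho_add[of x "- x" v] by (simp add: eq_neg_iff_add_eq_0 add.commute)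

lemma rho_diff: "rho (x - y) v = rho x v - rho y v"
  using rho_add[of x "- y" v] by (simp add: rho_uminus)

lemma rho_sum: "rho (sum f A) v = (\<Sum>a\<in>A. rho (f a) v)"
  by (induction A rule: infinite_finite_induct) (simp_all add: rho_add)

lemma poly_mapping_expand: "x = (\<Sum>k\<in>Poly_Mapping.keys x. Poly_Mapping.single k (Poly_Mapping.lookup x k))"
proof (rule poly_mapping_eqI)
  fix k
  show "Poly_Mapping.lookup x k = Poly_Mapping.lookup (\<Sum>k\<in>Poly_Mapping.keys x. Poly_Mapping.single k (Poly_Mapping.lookup x k)) k"
    by (cases "k \<in> Poly_Mapping.keys x") (simp_all add: lookup_sum lookup_single when_def in_keys_iff)
qed

lemma lin_rho: "lin (rho x)"
  unfolding rho_def[abs_def] by (rule lin_setsum, rule lin_smult, rule lin_wop)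

lemma rho_mult: "rho (x * y) v = rho x (rho y v)"
proof -
  let ?s = "\<lambda>x w. Poly_Mapping.single w (Poly_Mapping.lookup x w) :: falg"
  have s: "rho (?s x w * ?s y u) v = scale (Poly_Mapping.lookup x w) (wop (letters w) (scale (Poly_Mapping.lookup y u) (wop (letters u) v)))" for w u
    by (simp add: mult_single rho_single plus_word_def wop_append lin_scale[OF lin_wop])
  have "rho (x * y) v = rho ((\<Sum>w\<in>Poly_Mapping.keys x. ?s x w) * (\<Sum>u\<in>Poly_Mapping.keys y. ?s y u)) v"
    by (simp only: poly_mapping_expand[symmetric])
  also have "\<dots> = (\<Sum>w\<in>Poly_Mapping.keys x. \<Sum>u\<in>Poly_Mapping.keys y. scale (Poly_Mapping.lookup x w) (wop (letters w) (scale (Poly_Mapping.lookup y u) (wop (letters u) v))))"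
    by (simp only: sum_product rho_sum s)
  also have "\<dots> = rho x (rho y v)"
    by (simp only: rho_def[of x] rho_def[of y] lin_sum[OF lin_wop] fock.scale_sum_right)
  finally show ?thesis .
qed

lemma rho_const [simp]: "rho (const c) v = scale c v"
  by (simp add: const_def rho_single zero_word_def)

lemma rho_gen [simp]: "rho (gen g) v = gop g v"
  by (simp add: gen_def rho_single)

lemma rho_1 [simp]: "rho 1 v = v"
  using rho_const[of 1 v] by (simp add: const_def)

lemma rho_gen_power: "rho (gen g ^ n) v = (gop g ^^ n) v"
  by (induction n) (simp_all add: rho_mult)

lemma rho_cpow: "rho (cpow n) v = scale (qh powi n) v"
proof -
  have "(gop Cgen ^^ m) v = scale (qh ^ m) v" "(gop Cinv ^^ m) v = scale (inverse qh ^ m) v" for m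
    by (induction m) simp_all
  then show ?thesis by (simp add: cpow_def rho_gen_power power_int_def)
qed

text \<open>The coefficients of \<open>G ^ r\<close> unfold like \<open>pw\<close>, outer factor
  first, so the formal exponential is matched term by term although the free algebra is
  noncommutative.\<close>

lemma rho_exp_series:
  assumes "fps_nth G 0 = 0" "\<And>n v. n \<ge> 1 \<Longrightarrow> rho (fps_nth G n) v = x n v"
  shows "rho (fps_nth (exp_series G) n) v = exi x (int n) v"
proof -
  have pw: "rho (fps_nth (G ^ r) n) v = pw x r n v" for r n
  proof (induction r arbitrary: n)
    case 0
    then show ?case by simp
  next
    case (Suc r)
    have "rho (fps_nth (G ^ Suc r) n) v = (\<Sum>i=0..n. rho (fps_nth G i) (pw x r (n - i) v))"
      by (simp add: fps_mult_nth rho_sum rho_mult Suc)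
    also have "\<dots> = (\<Sum>i=1..n. x i (pw x r (n - i) v))"
      by (rule sum.mono_neutral_cong_right) (auto simp: assms not_less_eq_eq)
    finally show ?case by simp
  qed
  show ?thesis
    by (simp add: exp_series_def rho_sum rho_mult pw exi_def)
qed

lemma rho_k_coeff:
  assumes i: "i < N" and s: "s \<in> {1, -1}" and v: "v \<in> fock_space N"
  shows "rho (k_coeff q s i n) v = KK s i (- s * n) v"
proof (cases "n < 0")
  case True
  then show ?thesis using opK_zero[OF i s, of "- s * n" v] s by (auto simp: k_coeff_def)
next
  case False
  have d: "q - inverse q \<noteq> 0" using qq_ne by simp
  have "rho (k_coeff q s i n) v = opK0 N qh s i (rho (fps_nth (exp_series (Abs_fps (\<lambda>n. if n = 0 then 0
       else const (of_int s * (q - inverse q)) * gen (Hgen i (s * int n))))) (nat n)) v)"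
    using False s by (auto simp: k_coeff_def k_series_def rho_mult)
  also have "rho (fps_nth (exp_series (Abs_fps (\<lambda>n. if n = 0 then 0
       else const (of_int s * (q - inverse q)) * gen (Hgen i (s * int n))))) (nat n)) v = exi (HM s i) (int (nat n)) v"
    by (rule rho_exp_series) (use s d in \<open>auto simp: rho_mult\<close>)
  also have "opK0 N qh s i \<dots> = KK s i (- s * n) v"
    unfolding opK_exi[OF i s v] using False s by auto
  finally show ?thesis .
qed

lemma lin_opE: "i < N \<Longrightarrow> lin (EE i k)" and lin_opF: "i < N \<Longrightarrow> lin (FF i k)"
  and lin_opK: "i < N \<Longrightarrow> s \<in> {1, -1} \<Longrightarrow> lin (KK s i k)"
  using vop_lin vop_opE vop_opF vop_opK by blast+

lemma space_opE: "i < N \<Longrightarrow> v \<in> fock_space N \<Longrightarrow> EE i k v \<in> fock_space N"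
  and space_opF: "i < N \<Longrightarrow> v \<in> fock_space N \<Longrightarrow> FF i k v \<in> fock_space N"
  and space_opK: "i < N \<Longrightarrow> s \<in> {1, -1} \<Longrightarrow> v \<in> fock_space N \<Longrightarrow> KK s i k v \<in> fock_space N"
  using vop_space vop_opE vop_opF vop_opK by blast+

lemmas rho_simps = rho_add rho_diff rho_mult rho_sum rho_cpow

text \<open>Each constructor is one of the operator relations above, with exponents negated because
  generators index coefficients of \<open>z^(-k)\<close>, and with powers of \<open>c\<close> read
  as powers of \<open>qh\<close>.\<close>

lemma rho_relators:
  assumes "x \<in> relators N q d" and v: "v \<in> fock_space N"
  shows "rho x v = 0"
proof -
  have sp: "1 \<in> {1, -1 :: int}" and sm: "- 1 \<in> {1, -1 :: int}" by simp_all
  have dp: "d powi (m * int n) = (d powi m) ^ n" for m n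
    by (simp add: power_int_mult)
  have q1: "qh powi (- int n) = inverse qh ^ n" for n
    by (simp add: power_int_minus power_inverse)
  have q2: "qh powi (2 * int n) = q ^ n" "qh powi (- 2 * int n) = inverse q ^ n" for n
  proof -
    show "qh powi (2 * int n) = q ^ n" unfolding power_int_mult by simp
    have "qh powi (- 2) = inverse q" by (simp add: power_int_minus)
    then show "qh powi (- 2 * int n) = inverse q ^ n" unfolding power_int_mult[of qh "- 2"] by simp
  qed
  have idx: "- 1 * x = - x" "- (- 1) * x = x" "1 * x = x" "- (x - int n) = - x + int n" "- (x + int n) = - x - int n" "- (x + - int n) = - x + int n" for x n
    by simp_all
  show ?thesis
  using assms(1)
proof cases
  case (k_inv i)
  then show ?thesis using opK0_inverse[of i 1 v] by (simp add: rho_simps)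
next
  case (inv_k i)
  then show ?thesis using opK0_inverse[of i "-1" v] by (simp add: rho_simps)
next
  case c_inv
  then show ?thesis using qh0 by (simp add: rho_simps)
next
  case (c_central g)
  then show ?thesis by (simp add: rho_simps lin_scale[OF lin_gop])
next
  case (cinv_central g)
  then show ?thesis by (simp add: rho_simps lin_scale[OF lin_gop])
next
  case (kk i j s a b)
  then show ?thesis using rel_kk[of i j s v] v by (simp add: rho_simps rho_k_coeff space_opK)
next
  case (kpkm i j a b)
  let ?T = "theta q (- cartan N i j)"
  have l: "rho (const (fps_nth ?T n * d powi (- mskew N i j * int n)) * cpow (2 * int n) * k_coeff q 1 i (a - int n) * k_coeff q (- 1) j (b - int n)) v
    = scale (fps_nth ?T n * (q * d powi (- mskew N i j)) ^ n) (KK 1 i (- a + int n) (KK (- 1) j (b - int n) v))" for n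
    unfolding rho_mult rho_const rho_cpow rho_k_coeff[OF kpkm(3) sm v] rho_k_coeff[OF kpkm(2) sp space_opK[OF kpkm(3) sm v]]
    unfolding dp q2 idx by (simp only: fock.scale_scale power_mult_distrib mult_ac)
  have r: "rho (const (fps_nth ?T n * d powi (- mskew N i j * int n)) * cpow (- 2 * int n) * k_coeff q (- 1) j (b - int n) * k_coeff q 1 i (a - int n)) v
    = scale (fps_nth ?T n * (inverse q * d powi (- mskew N i j)) ^ n) (KK (- 1) j (b - int n) (KK 1 i (- a + int n) v))" for n
    unfolding rho_mult rho_const rho_cpow rho_k_coeff[OF kpkm(2) sp v] rho_k_coeff[OF kpkm(3) sm space_opK[OF kpkm(2) sp v]]
    unfolding dp q2 idx by (simp only: fock.scale_scale power_mult_distrib mult_ac)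
  show ?thesis
    using rel_kpkm[OF kpkm(2,3) v, of "- a" b] unfolding kpkm(1) rho_diff rho_sum l r by simp
next
  case (ke i j s a b)
  have s: "s = 1 \<or> s = -1" using ke(4) by blast
  then show ?thesis
  proof
    assume s: "s = 1"
    have r: "rho (const (fps_nth (theta q (- s * cartan N i j)) n * d powi (- s * mskew N i j * int n)) * cpow (- int n) * gen (Egen j (b + s * int n)) * k_coeff q s i (a - int n)) v
      = scale (fps_nth (theta q (- cartan N i j)) n * (inverse qh * d powi (- mskew N i j)) ^ n) (EE j (- b - int n) (KK 1 i (- a + int n) v))" for n
      unfolding s rho_mult rho_const rho_cpow rho_gen rho_k_coeff[OF ke(2) sp v] gop.simps if_P[OF ke(3)]
      unfolding dp q1 idx by (simp only: fock.scale_scale power_mult_distrib mult_ac)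
    show ?thesis
      using rel_ke_plus[OF ke(2,3) v, of "- a" "- b"] unfolding ke(1) rho_diff rho_sum r
      by (simp add: s rho_mult rho_k_coeff[OF ke(2) sp] ke(3) space_opE v)
  next
    assume s: "s = -1"
    have r: "rho (const (fps_nth (theta q (- s * cartan N i j)) n * d powi (- s * mskew N i j * int n)) * cpow (- int n) * gen (Egen j (b + s * int n)) * k_coeff q s i (a - int n)) v
      = scale (fps_nth (theta q (cartan N i j)) n * (inverse qh * d powi mskew N i j) ^ n) (EE j (- b + int n) (KK (- 1) i (a - int n) v))" for n
      unfolding s rho_mult rho_const rho_cpow rho_gen rho_k_coeff[OF ke(2) sm v] gop.simps if_P[OF ke(3)]
      unfolding dp q1 idx by (simp only: fock.scale_scale power_mult_distrib mult_ac)
    show ?thesis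
      using rel_ke_minus[OF ke(2,3) v, of a "- b"] unfolding ke(1) rho_diff rho_sum r
      by (simp add: s rho_mult rho_k_coeff[OF ke(2) sm] ke(3) space_opE v)
  qed
next
  case (kf i j s a b)
  have s: "s = 1 \<or> s = -1" using kf(4) by blast
  then show ?thesis
  proof
    assume s: "s = 1"
    have r: "rho (const (fps_nth (theta q (s * cartan N i j)) n * d powi (- s * mskew N i j * int n)) * cpow (int n) * gen (Fgen j (b + s * int n)) * k_coeff q s i (a - int n)) v
      = - scale (fps_nth (theta q (cartan N i j)) n * (qh * d powi (- mskew N i j)) ^ n) (FF j (- b - int n) (KK 1 i (- a + int n) v))" for n
      unfolding s rho_mult rho_const rho_cpow rho_gen rho_k_coeff[OF kf(2) sp v] gop.simps if_P[OF kf(3)]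
      unfolding dp power_int_of_nat idx by (simp only: fock.scale_scale power_mult_distrib mult_ac fock.scale_minus_right)
    show ?thesis
      using rel_kf_plus[OF kf(2,3) v, of "- a" "- b"] unfolding kf(1) rho_diff rho_sum r
      by (simp add: s rho_mult lin_uminus[OF lin_rho] rho_k_coeff[OF kf(2) sp] kf(3) space_opF v sum_negf)
  next
    assume s: "s = -1"
    have r: "rho (const (fps_nth (theta q (s * cartan N i j)) n * d powi (- s * mskew N i j * int n)) * cpow (int n) * gen (Fgen j (b + s * int n)) * k_coeff q s i (a - int n)) v
      = - scale (fps_nth (theta q (- cartan N i j)) n * (qh * d powi mskew N i j) ^ n) (FF j (- b + int n) (KK (- 1) i (a - int n) v))" for n
      unfolding s rho_mult rho_const rho_cpow rho_gen rho_k_coeff[OF kf(2) sm v] gop.simps if_P[OF kf(3)]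
      unfolding dp power_int_of_nat idx by (simp only: fock.scale_scale power_mult_distrib mult_ac fock.scale_minus_right)
    show ?thesis
      using rel_kf_minus[OF kf(2,3) v, of a "- b"] unfolding kf(1) rho_diff rho_sum r
      by (simp add: s rho_mult lin_uminus[OF lin_rho] rho_k_coeff[OF kf(2) sm] kf(3) space_opF v sum_negf)
  qed
next
  case (ef i j a b)
  show ?thesis
  proof (cases "i = j")
    case True
    have e: "- b - (- a) = a - b" "- a - (- b) = b - a" "- a + - b = - 1 * (a + b)" "- (- 1) * - (a + b) = - 1 * (a + b)" by simp_all
    have R: "EE i (- a) (FF i (- b) v) - FF i (- b) (EE i (- a) v) = - scale (1 / (q - inverse q))
      (scale (qh powi (a - b)) (KK 1 i (- 1 * (a + b)) v) - scale (qh powi (b - a)) (KK (- 1) i (- 1 * (a + b)) v))"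
      using rel_ef_eq[OF ef(2) v, of "- a" "- b"] unfolding e .
    show ?thesis
      unfolding ef(1) rho_diff rho_mult rho_gen rho_const rho_cpow rho_k_coeff[OF ef(2) sp v] rho_k_coeff[OF ef(2) sm v] e
        gop.simps if_P[OF ef(2)] if_P[OF ef(3)] lin_uminus[OF lin_opE[OF ef(2)]] True[symmetric]
      using R by (simp add: algebra_simps)
  next
    case False
    have "EE i (- a) (FF j (- b) v) = FF j (- b) (EE i (- a) v)" by (rule rel_ef_ne[OF ef(2,3) False v])
    then show ?thesis
      unfolding ef(1) rho_diff rho_mult rho_gen rho_const gop.simps if_P[OF ef(2)] if_P[OF ef(3)] lin_uminus[OF lin_opE[OF ef(2)]]
      using False by simp
  qed
next
  case (ee i j a b)
  have e: "- (a + 1) + 1 = - a" "- b - 1 = - (b + 1)" by simp_all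
  show ?thesis
    using rel_ee[OF ee(2,3) v, of "- (a + 1)" "- b"]
    unfolding ee(1) rho_diff rho_mult rho_gen rho_const gop.simps if_P[OF ee(2)] if_P[OF ee(3)] e by simp
next
  case (ff i j a b)
  let ?Q = "q powi cartan N i j" and ?Q' = "q powi (- cartan N i j)" and ?D = "d powi mskew N i j"
  have e: "- (a + 1) + 1 = - a" "- b - 1 = - (b + 1)" by simp_all
  \<comment> \<open>Used to multiply \<open>rel_ff\<close> back by \<open>q^a\<close>.\<close>
  have qc: "?Q * ?Q' = 1" "?Q * (?Q' * ?D) = ?D" using q0 by (simp_all add: power_int_minus)
  have "scale (?Q * ?D) (FF i (- (a + 1)) (FF j (- b) v)) - FF i (- a) (FF j (- (b + 1)) v)
    = scale ?D (FF j (- b) (FF i (- (a + 1)) v)) - scale ?Q (FF j (- (b + 1)) (FF i (- a) v))"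
    using arg_cong[OF rel_ff[OF ff(2,3) v, of "- (a + 1)" "- b"], of "scale ?Q"]
    unfolding e fock.scale_right_diff_distrib fock.scale_scale qc fock.scale_one .
  then show ?thesis
    unfolding ff(1) rho_diff rho_mult rho_gen rho_const gop.simps if_P[OF ff(2)] if_P[OF ff(3)] fock.scale_scale[symmetric]
      lin_uminus[OF lin_opF[OF ff(2)]] lin_uminus[OF lin_opF[OF ff(3)]] minus_minus by simp
next
  case (serre_e i j a b k)
  then show ?thesis using rel_serre_e[of i j v "- a" "- b" "- k"] v
    by (simp add: rho_simps serre_def lin_scale[OF lin_opE] mult_ac)
next
  case (serre_f i j a b k)
  then show ?thesis using rel_serre_f[of i j v "- a" "- b" "- k"] v
    by (simp add: rho_simps serre_def lin_scale[OF lin_opF] lin_uminus[OF lin_opF] mult_ac) (simp add: algebra_simps neg_eq_iff_add_eq_0)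
next
  case (ee0 i j a b)
  then show ?thesis using rel_ee0[of i j v "- a" "- b"] v by (simp add: rho_simps)
next
  case (ff0 i j a b)
  then show ?thesis using rel_ff0[of i j v "- a" "- b"] v by (simp add: rho_simps lin_uminus[OF lin_opF])
qed
qed

end


section \<open>The representation of the quantum toroidal algebra\<close>

lemma endo_carrier: "T \<in> carrier (endo_ring N) \<longleftrightarrow> T \<in> extensional (fock_space N) \<and> (\<forall>v\<in>fock_space N. T v \<in> fock_space N) \<and>
   (\<forall>v\<in>fock_space N. \<forall>w\<in>fock_space N. T (v + w) = T v + T w) \<and> (\<forall>v\<in>fock_space N. \<forall>x. T (scale x v) = scale x (T v))"
proof -
  have "0 \<in> fock_space N" by (rule fock_space_0)
  then show ?thesis by (auto simp: endo_ring_def Let_def PiE_def Pi_def)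
qed

lemma endo_simps:
  "S \<otimes>\<^bsub>endo_ring N\<^esub> T = compose (fock_space N) S T" "S \<oplus>\<^bsub>endo_ring N\<^esub> T = (\<lambda>v\<in>fock_space N. S v + T v)"
  "\<one>\<^bsub>endo_ring N\<^esub> = (\<lambda>v\<in>fock_space N. v)" "\<zero>\<^bsub>endo_ring N\<^esub> = (\<lambda>v\<in>fock_space N. 0)"
  by (simp_all add: endo_ring_def Let_def)

lemma endo_extensionalityI:
  "S \<in> carrier (endo_ring N) \<Longrightarrow> T \<in> carrier (endo_ring N) \<Longrightarrow> (\<And>v. v \<in> fock_space N \<Longrightarrow> S v = T v) \<Longrightarrow> S = T"
  by (rule extensionalityI[of _ "fock_space N"]) (auto simp: endo_carrier)

lemma restrict_endo:
  assumes "lin T" "\<And>v. v \<in> fock_space N \<Longrightarrow> T v \<in> fock_space N"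
  shows "restrict T (fock_space N) \<in> carrier (endo_ring N)"
  using assms by (simp add: endo_carrier fock_space_add fock_space_scale lin_add lin_scale)

lemma endo_closed:
  "S \<in> carrier (endo_ring N) \<Longrightarrow> T \<in> carrier (endo_ring N) \<Longrightarrow> S \<otimes>\<^bsub>endo_ring N\<^esub> T \<in> carrier (endo_ring N)"
  "S \<in> carrier (endo_ring N) \<Longrightarrow> T \<in> carrier (endo_ring N) \<Longrightarrow> S \<oplus>\<^bsub>endo_ring N\<^esub> T \<in> carrier (endo_ring N)"
  "\<one>\<^bsub>endo_ring N\<^esub> \<in> carrier (endo_ring N)" "\<zero>\<^bsub>endo_ring N\<^esub> \<in> carrier (endo_ring N)"
  by (simp_all add: endo_carrier endo_simps compose_def fock_space_add fock_space_scale fock_space_0 fock.scale_right_distrib)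

lemma ring_endo: "ring (endo_ring N)"
proof (rule ringI[OF abelian_groupI monoidI])
  fix x assume x: "x \<in> carrier (endo_ring N)"
  let ?y = "\<lambda>v\<in>fock_space N. - x v"
  have y: "?y \<in> carrier (endo_ring N)"
    using x by (simp add: endo_carrier fock_space_add fock_space_scale fock_space_uminus)
  have "?y \<oplus>\<^bsub>endo_ring N\<^esub> x = \<zero>\<^bsub>endo_ring N\<^esub>"
    by (rule endo_extensionalityI[OF endo_closed(2)[OF y x] endo_closed(4)]) (simp add: endo_simps)
  with y show "\<exists>y\<in>carrier (endo_ring N). y \<oplus>\<^bsub>endo_ring N\<^esub> x = \<zero>\<^bsub>endo_ring N\<^esub>" by blast
next
  fix x y z assume x: "x \<in> carrier (endo_ring N)" and y: "y \<in> carrier (endo_ring N)" and z: "z \<in> carrier (endo_ring N)"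
  show "x \<oplus>\<^bsub>endo_ring N\<^esub> y \<oplus>\<^bsub>endo_ring N\<^esub> z = x \<oplus>\<^bsub>endo_ring N\<^esub> (y \<oplus>\<^bsub>endo_ring N\<^esub> z)"
    by (auto simp: endo_simps add.assoc intro!: restrict_ext)
  show "x \<otimes>\<^bsub>endo_ring N\<^esub> y \<otimes>\<^bsub>endo_ring N\<^esub> z = x \<otimes>\<^bsub>endo_ring N\<^esub> (y \<otimes>\<^bsub>endo_ring N\<^esub> z)"
    using z by (auto simp: endo_simps endo_carrier compose_def intro!: restrict_ext)
  show "(x \<oplus>\<^bsub>endo_ring N\<^esub> y) \<otimes>\<^bsub>endo_ring N\<^esub> z = x \<otimes>\<^bsub>endo_ring N\<^esub> z \<oplus>\<^bsub>endo_ring N\<^esub> y \<otimes>\<^bsub>endo_ring N\<^esub> z"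
    using z by (auto simp: endo_simps endo_carrier compose_def intro!: restrict_ext)
  show "z \<otimes>\<^bsub>endo_ring N\<^esub> (x \<oplus>\<^bsub>endo_ring N\<^esub> y) = z \<otimes>\<^bsub>endo_ring N\<^esub> x \<oplus>\<^bsub>endo_ring N\<^esub> z \<otimes>\<^bsub>endo_ring N\<^esub> y"
    using x y z by (auto simp: endo_simps endo_carrier compose_def intro!: restrict_ext)
next
  fix x y
  show "x \<oplus>\<^bsub>endo_ring N\<^esub> y = y \<oplus>\<^bsub>endo_ring N\<^esub> x"
    by (simp add: endo_simps add.commute)
next
  fix x assume x: "x \<in> carrier (endo_ring N)"
  show "\<zero>\<^bsub>endo_ring N\<^esub> \<oplus>\<^bsub>endo_ring N\<^esub> x = x"
    by (rule endo_extensionalityI[OF endo_closed(2)[OF endo_closed(4) x] x]) (simp add: endo_simps)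
  show "\<one>\<^bsub>endo_ring N\<^esub> \<otimes>\<^bsub>endo_ring N\<^esub> x = x"
    by (rule endo_extensionalityI[OF endo_closed(1)[OF endo_closed(3) x] x]) (use x in \<open>simp add: endo_simps endo_carrier compose_def\<close>)
  show "x \<otimes>\<^bsub>endo_ring N\<^esub> \<one>\<^bsub>endo_ring N\<^esub> = x"
    by (rule endo_extensionalityI[OF endo_closed(1)[OF x endo_closed(3)] x]) (simp add: endo_simps compose_def)
qed (simp_all add: endo_closed)

lemma free_alg_carrier: "x \<in> carrier (free_alg N) \<longleftrightarrow> (\<forall>w\<in>Poly_Mapping.keys x. set (letters w) \<subseteq> gens N)"
  by (simp add: free_alg_def)

lemma free_alg_simps: "x \<otimes>\<^bsub>free_alg N\<^esub> y = x * y" "x \<oplus>\<^bsub>free_alg N\<^esub> y = x + y" "\<one>\<^bsub>free_alg N\<^esub> = 1" "\<zero>\<^bsub>free_alg N\<^esub> = 0"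
  by (simp_all add: free_alg_def)

lemma fa_0: "0 \<in> carrier (free_alg N)" and fa_const: "const c \<in> carrier (free_alg N)"
  and fa_gen: "g \<in> gens N \<Longrightarrow> gen g \<in> carrier (free_alg N)"
  by (simp_all add: free_alg_carrier const_def gen_def zero_word_def)

lemma fa_1: "1 \<in> carrier (free_alg N)"
  using fa_const[of 1 N] by (simp add: const_def)

lemma fa_add: "x \<in> carrier (free_alg N) \<Longrightarrow> y \<in> carrier (free_alg N) \<Longrightarrow> x + y \<in> carrier (free_alg N)"
  unfolding free_alg_carrier using keys_add[of x y] by blast

lemma fa_uminus: "x \<in> carrier (free_alg N) \<Longrightarrow> - x \<in> carrier (free_alg N)"
  unfolding free_alg_carrier by (simp add: in_keys_iff)

lemma fa_diff: "x \<in> carrier (free_alg N) \<Longrightarrow> y \<in> carrier (free_alg N) \<Longrightarrow> x - y \<in> carrier (free_alg N)"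
  using fa_add[OF _ fa_uminus] by fastforce

lemma fa_mult: "x \<in> carrier (free_alg N) \<Longrightarrow> y \<in> carrier (free_alg N) \<Longrightarrow> x * y \<in> carrier (free_alg N)"
  unfolding free_alg_carrier using keys_mult[of x y] by (fastforce simp: plus_word_def)

lemma fa_sum: "(\<And>a. a \<in> A \<Longrightarrow> f a \<in> carrier (free_alg N)) \<Longrightarrow> sum f A \<in> carrier (free_alg N)"
  by (induction A rule: infinite_finite_induct) (auto simp: fa_0 fa_add)

lemma fa_power: "x \<in> carrier (free_alg N) \<Longrightarrow> x ^ n \<in> carrier (free_alg N)"
  by (induction n) (auto simp: fa_1 fa_mult)

lemma fa_cpow: "cpow n \<in> carrier (free_alg N)"
  by (simp add: cpow_def fa_power fa_gen gens_def)

lemma fa_exp_series: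
  assumes "\<And>n. fps_nth G n \<in> carrier (free_alg N)"
  shows "fps_nth (exp_series G) n \<in> carrier (free_alg N)"
proof -
  have "fps_nth (G ^ r) n \<in> carrier (free_alg N)" for r n
  proof (induction r arbitrary: n)
    case 0
    then show ?case by (simp add: fa_0 fa_1)
  next
    case (Suc r)
    then show ?case by (auto simp: fps_mult_nth intro!: fa_sum fa_mult assms)
  qed
  then show ?thesis by (auto simp: exp_series_def intro!: fa_sum fa_mult fa_const)
qed

lemma fa_k_coeff: "i < N \<Longrightarrow> s \<in> {1, -1} \<Longrightarrow> k_coeff q s i n \<in> carrier (free_alg N)"
proof -
  assume i: "i < N" and s: "s \<in> {1, -1}"
  have "fps_nth (k_series q s i) n \<in> carrier (free_alg N)" for n
    unfolding k_series_def fps_mult_left_const_nth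
    by (intro fa_mult fa_gen fa_exp_series) (use i s in \<open>auto simp: gens_def intro!: fa_0 fa_mult fa_const fa_gen\<close>)
  then show ?thesis by (simp add: k_coeff_def fa_0)
qed

lemma relators_carrier: "x \<in> relators N q d \<Longrightarrow> x \<in> carrier (free_alg N)"
  by (induction x rule: relators.induct)
    (auto simp: serre_def gens_def intro!: fa_diff fa_add fa_mult fa_sum fa_const fa_cpow fa_gen fa_k_coeff fa_1)

lemma ring_free_alg: "ring (free_alg N)"
  by (rule ringI[OF abelian_groupI monoidI])
    (auto simp: free_alg_simps fa_add fa_0 fa_1 fa_mult algebra_simps intro!: bexI[OF _ fa_uminus])

context toroidal_fock
begin

definition hom_rho :: "falg \<Rightarrow> fock \<Rightarrow> fock" where
  "hom_rho x = restrict (rho x) (fock_space N)"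

lemma rho_space: "x \<in> carrier (free_alg N) \<Longrightarrow> v \<in> fock_space N \<Longrightarrow> rho x v \<in> fock_space N"
  unfolding rho_def free_alg_carrier by (intro fock_space_sum fock_space_scale wop_space) auto

lemma hom_rho_endo: "x \<in> carrier (free_alg N) \<Longrightarrow> hom_rho x \<in> carrier (endo_ring N)"
  unfolding hom_rho_def by (rule restrict_endo[OF lin_rho rho_space])

lemma hom_rho_hom: "hom_rho \<in> ring_hom (free_alg N) (endo_ring N)"
proof (rule ring_hom_memI)
  fix x y assume "x \<in> carrier (free_alg N)" "y \<in> carrier (free_alg N)"
  then show "hom_rho (x \<otimes>\<^bsub>free_alg N\<^esub> y) = hom_rho x \<otimes>\<^bsub>endo_ring N\<^esub> hom_rho y"
    by (auto simp: hom_rho_def free_alg_simps endo_simps rho_mult compose_def rho_space intro!: restrict_ext)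
  show "hom_rho (x \<oplus>\<^bsub>free_alg N\<^esub> y) = hom_rho x \<oplus>\<^bsub>endo_ring N\<^esub> hom_rho y"
    by (auto simp: hom_rho_def free_alg_simps endo_simps rho_add intro!: restrict_ext)
qed (auto simp: hom_rho_endo[unfolded hom_rho_def] hom_rho_def free_alg_simps endo_simps)

abbreviation "TI \<equiv> toroidal_ideal N q d"

lemma ideal_TI: "ideal TI (free_alg N)"
  unfolding toroidal_ideal_def by (rule ring.genideal_ideal[OF ring_free_alg]) (use relators_carrier in blast)

text \<open>The kernel of \<open>hom_rho\<close> is an ideal containing the relators, hence contains
  the ideal they generate.\<close>

lemma rho_TI:
  assumes "x \<in> TI" "v \<in> fock_space N"
  shows "rho x v = 0"
proof -
  interpret h: ring_hom_ring "free_alg N" "endo_ring N" hom_rho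
    by (rule ring_hom_ringI2[OF ring_free_alg ring_endo hom_rho_hom])
  have ker: "a_kernel (free_alg N) (endo_ring N) hom_rho = {x \<in> carrier (free_alg N). hom_rho x = \<zero>\<^bsub>endo_ring N\<^esub>}"
    by (rule a_kernel_def')
  have "hom_rho x = \<zero>\<^bsub>endo_ring N\<^esub>" if "x \<in> relators N q d" for x
    unfolding hom_rho_def endo_simps by (rule restrict_ext) (rule rho_relators[OF that])
  then have "relators N q d \<subseteq> a_kernel (free_alg N) (endo_ring N) hom_rho"
    unfolding ker using relators_carrier by blast
  then have "TI \<subseteq> a_kernel (free_alg N) (endo_ring N) hom_rho"
    unfolding toroidal_ideal_def by (rule ring.genideal_minimal[OF ring_free_alg h.kernel_is_ideal])
  then have "hom_rho x = \<zero>\<^bsub>endo_ring N\<^esub>" using assms(1) unfolding ker by blast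
  then have "hom_rho x v = (\<lambda>v\<in>fock_space N. 0) v" by (simp only: endo_simps)
  then show ?thesis using assms(2) by (simp add: hom_rho_def)
qed

text \<open>\<open>hom_rho\<close> is constant on cosets of the ideal, so its image of a coset is a
  singleton, whose element is the value.\<close>

definition tmap :: "falg set \<Rightarrow> fock \<Rightarrow> fock" where
  "tmap X = the_elem (hom_rho ` X)"

lemma tmap_tclass: "x \<in> carrier (free_alg N) \<Longrightarrow> tmap (tclass N q d x) = hom_rho x"
proof -
  assume x: "x \<in> carrier (free_alg N)"
  have X: "tclass N q d x = {i + x | i. i \<in> TI}"
    by (auto simp: tclass_def a_r_coset_def' free_alg_simps)
  have "hom_rho (i + x) = hom_rho x" if "i \<in> TI" for i
    unfolding hom_rho_def by (rule restrict_ext) (simp add: rho_add rho_TI[OF that])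
  moreover have "0 \<in> TI"
    using additive_subgroup.zero_closed[OF ideal.axioms(1)[OF ideal_TI]] by (simp add: free_alg_simps)
  ultimately have "hom_rho ` tclass N q d x = {hom_rho x}" unfolding X by auto
  then show ?thesis by (simp add: tmap_def)
qed

abbreviation "VA \<equiv> vertex_algebra N \<epsilon> qh ph d"

lemma VA_simps:
  "S \<otimes>\<^bsub>VA\<^esub> T = S \<otimes>\<^bsub>endo_ring N\<^esub> T" "S \<oplus>\<^bsub>VA\<^esub> T = S \<oplus>\<^bsub>endo_ring N\<^esub> T" "\<one>\<^bsub>VA\<^esub> = \<one>\<^bsub>endo_ring N\<^esub>"
  "carrier VA = generate_ring (endo_ring N) (range (scalar_op N) \<union> vertex_coeffs N \<epsilon> qh ph d)"
  by (simp_all add: vertex_algebra_def)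

lemma vertex_coeffs_mem:
  "i < N \<Longrightarrow> restrict (EE i k) (fock_space N) \<in> vertex_coeffs N \<epsilon> qh ph d"
  "i < N \<Longrightarrow> restrict (FF i k) (fock_space N) \<in> vertex_coeffs N \<epsilon> qh ph d"
  "i < N \<Longrightarrow> s \<in> {1, -1} \<Longrightarrow> restrict (KK s i k) (fock_space N) \<in> vertex_coeffs N \<epsilon> qh ph d"
  unfolding vertex_coeffs_def by blast+

lemma vertex_coeffs_endo: "vertex_coeffs N \<epsilon> qh ph d \<subseteq> carrier (endo_ring N)"
  unfolding vertex_coeffs_def
  by (auto intro!: restrict_endo lin_opE lin_opF lin_opK space_opE space_opF space_opK)

lemma scalar_op_endo: "scalar_op N x \<in> carrier (endo_ring N)"
  unfolding scalar_op_def by (rule restrict_endo) (auto simp: lin_def fock.scale_right_distrib mult.commute fock_space_scale)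

lemma VA_endo: "carrier VA \<subseteq> carrier (endo_ring N)"
  unfolding VA_simps by (rule ring.generate_ring_incl[OF ring_endo]) (use vertex_coeffs_endo scalar_op_endo in blast)

text \<open>Membership in the generated algebra, phrased for total operators; by
  \<open>good_cong\<close> only the values on \<open>fock_space N\<close> matter.\<close>

definition good :: "(fock \<Rightarrow> fock) \<Rightarrow> bool" where
  "good T \<longleftrightarrow> (\<forall>v\<in>fock_space N. T v \<in> fock_space N) \<and> restrict T (fock_space N) \<in> carrier VA"

lemma good_cong: "good S \<Longrightarrow> (\<And>v. v \<in> fock_space N \<Longrightarrow> S v = T v) \<Longrightarrow> good T"
  using restrict_ext[of "fock_space N" S T] by (simp add: good_def)

lemma good_add: "good S \<Longrightarrow> good T \<Longrightarrow> good (\<lambda>v. S v + T v)"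
proof -
  assume S: "good S" and T: "good T"
  have "restrict (\<lambda>v. S v + T v) (fock_space N) = restrict S (fock_space N) \<oplus>\<^bsub>endo_ring N\<^esub> restrict T (fock_space N)"
    by (auto simp: endo_simps intro!: restrict_ext)
  then show ?thesis using S T by (simp add: good_def VA_simps fock_space_add generate_ring.eng_add)
qed

lemma good_comp: "good S \<Longrightarrow> good T \<Longrightarrow> good (\<lambda>v. S (T v))"
proof -
  assume S: "good S" and T: "good T"
  have "restrict (\<lambda>v. S (T v)) (fock_space N) = restrict S (fock_space N) \<otimes>\<^bsub>endo_ring N\<^esub> restrict T (fock_space N)"
    using T by (auto simp: endo_simps compose_def good_def intro!: restrict_ext)
  then show ?thesis using S T by (simp add: good_def VA_simps generate_ring.eng_mult)
qed

lemma good_scale: "good (scale x)"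
  unfolding good_def VA_simps by (auto simp: fock_space_scale scalar_op_def[symmetric] intro!: generate_ring.incl)

lemma good_smult: "good S \<Longrightarrow> good (\<lambda>v. scale x (S v))"
  by (rule good_comp[OF good_scale])

lemma good_sum: "finite A \<Longrightarrow> (\<And>a. a \<in> A \<Longrightarrow> good (T a)) \<Longrightarrow> good (\<lambda>v. \<Sum>a\<in>A. T a v)"
proof (induction A rule: finite_induct)
  case empty
  then show ?case using good_scale[of 0] by (simp add: fock.scale_zero_left[abs_def])
next
  case (insert a A)
  then show ?case using good_add[of "T a" "\<lambda>v. \<Sum>a\<in>A. T a v"] by simp
qed

lemma good_EE: "i < N \<Longrightarrow> good (EE i k)" and good_FF: "i < N \<Longrightarrow> good (FF i k)"
  and good_KK: "i < N \<Longrightarrow> s \<in> {1, -1} \<Longrightarrow> good (KK s i k)"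
  unfolding good_def VA_simps
  by (auto simp: space_opE space_opF space_opK intro!: generate_ring.incl vertex_coeffs_mem)

text \<open>The algebra is generated by coefficients of currents, among which the
  \<open>h_(i,l)\<close> do not appear; their images are recovered from the coefficients of
  \<open>K_i^\<plusminus>(z)\<close>.\<close>

lemma good_HM: "i < N \<Longrightarrow> s \<in> {1, -1} \<Longrightarrow> n \<ge> 1 \<Longrightarrow> good (HM s i n)"
  by (rule HM_generated[where good = good]) (blast intro: good_cong good_add good_smult good_comp good_KK)+

lemma good_opK0: "i < N \<Longrightarrow> s \<in> {1, -1} \<Longrightarrow> good (opK0 N qh s i)"
  by (rule good_cong[OF good_KK[of i s 0]]) (auto simp: opK_exi)

lemma good_gop: "g \<in> gens N \<Longrightarrow> good (gop g)"
proof (cases g)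
  case (Fgen i k)
  assume "g \<in> gens N"
  then have i: "i < N" using Fgen by (auto simp: gens_def)
  show ?thesis by (rule good_cong[OF good_smult[OF good_FF[OF i, of "- k"], of "-1"]]) (simp add: Fgen i)
next
  case (Hgen i l)
  assume "g \<in> gens N"
  then have i: "i < N" and l: "l \<noteq> 0" using Hgen by (auto simp: gens_def)
  show ?thesis
  proof (cases "l > 0")
    case True
    show ?thesis by (rule good_cong[OF good_smult[OF good_HM[OF i, of 1 "nat l"]]]) (use True in \<open>auto simp: Hgen\<close>)
  next
    case False
    show ?thesis by (rule good_cong[OF good_smult[OF good_HM[OF i, of "-1" "nat (- l)"], of "- 1 / (q - inverse q)"]]) (use False l in \<open>auto simp: Hgen\<close>)
  qed
next
  case (Egen i k)
  assume "g \<in> gens N"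
  then show ?thesis using Egen good_cong[OF good_EE[of i "- k"]] by (simp add: gens_def)
next
  case (Kgen i)
  assume "g \<in> gens N"
  then show ?thesis using Kgen good_cong[OF good_opK0[of i 1]] by (simp add: gens_def)
next
  case (Kinv i)
  assume "g \<in> gens N"
  then show ?thesis using Kinv good_cong[OF good_opK0[of i "-1"]] by (simp add: gens_def)
next
  case Cgen
  then show ?thesis using good_cong[OF good_scale[of qh]] by simp
next
  case Cinv
  then show ?thesis using good_cong[OF good_scale[of "inverse qh"]] by simp
qed

lemma good_wop: "set gs \<subseteq> gens N \<Longrightarrow> good (wop gs)"
proof (induction gs)
  case Nil
  show ?case by (rule good_cong[OF good_scale[of 1]]) simp
next
  case (Cons g gs)
  then have "good (\<lambda>v. gop g (wop gs v))" using good_comp[OF good_gop, of g "wop gs"] by simp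
  then show ?case using good_cong by simp
qed

lemma good_rho: "x \<in> carrier (free_alg N) \<Longrightarrow> good (rho x)"
  unfolding rho_def[abs_def] free_alg_carrier by (rule good_sum, simp, rule good_smult, rule good_wop) blast

lemma toroidal_map_tmap: "toroidal_map N \<epsilon> qh ph d tmap"
proof -
  interpret I: ideal TI "free_alg N" by (rule ideal_TI)
  have cls: "X \<in> carrier (toroidal N q d) \<Longrightarrow> \<exists>x\<in>carrier (free_alg N). X = tclass N q d x" for X
    by (auto simp: toroidal_def FactRing_simps tclass_def a_r_coset_def)
  have "tmap \<in> ring_hom (toroidal N q d) VA"
  proof (rule ring_hom_memI)
    fix X assume "X \<in> carrier (toroidal N q d)"
    then obtain x where "x \<in> carrier (free_alg N)" "X = tclass N q d x" using cls by blast
    then show "tmap X \<in> carrier VA"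
      using good_rho[of x] by (simp add: tmap_tclass hom_rho_def good_def)
  next
    fix X Y assume "X \<in> carrier (toroidal N q d)" "Y \<in> carrier (toroidal N q d)"
    then obtain x y where x: "x \<in> carrier (free_alg N)" "X = tclass N q d x" and y: "y \<in> carrier (free_alg N)" "Y = tclass N q d y"
      using cls by meson
    have m: "X \<otimes>\<^bsub>toroidal N q d\<^esub> Y = tclass N q d (x * y)"
      using I.rcoset_mult_add[OF x(1) y(1)] by (simp add: toroidal_def FactRing_def x y tclass_def free_alg_simps)
    have a: "X \<oplus>\<^bsub>toroidal N q d\<^esub> Y = tclass N q d (x + y)"
      using I.a_rcos_sum[OF x(1) y(1)] by (simp add: toroidal_def FactRing_def x y tclass_def free_alg_simps)
    show "tmap (X \<otimes>\<^bsub>toroidal N q d\<^esub> Y) = tmap X \<otimes>\<^bsub>VA\<^esub> tmap Y"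
      unfolding m using x y ring_hom_mult[OF hom_rho_hom x(1) y(1)] by (simp add: tmap_tclass fa_mult free_alg_simps VA_simps)
    show "tmap (X \<oplus>\<^bsub>toroidal N q d\<^esub> Y) = tmap X \<oplus>\<^bsub>VA\<^esub> tmap Y"
      unfolding a using x y ring_hom_add[OF hom_rho_hom x(1) y(1)] by (simp add: tmap_tclass fa_add free_alg_simps VA_simps)
  next
    have "\<one>\<^bsub>toroidal N q d\<^esub> = tclass N q d 1" by (simp add: toroidal_def FactRing_def tclass_def free_alg_simps)
    then show "tmap \<one>\<^bsub>toroidal N q d\<^esub> = \<one>\<^bsub>VA\<^esub>"
      using ring_hom_one[OF hom_rho_hom] by (simp add: tmap_tclass fa_1 free_alg_simps VA_simps)
  qed
  moreover have "tmap (tclass N q d (const x)) = scalar_op N x" for x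
    by (auto simp: tmap_tclass fa_const hom_rho_def scalar_op_def intro!: restrict_ext)
  moreover have "tmap (tclass N q d (gen g)) = restrict T (fock_space N)"
    if "g \<in> gens N" "\<And>v. v \<in> fock_space N \<Longrightarrow> gop g v = T v" for g T
    using that by (auto simp: tmap_tclass fa_gen hom_rho_def intro!: restrict_ext)
  moreover have "tmap (tclass N q d (k_coeff q s i n)) = restrict (KK s i (- s * n)) (fock_space N)"
    if "i < N" "s \<in> {1, -1}" for i s n
    using that by (simp add: tmap_tclass fa_k_coeff hom_rho_def rho_k_coeff cong: restrict_cong)
  ultimately show ?thesis
    unfolding toroidal_map_def Let_def by (auto simp: gens_def scalar_op_def)
qed

end


section \<open>Irreducibility\<close>

lemma csubspace_sum: "csubspace W \<Longrightarrow> (\<And>a. a \<in> A \<Longrightarrow> f a \<in> W) \<Longrightarrow> sum f A \<in> W"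
  by (induction A rule: infinite_finite_induct) (auto simp: csubspace_def)

lemma csubspace_scale_cancel:
  assumes "csubspace W" "scale c v \<in> W" "c \<noteq> 0"
  shows "v \<in> W"
proof -
  have "scale (inverse c) (scale c v) \<in> W" using assms(1,2) unfolding csubspace_def by blast
  then show ?thesis using assms(3) by simp
qed

text \<open>Stability is required under the coefficients of the currents only, so that one argument
  serves both \<open>vertex_algebra\<close> and the image of the quantum toroidal algebra.\<close>

locale invariant_subspace = toroidal_fock +
  fixes W :: "fock set"
  assumes sub: "csubspace W" and incl: "W \<subseteq> fock_space N"
    and EEW: "i < N \<Longrightarrow> v \<in> W \<Longrightarrow> opE N \<epsilon> qh ph d i k v \<in> W"
    and FFW: "i < N \<Longrightarrow> v \<in> W \<Longrightarrow> opF N \<epsilon> qh ph d i k v \<in> W"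
    and KKW: "i < N \<Longrightarrow> s \<in> {1, -1} \<Longrightarrow> v \<in> W \<Longrightarrow> opK N qh ph d s i k v \<in> W"
    and p_plus: "\<not> root_of_unity (d powi (- int N) * (qh ^ 2) powi int N)"
    and p_minus: "\<not> root_of_unity (d powi (- int N) * (qh ^ 2) powi (- int N))"
begin

section \<open>Stability of an invariant subspace under the Heisenberg algebra\<close>

lemma W_0: "0 \<in> W" and W_add: "v \<in> W \<Longrightarrow> w \<in> W \<Longrightarrow> v + w \<in> W" and W_scale: "v \<in> W \<Longrightarrow> scale x v \<in> W"
  using sub unfolding csubspace_def by blast+

lemma W_diff: "v \<in> W \<Longrightarrow> w \<in> W \<Longrightarrow> v - w \<in> W"
  using W_add[OF _ W_scale, of v w "-1"] by simp

lemma opK0_W: "i < N \<Longrightarrow> s \<in> {1, -1} \<Longrightarrow> v \<in> W \<Longrightarrow> opK0 N qh s i v \<in> W"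
  using KKW[of i s v 0] opK_exi[of i s v 0] incl by auto

text \<open>\<open>HM_generated\<close> with \<open>good\<close> read as stability of
  \<open>W\<close>.\<close>

lemma HM_W: "i < N \<Longrightarrow> s \<in> {1, -1} \<Longrightarrow> n \<ge> 1 \<Longrightarrow> v \<in> W \<Longrightarrow> HM s i n v \<in> W"
proof -
  assume i: "i < N" and s: "s \<in> {1, -1}" and n: "n \<ge> 1" and v: "v \<in> W"
  have "\<forall>v\<in>W. HM s i n v \<in> W"
  proof (rule HM_generated[where good = "\<lambda>T. \<forall>v\<in>W. T v \<in> W", OF i s n])
    fix S T :: "fock \<Rightarrow> fock"
    assume "\<forall>v\<in>W. S v \<in> W" "\<And>v. v \<in> fock_space N \<Longrightarrow> S v = T v"
    then show "\<forall>v\<in>W. T v \<in> W" using incl by (metis subsetD)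
  qed (auto intro: W_add W_scale KKW i)
  then show ?thesis using v by blast
qed

lemma lamK_0: "n \<noteq> 0 \<Longrightarrow> lamK n \<noteq> 0"
proof -
  assume n: "n \<noteq> 0"
  have "q powi \<bar>n\<bar> \<noteq> q powi (- \<bar>n\<bar>)"
  proof
    assume e: "q powi \<bar>n\<bar> = q powi (- \<bar>n\<bar>)"
    have "q powi (\<bar>n\<bar> + \<bar>n\<bar>) = q powi \<bar>n\<bar> * q powi \<bar>n\<bar>" by (rule power_int_add) (use q0 in simp)
    also have "\<dots> = q powi (- \<bar>n\<bar>) * q powi \<bar>n\<bar>" by (simp only: e)
    also have "\<dots> = q powi (- \<bar>n\<bar> + \<bar>n\<bar>)" by (rule power_int_add[symmetric]) (use q0 in simp)
    finally show False using q_powi_ne_1[of "\<bar>n\<bar> + \<bar>n\<bar>"] n by simp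
  qed
  then show ?thesis using qh0 by (simp add: lamK_def)
qed

text \<open>Ratio between neighbouring normalised modes in the cyclic system.\<close>

definition rt :: "int \<Rightarrow> complex" where
  "rt m = d powi m * q powi (- \<bar>m\<bar>)"

lemma rt_0: "rt m \<noteq> 0"
  using d0 q0 by (simp add: rt_def)

text \<open>\<open>rt m ^ N\<close> is \<open>(p q^N)^(-m)\<close> for \<open>m > 0\<close> and
  \<open>(p q^(-N))^|m|\<close> for \<open>m < 0\<close>.\<close>

lemma rt_N: "m \<noteq> 0 \<Longrightarrow> rt m ^ N \<noteq> 1"
proof
  assume m: "m \<noteq> 0" and e: "rt m ^ N = 1"
  define n where "n = nat \<bar>m\<bar>"
  have n: "n > 0" and nm: "int n = \<bar>m\<bar>" using m by (simp_all add: n_def)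
  have r: "rt m ^ N = d powi (m * int N) * q powi (- int n * int N)"
    by (simp only: rt_def power_mult_distrib power_int_mult nm power_int_of_nat)
  have pw: "x powi (k * int n) = (x powi k) ^ n" for x :: complex and k
    by (simp add: power_int_mult)
  show False
  proof (cases "m > 0")
    case True
    then have "m = int n" using nm by simp
    then have "inverse (rt m ^ N) = (d powi (- int N) * q powi int N) ^ n"
      unfolding r power_mult_distrib pw[symmetric] by (simp add: power_int_minus mult.commute)
    then have "(d powi (- int N) * q powi int N) ^ n = 1" using e by (metis inverse_1)
    then show False using p_plus n unfolding root_of_unity_def by blast
  next
    case False
    then have "m = - int n" using nm by simp
    then have "rt m ^ N = (d powi (- int N) * q powi (- int N)) ^ n"
      unfolding r power_mult_distrib pw[symmetric] by (simp add: algebra_simps)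
    then have "(d powi (- int N) * q powi (- int N)) ^ n = 1" using e by metis
    then show False using p_minus n unfolding root_of_unity_def by blast
  qed
qed

text \<open>Up to a scalar, nonzero because \<open>q\<close> is generic, a mode of the exponent of
  \<open>K_i\<close> is this two-term combination. Splitting off the powers of \<open>cc\<close>
  makes the ratio \<open>rt m\<close> the same for all nodes.\<close>

lemma mode_W:
  assumes i: "i < N" and m: "m \<noteq> 0" and v: "v \<in> W"
  shows "scale (cc (ix i) powi (- m)) (heis N (int (ix i)) m v)
    - scale (rt m) (scale (cc (Suc i) powi (- m)) (heis N (int (Suc i)) m v)) \<in> W" (is "?u \<in> W")
proof -
  define s where "s = sgn m"
  define n where "n = nat \<bar>m\<bar>"
  have s: "s \<in> {1, -1}" and n: "n \<ge> 1" and mn: "s * int n = m"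
    using m by (auto simp: s_def n_def sgn_if)
  let ?c = "- of_int s * lamK (- m)"
  have sn: "- s * int n = - m" "s * - m < 0" using mn s n by auto
  have "HM s i n v = scale (1 / of_nat n) (\<Sum>j=1..N. scale (?c * ae i j (- m)) (heis N (int j) m v))"
    unfolding gmode_def gK_def aK_def mn sn(1) using sn(2) by (simp add: mult.assoc)
  also have "(\<Sum>j=1..N. scale (?c * ae i j (- m)) (heis N (int j) m v)) = scale ?c (\<Sum>j=1..N. scale (ae i j (- m)) (heis N (int j) m v))"
    by (simp add: fock.scale_sum_right)
  also have "(\<Sum>j=1..N. scale (ae i j (- m)) (heis N (int j) m v)) =
    (\<Sum>j\<in>{ix i, Suc i}. scale (ae i j (- m)) (heis N (int j) m v))"
    by (rule sum.mono_neutral_right) (use ix_range[OF i] in \<open>auto simp: ae_def\<close>)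
  also have "\<dots> = ?u"
  proof -
    have "(cc (Suc i) / d) powi (- m) = d powi m * cc (Suc i) powi (- m)"
      unfolding power_int_divide_distrib power_int_minus[of d] by (simp add: divide_inverse)
    then have "ae i (Suc i) (- m) = - (rt m * cc (Suc i) powi (- m))"
      using ix_ne_Suc[OF i] by (simp add: ae_def rt_def)
    moreover have "ae i (ix i) (- m) = cc (ix i) powi (- m)" by (simp add: ae_def)
    ultimately show ?thesis using ix_ne_Suc[OF i] by simp
  qed
  finally have "scale (?c / of_nat n) ?u \<in> W" using HM_W[OF i s n v] by simp
  then show ?thesis
    by (rule csubspace_scale_cancel[OF sub]) (use lamK_0[of "- m"] m s n in auto)
qed

text \<open>Going once around the cyclic Dynkin diagram multiplies the modes by \<open>rt m ^ N\<close>, which differs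
  from 1 because \<open>p q\<^sup>N\<close> and \<open>p q\<^sup>-\<^sup>N\<close> are not roots of unity.\<close>

lemma heis_W:
  assumes j: "j \<in> {1..N}" and m: "m \<noteq> 0" and v: "v \<in> W"
  shows "heis N (int j) m v \<in> W"
proof -
  define u where "u l = scale (cc l powi (- m)) (heis N (int l) m v)" for l
  have st: "u (ix i) - scale (rt m) (u (Suc i)) \<in> W" if "i < N" for i
    unfolding u_def by (rule mode_W[OF that m v])
  have cyc: "u N - scale (rt m ^ Suc k) (u (Suc k)) \<in> W" if "k < N" for k
    using that
  proof (induction k)
    case 0
    then show ?case using st[of 0] by (simp add: ix_def)
  next
    case (Suc k)
    have "u (Suc k) - scale (rt m) (u (Suc (Suc k))) \<in> W" using st[of "Suc k"] Suc.prems by (simp add: ix_def)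
    from W_add[OF Suc.IH W_scale[OF this, of "rt m ^ Suc k"]] Suc.prems show ?case
      by (simp add: fock.scale_right_diff_distrib mult_ac)
  qed
  have "u N - scale (rt m ^ N) (u N) \<in> W" using cyc[of "N - 1"] N1 by simp
  then have "scale (1 - rt m ^ N) (u N) \<in> W" by (simp add: fock.scale_left_diff_distrib)
  then have uN: "u N \<in> W" by (rule csubspace_scale_cancel[OF sub]) (use rt_N[OF m] in simp)
  have "u N - (u N - scale (rt m ^ j) (u j)) \<in> W"
    by (rule W_diff[OF uN]) (use cyc j in \<open>cases j; force\<close>)
  then have "scale (rt m ^ j) (u j) \<in> W" by simp
  then have "u j \<in> W" by (rule csubspace_scale_cancel[OF sub]) (simp add: rt_0)
  then show ?thesis unfolding u_def by (rule csubspace_scale_cancel[OF sub]) (simp add: cc0)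
qed

section \<open>From a nonzero invariant subspace to the whole Fock space\<close>

lemma pf_inj:
  assumes "\<alpha> \<in> root_lattice N" "\<beta> \<in> root_lattice N" "\<And>i. i < N \<Longrightarrow> pf i \<alpha> = pf i \<beta>"
  shows "\<alpha> = \<beta>"
proof -
  define \<delta> where "\<delta> = \<alpha> + - \<beta>"
  have r: "\<delta> \<in> root_lattice N" unfolding \<delta>_def
    by (rule root_lattice_iff_add[OF assms(1) root_lattice_uminus[OF N1 assms(2)]])
  have l: "Poly_Mapping.lookup \<delta> j = Poly_Mapping.lookup \<alpha> j - Poly_Mapping.lookup \<beta> j" for j
    by (simp add: \<delta>_def lookup_minus)
  \<comment> \<open>Equal pairings with the simple roots make all coordinates of the difference
    equal; being in the root lattice, it has coordinate sum zero.\<close>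
  have e: "Poly_Mapping.lookup \<delta> (Suc i) = Poly_Mapping.lookup \<delta> 1" if "i < N" for i
    using that
  proof (induction i)
    case (Suc i)
    then show ?case using assms(3)[of "Suc i"] by (simp add: pf_def ix_def l)
  qed simp
  have e': "Poly_Mapping.lookup \<delta> j = Poly_Mapping.lookup \<delta> 1" if "j \<in> {1..N}" for j
    using e[of "j - 1"] that by (cases j) auto
  have "(\<Sum>j=1..N. Poly_Mapping.lookup \<delta> j) = (\<Sum>j=1..N. Poly_Mapping.lookup \<delta> 1)"
    by (rule sum.cong[OF refl e'])
  then have "int N * Poly_Mapping.lookup \<delta> 1 = 0" using r unfolding root_lattice_iff[OF N1] by simp
  then have z: "Poly_Mapping.lookup \<delta> 1 = 0" using N1 by simp
  have "Poly_Mapping.lookup \<delta> j = 0" for j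
  proof (cases "j \<in> {1..N}")
    case True
    then show ?thesis using e'[OF True] z by simp
  next
    case False
    then show ?thesis using r unfolding root_lattice_iff[OF N1] by (meson in_keys_iff subsetD)
  qed
  then have "\<delta> = 0" by (intro poly_mapping_eqI) simp
  then show ?thesis by (simp add: \<delta>_def)
qed

lemma lookup_opK0: "i < N \<Longrightarrow> Poly_Mapping.lookup (opK0 N qh s i v) b = q powi (s * pf i (snd b)) * Poly_Mapping.lookup v b"
proof -
  assume i: "i < N"
  have o: "opK0 N qh s i (Poly_Mapping.single c 1) = scale (q powi (s * pf i (snd c))) (Poly_Mapping.single c 1)" for c
    using opK0_single[OF i, of s "fst c" "snd c"] by simp
  have "Poly_Mapping.lookup (opK0 N qh s i v) b = (\<Sum>c\<in>Poly_Mapping.keys v.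
      Poly_Mapping.lookup v c * (q powi (s * pf i (snd c)) * (if c = b then 1 else 0)))"
    by (subst fock_expand[of v]) (simp add: lin_sum[OF lin_opK0] lin_scale[OF lin_opK0] o lookup_sum lookup_scale lookup_single when_def mult.assoc)
  also have "\<dots> = (\<Sum>c\<in>Poly_Mapping.keys v. if c = b then q powi (s * pf i (snd b)) * Poly_Mapping.lookup v b else 0)"
    by (rule sum.cong) auto
  also have "\<dots> = q powi (s * pf i (snd b)) * Poly_Mapping.lookup v b"
    by (auto simp: sum.delta in_keys_iff)
  finally show ?thesis .
qed

lemma heis_pos_degree:
  fixes v :: fock
  assumes "n > 0" "Poly_Mapping.keys v \<subseteq> {b. degm (fst b) \<le> D}"
  shows "Poly_Mapping.keys (heis N j n v) \<subseteq> {b. degm (fst b) \<le> D - n}"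
proof (rule keys_lin_subset[OF lin_heis assms(2)])
  fix b :: "mono \<times> lattice" assume b: "b \<in> {b. degm (fst b) \<le> D}"
  obtain m \<alpha> where bm: "b = (m, \<alpha>)" by (cases b)
  show "Poly_Mapping.keys (heis N j n (Poly_Mapping.single b 1)) \<subseteq> {b. degm (fst b) \<le> D - n}"
    using b assms(1) degm_minus[of m "(idx N j, nat n)"]
    by (cases "Poly_Mapping.lookup m (idx N j, nat n) = 0") (simp_all add: bm heis_pos_single scale_single)
qed

text \<open>A nonzero vector of \<open>W\<close> with least degree bound is annihilated by every
  positive mode, since these keep it in \<open>W\<close> and lower the bound.\<close>

lemma vacuum_vector:
  assumes "W \<noteq> {0}"
  shows "\<exists>v\<in>W. v \<noteq> 0 \<and> Poly_Mapping.keys v \<subseteq> {b. fst b = 0}"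
proof -
  let ?P = "\<lambda>D v. v \<in> W \<and> v \<noteq> 0 \<and> Poly_Mapping.keys v \<subseteq> {b. degm (fst b) \<le> int D}"
  obtain v where v: "v \<in> W" "v \<noteq> 0" using assms W_0 by blast
  have "degm (fst b) \<le> int (\<Sum>b\<in>Poly_Mapping.keys v. nat (degm (fst b)))" if "b \<in> Poly_Mapping.keys v" for b
  proof -
    have "nat (degm (fst b)) \<le> (\<Sum>b\<in>Poly_Mapping.keys v. nat (degm (fst b)))"
      by (rule member_le_sum[OF that]) auto
    then show ?thesis by linarith
  qed
  then have "?P (\<Sum>b\<in>Poly_Mapping.keys v. nat (degm (fst b))) v" using v by blast
  then have ex: "\<exists>D v. ?P D v" by blast
  define D where "D = (LEAST D. \<exists>v. ?P D v)"
  have "\<exists>v. ?P D v" unfolding D_def by (rule LeastI_ex[OF ex])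
  then obtain w where w: "?P D w" by blast
  have "heis N (int j) n w = 0" if j: "j \<in> {1..N}" and n: "n > 0" for j n
  proof (rule ccontr)
    assume nz: "heis N (int j) n w \<noteq> 0"
    have k: "Poly_Mapping.keys (heis N (int j) n w) \<subseteq> {b. degm (fst b) \<le> int D - n}"
      by (rule heis_pos_degree[OF n]) (use w in blast)
    obtain b where "b \<in> Poly_Mapping.keys (heis N (int j) n w)" using nz by (metis keys_eq_empty ex_in_conv)
    then have "int D - n \<ge> 0" using k degm_nonneg[of "fst b"] by force
    then have "?P (nat (int D - n)) (heis N (int j) n w)"
      using k nz w heis_W[OF j, of n w] n by auto
    then have "D \<le> nat (int D - n)" unfolding D_def by (intro Least_le) blast
    then show False using n \<open>int D - n \<ge> 0\<close> by linarith
  qed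
  then have "Poly_Mapping.keys w \<subseteq> {b. fst b = 0}"
    using heis_kernel[of w N] w incl by force
  then show ?thesis using w by blast
qed

text \<open>Weights are separated by the eigenvalues \<open>q powi pf i \<alpha>\<close>, which are
  distinct for distinct exponents as \<open>q\<close> is generic. A vacuum vector of minimal support
  in \<open>W\<close> has a single weight, or an eigenvalue shift of some \<open>K_i\<close> would
  shorten it.\<close>

lemma exists_vc:
  assumes "W \<noteq> {0}"
  obtains \<gamma> where "\<gamma> \<in> root_lattice N" "vc \<gamma> \<in> W"
proof -
  let ?P = "\<lambda>v. v \<in> W \<and> v \<noteq> 0 \<and> Poly_Mapping.keys v \<subseteq> {b. fst b = 0}"
  obtain v0 where "?P v0" using vacuum_vector[OF assms] by blast
  then obtain v where v: "?P v" and least: "\<And>w. ?P w \<Longrightarrow> card (Poly_Mapping.keys v) \<le> card (Poly_Mapping.keys w)"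
    using ex_has_least_nat[of ?P v0 "\<lambda>v. card (Poly_Mapping.keys v)"] by blast
  have Q: "b \<in> Poly_Mapping.keys v \<Longrightarrow> fst b = 0 \<and> snd b \<in> root_lattice N" for b
    using v fock_space_singleI[of v N b] incl by (cases b) (auto simp: fock_space_def)
  obtain b where b: "b \<in> Poly_Mapping.keys v" using v by (metis keys_eq_empty ex_in_conv)
  have single: "b' = b" if b': "b' \<in> Poly_Mapping.keys v" for b'
  proof (rule ccontr)
    assume "b' \<noteq> b"
    then have "snd b \<noteq> snd b'" using Q[OF b] Q[OF b'] by (simp add: prod_eq_iff)
    then obtain i where i: "i < N" "pf i (snd b) \<noteq> pf i (snd b')"
      using pf_inj Q[OF b] Q[OF b'] by blast
    \<comment> \<open>Cancels the component at \<open>b\<close> and keeps the one at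
      \<open>b'\<close>.\<close>
    let ?w = "opK0 N qh 1 i v - scale (q powi pf i (snd b)) v"
    have l: "Poly_Mapping.lookup ?w c = (q powi pf i (snd c) - q powi pf i (snd b)) * Poly_Mapping.lookup v c" for c
      by (simp add: lookup_minus lookup_opK0[OF i(1)] lookup_scale left_diff_distrib)
    have ne: "q powi pf i (snd b') \<noteq> q powi pf i (snd b)"
    proof
      assume "q powi pf i (snd b') = q powi pf i (snd b)"
      then have "q powi (pf i (snd b') - pf i (snd b)) = 1" using q0 by (simp add: power_int_diff)
      then show False using q_powi_ne_1[of "pf i (snd b') - pf i (snd b)"] i(2) by simp
    qed
    have "Poly_Mapping.lookup ?w b' \<noteq> 0" using ne b' by (simp add: l in_keys_iff)
    then have nz: "?w \<noteq> 0" by (metis lookup_zero)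
    have k: "Poly_Mapping.keys ?w \<subseteq> Poly_Mapping.keys v - {b}" 
    proof
      fix c assume "c \<in> Poly_Mapping.keys ?w"
      then have "(q powi pf i (snd c) - q powi pf i (snd b)) * Poly_Mapping.lookup v c \<noteq> 0"
        unfolding in_keys_iff l .
      then show "c \<in> Poly_Mapping.keys v - {b}" by (auto simp: in_keys_iff)
    qed
    have "?P ?w" using v k nz W_diff[OF opK0_W[OF i(1), of 1 v] W_scale, of v] by auto
    then have "card (Poly_Mapping.keys v) \<le> card (Poly_Mapping.keys ?w)" by (rule least)
    also have "\<dots> \<le> card (Poly_Mapping.keys v - {b})" by (rule card_mono[OF _ k]) simp
    also have "\<dots> < card (Poly_Mapping.keys v)" by (rule card_Diff1_less[OF _ b]) simp
    finally show False by simp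
  qed
  then have "Poly_Mapping.keys v = {b}" using b by blast
  then have "v = scale (Poly_Mapping.lookup v b) (Poly_Mapping.single b 1)"
    using fock_expand[of v] by simp
  moreover have "b = (0, snd b)" using Q[OF b] by (simp add: prod_eq_iff)
  ultimately have "scale (Poly_Mapping.lookup v b) (vc (snd b)) \<in> W" using v by metis
  then have "vc (snd b) \<in> W"
    by (rule csubspace_scale_cancel[OF sub]) (use b in \<open>simp add: in_keys_iff\<close>)
  then show ?thesis using Q[OF b] that by blast
qed

text \<open>At the lowest exponent occurring on \<open>e^\<gamma>\<close>, which is
  \<open>pf i \<gamma> + 1\<close> for \<open>E_i\<close> and \<open>- pf i \<gamma> + 1\<close> for
  \<open>F_i\<close>, the creation exponential contributes only its constant term.\<close>

lemma vc_step:
  assumes i: "i < N" and \<gamma>: "\<gamma> \<in> root_lattice N" "vc \<gamma> \<in> W"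
  shows "vc (\<gamma> + bt i) \<in> W" "vc (\<gamma> - bt i) \<in> W"
proof -
  have u: "\<epsilon> \<beta> \<gamma> \<noteq> 0" if "\<beta> \<in> root_lattice N" for \<beta>
  proof -
    have "\<epsilon> \<beta> \<gamma> \<in> {1, -1}" using coc that \<gamma>(1) unfolding cocycle_def by blast
    then show ?thesis by auto
  qed
  have kp: "kap i \<noteq> 0" by (simp add: kap_def cc0)
  have "EE i (pf i \<gamma> + 1) (vc \<gamma>) = scale (tE i \<gamma>) (vc (\<gamma> + bt i))"
    by (simp add: vop_vc[OF vop_opE[OF i]])
  then have "scale (tE i \<gamma>) (vc (\<gamma> + bt i)) \<in> W" using EEW[OF i \<gamma>(2)] by metis
  then show "vc (\<gamma> + bt i) \<in> W"
    by (rule csubspace_scale_cancel[OF sub]) (use u[OF bt_lattice] kp in \<open>simp add: tE_def psi0\<close>)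
  have "FF i (- pf i \<gamma> + 1) (vc \<gamma>) = scale (tF i \<gamma>) (vc (\<gamma> - bt i))"
    by (simp add: vop_vc[OF vop_opF[OF i]])
  then have "scale (tF i \<gamma>) (vc (\<gamma> - bt i)) \<in> W" using FFW[OF i \<gamma>(2)] by metis
  then show "vc (\<gamma> - bt i) \<in> W"
    by (rule csubspace_scale_cancel[OF sub]) (use u[OF root_lattice_uminus[OF N1 bt_lattice]] kp in \<open>simp add: tF_def psi0\<close>)
qed

lemma vc_W:
  assumes \<gamma>: "\<gamma> \<in> root_lattice N" "vc \<gamma> \<in> W" and \<alpha>: "\<alpha> \<in> root_lattice N"
  shows "vc \<alpha> \<in> W"
proof -
  let ?b = "\<lambda>i x. eps N (int i) x - eps N (int i + 1) x"
  have e: "?b i (x + 1) = ?b i x + bt i" "?b i (x - 1) = ?b i x - bt i" for i x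
    by (simp_all add: bt_def eps_def single_add single_diff)
  have line: "vc (\<beta> + ?b i x) \<in> W" if i: "i < N" and \<beta>: "\<beta> \<in> root_lattice N" "vc \<beta> \<in> W" for i x \<beta>
  proof (induction x rule: int_induct[where k = 0])
    case base
    then show ?case using \<beta> by (simp add: eps_def)
  next
    case (step1 x)
    have "vc (\<beta> + ?b i x + bt i) \<in> W"
      by (rule vc_step(1)[OF i root_lattice_iff_add[OF \<beta>(1) root_lattice_eps[OF N1]] step1(2)])
    then show ?case unfolding e by (simp add: algebra_simps)
  next
    case (step2 x)
    have "vc (\<beta> + ?b i x - bt i) \<in> W"
      by (rule vc_step(2)[OF i root_lattice_iff_add[OF \<beta>(1) root_lattice_eps[OF N1]] step2(2)])
    then show ?case unfolding e by (simp add: algebra_simps)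
  qed
  have "\<alpha> + - \<gamma> \<in> root_lattice N"
    by (rule root_lattice_iff_add[OF \<alpha> root_lattice_uminus[OF N1 \<gamma>(1)]])
  then obtain x where x: "\<alpha> + - \<gamma> = (\<Sum>i=1..<N. ?b i (x i))" unfolding root_lattice_def by blast
  have "\<gamma> + (\<Sum>i=1..<n. ?b i (x i)) \<in> root_lattice N \<and> vc (\<gamma> + (\<Sum>i=1..<n. ?b i (x i))) \<in> W" if "n \<le> N" for n
    using that
  proof (induction n)
    case 0
    then show ?case using \<gamma> by simp
  next
    case (Suc n)
    show ?case
    proof (cases "n = 0")
      case True
      then show ?thesis using \<gamma> by simp
    next
      case False
      then have "(\<Sum>i=1..<Suc n. ?b i (x i)) = (\<Sum>i=1..<n. ?b i (x i)) + ?b n (x n)" by simp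
      then show ?thesis
        using Suc line[of n "\<gamma> + (\<Sum>i=1..<n. ?b i (x i))" "x n"]
          root_lattice_iff_add[OF _ root_lattice_eps[OF N1], of "\<gamma> + (\<Sum>i=1..<n. ?b i (x i))" "int n" "x n" "int n + 1"]
        by (simp add: add.assoc)
    qed
  qed
  from this[of N] show ?thesis unfolding x[symmetric] by simp
qed

lemma W_full: "W = {0} \<or> W = fock_space N"
proof (cases "W = {0}")
  case False
  obtain \<gamma> where \<gamma>: "\<gamma> \<in> root_lattice N" "vc \<gamma> \<in> W" by (rule exists_vc[OF False])
  have mono: "Poly_Mapping.single (m, \<alpha>) 1 \<in> W"
    if "Poly_Mapping.keys m \<subseteq> {1..N} \<times> {1..}" "\<alpha> \<in> root_lattice N" for m \<alpha>
    using that(1)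
  proof (induction "nat (degm m)" arbitrary: m rule: less_induct)
    case less
    show ?case
    proof (cases "m = 0")
      case True
      then show ?thesis using vc_W[OF \<gamma> that(2)] by simp
    next
      case False
      then obtain j n where jn: "(j, n) \<in> Poly_Mapping.keys m" by (metis keys_eq_empty ex_in_conv surj_pair)
      then have j: "j \<in> {1..N}" and n: "n \<ge> 1" using less.prems by auto
      let ?s = "Poly_Mapping.single (j, n) (1::nat)"
      have l: "Poly_Mapping.lookup m (j, n) \<noteq> 0" using jn by (simp add: in_keys_iff)
      have "degm (m - ?s) = degm m - int n" using degm_minus[OF l] by simp
      then have "nat (degm (m - ?s)) < nat (degm m)" using degm_nonneg[of "m - ?s"] n by linarith
      moreover have "Poly_Mapping.keys (m - ?s) \<subseteq> Poly_Mapping.keys m"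
        by (auto simp: in_keys_iff lookup_minus)
      ultimately have "Poly_Mapping.single (m - ?s, \<alpha>) 1 \<in> W"
        using less.prems by (intro less.hyps) blast+
      then have "heis N (int j) (- int n) (Poly_Mapping.single (m - ?s, \<alpha>) 1) \<in> W"
        by (intro heis_W[OF j]) (use n in auto)
      then show ?thesis using n mono_minus_single[OF l] by (simp add: heis_neg_single idx_id[OF j])
    qed
  qed
  have "v \<in> W" if "v \<in> fock_space N" for v
  proof (subst fock_expand[of v], rule csubspace_sum[OF sub])
    fix b assume "b \<in> Poly_Mapping.keys v"
    then have "Poly_Mapping.single b 1 \<in> W" using that mono by (cases b) (auto simp: fock_space_def)
    then show "scale (Poly_Mapping.lookup v b) (Poly_Mapping.single b 1) \<in> W" by (rule W_scale)
  qed
  then show ?thesis using incl by blast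
qed simp

end

text \<open>The two algebras to which this applies supply \<open>F_i\<close> with opposite signs, so
  the hypothesis on \<open>F\<close> admits either; stability of a subspace does not depend on the
  sign.\<close>

lemma (in toroidal_fock) irreducible_underI:
  assumes p: "\<not> root_of_unity (d powi (- int N) * q powi int N)" "\<not> root_of_unity (d powi (- int N) * q powi (- int N))"
    and A: "A \<subseteq> carrier (endo_ring N)"
    and E: "\<And>i k. i < N \<Longrightarrow> restrict (EE i k) (fock_space N) \<in> A"
    and F: "\<And>i k. i < N \<Longrightarrow> (\<lambda>v\<in>fock_space N. - FF i k v) \<in> A \<or> restrict (FF i k) (fock_space N) \<in> A"
    and K: "\<And>i s k. i < N \<Longrightarrow> s \<in> {1, -1} \<Longrightarrow> restrict (KK s i k) (fock_space N) \<in> A"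
  shows "irreducible_under N A"
proof -
  have "Poly_Mapping.lookup (vc 0) (0, 0) \<noteq> 0" by simp
  then have "vc 0 \<noteq> 0" by (metis lookup_zero)
  moreover have "vc 0 \<in> fock_space N" by (rule fock_space_single) (simp_all add: root_lattice_0[OF N1])
  ultimately have ne: "fock_space N \<noteq> {0}" by blast
  have irr: "W = {0} \<or> W = fock_space N"
    if W: "csubspace W" "W \<subseteq> fock_space N" and inv: "\<And>T. T \<in> A \<Longrightarrow> T ` W \<subseteq> W" for W
  proof -
    have T: "T v \<in> W" if "restrict T (fock_space N) \<in> A" "v \<in> W" for T v
    proof -
      have "restrict T (fock_space N) v \<in> W" using inv[OF that(1)] that(2) by blast
      then show ?thesis using that(2) W(2) by auto
    qed
    have "invariant_subspace N \<epsilon> qh ph d W"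
    proof
      fix i k v assume i: "i < N" and v: "v \<in> W"
      show "opF N \<epsilon> qh ph d i k v \<in> W"
      proof (cases "restrict (FF i k) (fock_space N) \<in> A")
        case False
        then have "- FF i k v \<in> W" using F[OF i, of k] T[of "\<lambda>v. - FF i k v"] v by blast
        then have "scale (-1) (- FF i k v) \<in> W" using W(1) unfolding csubspace_def by blast
        then show ?thesis by simp
      qed (use T v in blast)
    qed (use W p T E K in auto)
    then show ?thesis by (rule invariant_subspace.W_full)
  qed
  show ?thesis unfolding irreducible_under_def
    by (intro conjI A ne allI impI) (rule irr; blast)
qed

theorem theorem3p11:
  fixes N :: nat and q d p qh ph :: complex and \<epsilon> :: "lattice \<Rightarrow> lattice \<Rightarrow> int"
  assumes "N \<ge> 3"
    and "generic q" and "qh ^ 2 = q"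
    and "d \<noteq> 0" and "p = d powi (- int N)" and "ph ^ 2 = p"
    and "cocycle N \<epsilon>"
    and "\<not> root_of_unity (p * q powi int N)" and "\<not> root_of_unity (p * q powi (- int N))"
  shows "irreducible_under N (carrier (vertex_algebra N \<epsilon> qh ph d)) \<and>
    (\<exists>\<pi>. toroidal_map N \<epsilon> qh ph d \<pi> \<and>
         irreducible_under N (\<pi> ` carrier (toroidal N q d)))"
proof -
  interpret T: toroidal_fock N \<epsilon> qh ph d
    by unfold_locales (use assms in auto)
  note p = assms(8,9)[unfolded assms(5) assms(3)[symmetric]]
  have "irreducible_under N (carrier T.VA)"
  proof (rule T.irreducible_underI[OF p T.VA_endo])
    fix i k s assume "i < N" "s \<in> {1, -1 :: int}"
    then show "restrict (T.KK s i k) (fock_space N) \<in> carrier T.VA"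
      unfolding T.VA_simps by (intro generate_ring.incl UnI2 T.vertex_coeffs_mem)
  next
    fix i k assume "i < N"
    then show "restrict (T.EE i k) (fock_space N) \<in> carrier T.VA"
      "(\<lambda>v\<in>fock_space N. - T.FF i k v) \<in> carrier T.VA \<or> restrict (T.FF i k) (fock_space N) \<in> carrier T.VA"
      unfolding T.VA_simps by (auto intro!: generate_ring.incl T.vertex_coeffs_mem)
  qed
  \<comment> \<open>The image of \<open>tmap\<close> contains every coefficient of the currents,
    with a minus sign on \<open>F_i\<close>.\<close>
  moreover have "irreducible_under N (T.tmap ` carrier (toroidal N q d))"
  proof (rule T.irreducible_underI[OF p])
    note t = T.toroidal_map_tmap[unfolded toroidal_map_def Let_def assms(3)]
    have cl: "tclass N q d x \<in> carrier (toroidal N q d)" if "x \<in> carrier (free_alg N)" for x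
      using that by (auto simp: toroidal_def FactRing_simps tclass_def a_r_coset_def)
    show "T.tmap ` carrier (toroidal N q d) \<subseteq> carrier (endo_ring N)"
      using ring_hom_closed[OF conjunct1[OF t]] T.VA_endo by blast
    fix i k s assume i: "i < N"
    have g: "gen (Egen i (- k)) \<in> carrier (free_alg N)" "gen (Fgen i (- k)) \<in> carrier (free_alg N)"
      using i by (auto simp: gens_def intro!: fa_gen)
    have "T.tmap (tclass N q d (gen (Egen i (- k)))) = restrict (T.EE i k) (fock_space N)" using t i by simp
    then show "restrict (T.EE i k) (fock_space N) \<in> T.tmap ` carrier (toroidal N q d)"
      using cl[OF g(1)] by (metis imageI)
    have "T.tmap (tclass N q d (gen (Fgen i (- k)))) = (\<lambda>v\<in>fock_space N. - T.FF i k v)" using t i by simp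
    then show "(\<lambda>v\<in>fock_space N. - T.FF i k v) \<in> T.tmap ` carrier (toroidal N q d)
      \<or> restrict (T.FF i k) (fock_space N) \<in> T.tmap ` carrier (toroidal N q d)"
      using cl[OF g(2)] by (metis imageI)
    assume s: "s \<in> {1, -1 :: int}"
    \<comment> \<open>\<open>k_coeff q s i n\<close> is the coefficient of \<open>z^(-s n)\<close>,
      so exponent \<open>k\<close> corresponds to \<open>n = -s k\<close>.\<close>
    then have "- s * (- s * k) = k" by auto
    then have "T.tmap (tclass N q d (k_coeff q s i (- s * k))) = restrict (T.KK s i k) (fock_space N)" using t i s by metis
    then show "restrict (T.KK s i k) (fock_space N) \<in> T.tmap ` carrier (toroidal N q d)"
      using cl[OF fa_k_coeff[OF i s]] by (metis imageI)
  qed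
  ultimately show ?thesis using T.toroidal_map_tmap by blast
qed

end
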